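(* Let $(E,\mathcal{E},\pi)$ be any $\sigma$-finite measured space and let $X=(X_n)_{n\in\mathbb{Z}}$ be a stationary process with values in $E$. Assume that one has chosen a regular version of the conditional law of $X_0$ given $X^{\lhd}_{-1}$ in such a way that for every $x\in E^{\lhd}$ the law $\mathcal{L}(X_0\mid X^{\lhd}_{-1}=x)$ has a density $f(\cdot|x)$ with respect to $\pi$, and that for $\pi$-almost every $a$ in $E$, $f(a|X^{\lhd}_{-1})>0$ almost surely. For $n\ge 0$ let $$\eta_n=\mathbb{E}\big[\|f(\cdot|Y_{-n:-1})-f(\cdot|X^{\lhd}_{-n-1}Y_{-n:-1})\|\big],$$ where $Y$ is an independent copy of $X$. If $$\sum_{k=0}^{+\infty}\eta_k<+\infty,$$ then $\mathcal{F}^X$ admits a generating parametrization, hence $\mathcal{F}^X$ is standard.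
   Context: Notation. $E^{\lhd}$ is the set of sequences $(\xi_n)_{n\le -1}$ with values in $E$. For a process $X$, $X^{\lhd}_n=(X_k)_{k\le n}$, and any sequence indexed by $\{k\le n\}$ is identified, by shifting indices, with an element of $E^{\lhd}$. $X_{i:j}=(X_i,\dots,X_j)$. For $x\in E^{\lhd}$ and $z=(z_1,\dots,z_n)\in E^n$, $xz=(\dots,x_{-2},x_{-1},z_1,\dots,z_n)\in E^{\lhd}$ is the concatenation. For $n\ge 0$ and $z\in E^n$, $f(\cdot|z)$ denotes the density with respect to $\pi$ of the conditional law $\mathcal{L}(X_0\mid X_{-n:-1}=z)$ (which exists as a consequence of the density assumption on $\mathcal{L}(X_0\mid X^{\lhd}_{-1}=x)$). The conditional densities are jointly measurable in their two arguments. For probability densities $f,g$ on $(E,\pi)$, $\|f-g\|=\frac12\int_E|f-g|\,d\pi$. Filtrations. $\mathcal{F}^X=(\mathcal{F}^X_n)_{n\in\mathbb{Z}}$ with $\mathcal{F}^X_n=\sigma(X_k; k\le n)$; similarly $\mathcal{F}^U_n=\sigma(U_k;k\le n)$ and $\mathcal{F}^{X,U}_n=\sigma(X_k,U_k;k\le n)$. All $\sigma$-fields are assumed to be complete. Parametrizations. A process $U=(U_n)_{n\in\mathbb{Z}}$ (with values in some measurable space) is a parametrization of $X$ (or of $\mathcal{F}^X$) if for every $n\in\mathbb{Z}$: (i) $U_{n+1}$ is independent of $\mathcal{F}^{X,U}_n$, and (ii) $X_{n+1}$ is measurable with respect to $\sigma(U_{n+1})\vee\mathcal{F}^X_n$.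 It is a generating parametrization if moreover $X_n$ is $\mathcal{F}^U_n$-measurable for every $n\in\mathbb{Z}$. "$\mathcal{F}^X$ admits a generating parametrization" is understood up to an enlargement of the probability space on which $X$ is defined. Standardness. $\mathcal{F}^X$ is immersed in a filtration $\mathcal{G}=(\mathcal{G}_n)_{n\in\mathbb{Z}}$ if $\mathcal{F}^X_n\subset\mathcal{G}_n$ for every $n$ and, for every $n\in\mathbb{Z}$, $\mathcal{F}^X_{n+1}$ and $\mathcal{G}_n$ are independent conditionally on $\mathcal{F}^X_n$. $\mathcal{F}^X$ is standard if, modulo an enlargement of the probability space, it can be immersed in the natural filtration of an i.i.d. process indexed by $\mathbb{Z}$ with values in a separable space.
   Formalization: Standardness is concluded only when the measure algebra of π is separable; without this it is false (X i.i.d. coin-tossing on {0,1}^I, I uncountable). Otherwise only immersion in the filtration of an i.i.d. process is stated. The generating parametrization holds for all π. *)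

theory Defs
  imports "HOL-Probability.Probability"
begin

text \<open>
  All words are indexed backwards in time, starting with the most recent letter.
  A sequence \<open>(\<xi>\<^sub>n)\<close> indexed by \<open>n \<le> -1\<close> is the function \<open>j \<mapsto> \<xi>\<^sub>-\<^sub>1\<^sub>-\<^sub>j\<close> on the natural numbers,
  a word \<open>(z\<^sub>1, \<dots>, z\<^sub>n)\<close> is the function \<open>j \<mapsto> z\<^sub>n\<^sub>-\<^sub>j\<close> on \<open>{..<n}\<close>, and the concatenation of the past \<open>x\<close>
  followed by the word \<open>z\<close> of length \<open>n\<close> is \<open>comb_seq n z x\<close>.
\<close>

abbreviation past_space :: "'e measure \<Rightarrow> (nat \<Rightarrow> 'e) measure" where
  "past_space E \<equiv> Pi\<^sub>M UNIV (\<lambda>_. E)"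

abbreviation word_space :: "'e measure \<Rightarrow> nat \<Rightarrow> (nat \<Rightarrow> 'e) measure" where
  "word_space E n \<equiv> Pi\<^sub>M {..<n} (\<lambda>_. E)"

text \<open>\<open>past X m\<close> is the sequence \<open>(X\<^sub>k)\<close>, \<open>k \<le> m\<close>; \<open>word X n\<close> is \<open>(X\<^sub>-\<^sub>n, \<dots>, X\<^sub>-\<^sub>1)\<close>.\<close>

definition past :: "(int \<Rightarrow> 'w \<Rightarrow> 'e) \<Rightarrow> int \<Rightarrow> 'w \<Rightarrow> nat \<Rightarrow> 'e" where
  "past X m \<omega> = (\<lambda>j. X (m - int j) \<omega>)"

definition word :: "(int \<Rightarrow> 'w \<Rightarrow> 'e) \<Rightarrow> nat \<Rightarrow> 'w \<Rightarrow> nat \<Rightarrow> 'e" where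
  "word X n \<omega> = restrict (past X (-1) \<omega>) {..<n}"

definition stationary :: "'w measure \<Rightarrow> 'e measure \<Rightarrow> (int \<Rightarrow> 'w \<Rightarrow> 'e) \<Rightarrow> bool" where
  "stationary M E X \<longleftrightarrow>
     (\<forall>n. X n \<in> measurable M E) \<and>
     (\<forall>m. distr M (Pi\<^sub>M UNIV (\<lambda>_. E)) (\<lambda>\<omega> n. X (n + m) \<omega>)
        = distr M (Pi\<^sub>M UNIV (\<lambda>_. E)) (\<lambda>\<omega> n. X n \<omega>))"

text \<open>
  \<open>conditional_density M P Z \<pi> W f\<close>: for every \<open>z\<close> the function \<open>f z\<close> is a probability density
  with respect to \<open>\<pi>\<close>, jointly measurable in both arguments, and \<open>z \<mapsto> f z \<cdot> \<pi>\<close> is a regular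
  version of the conditional law of \<open>W\<close> given \<open>Z\<close>.
\<close>

definition conditional_density ::
  "'w measure \<Rightarrow> 'z measure \<Rightarrow> ('w \<Rightarrow> 'z) \<Rightarrow> 'e measure \<Rightarrow> ('w \<Rightarrow> 'e) \<Rightarrow> ('z \<Rightarrow> 'e \<Rightarrow> real) \<Rightarrow> bool" where
  "conditional_density M P Z \<pi> W f \<longleftrightarrow>
     (\<lambda>(z, a). f z a) \<in> borel_measurable (P \<Otimes>\<^sub>M \<pi>) \<and>
     (\<forall>z\<in>space P. \<forall>a\<in>space \<pi>. 0 \<le> f z a) \<and>
     (\<forall>z\<in>space P. (\<integral>\<^sup>+ a. ennreal (f z a) \<partial>\<pi>) = 1) \<and>
     (\<forall>A\<in>sets P. \<forall>B\<in>sets \<pi>.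
        emeasure M {\<omega> \<in> space M. Z \<omega> \<in> A \<and> W \<omega> \<in> B}
        = (\<integral>\<^sup>+ \<omega>. indicator A (Z \<omega>) * emeasure (density \<pi> (\<lambda>a. ennreal (f (Z \<omega>) a))) B \<partial>M))"

definition density_dist :: "'e measure \<Rightarrow> ('e \<Rightarrow> real) \<Rightarrow> ('e \<Rightarrow> real) \<Rightarrow> real" where
  "density_dist \<pi> f g = 1 / 2 * (\<integral> a. \<bar>f a - g a\<bar> \<partial>\<pi>)"

text \<open>
  The independent copy \<open>Y\<close> of \<open>X\<close> is realised on the second factor of \<open>M \<Otimes>\<^sub>M M\<close>; \<open>f\<close> is the
  conditional density given the whole past, \<open>g n\<close> the one given the last \<open>n\<close> letters.
\<close>

definition eta ::
  "'w measure \<Rightarrow> 'e measure \<Rightarrow> (int \<Rightarrow> 'w \<Rightarrow> 'e) \<Rightarrow> ((nat \<Rightarrow> 'e) \<Rightarrow> 'e \<Rightarrow> real) \<Rightarrow>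
   (nat \<Rightarrow> (nat \<Rightarrow> 'e) \<Rightarrow> 'e \<Rightarrow> real) \<Rightarrow> nat \<Rightarrow> real" where
  "eta M \<pi> X f g n =
     (\<integral> (\<omega>, \<omega>'). density_dist \<pi> (g n (word X n \<omega>'))
                    (f (comb_seq n (word X n \<omega>') (past X (- int n - 1) \<omega>))) \<partial>(M \<Otimes>\<^sub>M M))"

text \<open>
  Completeness of a sigma-field means that it contains all subsets of null events, that is, all
  null sets of \<open>completion M\<close>. Accordingly, independence of complete sigma-fields is expressed
  in \<open>completion M\<close>.
\<close>

definition natural_filtration ::
  "'w measure \<Rightarrow> 'e measure \<Rightarrow> (int \<Rightarrow> 'w \<Rightarrow> 'e) \<Rightarrow> int \<Rightarrow> 'w measure" where
  "natural_filtration M E X n =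
     sigma (space M) ({X k -` A \<inter> space M | k A. k \<le> n \<and> A \<in> sets E} \<union> null_sets (completion M))"

definition cond_indep :: "'w measure \<Rightarrow> 'w measure \<Rightarrow> 'w measure \<Rightarrow> 'w measure \<Rightarrow> bool" where
  "cond_indep M H A B \<longleftrightarrow>
     (\<forall>a\<in>sets A. \<forall>b\<in>sets B. AE \<omega> in M.
        real_cond_exp M H (indicator (a \<inter> b)) \<omega>
        = real_cond_exp M H (indicator a) \<omega> * real_cond_exp M H (indicator b) \<omega>)"

definition immersed :: "'w measure \<Rightarrow> (int \<Rightarrow> 'w measure) \<Rightarrow> (int \<Rightarrow> 'w measure) \<Rightarrow> bool" where
  "immersed M F G \<longleftrightarrow>
     (\<forall>n. sets (F n) \<subseteq> sets (G n) \<and> cond_indep (completion M) (F n) (F (n + 1)) (G n))"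

definition parametrization ::
  "'w measure \<Rightarrow> 'e measure \<Rightarrow> (int \<Rightarrow> 'w \<Rightarrow> 'e) \<Rightarrow> 'u measure \<Rightarrow> (int \<Rightarrow> 'w \<Rightarrow> 'u) \<Rightarrow> bool" where
  "parametrization M E X S U \<longleftrightarrow>
     (\<forall>n. U n \<in> measurable M S) \<and>
     (\<forall>n. prob_space.indep_set (completion M)
            {U (n + 1) -` A \<inter> space M | A. A \<in> sets S}
            (sets (natural_filtration M (E \<Otimes>\<^sub>M S) (\<lambda>k \<omega>. (X k \<omega>, U k \<omega>)) n))) \<and>
     (\<forall>n. X (n + 1) \<in> measurable
            (sigma (space M) ({U (n + 1) -` A \<inter> space M | A. A \<in> sets S}
                               \<union> sets (natural_filtration M E X n))) E)"

definition generating_parametrization ::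
  "'w measure \<Rightarrow> 'e measure \<Rightarrow> (int \<Rightarrow> 'w \<Rightarrow> 'e) \<Rightarrow> 'u measure \<Rightarrow> (int \<Rightarrow> 'w \<Rightarrow> 'u) \<Rightarrow> bool" where
  "generating_parametrization M E X S U \<longleftrightarrow>
     parametrization M E X S U \<and> (\<forall>n. X n \<in> measurable (natural_filtration M S U n) E)"

definition enlargement :: "'w measure \<Rightarrow> 'r measure \<Rightarrow> ('r \<Rightarrow> 'w) \<Rightarrow> bool" where
  "enlargement M N p \<longleftrightarrow> prob_space N \<and> p \<in> measurable N M \<and> distr N M p = M"

text \<open>
  HOL cannot quantify existentially over types, so the type \<open>'r\<close> of the points of the enlarged
  probability space and the type of the values of the auxiliary process are parameters. Naming
  concrete types in a conclusion only makes the existence claim more precise.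
\<close>

definition admits_generating_parametrization ::
  "'r itself \<Rightarrow> 'u itself \<Rightarrow> 'w measure \<Rightarrow> 'e measure \<Rightarrow> (int \<Rightarrow> 'w \<Rightarrow> 'e) \<Rightarrow> bool" where
  "admits_generating_parametrization _ _ M E X \<longleftrightarrow>
     (\<exists>(N :: 'r measure) p (S :: 'u measure) U.
        enlargement M N p \<and> generating_parametrization N E (\<lambda>n. X n \<circ> p) S U)"

definition iid_process :: "'w measure \<Rightarrow> 'v measure \<Rightarrow> (int \<Rightarrow> 'w \<Rightarrow> 'v) \<Rightarrow> bool" where
  "iid_process M S V \<longleftrightarrow>
     prob_space.indep_vars M (\<lambda>_. S) V UNIV \<and> (\<forall>n. distr M S (V n) = distr M S (V 0))"

definition immersible_in_iid ::
  "'r itself \<Rightarrow> 'v measure \<Rightarrow> 'w measure \<Rightarrow> 'e measure \<Rightarrow> (int \<Rightarrow> 'w \<Rightarrow> 'e) \<Rightarrow> bool" where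
  "immersible_in_iid _ S M E X \<longleftrightarrow>
     (\<exists>(N :: 'r measure) p V.
        enlargement M N p \<and> iid_process N S V \<and>
        immersed N (natural_filtration N E (\<lambda>n. X n \<circ> p)) (natural_filtration N S V))"

text \<open>
  A metric space is separable if and only if it is second countable, so the sort of \<open>'v\<close>
  describes the separable metric spaces (with their Borel sets).
\<close>

definition standard ::
  "'r itself \<Rightarrow> 'v::{metric_space, second_countable_topology} itself \<Rightarrow>
   'w measure \<Rightarrow> 'e measure \<Rightarrow> (int \<Rightarrow> 'w \<Rightarrow> 'e) \<Rightarrow> bool" where
  "standard R _ M E X \<longleftrightarrow> immersible_in_iid R (borel :: 'v measure) M E X"

text \<open>
  Separability of the measure algebra of \<open>\<pi>\<close>. It cannot be dispensed with for standardness: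
  if \<open>X\<close> is standard, then the space of integrable \<open>\<sigma>(X\<^sub>0)\<close>-measurable functions is separable,
  and hence so is the measure algebra of \<open>\<pi>\<close> as soon as the law of \<open>X\<^sub>0\<close> is equivalent to \<open>\<pi>\<close>.
  An i.i.d. process of uniform elements of an uncountable power of \<open>{0, 1}\<close> is therefore not
  standard, although it is a generating parametrization of itself.
\<close>

definition essentially_separable :: "'e measure \<Rightarrow> bool" where
  "essentially_separable \<pi> \<longleftrightarrow>
     (\<exists>G. countable G \<and> G \<subseteq> sets \<pi> \<and>
        (\<forall>A\<in>sets \<pi>. \<exists>B\<in>sigma_sets (space \<pi>) G. (A - B) \<union> (B - A) \<in> null_sets \<pi>))"

end

(*
  Replacing \<pi> by an equivalent probability measure and dividing the densities accordingly, one may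
  assume that \<pi> is a probability measure.

  A density \<phi> is sampled from an i.i.d. sequence of marks by a rejection scheme that looks only at
  whether the marks lie below the graph of \<phi>. The same noise then serves all densities at once, and for two
  densities \<phi>, \<psi> the chosen marks coincide and have their letter in B with probability at least
  the integral of min(\<phi>, \<psi>) over B, divided by 1 + 4 \<integral>|\<phi> - \<psi>|. Two chains driven by the same noises but started
  from two different pasts x, x' therefore choose the same marks up to time n with probability at
  least the expectation of B_n(x) B_n(x') over the next letters of X, where B_n(x) is the product
  over k < n of min(1, f/g_k) / (1 + 8 ||f - g_k||), taken along the past x followed by the letters. Since the expectation
  of 1 - (k-th factor) is of order \<eta>_k and f > 0, summability bounds B_n(x) away from 0 uniformly
  in n, almost surely for almost every x. So from stationary starting points the two chains have
  a positive chance never to separate again. This applies afresh at every time m, also on the event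
  that they separated between times n and m, because the two states are stationary at time m;
  letting m and then n tend to infinity, the chains almost surely agree from some time on. Hence,
  for suitable deterministic starting pasts x_k, the chain started k steps ago from x_k
  approximates X.

  Given X, let the noises U_n be independent, U_n following the conditional law of a noise that
  selects X_n from the past of X. Then U parametrizes X, and X_n is a limit of the
  chains started from the deterministic pasts x_k, so it is measurable for the completed past of U.
*)

theory Submission
  imports Defs
begin

section \<open>Sequences of independent variables\<close>

text \<open>The state space is arbitrary: regular conditional laws need not exist and the diagonal
  need not be measurable. Everything is therefore read off the position of the chosen mark, a
  natural number. Equal positions force equal letters, and as the choice is made from a countable
  list, the conditional law of the noise given the letter can be written down: prescribe the letter
  of one mark and keep the noises that choose this mark.

  The densities have no common bound, so rejection lacks an envelope. Their undergraphs are cut into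
  layers of height 1, each tested by a mark of its own, and a block counts only if exactly one layer
  accepts. With heights up to 4, the maximum of two densities catches none of the tested marks with
  probability at least 1 - 2/4.

  Chains from different pasts never share a state, but after \<open>k\<close> common letters they
  share \<open>g k\<close>. Measuring each state against \<open>g k\<close> splits the agreement
  bound into one factor per chain; this is why the lower bound is an expectation over a single
  trajectory of X, in which the two pasts enter through separate products.\<close>

lemma measurable_PiM_UNIV:
  assumes "\<And>i. (\<lambda>x. f x i) \<in> measurable N (M i)"
  shows "f \<in> measurable N (Pi\<^sub>M UNIV M)"
  using assms by (intro measurable_PiM_single') (auto simp: space_PiM dest: measurable_space)

text \<open>The update map sends \<open>M \<Otimes>\<^sub>M S\<close> to \<open>S\<close>, so
  overwriting one coordinate by an independent draw does not change the law. This is how a single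
  mark is integrated out with all others held fixed.\<close>

lemma (in sequence_space) nn_integral_resample:
  assumes [measurable]: "H \<in> borel_measurable S"
  shows "(\<integral>\<^sup>+ u. H u \<partial>S) = (\<integral>\<^sup>+ u. \<integral>\<^sup>+ z. H (u(i := z)) \<partial>M \<partial>S)"
proof -
  interpret MS: pair_sigma_finite M S ..
  have upd: "(\<lambda>(x, X). X(i := x)) \<in> measurable (M \<Otimes>\<^sub>M S) S"
    by (rule measurable_PiM_UNIV) (simp add: fun_upd_def split_beta')
  have "(\<integral>\<^sup>+ u. H u \<partial>S) = (\<integral>\<^sup>+ u. H u \<partial>distr (M \<Otimes>\<^sub>M S) S (\<lambda>(x, X). X(i := x)))"
    using distr_pair_PiM_eq_PiM[of UNIV "\<lambda>_. M" i] prob_space by simp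
  also have "\<dots> = (\<integral>\<^sup>+ p. H ((snd p)(i := fst p)) \<partial>(M \<Otimes>\<^sub>M S))"
    using upd by (subst nn_integral_distr) (auto simp: split_beta')
  also have "\<dots> = (\<integral>\<^sup>+ u. \<integral>\<^sup>+ z. H (u(i := z)) \<partial>M \<partial>S)"
    using upd by (subst MS.nn_integral_snd[symmetric]) (auto simp: split_beta' intro: measurable_compose)
  finally show ?thesis .
qed

lemma (in sequence_space) distr_swap:
  "distr S S (\<lambda>u n. u (Transposition.transpose i j n)) = S"
proof -
  have "distr S S (\<lambda>\<omega>. \<lambda>n\<in>UNIV. \<omega> (Transposition.transpose i j n)) = S"
    by (rule distr_PiM_reindex) (auto intro: prob_space)
  then show ?thesis by (simp add: restrict_def)
qed

text \<open>The elementary formula behind rejection sampling: the first visit to \<open>B\<close>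
  happens at time \<open>n\<close> and lies in \<open>A\<close> with probability a (1 - b)^n, and
  the geometric series sums to a / b.\<close>

lemma (in sequence_space) emeasure_first_hit:
  assumes [measurable]: "A \<in> sets M" "B \<in> sets M" and AB: "A \<subseteq> B" and pos: "emeasure M B > 0"
  shows "emeasure S {v \<in> space S. \<exists>n. v n \<in> A \<and> (\<forall>m<n. v m \<notin> B)} = emeasure M A / emeasure M B"
proof -
  let ?D = "\<lambda>n. {v \<in> space S. v n \<in> A \<and> (\<forall>m<n. v m \<notin> B)}"
  let ?a = "M.prob A" and ?b = "M.prob B"
  have b: "0 < ?b" "?b \<le> 1" using pos by (auto simp: M.emeasure_eq_measure)
  have D: "P.prob (?D n) = ?a * (1 - ?b) ^ n" for n
  proof -
    let ?F = "\<lambda>m. if m = n then A else space M - B"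
    have "?D n = {v \<in> space S. \<forall>m\<in>{..n}. v m \<in> ?F m}"
      by (auto simp: space_PiM PiE_iff order_le_less)
    also have "P.prob \<dots> = (\<Prod>m\<in>{..n}. M.prob (?F m))"
      using emeasure_PiM_Collect[of "{..n}" ?F] 
      by (simp add: P.emeasure_eq_measure M.emeasure_eq_measure prod_ennreal prod_nonneg)
    also have "{..n} = insert n {..<n}" by auto
    also have "(\<Prod>m\<in>insert n {..<n}. M.prob (?F m)) = ?a * (\<Prod>m<n. M.prob (?F m))"
      by (subst prod.insert) auto
    also have "(\<Prod>m<n. M.prob (?F m)) = (\<Prod>m<n. 1 - ?b)"
      by (intro prod.cong) (auto simp: M.prob_compl)
    finally show ?thesis by simp
  qed
  have "(\<lambda>n. P.prob (?D n)) sums P.prob (\<Union>n. ?D n)"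
  proof (rule P.finite_measure_UNION)
    have "?D n \<in> sets S" for n by measurable
    then show "range ?D \<subseteq> sets S" by blast
    have "?D m \<inter> ?D n = {}" if "m < n" for m n
      using AB that by blast
    then show "disjoint_family ?D"
      unfolding disjoint_family_on_def by (metis (no_types, lifting) inf_commute linorder_neqE_nat)
  qed
  then have *: "(\<lambda>n. ?a * (1 - ?b) ^ n) sums P.prob (\<Union>n. ?D n)"
    unfolding D .
  have "(\<lambda>n. ?a * (1 - ?b) ^ n) sums (?a * (1 / (1 - (1 - ?b))))"
    using b by (intro sums_mult geometric_sums) auto
  from sums_unique2[OF * this] have "P.prob (\<Union>n. ?D n) = ?a / ?b" by simp
  moreover have "(\<Union>n. ?D n) = {v \<in> space S. \<exists>n. v n \<in> A \<and> (\<forall>m<n. v m \<notin> B)}" by auto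
  ultimately show ?thesis
    using b by (simp only: P.emeasure_eq_measure M.emeasure_eq_measure divide_ennreal measure_nonneg)
qed

text \<open>A pairing function turns one sequence into a double array, so that every mark of every
  block keeps a single natural number as its address.\<close>

definition block :: "(nat \<Rightarrow> 'z) \<Rightarrow> nat \<Rightarrow> nat \<Rightarrow> 'z" where
  "block u n i = u (prod_encode (n, i))"

lemma (in sequence_space) measurable_block [measurable]:
  "block \<in> measurable S (Pi\<^sub>M UNIV (\<lambda>_. S))" "(\<lambda>u. block u n) \<in> measurable S S"
proof -
  show *: "(\<lambda>u. block u n) \<in> measurable S S" for n
    unfolding block_def[abs_def] by (rule measurable_PiM_UNIV) simp
  show "block \<in> measurable S (Pi\<^sub>M UNIV (\<lambda>_. S))"
    by (rule measurable_PiM_UNIV) (rule *)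
qed

text \<open>The inverse arrangement \<open>flat\<close> is treated first: it pulls a finite cylinder
  back to finitely many cylinders, one for each row that meets \<open>J\<close>, and their
  probabilities multiply. The claim follows because \<open>block\<close> undoes
  \<open>flat\<close>.\<close>

lemma (in sequence_space) distr_block: "distr S (Pi\<^sub>M UNIV (\<lambda>_. S)) block = Pi\<^sub>M UNIV (\<lambda>_::nat. S)"
proof -
  interpret SS: sequence_space S ..
  let ?T = "Pi\<^sub>M UNIV (\<lambda>_::nat. S)"
  define flat :: "(nat \<Rightarrow> nat \<Rightarrow> 'a) \<Rightarrow> nat \<Rightarrow> 'a"
    where "flat v m = v (fst (prod_decode m)) (snd (prod_decode m))" for v m
  have [measurable]: "flat \<in> measurable ?T S"
    unfolding flat_def[abs_def]
  proof (rule measurable_PiM_UNIV)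
    fix m
    show "(\<lambda>v. v (fst (prod_decode m)) (snd (prod_decode m))) \<in> measurable ?T M"
      by (rule measurable_compose[where N = S and g = "\<lambda>u. u (snd (prod_decode m))"]) auto
  qed
  have "distr ?T S flat = S"
  proof (rule PiM_eq)
    fix J F assume J: "finite J" "J \<subseteq> (UNIV :: nat set)" "\<And>j. j \<in> J \<Longrightarrow> F j \<in> sets M"
    let ?K = "fst ` prod_decode ` J" and ?L = "\<lambda>n. {i. prod_encode (n, i) \<in> J}"
    let ?B = "\<lambda>n. {u \<in> space S. \<forall>i\<in>?L n. u i \<in> F (prod_encode (n, i))}"
    have finL: "finite (?L n)" for n
    proof -
      have "finite ((\<lambda>i. prod_encode (n, i)) -` J)"
        by (rule finite_vimageI[OF J(1)]) (simp add: inj_on_def)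
      then show ?thesis by (simp add: vimage_def)
    qed
    have FL: "i \<in> ?L n \<Longrightarrow> F (prod_encode (n, i)) \<in> sets M" for i n using J(3) by auto
    have B [measurable]: "?B n \<in> sets S" for n
    proof (rule sets.sets_Collect_finite_All[OF _ finL])
      fix i assume "i \<in> ?L n"
      note FL[OF this, measurable]
      show "{u \<in> space S. u i \<in> F (prod_encode (n, i))} \<in> sets S" by measurable
    qed
    have "flat -` prod_emb UNIV (\<lambda>_. M) J (Pi\<^sub>E J F) \<inter> space ?T = {v \<in> space ?T. \<forall>n\<in>?K. v n \<in> ?B n}"
    proof (intro set_eqI iffI)
      fix v assume "v \<in> flat -` prod_emb UNIV (\<lambda>_. M) J (Pi\<^sub>E J F) \<inter> space ?T"
      then have "v \<in> space ?T" "\<forall>m\<in>J. flat v m \<in> F m" by (auto simp: prod_emb_def)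
      then show "v \<in> {v \<in> space ?T. \<forall>n\<in>?K. v n \<in> ?B n}"
        by (force simp: flat_def space_PiM PiE_iff)
    next
      fix v assume v: "v \<in> {v \<in> space ?T. \<forall>n\<in>?K. v n \<in> ?B n}"
      have "flat v m \<in> F m" if "m \<in> J" for m
      proof -
        have "v (fst (prod_decode m)) \<in> ?B (fst (prod_decode m))" using v that by auto
        then have "\<And>i. prod_encode (fst (prod_decode m), i) \<in> J \<Longrightarrow>
            v (fst (prod_decode m)) i \<in> F (prod_encode (fst (prod_decode m), i))"
          by auto
        from this[of "snd (prod_decode m)"] show ?thesis
          using that by (simp add: flat_def)
      qed
      moreover have v': "v \<in> space ?T" using v by auto
      moreover have "flat v \<in> space S"
        using v' by (simp add: space_PiM PiE_iff flat_def)
      ultimately show "v \<in> flat -` prod_emb UNIV (\<lambda>_. M) J (Pi\<^sub>E J F) \<inter> space ?T"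
        by (simp add: prod_emb_def PiE_iff space_PiM)
    qed
    then have "emeasure (distr ?T S flat) (prod_emb UNIV (\<lambda>_. M) J (Pi\<^sub>E J F))
        = emeasure ?T {v \<in> space ?T. \<forall>n\<in>?K. v n \<in> ?B n}"
      using J by (subst emeasure_distr) (auto intro!: sets_PiM_I)
    also have "\<dots> = (\<Prod>n\<in>?K. emeasure S (?B n))"
      using J(1) by (intro SS.emeasure_PiM_Collect B) simp_all
    also have "\<dots> = (\<Prod>n\<in>?K. \<Prod>i\<in>?L n. emeasure M (F (prod_encode (n, i))))"
      by (intro prod.cong refl emeasure_PiM_Collect finL FL) simp_all
    also have "\<dots> = (\<Prod>(n, i)\<in>Sigma ?K ?L. emeasure M (F (prod_encode (n, i))))"
      using J(1) finL by (subst prod.Sigma) auto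
    also have "\<dots> = (\<Prod>j\<in>J. emeasure M (F j))"
    proof (rule prod.reindex_bij_witness[where i = prod_decode and j = prod_encode])
      fix m assume m: "m \<in> J"
      obtain n i where ni: "prod_decode m = (n, i)" by (cases "prod_decode m")
      then have "prod_encode (n, i) = m" by (metis prod_decode_inverse)
      moreover have "n \<in> ?K" using m ni by (force simp: image_iff)
      ultimately show "prod_decode m \<in> Sigma ?K ?L" using m ni by simp
    qed auto
    finally show "emeasure (distr ?T S flat) (prod_emb UNIV (\<lambda>_. M) J (Pi\<^sub>E J F)) = (\<Prod>j\<in>J. emeasure M (F j))" .
  qed simp
  then have "distr S ?T block = distr (distr ?T S flat) ?T block" by simp
  also have "\<dots> = distr ?T ?T (block \<circ> flat)"
    by (rule distr_distr) measurable
  also have "block \<circ> flat = (\<lambda>v. v)"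
    by (simp add: fun_eq_iff block_def flat_def)
  finally show ?thesis by (simp add: distr_id2)
qed

text \<open>The point \<open>u (2 k + 1)\<close> makes up for the missing condition on \<open>u (2 k)\<close>, so that the second
  factor does not depend on \<open>k\<close>.\<close>

lemma (in sequence_space) emeasure_tick:
  assumes [measurable]: "V \<in> sets M" "\<And>i. W i \<in> sets M"
  shows "emeasure S {u \<in> space S. u (2 * k) \<in> V \<and> (\<forall>i. i \<noteq> k \<longrightarrow> u (2 * i) \<notin> W i) \<and> u (2 * k + 1) \<notin> W k}
       = emeasure M V * emeasure S {u \<in> space S. \<forall>i. u (2 * i) \<notin> W i}"
proof -
  let ?R = "{u \<in> space S. (\<forall>i. i \<noteq> k \<longrightarrow> u (2 * i) \<notin> W i) \<and> u (2 * k + 1) \<notin> W k}"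
  let ?A = "{u \<in> space S. u (2 * k) \<in> V \<and> (\<forall>i. i \<noteq> k \<longrightarrow> u (2 * i) \<notin> W i) \<and> u (2 * k + 1) \<notin> W k}"
  have V: "V \<subseteq> space M" using assms(1) by (rule sets.sets_into_space)
  have [measurable]: "?R \<in> sets S" "?A \<in> sets S" by measurable
  have "emeasure S ?A = (\<integral>\<^sup>+ u. indicator ?A u \<partial>S)" by simp
  also have "\<dots> = (\<integral>\<^sup>+ u. \<integral>\<^sup>+ z. indicator ?A (u(2 * k := z)) \<partial>M \<partial>S)"
    by (rule nn_integral_resample) auto
  also have "\<dots> = (\<integral>\<^sup>+ u. \<integral>\<^sup>+ z. indicator V z * indicator ?R u \<partial>M \<partial>S)"
  proof (intro nn_integral_cong)
    fix u z assume uz: "u \<in> space S" "z \<in> space M"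
    then have "u(2 * k := z) \<in> space S" by (auto simp: space_PiM)
    moreover have "2 * i \<noteq> 2 * k + 1" "2 * k + 1 \<noteq> 2 * k" for i :: nat by presburger+
    ultimately show "indicator ?A (u(2 * k := z)) = indicator V z * (indicator ?R u :: ennreal)"
      using uz by (auto simp: indicator_def)
  qed
  also have "\<dots> = emeasure M V * emeasure S ?R"
    by (simp add: nn_integral_multc nn_integral_cmult)
  \<comment> \<open>The swap of the positions 2k and 2k + 1 preserves \<open>S\<close> and turns the
    condition on the odd position into the missing one on the even position.\<close>
  also have "emeasure S ?R = emeasure (distr S S (\<lambda>u n. u (Transposition.transpose (2*k) (2*k+1) n))) 
      {u \<in> space S. \<forall>i. u (2 * i) \<notin> W i}"
  proof (subst emeasure_distr)
    have ne: "2 * i \<noteq> Suc (2 * k)" for i by presburger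
    have "((\<lambda>u n. u (Transposition.transpose (2*k) (2*k+1) n)) -` {u \<in> space S. \<forall>i. u (2 * i) \<notin> W i} \<inter> space S) = ?R"
    proof (intro set_eqI)
      fix u
      have "(\<forall>i. u (Transposition.transpose (2*k) (2*k+1) (2 * i)) \<notin> W i) \<longleftrightarrow>
         (\<forall>i. i \<noteq> k \<longrightarrow> u (2 * i) \<notin> W i) \<and> u (2 * k + 1) \<notin> W k"
        by (auto simp: Transposition.transpose_def ne)
      then show "u \<in> ((\<lambda>u n. u (Transposition.transpose (2*k) (2*k+1) n)) -` {u \<in> space S. \<forall>i. u (2 * i) \<notin> W i} \<inter> space S) \<longleftrightarrow> u \<in> ?R"
        by (auto simp: space_PiM)
    qed
    then show "emeasure S ?R = emeasure S ((\<lambda>u n. u (Transposition.transpose (2*k) (2*k+1) n)) -` {u \<in> space S. \<forall>i. u (2 * i) \<notin> W i} \<inter> space S)" by simp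
    show "{u \<in> space S. \<forall>i. u (2 * i) \<notin> W i} \<in> sets S" by measurable
  qed (auto intro!: measurable_PiM_UNIV)
  also have "\<dots> = emeasure S {u \<in> space S. \<forall>i. u (2 * i) \<notin> W i}"
    by (simp only: distr_swap)
  finally show ?thesis .
qed

section \<open>Rejection sampling from a common noise\<close>

definition mark :: "'e measure \<Rightarrow> ('e \<times> real) measure" where
  "mark \<pi> = \<pi> \<Otimes>\<^sub>M uniform_measure lborel {0..4}"

abbreviation noise :: "'e measure \<Rightarrow> (nat \<Rightarrow> 'e \<times> real) measure" where
  "noise \<pi> \<equiv> Pi\<^sub>M UNIV (\<lambda>_. mark \<pi>)"

text \<open>The undergraph of \<open>\<phi>\<close> is cut into the layers \<open>[k, k + 1)\<close>. Marks have heights in \<open>[0, 4]\<close> so that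
  with positive probability a mark is rejected whatever \<open>\<phi>\<close> is.\<close>

definition hit :: "('e \<Rightarrow> real) \<Rightarrow> nat \<Rightarrow> 'e \<times> real \<Rightarrow> bool" where
  "hit \<phi> k z \<longleftrightarrow> 0 \<le> snd z \<and> snd z < 1 \<and> real k + snd z < \<phi> (fst z)"

text \<open>A block \<open>c\<close> of marks succeeds at layer \<open>k\<close> if its mark \<open>2 k\<close> is the only accepted one among the
  marks \<open>2 i\<close>, each tested in layer \<open>i\<close>, and the additional mark \<open>2 k + 1\<close> is rejected in layer \<open>k\<close>.\<close>

definition succ_at :: "('e \<Rightarrow> real) \<Rightarrow> (nat \<Rightarrow> 'e \<times> real) \<Rightarrow> nat \<Rightarrow> bool" where
  "succ_at \<phi> c k \<longleftrightarrow>
     hit \<phi> k (c (2 * k)) \<and> (\<forall>i. i \<noteq> k \<longrightarrow> \<not> hit \<phi> i (c (2 * i))) \<and> \<not> hit \<phi> k (c (2 * k + 1))"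

text \<open>The position in \<open>u\<close> of the accepted mark of the first successful block. If no block succeeds, which has
  probability 0, then \<open>LEAST\<close> returns an arbitrary number.\<close>

definition sel :: "('e \<Rightarrow> real) \<Rightarrow> (nat \<Rightarrow> 'e \<times> real) \<Rightarrow> nat" where
  "sel \<phi> u = (let n = (LEAST n. \<exists>k. succ_at \<phi> (block u n) k)
     in prod_encode (n, 2 * (LEAST k. succ_at \<phi> (block u n) k)))"

definition letter :: "('e \<Rightarrow> real) \<Rightarrow> (nat \<Rightarrow> 'e \<times> real) \<Rightarrow> 'e" where
  "letter \<phi> u = fst (u (sel \<phi> u))"

lemma space_mark: "space (mark \<pi>) = space \<pi> \<times> UNIV"
  by (simp add: mark_def space_pair_measure)

lemma sets_mark [measurable_cong]: "sets (mark \<pi>) = sets (\<pi> \<Otimes>\<^sub>M borel)"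
  unfolding mark_def by (rule sets_pair_measure_cong) simp_all

lemma measurable_hit [measurable (raw)]:
  assumes [measurable]: "(\<lambda>(x, a). \<phi> x a) \<in> borel_measurable (N \<Otimes>\<^sub>M \<pi>)" "z \<in> measurable N (mark \<pi>)"
  shows "Measurable.pred N (\<lambda>x. hit (\<phi> x) k (z x))"
proof -
  have [measurable]: "(\<lambda>x. fst (z x)) \<in> measurable N \<pi>" "(\<lambda>x. snd (z x)) \<in> borel_measurable N"
    using assms(2) unfolding measurable_cong_sets[OF refl sets_mark]
    by (auto intro: measurable_fst' measurable_snd')
  have [measurable]: "(\<lambda>x. \<phi> x (fst (z x))) \<in> borel_measurable N"
    using measurable_compose[OF measurable_Pair[OF measurable_ident \<open>(\<lambda>x. fst (z x)) \<in> _\<close>] assms(1)]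
    by simp
  show ?thesis unfolding hit_def by measurable
qed

lemma measurable_sel:
  assumes [measurable]: "(\<lambda>(x, a). \<phi> x a) \<in> borel_measurable (N \<Otimes>\<^sub>M \<pi>)" "u \<in> measurable N (noise \<pi>)"
  shows "(\<lambda>x. sel (\<phi> x) (u x)) \<in> measurable N (count_space UNIV)"
proof -
  have [measurable]: "(\<lambda>x. block (u x) n i) \<in> measurable N (mark \<pi>)" for n i
    unfolding block_def by measurable
  have [measurable]: "Measurable.pred N (\<lambda>x. succ_at (\<phi> x) (block (u x) n) k)" for n k
    unfolding succ_at_def by measurable
  have "Measurable.pred N (\<lambda>x. sel (\<phi> x) (u x) = j)" for j
  proof -
    have "sel (\<phi> x) (u x) = j \<longleftrightarrow>
       (\<exists>n k. j = prod_encode (n, 2 * k) \<and> n = (LEAST n. \<exists>k. succ_at (\<phi> x) (block (u x) n) k) \<and>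
          k = (LEAST k. succ_at (\<phi> x) (block (u x) n) k))" for x
      by (auto simp: sel_def Let_def)
    then show ?thesis by simp
  qed
  then show ?thesis
    by (intro measurable_count_space_eq_countable[THEN iffD2]) (auto simp: pred_def vimage_def Int_def conj_commute)
qed

lemma measurable_letter:
  assumes [measurable]: "(\<lambda>(x, a). \<phi> x a) \<in> borel_measurable (N \<Otimes>\<^sub>M \<pi>)" "u \<in> measurable N (noise \<pi>)"
  shows "(\<lambda>x. letter (\<phi> x) (u x)) \<in> measurable N \<pi>"
proof -
  note [measurable] = measurable_sel[OF assms]
  have "(\<lambda>x. u x (sel (\<phi> x) (u x))) \<in> measurable N (mark \<pi>)"
    by (rule measurable_compose_countable'[where I = UNIV]) auto
  then show ?thesis
    unfolding letter_def using measurable_cong_sets[OF refl sets_mark] by (metis measurable_fst')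
qed

section \<open>Layers of an undergraph and the mass of the accepted marks\<close>

definition clip :: "real \<Rightarrow> real" where
  "clip y = max 0 (min 1 y)"

text \<open>\<open>clip (y - real k)\<close> is the length of the part of [0, y) in the layer [k, k
  + 1), so the partial sums equal min(y, n) and are constant as soon as n \<ge> y.\<close>

lemma clip_sums:
  assumes "0 \<le> y"
  shows "(\<Sum>k. ennreal (clip (y - real k))) = ennreal y"
proof (rule suminf_ennreal_eq)
  have part: "(\<Sum>k<n. clip (y - real k)) = min y (real n)" for n
    by (induction n) (use assms in \<open>auto simp: clip_def\<close>)
  have "\<forall>\<^sub>F n in sequentially. y = (\<Sum>k<n. clip (y - real k))"
    unfolding part using eventually_ge_at_top[of "nat \<lceil>y\<rceil>"]
    by eventually_elim (simp add: min_absorb1 nat_ceiling_le_eq)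
  then show "(\<lambda>k. clip (y - real k)) sums y"
    unfolding sums_def by (rule tendsto_eventually[OF eventually_mono]) simp
qed (simp add: clip_def)

lemma ennreal_divide_4: "0 \<le> x \<Longrightarrow> ennreal x / 4 = ennreal (x / 4)"
  using divide_ennreal[of x 4] by simp

lemma ennreal_one_plus_4: "0 \<le> x \<Longrightarrow> 1 + 4 * ennreal x = ennreal (1 + 4 * x)"
  by (simp add: ennreal_mult')

locale sampler = prob_space \<pi> for \<pi> :: "'e measure"
begin

sublocale height: prob_space "uniform_measure lborel {0..4::real}"
  by (rule prob_space_uniform_measure) auto

sublocale marks: pair_prob_space \<pi> "uniform_measure lborel {0..4::real}" ..

sublocale mark: prob_space "mark \<pi>"
  unfolding mark_def by unfold_locales

sublocale noise: sequence_space "mark \<pi>" ..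

lemma emeasure_hit:
  assumes [measurable]: "\<phi> \<in> borel_measurable \<pi>" "B \<in> sets \<pi>"
  shows "emeasure (mark \<pi>) {z \<in> space (mark \<pi>). fst z \<in> B \<and> hit \<phi> k z}
    = (\<integral>\<^sup>+ a. ennreal (clip (\<phi> a - real k)) / 4 * indicator B a \<partial>\<pi>)"
proof -
  let ?X = "{z \<in> space (mark \<pi>). fst z \<in> B \<and> hit \<phi> k z}"
  have X: "?X \<in> sets (\<pi> \<Otimes>\<^sub>M uniform_measure lborel {0..4})"
    unfolding mark_def[symmetric] by measurable
  have "emeasure (mark \<pi>) ?X = (\<integral>\<^sup>+ a. emeasure (uniform_measure lborel {0..4::real}) (Pair a -` ?X) \<partial>\<pi>)"
    unfolding mark_def[of \<pi>] using height.emeasure_pair_measure_alt[OF X] by (simp add: mark_def)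
  also have "\<dots> = (\<integral>\<^sup>+ a. ennreal (clip (\<phi> a - real k)) / 4 * indicator B a \<partial>\<pi>)"
  proof (rule nn_integral_cong)
    fix a assume a: "a \<in> space \<pi>"
    have *: "Pair a -` ?X = (if a \<in> B then {0..<min 1 (\<phi> a - real k)} else {})"
      using a by (auto simp: space_mark hit_def)
    have "{0..4::real} \<inter> {0..<min 1 (\<phi> a - real k)} = {0..<min 1 (\<phi> a - real k)}" by auto
    moreover have "emeasure lborel {0..<min 1 (\<phi> a - real k)} = ennreal (clip (\<phi> a - real k))"
      by (cases "0 \<le> min 1 (\<phi> a - real k)") (auto simp: clip_def max_def ennreal_neg)
    ultimately show "emeasure (uniform_measure lborel {0..4::real}) (Pair a -` ?X)
        = ennreal (clip (\<phi> a - real k)) / 4 * indicator B a"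
      unfolding * by (auto simp: emeasure_uniform_measure)
  qed
  finally show ?thesis .
qed

text \<open>Tonelli over the layers: stacked together they restore \<phi>, and the factor 1/4 is the
  density of the uniform heights on [0, 4].\<close>

lemma suminf_hit:
  assumes [measurable]: "\<phi> \<in> borel_measurable \<pi>" "B \<in> sets \<pi>" and nn: "\<And>a. a \<in> space \<pi> \<Longrightarrow> 0 \<le> \<phi> a"
  shows "(\<Sum>k. emeasure (mark \<pi>) {z \<in> space (mark \<pi>). fst z \<in> B \<and> hit \<phi> k z})
    = (\<integral>\<^sup>+ a. ennreal (\<phi> a) * indicator B a \<partial>\<pi>) / 4"
proof -
  have [measurable]: "(\<lambda>a. clip (\<phi> a - real k)) \<in> borel_measurable \<pi>" for k
    unfolding clip_def by measurable
  have "(\<Sum>k. emeasure (mark \<pi>) {z \<in> space (mark \<pi>). fst z \<in> B \<and> hit \<phi> k z})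
     = (\<integral>\<^sup>+ a. (\<Sum>k. ennreal (clip (\<phi> a - real k)) / 4 * indicator B a) \<partial>\<pi>)"
    by (subst nn_integral_suminf) (simp_all add: emeasure_hit)
  also have "\<dots> = (\<integral>\<^sup>+ a. ennreal (\<phi> a) * indicator B a / 4 \<partial>\<pi>)"
  proof (rule nn_integral_cong)
    fix a assume "a \<in> space \<pi>"
    then have "(\<Sum>k. ennreal (clip (\<phi> a - real k))) = ennreal (\<phi> a)"
      by (intro clip_sums nn)
    then show "(\<Sum>k. ennreal (clip (\<phi> a - real k)) / 4 * indicator B a) = ennreal (\<phi> a) * indicator B a / 4"
      by (simp add: divide_ennreal_def ac_simps flip: ennreal_suminf_cmult)
         (simp add: ennreal_suminf_multc ennreal_suminf_cmult ac_simps)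
  qed
  also have "\<dots> = (\<integral>\<^sup>+ a. ennreal (\<phi> a) * indicator B a \<partial>\<pi>) / 4"
    by (rule nn_integral_divide) measurable
  finally show ?thesis .
qed

text \<open>For \<open>lo\<close> and \<open>hi\<close> the minimum and the maximum of two densities: both succeed in the block, with the same mark.\<close>

definition good :: "('e \<Rightarrow> real) \<Rightarrow> ('e \<Rightarrow> real) \<Rightarrow> 'e set \<Rightarrow> (nat \<Rightarrow> 'e \<times> real) set" where
  "good lo hi B = {c \<in> space (noise \<pi>). \<exists>k. fst (c (2 * k)) \<in> B \<and> hit lo k (c (2 * k)) \<and>
     (\<forall>i. i \<noteq> k \<longrightarrow> \<not> hit hi i (c (2 * i))) \<and> \<not> hit hi k (c (2 * k + 1))}"

text \<open>The factor left over by \<open>emeasure_tick\<close>, the same for every layer. It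
  cancels in the ratio of good to stopping blocks, so that apart from the bound 1/2 from below only
  its finiteness matters.\<close>

definition silent :: "('e \<Rightarrow> real) \<Rightarrow> ennreal" where
  "silent hi = emeasure (noise \<pi>) {c \<in> space (noise \<pi>). \<forall>i. \<not> hit hi i (c (2 * i))}"

lemma sets_good [measurable]:
  assumes [measurable]: "lo \<in> borel_measurable \<pi>" "hi \<in> borel_measurable \<pi>" "B \<in> sets \<pi>"
  shows "good lo hi B \<in> sets (noise \<pi>)"
  unfolding good_def by measurable

text \<open>Since \<open>lo\<close> is below \<open>hi\<close>, a mark accepted by \<open>lo\<close>
  in layer \<open>k\<close> violates the requirement of every other layer, so the events for
  different \<open>k\<close> are disjoint. By \<open>emeasure_tick\<close> each contributes the mass
  of its layer times one common factor, and the masses add up by \<open>suminf_hit\<close>; the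
  density is not distorted.\<close>

lemma emeasure_good:
  assumes [measurable]: "lo \<in> borel_measurable \<pi>" "hi \<in> borel_measurable \<pi>" "B \<in> sets \<pi>"
    and nn: "\<And>a. a \<in> space \<pi> \<Longrightarrow> 0 \<le> lo a" and le: "\<And>a. a \<in> space \<pi> \<Longrightarrow> lo a \<le> hi a"
  shows "emeasure (noise \<pi>) (good lo hi B) = (\<integral>\<^sup>+ a. ennreal (lo a) * indicator B a \<partial>\<pi>) / 4 * silent hi"
proof -
  define V where "V k = {z \<in> space (mark \<pi>). fst z \<in> B \<and> hit lo k z}" for k
  define W where "W k = {z \<in> space (mark \<pi>). hit hi k z}" for k
  have [measurable]: "V k \<in> sets (mark \<pi>)" "W k \<in> sets (mark \<pi>)" for k
    unfolding V_def W_def by measurable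
  define E where "E k = {c \<in> space (noise \<pi>). c (2 * k) \<in> V k \<and> (\<forall>i. i \<noteq> k \<longrightarrow> c (2 * i) \<notin> W i) \<and> c (2 * k + 1) \<notin> W k}" for k
  have c: "c i \<in> space (mark \<pi>)" if "c \<in> space (noise \<pi>)" for c i
    using that by (auto simp: space_PiM)
  have VW: "V k \<subseteq> W k" for k
    using le by (fastforce simp: V_def W_def hit_def space_mark)
  have "disjoint_family E"
    unfolding disjoint_family_on_def
  proof (intro ballI impI)
    fix m n :: nat assume "m \<noteq> n"
    then show "E m \<inter> E n = {}" using VW by (auto simp: E_def)
  qed
  moreover have "range E \<subseteq> sets (noise \<pi>)"
    unfolding E_def by auto
  ultimately have "(\<Sum>k. emeasure (noise \<pi>) (E k)) = emeasure (noise \<pi>) (\<Union>k. E k)"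
    by (intro suminf_emeasure)
  also have "(\<Union>k. E k) = good lo hi B"
    using c by (auto simp: good_def E_def V_def W_def)
  also have "(\<Sum>k. emeasure (noise \<pi>) (E k)) = (\<Sum>k. emeasure (mark \<pi>) (V k) * silent hi)"
  proof (rule suminf_cong)
    fix k
    have "{c \<in> space (noise \<pi>). \<forall>i. c (2 * i) \<notin> W i} = {c \<in> space (noise \<pi>). \<forall>i. \<not> hit hi i (c (2 * i))}"
      using c by (auto simp: W_def)
    then show "emeasure (noise \<pi>) (E k) = emeasure (mark \<pi>) (V k) * silent hi"
      unfolding E_def silent_def by (subst noise.emeasure_tick) auto
  qed
  also have "\<dots> = (\<Sum>k. emeasure (mark \<pi>) (V k)) * silent hi"
    by (rule ennreal_suminf_multc)
  also have "(\<Sum>k. emeasure (mark \<pi>) (V k)) = (\<integral>\<^sup>+ a. ennreal (lo a) * indicator B a \<partial>\<pi>) / 4"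
    unfolding V_def by (rule suminf_hit) (auto intro: nn)
  finally show ?thesis by simp
qed

text \<open>Union bound: the expected number of tested marks under the graph of \<open>hi\<close> is
  a quarter of its integral, hence at most 2/4. The maximum of two probability densities has
  integral at most 2, which is where the height 4 of the marks comes from.\<close>

lemma silent_ge:
  assumes [measurable]: "hi \<in> borel_measurable \<pi>" and nn: "\<And>a. a \<in> space \<pi> \<Longrightarrow> 0 \<le> hi a"
    and le: "(\<integral>\<^sup>+ a. ennreal (hi a) \<partial>\<pi>) \<le> 2"
  shows "1 / 2 \<le> silent hi"
proof -
  let ?R = "{c \<in> space (noise \<pi>). \<forall>i. \<not> hit hi i (c (2 * i))}"
  let ?W = "\<lambda>i. {z \<in> space (mark \<pi>). fst z \<in> space \<pi> \<and> hit hi i z}"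
  have "emeasure (noise \<pi>) (space (noise \<pi>) - ?R) \<le> emeasure (noise \<pi>) (\<Union>i. {c \<in> space (noise \<pi>). c (2 * i) \<in> ?W i})"
  proof (rule emeasure_mono)
    show "space (noise \<pi>) - ?R \<subseteq> (\<Union>i. {c \<in> space (noise \<pi>). c (2 * i) \<in> ?W i})"
    proof
      fix c assume c: "c \<in> space (noise \<pi>) - ?R"
      then obtain i where "hit hi i (c (2 * i))" by auto
      moreover have "c (2 * i) \<in> space (mark \<pi>)" using c by (auto simp: space_PiM)
      ultimately have "c \<in> {c \<in> space (noise \<pi>). c (2 * i) \<in> ?W i}"
        using c by (simp add: space_mark mem_Times_iff)
      then show "c \<in> (\<Union>i. {c \<in> space (noise \<pi>). c (2 * i) \<in> ?W i})" by blast
    qed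
    show "(\<Union>i. {c \<in> space (noise \<pi>). c (2 * i) \<in> ?W i}) \<in> sets (noise \<pi>)"
      by measurable
  qed
  also have "\<dots> \<le> (\<Sum>i. emeasure (noise \<pi>) {c \<in> space (noise \<pi>). c (2 * i) \<in> ?W i})"
    by (rule emeasure_subadditive_countably) auto
  also have "\<dots> = (\<Sum>i. emeasure (mark \<pi>) (?W i))"
    by (intro suminf_cong noise.emeasure_PiM_Collect_single) auto
  also have "\<dots> = (\<integral>\<^sup>+ a. ennreal (hi a) * indicator (space \<pi>) a \<partial>\<pi>) / 4"
    by (rule suminf_hit) (auto intro: nn)
  also have "\<dots> = (\<integral>\<^sup>+ a. ennreal (hi a) \<partial>\<pi>) / 4"
    by (intro arg_cong[where f = "\<lambda>x. x / 4"] nn_integral_cong) auto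
  also have "\<dots> \<le> 2 / 4"
    using le by (rule divide_right_mono_ennreal)
  also have "2 / 4 = ennreal (1 / 2)"
    using ennreal_divide_4[of 2] by simp
  finally have "emeasure (noise \<pi>) (space (noise \<pi>) - ?R) \<le> ennreal (1 / 2)" .
  then have "noise.P.prob (space (noise \<pi>) - ?R) \<le> 1 / 2"
    unfolding noise.P.emeasure_eq_measure by (subst (asm) ennreal_le_iff) simp_all
  then have "1 / 2 \<le> noise.P.prob ?R"
    by (subst (asm) noise.P.prob_compl) auto
  then have "ennreal (1 / 2) \<le> silent hi"
    unfolding silent_def noise.P.emeasure_eq_measure by (rule ennreal_leI)
  then show ?thesis using divide_ennreal[of 1 2] by simp
qed

text \<open>In block \<open>n\<close> the mark \<open>2 * k\<close> is accepted by both densities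
  and the other marks that matter are rejected by both, so either density succeeds there at
  \<open>k\<close> and nowhere else. As neither succeeds earlier, both pairs of \<open>LEAST\<close>
  operators return the same numbers.\<close>

lemma agree_on_good:
  assumes u: "u \<in> space (noise \<pi>)" and n: "block u n \<in> good (\<lambda>a. min (\<phi> a) (\<psi> a)) (\<lambda>a. max (\<phi> a) (\<psi> a)) B"
    and first: "\<forall>m<n. \<not> (\<exists>k. succ_at \<phi> (block u m) k \<or> succ_at \<psi> (block u m) k)"
  shows "sel \<phi> u = sel \<psi> u \<and> letter \<phi> u \<in> B"
proof -
  obtain k where k: "fst (block u n (2 * k)) \<in> B" "hit (\<lambda>a. min (\<phi> a) (\<psi> a)) k (block u n (2 * k))"
     "\<And>i. i \<noteq> k \<Longrightarrow> \<not> hit (\<lambda>a. max (\<phi> a) (\<psi> a)) i (block u n (2 * i))"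
     "\<not> hit (\<lambda>a. max (\<phi> a) (\<psi> a)) k (block u n (2 * k + 1))"
    using n by (auto simp: good_def)
  have *: "sel \<theta> u = prod_encode (n, 2 * k)" if \<theta>: "\<theta> = \<phi> \<or> \<theta> = \<psi>" for \<theta>
  proof -
    have le: "min (\<phi> a) (\<psi> a) \<le> \<theta> a" "\<theta> a \<le> max (\<phi> a) (\<psi> a)" for a
      using \<theta> by auto
    have "hit (\<lambda>a. min (\<phi> a) (\<psi> a)) i z \<Longrightarrow> hit \<theta> i z" "hit \<theta> i z \<Longrightarrow> hit (\<lambda>a. max (\<phi> a) (\<psi> a)) i z" for i z
      using le[of "fst z"] unfolding hit_def by linarith+
    then have s: "succ_at \<theta> (block u n) i \<longleftrightarrow> i = k" for i
      using k unfolding succ_at_def by blast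
    then have "(LEAST k. succ_at \<theta> (block u n) k) = k"
      by (auto intro: Least_equality)
    moreover have "(LEAST n. \<exists>k. succ_at \<theta> (block u n) k) = n"
    proof (rule Least_equality)
      show "\<exists>k. succ_at \<theta> (block u n) k" using s by blast
      show "n \<le> m" if "\<exists>k. succ_at \<theta> (block u m) k" for m
        using first \<theta> that by (meson not_le)
    qed
    ultimately show ?thesis by (simp add: sel_def)
  qed
  then show ?thesis
    using k(1) by (simp add: letter_def block_def)
qed

lemma good_succ_at:
  assumes "c \<in> good \<phi> \<phi> B"
  shows "\<exists>k. succ_at \<phi> c k"
  using assms by (auto simp: good_def succ_at_def)

lemma good_succ_at_min_max:
  assumes "c \<in> good (\<lambda>a. min (\<phi> a) (\<psi> a)) (\<lambda>a. max (\<phi> a) (\<psi> a)) B"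
  shows "\<exists>k. succ_at \<phi> c k"
proof -
  have hi: "hit (\<lambda>a. max (\<phi> a) (\<psi> a)) k z \<longleftrightarrow> hit \<phi> k z \<or> hit \<psi> k z"
    "hit (\<lambda>a. min (\<phi> a) (\<psi> a)) k z \<longleftrightarrow> hit \<phi> k z \<and> hit \<psi> k z" for k z
    by (auto simp: hit_def)
  show ?thesis using assms unfolding good_def hi succ_at_def by blast
qed

text \<open>Only points that separate the two acceptance regions can produce a tick that stops
  exactly one of the two selections or stops them differently.\<close>

lemma emeasure_agree_ge:
  assumes [measurable]: "\<phi> \<in> borel_measurable \<pi>" "\<psi> \<in> borel_measurable \<pi>" "B \<in> sets \<pi>"
    and nn: "\<And>a. a \<in> space \<pi> \<Longrightarrow> 0 \<le> \<phi> a" "\<And>a. a \<in> space \<pi> \<Longrightarrow> 0 \<le> \<psi> a"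
    and one: "(\<integral>\<^sup>+ a. ennreal (\<phi> a) \<partial>\<pi>) = 1" "(\<integral>\<^sup>+ a. ennreal (\<psi> a) \<partial>\<pi>) = 1"
  shows "(\<integral>\<^sup>+ a. ennreal (min (\<phi> a) (\<psi> a)) * indicator B a \<partial>\<pi>)
      / (1 + 4 * (\<integral>\<^sup>+ a. ennreal \<bar>\<phi> a - \<psi> a\<bar> \<partial>\<pi>))
    \<le> emeasure (noise \<pi>) {u \<in> space (noise \<pi>). sel \<phi> u = sel \<psi> u \<and> letter \<phi> u \<in> B}"
proof -
  let ?lo = "\<lambda>a. min (\<phi> a) (\<psi> a)" and ?hi = "\<lambda>a. max (\<phi> a) (\<psi> a)"
  define D where "D = (\<integral>\<^sup>+ a. ennreal \<bar>\<phi> a - \<psi> a\<bar> \<partial>\<pi>)"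
  define L where "L = (\<integral>\<^sup>+ a. ennreal (?lo a) * indicator B a \<partial>\<pi>)"
  define R where "R = silent ?hi"
  let ?stop = "{c \<in> space (noise \<pi>). \<exists>k. succ_at \<phi> c k \<or> succ_at \<psi> c k}"
  have [measurable]: "?stop \<in> sets (noise \<pi>)"
    unfolding succ_at_def by measurable
  have lo_nn: "0 \<le> ?lo a" if "a \<in> space \<pi>" for a using nn that by auto
  have lo1: "(\<integral>\<^sup>+ a. ennreal (?lo a) \<partial>\<pi>) \<le> 1"
    unfolding one(1)[symmetric] by (intro nn_integral_mono ennreal_leI) auto
  have "(\<integral>\<^sup>+ a. ennreal (?hi a) \<partial>\<pi>) \<le> (\<integral>\<^sup>+ a. ennreal (\<phi> a) + ennreal (\<psi> a) \<partial>\<pi>)"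
  proof (rule nn_integral_mono)
    fix a assume "a \<in> space \<pi>"
    then show "ennreal (?hi a) \<le> ennreal (\<phi> a) + ennreal (\<psi> a)"
      using nn by (subst ennreal_plus[symmetric]) (auto intro!: ennreal_leI simp del: ennreal_plus)
  qed
  also have "\<dots> = 2" by (subst nn_integral_add) (auto simp: one)
  finally have R: "1 / 2 \<le> R"
    unfolding R_def using nn by (intro silent_ge) (auto simp: le_max_iff_disj)
  have R_le: "R \<le> 1" unfolding R_def silent_def by (rule noise.P.emeasure_le_1)
  have D_le: "D \<le> 2"
  proof -
    have "D \<le> (\<integral>\<^sup>+ a. ennreal (\<phi> a) + ennreal (\<psi> a) \<partial>\<pi>)"
      unfolding D_def
    proof (rule nn_integral_mono)
      fix a assume "a \<in> space \<pi>"
      then show "ennreal \<bar>\<phi> a - \<psi> a\<bar> \<le> ennreal (\<phi> a) + ennreal (\<psi> a)"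
        using nn[of a] by (subst ennreal_plus[symmetric]) (auto intro!: ennreal_leI simp del: ennreal_plus)
    qed
    also have "\<dots> = 2" by (subst nn_integral_add) (auto simp: one)
    finally show ?thesis .
  qed
  then obtain d where d: "D = ennreal d" "0 \<le> d" by (cases D) (auto simp: top_unique)
  obtain r where r: "R = ennreal r" "0 \<le> r" using R_le by (cases R) (auto simp: top_unique)
  have L_le: "L \<le> 1"
    unfolding L_def by (rule order_trans[OF nn_integral_mono lo1]) (auto simp: indicator_def)
  have hi_split: "(\<integral>\<^sup>+ a. ennreal (?hi a) \<partial>\<pi>) = (\<integral>\<^sup>+ a. ennreal (?lo a) \<partial>\<pi>) + D"
    unfolding D_def
  proof (subst nn_integral_add[symmetric])
    show "(\<integral>\<^sup>+ a. ennreal (?hi a) \<partial>\<pi>) = (\<integral>\<^sup>+ a. ennreal (?lo a) + ennreal \<bar>\<phi> a - \<psi> a\<bar> \<partial>\<pi>)"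
    proof (rule nn_integral_cong)
      fix a assume a: "a \<in> space \<pi>"
      have "?hi a = ?lo a + \<bar>\<phi> a - \<psi> a\<bar>" by (auto simp: min_def max_def)
      with lo_nn[OF a] show "ennreal (?hi a) = ennreal (?lo a) + ennreal \<bar>\<phi> a - \<psi> a\<bar>"
        by (simp add: ennreal_plus[symmetric] del: ennreal_plus)
    qed
  qed auto
  define \<Delta> where "\<Delta> k = {z \<in> space (mark \<pi>). hit \<phi> k z \<noteq> hit \<psi> k z}" for k
  have [measurable]: "\<Delta> k \<in> sets (mark \<pi>)" for k
    unfolding \<Delta>_def by measurable
  \<comment> \<open>Each layer of the maximum is the disjoint union of the layer of the minimum and
    \<open>\<Delta> k\<close>. Summing over the layers gives the claim after cancelling the mass of
    the minimum, which is finite.\<close>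
  have \<Delta>: "(\<Sum>k. emeasure (mark \<pi>) (\<Delta> k)) = D / 4"
  proof -
    have sp: "{z \<in> space (mark \<pi>). fst z \<in> space \<pi> \<and> P z} = {z \<in> space (mark \<pi>). P z}" for P
      by (auto simp: space_mark)
    have "emeasure (mark \<pi>) {z \<in> space (mark \<pi>). fst z \<in> space \<pi> \<and> hit ?hi k z}
        = emeasure (mark \<pi>) {z \<in> space (mark \<pi>). fst z \<in> space \<pi> \<and> hit ?lo k z} + emeasure (mark \<pi>) (\<Delta> k)" for k
      unfolding sp
    proof (subst plus_emeasure)
      show "emeasure (mark \<pi>) {z \<in> space (mark \<pi>). hit ?hi k z} = emeasure (mark \<pi>) ({z \<in> space (mark \<pi>). hit ?lo k z} \<union> \<Delta> k)"
        by (rule arg_cong[where f = "emeasure _"]) (auto simp: \<Delta>_def hit_def)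
    qed (auto simp: \<Delta>_def hit_def)
    then have "(\<integral>\<^sup>+ a. ennreal (?hi a) * indicator (space \<pi>) a \<partial>\<pi>) / 4
       = (\<Sum>k. emeasure (mark \<pi>) {z \<in> space (mark \<pi>). fst z \<in> space \<pi> \<and> hit ?lo k z} + emeasure (mark \<pi>) (\<Delta> k))"
      using nn by (subst suminf_hit[symmetric]) (auto simp: le_max_iff_disj)
    also have "\<dots> = (\<integral>\<^sup>+ a. ennreal (?lo a) * indicator (space \<pi>) a \<partial>\<pi>) / 4 + (\<Sum>k. emeasure (mark \<pi>) (\<Delta> k))"
      using lo_nn by (subst suminf_add[symmetric]) (auto simp: suminf_hit)
    finally have "((\<integral>\<^sup>+ a. ennreal (?lo a) \<partial>\<pi>) + D) / 4 = (\<integral>\<^sup>+ a. ennreal (?lo a) \<partial>\<pi>) / 4 + (\<Sum>k. emeasure (mark \<pi>) (\<Delta> k))"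
      by (simp add: hi_split[symmetric] cong: nn_integral_cong)
    then have "(\<integral>\<^sup>+ a. ennreal (?lo a) \<partial>\<pi>) / 4 + D / 4 = (\<integral>\<^sup>+ a. ennreal (?lo a) \<partial>\<pi>) / 4 + (\<Sum>k. emeasure (mark \<pi>) (\<Delta> k))"
      by (simp add: divide_ennreal_def distrib_right)
    moreover have "(\<integral>\<^sup>+ a. ennreal (?lo a) \<partial>\<pi>) / 4 \<noteq> \<top>"
      using lo1 by (auto simp: ennreal_divide_eq_top_iff top_unique)
    ultimately show ?thesis by (simp add: ennreal_add_left_cancel)
  qed
  \<comment> \<open>If no mark separates the two regions in its layer, a success of one density is a
    success of both at the same mark, that is, the block is good. Layer \<open>k\<close> offers two
    marks, \<open>2 * k\<close> and \<open>2 * k + 1\<close>, so the exceptional event has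
    probability at most 2 D/4, and \<open>1 / 2 \<le> R\<close> turns D/2 into a multiple of
    \<open>R\<close>.\<close>
  have stop_le: "emeasure (noise \<pi>) ?stop \<le> R / 4 * (1 + 4 * D)"
  proof -
    let ?F = "\<lambda>k. {c \<in> space (noise \<pi>). c (2 * k) \<in> \<Delta> k} \<union> {c \<in> space (noise \<pi>). c (2 * k + 1) \<in> \<Delta> k}"
    have "?stop \<subseteq> good ?lo ?hi (space \<pi>) \<union> (\<Union>k. ?F k)"
    proof
      fix c assume c: "c \<in> ?stop"
      then have sp: "c i \<in> space (mark \<pi>)" for i by (auto simp: space_PiM)
      show "c \<in> good ?lo ?hi (space \<pi>) \<union> (\<Union>k. ?F k)"
      proof (cases "c \<in> (\<Union>k. ?F k)")
        case False
        then have eq: "hit \<phi> k (c (2 * k)) = hit \<psi> k (c (2 * k))" "hit \<phi> k (c (2 * k + 1)) = hit \<psi> k (c (2 * k + 1))" for k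
          using sp c by (auto simp: \<Delta>_def)
        have hi: "hit ?hi k z \<longleftrightarrow> hit \<phi> k z \<or> hit \<psi> k z" "hit ?lo k z \<longleftrightarrow> hit \<phi> k z \<and> hit \<psi> k z" for k z
          by (auto simp: hit_def)
        obtain k where k: "succ_at \<phi> c k \<or> succ_at \<psi> c k" using c by auto
        have "fst (c (2 * k)) \<in> space \<pi>" using sp[of "2 * k"] by (auto simp: space_mark)
        moreover have "hit \<phi> k (c (2 * k)) \<and> (\<forall>i. i \<noteq> k \<longrightarrow> \<not> hit \<phi> i (c (2 * i))) \<and> \<not> hit \<phi> k (c (2 * k + 1))"
          using k unfolding succ_at_def eq by blast
        moreover have "c \<in> space (noise \<pi>)" using c by simp
        ultimately have "c \<in> good ?lo ?hi (space \<pi>)"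
          unfolding good_def hi mem_Collect_eq using eq by blast
        then show ?thesis by simp
      qed simp
    qed
    then have "emeasure (noise \<pi>) ?stop \<le> emeasure (noise \<pi>) (good ?lo ?hi (space \<pi>) \<union> (\<Union>k. ?F k))"
      by (intro emeasure_mono) auto
    also have "\<dots> \<le> emeasure (noise \<pi>) (good ?lo ?hi (space \<pi>)) + emeasure (noise \<pi>) (\<Union>k. ?F k)"
      by (rule emeasure_subadditive) auto
    also have "emeasure (noise \<pi>) (\<Union>k. ?F k) \<le> (\<Sum>k. emeasure (noise \<pi>) (?F k))"
      by (rule emeasure_subadditive_countably) auto
    also have "\<dots> \<le> (\<Sum>k. emeasure (mark \<pi>) (\<Delta> k) + emeasure (mark \<pi>) (\<Delta> k))"
    proof (rule suminf_le)
      fix k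
      have "emeasure (noise \<pi>) (?F k) \<le> emeasure (noise \<pi>) {c \<in> space (noise \<pi>). c (2 * k) \<in> \<Delta> k} + emeasure (noise \<pi>) {c \<in> space (noise \<pi>). c (2 * k + 1) \<in> \<Delta> k}"
        by (rule emeasure_subadditive) auto
      also have "\<dots> = emeasure (mark \<pi>) (\<Delta> k) + emeasure (mark \<pi>) (\<Delta> k)"
        by (intro arg_cong2[where f = "(+)"] noise.emeasure_PiM_Collect_single) auto
      finally show "emeasure (noise \<pi>) (?F k) \<le> emeasure (mark \<pi>) (\<Delta> k) + emeasure (mark \<pi>) (\<Delta> k)" .
    qed auto
    also have "\<dots> = D / 4 + D / 4"
      by (subst suminf_add[symmetric]) (auto simp: \<Delta>)
    also have "\<dots> = 1 / 2 * D"
    proof -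
      have "ennreal (d / 4) + ennreal (d / 4) = ennreal (1 / 2 * d)"
        using d(2) by (subst ennreal_plus[symmetric]) simp_all
      also have "\<dots> = ennreal (1 / 2) * ennreal d"
        using d(2) by (intro ennreal_mult) simp_all
      finally have "ennreal (d / 4) + ennreal (d / 4) = ennreal (1 / 2) * ennreal d" .
      moreover have "ennreal (1 / 2) = 1 / 2"
        using divide_ennreal[of 1 2] by simp
      ultimately show ?thesis unfolding d(1) by (simp add: ennreal_divide_4 d(2))
    qed
    also have "1 / 2 * D \<le> R * D"
      using R by (rule mult_right_mono) simp
    also have "emeasure (noise \<pi>) (good ?lo ?hi (space \<pi>)) = (\<integral>\<^sup>+ a. ennreal (?lo a) * indicator (space \<pi>) a \<partial>\<pi>) / 4 * R"
      unfolding R_def using lo_nn by (intro emeasure_good) auto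
    also have "(\<integral>\<^sup>+ a. ennreal (?lo a) * indicator (space \<pi>) a \<partial>\<pi>) = (\<integral>\<^sup>+ a. ennreal (?lo a) \<partial>\<pi>)"
      by (intro nn_integral_cong) auto
    also have "(\<integral>\<^sup>+ a. ennreal (?lo a) \<partial>\<pi>) / 4 * R \<le> 1 / 4 * R"
      by (intro mult_right_mono divide_right_mono_ennreal lo1) simp
    finally have "emeasure (noise \<pi>) ?stop \<le> 1 / 4 * R + R * D" by (simp add: add_mono)
    also have "\<dots> = R / 4 * (1 + 4 * D)"
    proof -
      have "1 / 4 = ennreal (1 / 4)" using ennreal_divide_4[of 1] by simp
      moreover have "ennreal (1 / 4) * ennreal r + ennreal r * ennreal d = ennreal (r / 4) * ennreal (1 + 4 * d)"
        using d(2) r(2)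
        by (simp add: ennreal_mult[symmetric] ennreal_plus[symmetric] algebra_simps del: ennreal_plus)
      ultimately show ?thesis
        unfolding d(1) r(1) by (simp only: ennreal_divide_4 r(2) ennreal_one_plus_4 d(2))
    qed
    finally show ?thesis .
  qed
  have good_stop: "good ?lo ?hi B \<subseteq> ?stop"
  proof
    fix c assume c: "c \<in> good ?lo ?hi B"
    then have "c \<in> space (noise \<pi>)" by (simp add: good_def)
    with good_succ_at_min_max[OF c] show "c \<in> ?stop" by blast
  qed
  have stop_pos: "0 < emeasure (noise \<pi>) ?stop"
  proof -
    have "0 < 1 / 4 * silent \<phi>"
    proof -
      have "1 / 2 \<le> silent \<phi>"
        by (rule silent_ge) (simp_all add: nn one)
      moreover have "(0::ennreal) < 1 / 2" by (simp add: ennreal_zero_less_divide)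
      ultimately have "0 < silent \<phi>" by (rule less_le_trans[rotated])
      then show ?thesis by (simp add: ennreal_zero_less_mult_iff ennreal_zero_less_divide)
    qed
    also have "\<dots> = emeasure (noise \<pi>) (good \<phi> \<phi> (space \<pi>))"
      using nn(1) by (subst emeasure_good) (auto simp: one(1) cong: nn_integral_cong)
    also have "\<dots> \<le> emeasure (noise \<pi>) ?stop"
    proof (rule emeasure_mono)
      show "good \<phi> \<phi> (space \<pi>) \<subseteq> ?stop"
      proof
        fix c assume c: "c \<in> good \<phi> \<phi> (space \<pi>)"
        then have "c \<in> space (noise \<pi>)" by (simp add: good_def)
        with good_succ_at[OF c] show "c \<in> ?stop" by blast
      qed
    qed measurable
    finally show ?thesis .
  qed
  \<comment> \<open>The blocks are independent ticks. If the first tick that stops at least one of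
    the two selections is good for \<open>B\<close>, the selections agree with letter in
    \<open>B\<close>, and \<open>emeasure_first_hit\<close> gives the probability of this as a
    ratio.\<close>
  interpret ticks: sequence_space "noise \<pi>" ..
  let ?H = "{v \<in> space (Pi\<^sub>M UNIV (\<lambda>_::nat. noise \<pi>)). \<exists>n. v n \<in> good ?lo ?hi B \<and> (\<forall>m<n. v m \<notin> ?stop)}"
  have "L / 4 * R = emeasure (noise \<pi>) (good ?lo ?hi B)"
    unfolding L_def R_def using lo_nn by (subst emeasure_good) auto
  then have "L / 4 * R / emeasure (noise \<pi>) ?stop = emeasure (Pi\<^sub>M UNIV (\<lambda>_::nat. noise \<pi>)) ?H"
    using ticks.emeasure_first_hit[OF _ _ good_stop stop_pos] by simp
  also have "\<dots> = emeasure (distr (noise \<pi>) (Pi\<^sub>M UNIV (\<lambda>_::nat. noise \<pi>)) block) ?H"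
    by (simp only: noise.distr_block)
  also have "\<dots> = emeasure (noise \<pi>) (block -` ?H \<inter> space (noise \<pi>))"
    by (rule emeasure_distr) measurable
  also have "\<dots> \<le> emeasure (noise \<pi>) {u \<in> space (noise \<pi>). sel \<phi> u = sel \<psi> u \<and> letter \<phi> u \<in> B}"
  proof (rule emeasure_mono)
    show "block -` ?H \<inter> space (noise \<pi>) \<subseteq> {u \<in> space (noise \<pi>). sel \<phi> u = sel \<psi> u \<and> letter \<phi> u \<in> B}"
    proof
      fix u assume u: "u \<in> block -` ?H \<inter> space (noise \<pi>)"
      then obtain n where n: "block u n \<in> good ?lo ?hi B" "\<forall>m<n. block u m \<notin> ?stop" by auto
      have "block u m \<in> space (noise \<pi>)" for m
        using u by (auto simp: block_def space_PiM)
      with n(2) have "\<forall>m<n. \<not> (\<exists>k. succ_at \<phi> (block u m) k \<or> succ_at \<psi> (block u m) k)" by auto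
      from agree_on_good[OF _ n(1) this] u
      show "u \<in> {u \<in> space (noise \<pi>). sel \<phi> u = sel \<psi> u \<and> letter \<phi> u \<in> B}" by auto
    qed
    have [measurable]: "(\<lambda>u. sel \<phi> u) \<in> measurable (noise \<pi>) (count_space UNIV)"
      "(\<lambda>u. sel \<psi> u) \<in> measurable (noise \<pi>) (count_space UNIV)" "(\<lambda>u. letter \<phi> u) \<in> measurable (noise \<pi>) \<pi>"
      by (rule measurable_sel[where \<pi> = \<pi>] measurable_letter; measurable)+
    show "{u \<in> space (noise \<pi>). sel \<phi> u = sel \<psi> u \<and> letter \<phi> u \<in> B} \<in> sets (noise \<pi>)"
      by measurable
  qed
  finally have "L / 4 * R / emeasure (noise \<pi>) ?stop
      \<le> emeasure (noise \<pi>) {u \<in> space (noise \<pi>). sel \<phi> u = sel \<psi> u \<and> letter \<phi> u \<in> B}" .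
  \<comment> \<open>The factor \<open>R\<close> of the numerator cancels against the one in
    \<open>stop_le\<close>.\<close>
  moreover have "L / (1 + 4 * D) \<le> L / 4 * R / emeasure (noise \<pi>) ?stop"
  proof -
    obtain l where l: "L = ennreal l" "0 \<le> l"
      using L_le by (cases L) (auto simp: top_unique)
    obtain p where p: "emeasure (noise \<pi>) ?stop = ennreal p" "0 < p"
      using stop_pos by (simp add: noise.P.emeasure_eq_measure)
    have "ennreal p \<le> ennreal (r / 4 * (1 + 4 * d))"
    proof -
      have "R / 4 * (1 + 4 * D) = ennreal (r / 4 * (1 + 4 * d))"
        unfolding d(1) r(1) using d(2) r(2)
        by (simp only: ennreal_divide_4 ennreal_one_plus_4 ennreal_mult[symmetric])
      then show ?thesis using stop_le p(1) by simp
    qed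
    then have pr: "p \<le> r / 4 * (1 + 4 * d)" using d(2) r(2) by (simp add: ennreal_le_iff)
    have "l / (1 + 4 * d) \<le> l / 4 * r / p"
    proof -
      have "l * p \<le> l * (r / 4 * (1 + 4 * d))" using pr l(2) by (rule mult_left_mono)
      then show ?thesis using p(2) d(2) by (simp add: field_simps)
    qed
    moreover have "L / (1 + 4 * D) = ennreal (l / (1 + 4 * d))"
      unfolding l(1) d(1) using l(2) d(2) by (subst ennreal_one_plus_4) (simp_all only: divide_ennreal)
    moreover have "L / 4 * R / ennreal p = ennreal (l / 4 * r / p)"
    proof -
      have "L / 4 * R = ennreal (l / 4) * ennreal r"
        unfolding l(1) r(1) using l(2) by (simp only: ennreal_divide_4)
      also have "\<dots> = ennreal (l / 4 * r)"
        using l(2) r(2) by (intro ennreal_mult[symmetric]) simp_all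
      finally show ?thesis
        using l(2) p(2) r(2) by (simp only: divide_ennreal mult_nonneg_nonneg divide_nonneg_nonneg zero_le_numeral)
    qed
    ultimately show ?thesis unfolding p by (simp add: ennreal_leI)
  qed
  ultimately show ?thesis unfolding L_def D_def by (rule order_trans[rotated])
qed

lemma measurable_sel1 [measurable]:
  assumes [measurable]: "\<phi> \<in> borel_measurable \<pi>"
  shows "sel \<phi> \<in> measurable (noise \<pi>) (count_space UNIV)"
  by (rule measurable_sel[of "\<lambda>_. \<phi>" "noise \<pi>" \<pi> "\<lambda>u. u"]) measurable

lemma measurable_letter1 [measurable]:
  assumes [measurable]: "\<phi> \<in> borel_measurable \<pi>"
  shows "letter \<phi> \<in> measurable (noise \<pi>) \<pi>"
  by (rule measurable_letter[of "\<lambda>_. \<phi>" "noise \<pi>" \<pi> "\<lambda>u. u"]) measurable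

text \<open>For \<psi> = \<phi> the agreement bound says that the law of the letter dominates the
  measure with density \<phi> on every set. Both are probability measures, so the inequality for the
  complement gives equality.\<close>

lemma distr_letter:
  assumes [measurable]: "\<phi> \<in> borel_measurable \<pi>"
    and nn: "\<And>a. a \<in> space \<pi> \<Longrightarrow> 0 \<le> \<phi> a" and one: "(\<integral>\<^sup>+ a. ennreal (\<phi> a) \<partial>\<pi>) = 1"
  shows "distr (noise \<pi>) \<pi> (letter \<phi>) = density \<pi> (\<lambda>a. ennreal (\<phi> a))"
proof (rule measure_eqI)
  let ?L = "distr (noise \<pi>) \<pi> (letter \<phi>)" and ?R = "density \<pi> (\<lambda>a. ennreal (\<phi> a))"
  interpret L: prob_space ?L by (rule noise.P.prob_space_distr) measurable
  interpret R: prob_space ?R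
    by (rule prob_spaceI) (simp add: emeasure_density one cong: nn_integral_cong)
  have le: "R.prob B \<le> L.prob B" if [measurable]: "B \<in> sets \<pi>" for B
  proof -
    have "emeasure ?R B \<le> emeasure ?L B"
      using emeasure_agree_ge[OF assms(1,1) that nn nn one one]
      by (simp add: emeasure_density emeasure_distr vimage_def Int_def conj_commute divide_ennreal_def)
    then show ?thesis
      by (simp add: L.emeasure_eq_measure R.emeasure_eq_measure)
  qed
  fix B assume "B \<in> sets ?L"
  then have [measurable]: "B \<in> sets \<pi>" by simp
  have "L.prob B = 1 - L.prob (space \<pi> - B)"
    using L.prob_compl[of B] by simp
  also have "\<dots> \<le> 1 - R.prob (space \<pi> - B)"
    using le[of "space \<pi> - B"] by simp
  also have "\<dots> = R.prob B"
    using R.prob_compl[of B] by simp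
  finally have "L.prob B = R.prob B" using le[of B] by simp
  then show "emeasure ?L B = emeasure ?R B"
    by (simp add: L.emeasure_eq_measure R.emeasure_eq_measure)
qed simp

lemma nn_integral_letter:
  assumes [measurable]: "\<phi> \<in> borel_measurable \<pi>" "h \<in> borel_measurable \<pi>"
    and nn: "\<And>a. a \<in> space \<pi> \<Longrightarrow> 0 \<le> \<phi> a" and one: "(\<integral>\<^sup>+ a. ennreal (\<phi> a) \<partial>\<pi>) = 1"
  shows "(\<integral>\<^sup>+ u. h (letter \<phi> u) \<partial>noise \<pi>) = (\<integral>\<^sup>+ a. ennreal (\<phi> a) * h a \<partial>\<pi>)"
proof -
  have "(\<integral>\<^sup>+ u. h (letter \<phi> u) \<partial>noise \<pi>) = (\<integral>\<^sup>+ a. h a \<partial>distr (noise \<pi>) \<pi> (letter \<phi>))"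
    by (simp add: nn_integral_distr)
  also have "\<dots> = (\<integral>\<^sup>+ a. ennreal (\<phi> a) * h a \<partial>\<pi>)"
    by (subst distr_letter[OF assms(1)]) (auto simp: nn one nn_integral_density)
  finally show ?thesis .
qed

text \<open>The bound for sets is a domination of measures, and integrals of nonnegative functions
  inherit it. The function \<open>h\<close> will be the chance of further agreement after the common
  letter.\<close>

lemma nn_integral_agree_ge:
  assumes [measurable]: "\<phi> \<in> borel_measurable \<pi>" "\<psi> \<in> borel_measurable \<pi>" "h \<in> borel_measurable \<pi>"
    and nn: "\<And>a. a \<in> space \<pi> \<Longrightarrow> 0 \<le> \<phi> a" "\<And>a. a \<in> space \<pi> \<Longrightarrow> 0 \<le> \<psi> a"
    and one: "(\<integral>\<^sup>+ a. ennreal (\<phi> a) \<partial>\<pi>) = 1" "(\<integral>\<^sup>+ a. ennreal (\<psi> a) \<partial>\<pi>) = 1"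
  shows "(\<integral>\<^sup>+ a. ennreal (min (\<phi> a) (\<psi> a)) / (1 + 4 * (\<integral>\<^sup>+ a. ennreal \<bar>\<phi> a - \<psi> a\<bar> \<partial>\<pi>)) * h a \<partial>\<pi>)
    \<le> (\<integral>\<^sup>+ u. indicator {u. sel \<phi> u = sel \<psi> u} u * h (letter \<phi> u) \<partial>noise \<pi>)"
proof -
  let ?c = "1 + 4 * (\<integral>\<^sup>+ a. ennreal \<bar>\<phi> a - \<psi> a\<bar> \<partial>\<pi>)"
  let ?A = "{u \<in> space (noise \<pi>). sel \<phi> u = sel \<psi> u}"
  let ?\<nu> = "density \<pi> (\<lambda>a. ennreal (min (\<phi> a) (\<psi> a)) / ?c)"
  let ?\<mu> = "distr (density (noise \<pi>) (indicator ?A)) \<pi> (letter \<phi>)"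
  have "?\<nu> \<le> ?\<mu>"
  proof (subst le_measure, simp, intro ballI)
    fix B assume "B \<in> sets ?\<nu>"
    then have [measurable]: "B \<in> sets \<pi>" by simp
    have "emeasure ?\<nu> B = (\<integral>\<^sup>+ a. ennreal (min (\<phi> a) (\<psi> a)) * indicator B a / ?c \<partial>\<pi>)"
      by (simp add: emeasure_density divide_ennreal_def ac_simps)
    also have "\<dots> = (\<integral>\<^sup>+ a. ennreal (min (\<phi> a) (\<psi> a)) * indicator B a \<partial>\<pi>) / ?c"
      by (rule nn_integral_divide) measurable
    also have "\<dots> \<le> emeasure (noise \<pi>) {u \<in> space (noise \<pi>). sel \<phi> u = sel \<psi> u \<and> letter \<phi> u \<in> B}"
      by (rule emeasure_agree_ge) (use assms in auto)
    also have "{u \<in> space (noise \<pi>). sel \<phi> u = sel \<psi> u \<and> letter \<phi> u \<in> B} = ?A \<inter> (letter \<phi> -` B \<inter> space (noise \<pi>))"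
      by auto
    also have "emeasure (noise \<pi>) \<dots> = emeasure ?\<mu> B"
      by (subst emeasure_distr, measurable, subst emeasure_density)
         (auto simp: nn_integral_indicator[symmetric] indicator_inter_arith simp del: nn_integral_indicator intro!: nn_integral_cong)
    finally show "emeasure ?\<nu> B \<le> emeasure ?\<mu> B" .
  qed
  then have "nn_integral ?\<nu> h \<le> nn_integral ?\<mu> h"
    by (intro nn_integral_mono_measure) simp_all
  also have "nn_integral ?\<mu> h = (\<integral>\<^sup>+ u. h (letter \<phi> u) \<partial>density (noise \<pi>) (indicator ?A))"
    by (rule nn_integral_distr) measurable
  also have "\<dots> = (\<integral>\<^sup>+ u. indicator ?A u * h (letter \<phi> u) \<partial>noise \<pi>)"
    by (rule nn_integral_density) measurable
  also have "\<dots> = (\<integral>\<^sup>+ u. indicator {u. sel \<phi> u = sel \<psi> u} u * h (letter \<phi> u) \<partial>noise \<pi>)"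
    by (intro nn_integral_cong) (simp add: indicator_def)
  finally show ?thesis
    by (simp add: nn_integral_density)
qed

end

section \<open>Chains driven by the noise\<close>

lemma measure_eqI_rectangles:
  assumes sets: "sets K = sets (P \<Otimes>\<^sub>M Q)" "sets L = sets (P \<Otimes>\<^sub>M Q)" and fin: "finite_measure K"
    and eq: "\<And>A B. A \<in> sets P \<Longrightarrow> B \<in> sets Q \<Longrightarrow> emeasure K (A \<times> B) = emeasure L (A \<times> B)"
  shows "K = L"
proof (rule measure_eqI_generator_eq[OF Int_stable_pair_measure_generator pair_measure_closed])
  show "\<And>X. X \<in> {a \<times> b |a b. a \<in> sets P \<and> b \<in> sets Q} \<Longrightarrow> emeasure K X = emeasure L X"
    using eq by auto
  show "range (\<lambda>_::nat. space P \<times> space Q) \<subseteq> {a \<times> b |a b. a \<in> sets P \<and> b \<in> sets Q}" by blast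
  show "emeasure K (space P \<times> space Q) \<noteq> \<infinity>"
    using fin by (simp add: finite_measure.emeasure_finite)
qed (use sets sets_pair_measure[of P Q] in auto)

lemma conditional_density_nn_integral:
  assumes "prob_space M" and "sigma_finite_measure \<pi>"
    and [measurable]: "Z \<in> measurable M P" "W \<in> measurable M \<pi>" "H \<in> borel_measurable (P \<Otimes>\<^sub>M \<pi>)"
    and cd: "conditional_density M P Z \<pi> W f"
  shows "(\<integral>\<^sup>+ \<omega>. H (Z \<omega>, W \<omega>) \<partial>M) = (\<integral>\<^sup>+ \<omega>. \<integral>\<^sup>+ a. ennreal (f (Z \<omega>) a) * H (Z \<omega>, a) \<partial>\<pi> \<partial>M)"
proof -
  interpret M: prob_space M by fact
  interpret \<pi>: sigma_finite_measure \<pi> by fact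
  let ?\<nu> = "distr M P Z"
  interpret \<nu>: prob_space ?\<nu> by (rule M.prob_space_distr) measurable
  interpret \<nu>\<pi>: pair_sigma_finite ?\<nu> \<pi> ..
  have f [measurable]: "(\<lambda>(z, a). f z a) \<in> borel_measurable (P \<Otimes>\<^sub>M \<pi>)"
    using cd by (simp add: conditional_density_def)
  have f1: "(\<lambda>a. f z a) \<in> borel_measurable \<pi>" if "z \<in> space P" for z
    using measurable_compose[OF measurable_Pair1'[OF that] f] by simp
  let ?K = "density (?\<nu> \<Otimes>\<^sub>M \<pi>) (\<lambda>(z, a). ennreal (f z a))"
  have int: "(\<integral>\<^sup>+ p. G p \<partial>?K) = (\<integral>\<^sup>+ \<omega>. \<integral>\<^sup>+ a. ennreal (f (Z \<omega>) a) * G (Z \<omega>, a) \<partial>\<pi> \<partial>M)"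
    if [measurable]: "G \<in> borel_measurable (P \<Otimes>\<^sub>M \<pi>)" for G
  proof -
    have "(\<integral>\<^sup>+ p. G p \<partial>?K) = (\<integral>\<^sup>+ p. (case p of (z, a) \<Rightarrow> ennreal (f z a)) * G p \<partial>(?\<nu> \<Otimes>\<^sub>M \<pi>))"
      by (rule nn_integral_density) measurable
    also have "\<dots> = (\<integral>\<^sup>+ z. \<integral>\<^sup>+ a. ennreal (f z a) * G (z, a) \<partial>\<pi> \<partial>?\<nu>)"
      by (subst \<pi>.nn_integral_fst[symmetric]) auto
    also have "\<dots> = (\<integral>\<^sup>+ \<omega>. \<integral>\<^sup>+ a. ennreal (f (Z \<omega>) a) * G (Z \<omega>, a) \<partial>\<pi> \<partial>M)"
      by (rule nn_integral_distr) measurable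
    finally show ?thesis .
  qed
  have "distr M (P \<Otimes>\<^sub>M \<pi>) (\<lambda>\<omega>. (Z \<omega>, W \<omega>)) = ?K"
  proof (rule measure_eqI_rectangles[where P = P and Q = \<pi>])
    show "finite_measure (distr M (P \<Otimes>\<^sub>M \<pi>) (\<lambda>\<omega>. (Z \<omega>, W \<omega>)))"
      by (intro M.finite_measure_distr) measurable
    fix A B assume [measurable]: "A \<in> sets P" "B \<in> sets \<pi>"
    have "emeasure (distr M (P \<Otimes>\<^sub>M \<pi>) (\<lambda>\<omega>. (Z \<omega>, W \<omega>))) (A \<times> B) = emeasure M {\<omega> \<in> space M. Z \<omega> \<in> A \<and> W \<omega> \<in> B}"
      by (subst emeasure_distr) (auto intro!: arg_cong[where f = "emeasure M"])
    also have "\<dots> = (\<integral>\<^sup>+ \<omega>. indicator A (Z \<omega>) * emeasure (density \<pi> (\<lambda>a. ennreal (f (Z \<omega>) a))) B \<partial>M)"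
      using cd by (simp add: conditional_density_def)
    also have "\<dots> = (\<integral>\<^sup>+ \<omega>. \<integral>\<^sup>+ a. ennreal (f (Z \<omega>) a) * indicator (A \<times> B) (Z \<omega>, a) \<partial>\<pi> \<partial>M)"
    proof (rule nn_integral_cong)
      fix \<omega> assume "\<omega> \<in> space M"
      then have [measurable]: "(\<lambda>a. f (Z \<omega>) a) \<in> borel_measurable \<pi>"
        using measurable_space[of Z M P] by (intro f1) auto
      show "indicator A (Z \<omega>) * emeasure (density \<pi> (\<lambda>a. ennreal (f (Z \<omega>) a))) B
          = (\<integral>\<^sup>+ a. ennreal (f (Z \<omega>) a) * indicator (A \<times> B) (Z \<omega>, a) \<partial>\<pi>)"
        by (simp add: emeasure_density indicator_times indicator_def)
    qed
    also have "\<dots> = emeasure ?K (A \<times> B)"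
      by (subst int[symmetric]) auto
    finally show "emeasure (distr M (P \<Otimes>\<^sub>M \<pi>) (\<lambda>\<omega>. (Z \<omega>, W \<omega>))) (A \<times> B) = emeasure ?K (A \<times> B)" .
  qed (simp_all cong: sets_pair_measure_cong)
  then have "(\<integral>\<^sup>+ p. H p \<partial>?K) = (\<integral>\<^sup>+ p. H p \<partial>distr M (P \<Otimes>\<^sub>M \<pi>) (\<lambda>\<omega>. (Z \<omega>, W \<omega>)))" by simp
  also have "\<dots> = (\<integral>\<^sup>+ \<omega>. H (Z \<omega>, W \<omega>) \<partial>M)"
    by (rule nn_integral_distr) measurable
  finally show ?thesis by (simp add: int)
qed

lemma past_Suc: "past X m \<omega> = case_nat (X m \<omega>) (past X (m - 1) \<omega>)"
  by (auto simp: past_def fun_eq_iff split: nat.split) (simp add: algebra_simps)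

lemma measurable_past:
  assumes "\<And>n. X n \<in> measurable M E"
  shows "past X m \<in> measurable M (past_space E)"
  unfolding past_def[abs_def] using assms by (intro measurable_PiM_UNIV) simp

locale chain = sampler \<pi> + M: prob_space M
  for \<pi> :: "'e measure" and M :: "'w measure" +
  fixes X :: "int \<Rightarrow> 'w \<Rightarrow> 'e"
    and f :: "(nat \<Rightarrow> 'e) \<Rightarrow> 'e \<Rightarrow> real" and g :: "nat \<Rightarrow> (nat \<Rightarrow> 'e) \<Rightarrow> 'e \<Rightarrow> real"
  assumes stat: "stationary M \<pi> X"
    and f_cd: "conditional_density M (past_space \<pi>) (past X (-1)) \<pi> (X 0) f"
    and g_cd: "\<And>n. conditional_density M (word_space \<pi> n) (word X n) \<pi> (X 0) (g n)"
begin

lemma X_measurable [measurable]: "X n \<in> measurable M \<pi>"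
  using stat by (simp add: stationary_def)

lemma past_measurable [measurable]: "past X m \<in> measurable M (past_space \<pi>)"
  by (rule measurable_past) measurable

lemma f_measurable' [measurable]: "(\<lambda>(s, a). f s a) \<in> borel_measurable (past_space \<pi> \<Otimes>\<^sub>M \<pi>)"
  using f_cd by (simp add: conditional_density_def)

lemma f_measurable [measurable (raw)]:
  assumes "s \<in> measurable N (past_space \<pi>)" "a \<in> measurable N \<pi>"
  shows "(\<lambda>x. f (s x) (a x)) \<in> borel_measurable N"
  using measurable_compose[OF measurable_Pair[OF assms] f_measurable'] by simp

lemma g_measurable [measurable (raw)]:
  assumes "s \<in> measurable N (word_space \<pi> n)" "a \<in> measurable N \<pi>"
  shows "(\<lambda>x. g n (s x) (a x)) \<in> borel_measurable N"
  using measurable_compose[OF measurable_Pair[OF assms], of "\<lambda>(s, a). g n s a" borel] g_cd[of n]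
  by (simp add: conditional_density_def)

lemma f_nonneg: "s \<in> space (past_space \<pi>) \<Longrightarrow> a \<in> space \<pi> \<Longrightarrow> 0 \<le> f s a"
  and f_one: "s \<in> space (past_space \<pi>) \<Longrightarrow> (\<integral>\<^sup>+ a. ennreal (f s a) \<partial>\<pi>) = 1"
  and g_nonneg: "w \<in> space (word_space \<pi> n) \<Longrightarrow> a \<in> space \<pi> \<Longrightarrow> 0 \<le> g n w a"
  and g_one: "w \<in> space (word_space \<pi> n) \<Longrightarrow> (\<integral>\<^sup>+ a. ennreal (g n w a) \<partial>\<pi>) = 1"
  using f_cd g_cd[of n] by (auto simp: conditional_density_def)

lemma f_measurable1: "s \<in> space (past_space \<pi>) \<Longrightarrow> f s \<in> borel_measurable \<pi>"
  by (rule f_measurable) auto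

section \<open>The law of the past and its one-step transitions\<close>

definition mu :: "(nat \<Rightarrow> 'e) measure" where
  "mu = distr M (past_space \<pi>) (past X (-1))"

lemma sets_mu [measurable_cong, simp]: "sets mu = sets (past_space \<pi>)"
  by (simp add: mu_def)

lemma space_mu [simp]: "space mu = space (past_space \<pi>)"
  by (simp add: mu_def)

sublocale mu: prob_space mu
  unfolding mu_def by (rule M.prob_space_distr) measurable

lemma distr_past: "distr M (past_space \<pi>) (past X m) = mu"
proof -
  let ?P = "Pi\<^sub>M UNIV (\<lambda>_::int. \<pi>)"
  have [measurable]: "(\<lambda>\<omega> n. X (n + k) \<omega>) \<in> measurable M ?P" for k
    by (rule measurable_PiM_UNIV) measurable
  have [measurable]: "(\<lambda>x (j::nat). x (- 1 - int j)) \<in> measurable ?P (past_space \<pi>)"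
    by (rule measurable_PiM_UNIV) measurable
  have *: "distr M (past_space \<pi>) (past X (k - 1)) =
      distr (distr M ?P (\<lambda>\<omega> n. X (n + k) \<omega>)) (past_space \<pi>) (\<lambda>x j. x (- 1 - int j))" for k
    by (subst distr_distr) (auto intro!: distr_cong simp: past_def fun_eq_iff algebra_simps)
  have "distr M ?P (\<lambda>\<omega> n. X (n + k) \<omega>) = distr M ?P (\<lambda>\<omega> n. X (n + 0) \<omega>)" for k
    using stat by (simp add: stationary_def)
  then have "distr M (past_space \<pi>) (past X (k - 1)) = distr M (past_space \<pi>) (past X (0 - 1))" for k
    unfolding * by metis
  from this[of "m + 1"] show ?thesis by (simp add: mu_def)
qed

lemma nn_integral_past:
  assumes [measurable]: "H \<in> borel_measurable (past_space \<pi>)"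
  shows "(\<integral>\<^sup>+ \<omega>. H (past X m \<omega>) \<partial>M) = (\<integral>\<^sup>+ s. H s \<partial>mu)"
  unfolding distr_past[of m, symmetric] by (subst nn_integral_distr) auto

lemma nn_integral_step_law:
  assumes [measurable]: "H \<in> borel_measurable (past_space \<pi> \<Otimes>\<^sub>M \<pi>)"
  shows "(\<integral>\<^sup>+ \<omega>. H (past X (m - 1) \<omega>, X m \<omega>) \<partial>M) = (\<integral>\<^sup>+ s. \<integral>\<^sup>+ a. ennreal (f s a) * H (s, a) \<partial>\<pi> \<partial>mu)"
proof -
  let ?H = "\<lambda>s. H (\<lambda>j. s (Suc j), s 0)"
  have "(\<lambda>s (j::nat). s (Suc j)) \<in> measurable (past_space \<pi>) (past_space \<pi>)"
    by (rule measurable_PiM_UNIV) (rule measurable_component_singleton, simp)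
  then have "(\<lambda>s. (\<lambda>j. s (Suc j), s 0)) \<in> measurable (past_space \<pi>) (past_space \<pi> \<Otimes>\<^sub>M \<pi>)"
    by (rule measurable_Pair) (rule measurable_component_singleton, simp)
  from measurable_compose[OF this assms]
  have [measurable]: "?H \<in> borel_measurable (past_space \<pi>)" .
  have H: "H (past X (m - 1) \<omega>, X m \<omega>) = ?H (past X m \<omega>)" for m \<omega>
    by (subst (2) past_Suc, subst (2) past_Suc) simp
  have "(\<integral>\<^sup>+ \<omega>. H (past X (m - 1) \<omega>, X m \<omega>) \<partial>M) = (\<integral>\<^sup>+ \<omega>. H (past X (0 - 1) \<omega>, X 0 \<omega>) \<partial>M)"
    unfolding H using nn_integral_past[of ?H m] nn_integral_past[of ?H 0] by simp
  also have "\<dots> = (\<integral>\<^sup>+ \<omega>. \<integral>\<^sup>+ a. ennreal (f (past X (- 1) \<omega>) a) * H (past X (- 1) \<omega>, a) \<partial>\<pi> \<partial>M)"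
    using conditional_density_nn_integral[OF M.prob_space_axioms sigma_finite_measure_axioms _ _ assms f_cd] by simp
  also have "\<dots> = (\<integral>\<^sup>+ s. \<integral>\<^sup>+ a. ennreal (f s a) * H (s, a) \<partial>\<pi> \<partial>mu)"
    by (rule nn_integral_past) measurable
  finally show ?thesis .
qed

text \<open>Stationarity gives this word the law of \<open>word X n\<close>. Placed at the times 0,
  ..., n - 1 it grows by a newer letter when \<open>n\<close> grows, so words of all lengths are
  read along one trajectory.\<close>

definition wd :: "nat \<Rightarrow> 'w \<Rightarrow> nat \<Rightarrow> 'e" where
  "wd n \<omega> = restrict (past X (int n - 1) \<omega>) {..<n}"

lemma wd_measurable [measurable]: "wd n \<in> measurable M (word_space \<pi> n)"
  unfolding wd_def[abs_def] by (rule measurable_compose[OF past_measurable measurable_restrict_subset]) simp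

lemma word_measurable [measurable]: "word X n \<in> measurable M (word_space \<pi> n)"
  unfolding word_def[abs_def] by (rule measurable_compose[OF past_measurable measurable_restrict_subset]) simp

lemma nn_integral_wd:
  assumes [measurable]: "H \<in> borel_measurable (word_space \<pi> n)"
  shows "(\<integral>\<^sup>+ \<omega>. H (wd n \<omega>) \<partial>M) = (\<integral>\<^sup>+ \<omega>. H (word X n \<omega>) \<partial>M)"
proof -
  have [measurable]: "(\<lambda>s. H (restrict s {..<n})) \<in> borel_measurable (past_space \<pi>)"
    by (rule measurable_compose[OF measurable_restrict_subset assms]) simp
  show ?thesis
    unfolding wd_def word_def by (simp add: nn_integral_past[of "\<lambda>s. H (restrict s {..<n})"])
qed

text \<open>The assumption on \<open>g n\<close> concerns time 0 and the word before it;
  stationarity moves it to time \<open>n\<close>, where the word starts at time 0.\<close>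

lemma nn_integral_word_step:
  assumes [measurable]: "H \<in> borel_measurable (word_space \<pi> n \<Otimes>\<^sub>M \<pi>)"
  shows "(\<integral>\<^sup>+ \<omega>. H (wd n \<omega>, X (int n) \<omega>) \<partial>M) = (\<integral>\<^sup>+ \<omega>. \<integral>\<^sup>+ a. ennreal (g n (wd n \<omega>) a) * H (wd n \<omega>, a) \<partial>\<pi> \<partial>M)"
proof -
  let ?H = "\<lambda>s. H (restrict (\<lambda>j. s (Suc j)) {..<n}, s 0)"
  have "(\<lambda>s. restrict (\<lambda>j::nat. s (Suc j)) {..<n}) \<in> measurable (past_space \<pi>) (word_space \<pi> n)"
    by (rule measurable_restrict) (rule measurable_component_singleton, simp)
  then have "(\<lambda>s. (restrict (\<lambda>j::nat. s (Suc j)) {..<n}, s 0)) \<in> measurable (past_space \<pi>) (word_space \<pi> n \<Otimes>\<^sub>M \<pi>)"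
    by (rule measurable_Pair) (rule measurable_component_singleton, simp)
  from measurable_compose[OF this assms]
  have [measurable]: "?H \<in> borel_measurable (past_space \<pi>)" .
  have H: "H (restrict (past X (m - 1) \<omega>) {..<n}, X m \<omega>) = ?H (past X m \<omega>)" for m \<omega>
    by (subst (2) past_Suc, subst (2) past_Suc) simp
  have "(\<integral>\<^sup>+ \<omega>. H (wd n \<omega>, X (int n) \<omega>) \<partial>M) = (\<integral>\<^sup>+ \<omega>. H (restrict (past X (0 - 1) \<omega>) {..<n}, X 0 \<omega>) \<partial>M)"
    unfolding H wd_def using nn_integral_past[of ?H "int n"] nn_integral_past[of ?H 0] by simp
  also have "\<dots> = (\<integral>\<^sup>+ \<omega>. H (word X n \<omega>, X 0 \<omega>) \<partial>M)"
    by (simp add: word_def)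
  also have "\<dots> = (\<integral>\<^sup>+ \<omega>. \<integral>\<^sup>+ a. ennreal (g n (word X n \<omega>) a) * H (word X n \<omega>, a) \<partial>\<pi> \<partial>M)"
    by (rule conditional_density_nn_integral[OF M.prob_space_axioms sigma_finite_measure_axioms _ _ assms g_cd]) measurable
  also have "\<dots> = (\<integral>\<^sup>+ \<omega>. \<integral>\<^sup>+ a. ennreal (g n (wd n \<omega>) a) * H (wd n \<omega>, a) \<partial>\<pi> \<partial>M)"
    by (rule nn_integral_wd[symmetric]) measurable
  finally show ?thesis .
qed

section \<open>The chain and its invariant law\<close>

definition step :: "(nat \<Rightarrow> 'e) \<Rightarrow> (nat \<Rightarrow> 'e \<times> real) \<Rightarrow> nat \<Rightarrow> 'e" where
  "step s u = case_nat (letter (f s) u) s"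

lemma sel_f_measurable [measurable (raw)]:
  assumes [measurable]: "s \<in> measurable N (past_space \<pi>)" "u \<in> measurable N (noise \<pi>)"
  shows "(\<lambda>x. sel (f (s x)) (u x)) \<in> measurable N (count_space UNIV)"
  by (rule measurable_sel[where \<pi> = \<pi>]) measurable

lemma letter_f_measurable [measurable (raw)]:
  assumes [measurable]: "s \<in> measurable N (past_space \<pi>)" "u \<in> measurable N (noise \<pi>)"
  shows "(\<lambda>x. letter (f (s x)) (u x)) \<in> measurable N \<pi>"
  by (rule measurable_letter[where \<pi> = \<pi>]) measurable

lemma step_measurable [measurable (raw)]:
  assumes [measurable]: "s \<in> measurable N (past_space \<pi>)" "u \<in> measurable N (noise \<pi>)"
  shows "(\<lambda>x. step (s x) (u x)) \<in> measurable N (past_space \<pi>)"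
  unfolding step_def by measurable

text \<open>The letter chosen by the noise has density \<open>f s\<close>, which is also the
  conditional density of the next letter of X; hence \<open>mu\<close> is invariant under the random
  map \<open>step\<close>.\<close>

lemma nn_integral_step:
  assumes [measurable]: "H \<in> borel_measurable (past_space \<pi>)"
  shows "(\<integral>\<^sup>+ s. \<integral>\<^sup>+ u. H (step s u) \<partial>noise \<pi> \<partial>mu) = (\<integral>\<^sup>+ s. H s \<partial>mu)"
proof -
  have "(\<integral>\<^sup>+ s. \<integral>\<^sup>+ u. H (step s u) \<partial>noise \<pi> \<partial>mu) = (\<integral>\<^sup>+ s. \<integral>\<^sup>+ a. ennreal (f s a) * H (case_nat a s) \<partial>\<pi> \<partial>mu)"
  proof (rule nn_integral_cong)
    fix s assume "s \<in> space mu"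
    then have s [simp]: "s \<in> space (past_space \<pi>)" by simp
    note [measurable] = f_measurable1[OF s]
    have "(\<lambda>a. case_nat a s) \<in> measurable \<pi> (past_space \<pi>)" by measurable
    then have [measurable]: "(\<lambda>a. H (case_nat a s)) \<in> borel_measurable \<pi>" by measurable
    show "(\<integral>\<^sup>+ u. H (step s u) \<partial>noise \<pi>) = (\<integral>\<^sup>+ a. ennreal (f s a) * H (case_nat a s) \<partial>\<pi>)"
      unfolding step_def
      by (rule nn_integral_letter[of "f s" "\<lambda>a. H (case_nat a s)"]) (auto simp: f_nonneg f_one)
  qed
  also have "\<dots> = (\<integral>\<^sup>+ \<omega>. H (case_nat (X 0 \<omega>) (past X (0 - 1) \<omega>)) \<partial>M)"
    using nn_integral_step_law[of "\<lambda>p. H (case_nat (snd p) (fst p))" 0] by simp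
  also have "\<dots> = (\<integral>\<^sup>+ s. H s \<partial>mu)"
    unfolding past_Suc[symmetric] by (rule nn_integral_past) measurable
  finally show ?thesis .
qed

primrec run :: "(nat \<Rightarrow> 'e) \<Rightarrow> (nat \<Rightarrow> nat \<Rightarrow> 'e \<times> real) \<Rightarrow> nat \<Rightarrow> nat \<Rightarrow> 'e" where
  "run s v 0 = s"
| "run s v (Suc n) = step (run s v n) (v n)"

abbreviation noises :: "(nat \<Rightarrow> nat \<Rightarrow> 'e \<times> real) measure" where
  "noises \<equiv> Pi\<^sub>M UNIV (\<lambda>_. noise \<pi>)"

sublocale V: sequence_space "noise \<pi>" ..

lemma run_measurable [measurable (raw)]:
  assumes [measurable]: "s \<in> measurable N (past_space \<pi>)" "v \<in> measurable N noises"
  shows "(\<lambda>x. run (s x) (v x) n) \<in> measurable N (past_space \<pi>)"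
  by (induction n) simp_all

lemma run_case_nat: "run s (case_nat u v) (Suc n) = run (step s u) v n"
  by (induction n) simp_all

lemma run_cong: "(\<And>k. k < n \<Longrightarrow> v k = v' k) \<Longrightarrow> run s v n = run s v' n"
  by (induction n) simp_all

lemma run_comb_seq: "run s (comb_seq m v v') (m + n) = run (run s v m) v' n"
proof (induction n)
  case 0
  show ?case by (simp, rule run_cong) (simp add: comb_seq_less)
next
  case (Suc n)
  then show ?case using comb_seq_add[of m v v' n] by (simp add: add.commute)
qed

lemma nn_integral_noises_iter:
  assumes [measurable]: "H \<in> borel_measurable noises"
  shows "(\<integral>\<^sup>+ v. H v \<partial>noises) = (\<integral>\<^sup>+ u. \<integral>\<^sup>+ v. H (case_nat u v) \<partial>noises \<partial>noise \<pi>)"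
proof -
  have "(\<integral>\<^sup>+ v. H v \<partial>noises) = (\<integral>\<^sup>+ v. H v \<partial>distr (noise \<pi> \<Otimes>\<^sub>M noises) noises (\<lambda>(s, \<omega>). case_nat s \<omega>))"
    by (simp only: V.PiM_iter)
  also have "\<dots> = (\<integral>\<^sup>+ p. H (case_nat (fst p) (snd p)) \<partial>(noise \<pi> \<Otimes>\<^sub>M noises))"
    by (subst nn_integral_distr) (auto simp: split_beta')
  also have "\<dots> = (\<integral>\<^sup>+ u. \<integral>\<^sup>+ v. H (case_nat u v) \<partial>noises \<partial>noise \<pi>)"
    by (subst V.P.nn_integral_fst[symmetric]) auto
  finally show ?thesis .
qed

lemma nn_integral_noises_comb:
  assumes [measurable]: "H \<in> borel_measurable noises"
  shows "(\<integral>\<^sup>+ v. H v \<partial>noises) = (\<integral>\<^sup>+ v. \<integral>\<^sup>+ v'. H (comb_seq m v v') \<partial>noises \<partial>noises)"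
proof -
  have "(\<integral>\<^sup>+ v. H v \<partial>noises) = (\<integral>\<^sup>+ v. H v \<partial>distr (noises \<Otimes>\<^sub>M noises) noises (\<lambda>(v, v'). comb_seq m v v'))"
    by (simp only: V.PiM_comb_seq)
  also have "\<dots> = (\<integral>\<^sup>+ p. H (comb_seq m (fst p) (snd p)) \<partial>(noises \<Otimes>\<^sub>M noises))"
    by (subst nn_integral_distr) (auto simp: split_beta')
  also have "\<dots> = (\<integral>\<^sup>+ v. \<integral>\<^sup>+ v'. H (comb_seq m v v') \<partial>noises \<partial>noises)"
    by (subst V.P.nn_integral_fst[symmetric]) auto
  finally show ?thesis .
qed

lemma nn_integral_run:
  assumes "H \<in> borel_measurable (past_space \<pi>)"
  shows "(\<integral>\<^sup>+ s. \<integral>\<^sup>+ v. H (run s v n) \<partial>noises \<partial>mu) = (\<integral>\<^sup>+ s. H s \<partial>mu)"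
  using assms
proof (induction n arbitrary: H)
  case 0
  then show ?case by (simp add: V.P.emeasure_space_1)
next
  case (Suc n)
  note [measurable] = Suc.prems
  have "(\<integral>\<^sup>+ s. \<integral>\<^sup>+ v. H (run s v (Suc n)) \<partial>noises \<partial>mu) = (\<integral>\<^sup>+ s. \<integral>\<^sup>+ u. \<integral>\<^sup>+ v. H (run (step s u) v n) \<partial>noises \<partial>noise \<pi> \<partial>mu)"
    by (intro nn_integral_cong, subst nn_integral_noises_iter) (simp_all add: run_case_nat del: run.simps(2))
  also have "\<dots> = (\<integral>\<^sup>+ s. \<integral>\<^sup>+ v. H (run s v n) \<partial>noises \<partial>mu)"
    by (rule nn_integral_step[of "\<lambda>s. \<integral>\<^sup>+ v. H (run s v n) \<partial>noises"]) measurable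
  also have "\<dots> = (\<integral>\<^sup>+ s. H s \<partial>mu)" using Suc by simp
  finally show ?case .
qed

end

section \<open>Coupling of two chains\<close>

text \<open>The Weierstrass inequality, product at least 1 minus the sum of the defects, may say
  nothing about the whole product, but it gives 1/2 for a tail whose defects sum to less than 1/2;
  the finitely many remaining factors are positive.\<close>

lemma prod_bounded_below:
  fixes \<beta> :: "nat \<Rightarrow> real"
  assumes \<beta>: "\<And>k. 0 < \<beta> k" "\<And>k. \<beta> k \<le> 1" and sm: "summable (\<lambda>k. 1 - \<beta> k)"
  shows "\<exists>\<epsilon>>0. \<forall>n. \<epsilon> \<le> (\<Prod>k<n. \<beta> k)"
proof -
  have w: "1 - (\<Sum>k\<in>A. 1 - \<beta> k) \<le> (\<Prod>k\<in>A. \<beta> k)" if "finite A" for A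
    using that
  proof induction
    case (insert x A)
    have nn: "0 \<le> \<beta> k" for k using \<beta>(1)[of k] by simp
    have p: "0 \<le> (\<Prod>k\<in>A. \<beta> k)" "(\<Prod>k\<in>A. \<beta> k) \<le> 1"
      by (simp_all add: prod_nonneg prod_le_1 nn \<beta>(2))
    have "(1 - \<beta> x) * (\<Prod>k\<in>A. \<beta> k) \<le> (1 - \<beta> x) * 1"
      using \<beta>(2)[of x] p by (intro mult_left_mono) auto
    with insert p show ?case by (simp add: algebra_simps)
  qed simp
  have "(\<lambda>n. (\<Sum>k. 1 - \<beta> k) - (\<Sum>k<n. 1 - \<beta> k)) \<longlonglongrightarrow> (\<Sum>k. 1 - \<beta> k) - (\<Sum>k. 1 - \<beta> k)"
    by (intro tendsto_intros summable_LIMSEQ sm)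
  then have "\<forall>\<^sub>F n in sequentially. (\<Sum>k. 1 - \<beta> k) - (\<Sum>k<n. 1 - \<beta> k) < 1 / 2"
    by (rule order_tendstoD) simp
  then obtain K where K: "(\<Sum>k. 1 - \<beta> k) - (\<Sum>k<K. 1 - \<beta> k) < 1 / 2"
    by (auto simp: eventually_sequentially)
  have pos: "0 < (\<Prod>k<n. \<beta> k)" for n by (intro prod_pos \<beta>) 
  have anti: "(\<Prod>k<n. \<beta> k) \<le> (\<Prod>k<m. \<beta> k)" if "m \<le> n" for m n
    using that
  proof (induction rule: dec_induct)
    case (step i)
    have "(\<Prod>k<Suc i. \<beta> k) \<le> (\<Prod>k<i. \<beta> k)"
      using \<beta>(2)[of i] pos[of i] by (simp add: mult_left_le)
    with step show ?case by simp
  qed simp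
  have "(\<Prod>k<K. \<beta> k) * (1 / 2) \<le> (\<Prod>k<n. \<beta> k)" for n
  proof (cases "n \<le> K")
    case True
    then show ?thesis using anti[OF True] pos[of K] by linarith
  next
    case False
    then have split: "{..<n} = {..<K} \<union> {K..<n}" by auto
    have "(\<Sum>k<n. 1 - \<beta> k) \<le> (\<Sum>k. 1 - \<beta> k)"
      using sm \<beta>(2) by (intro sum_le_suminf) auto
    then have "(\<Sum>k=K..<n. 1 - \<beta> k) < 1 / 2"
      using K unfolding split by (subst (asm) sum.union_disjoint) auto
    then have "1 / 2 \<le> (\<Prod>k=K..<n. \<beta> k)" using w[of "{K..<n}"] by simp
    then have "(\<Prod>k<K. \<beta> k) * (1 / 2) \<le> (\<Prod>k<K. \<beta> k) * (\<Prod>k=K..<n. \<beta> k)"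
      using pos[of K] by (intro mult_left_mono) auto
    also have "\<dots> = (\<Prod>k<n. \<beta> k)"
      unfolding split by (subst prod.union_disjoint) auto
    finally show ?thesis .
  qed
  then show ?thesis using pos[of K] by (intro exI[of _ "(\<Prod>k<K. \<beta> k) * (1 / 2)"]) auto
qed

lemma pred_eq_nat:
  fixes A B :: "'a \<Rightarrow> nat"
  assumes [measurable]: "A \<in> measurable N (count_space UNIV)" "B \<in> measurable N (count_space UNIV)"
  shows "Measurable.pred N (\<lambda>x. A x = B x)"
proof -
  have "Measurable.pred N (\<lambda>x. \<exists>i. A x = i \<and> B x = i)" by measurable
  moreover have "(\<lambda>x. A x = B x) = (\<lambda>x. \<exists>i. A x = i \<and> B x = i)" by auto
  ultimately show ?thesis by (simp only:)
qed

context chain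
begin

text \<open>Agreement refers to the position of the mark, not to the letter: it is a measurable
  event over any state space, and it forces equal letters because both chains read the same
  noise.\<close>

definition agree :: "(nat \<Rightarrow> 'e) \<Rightarrow> (nat \<Rightarrow> 'e) \<Rightarrow> (nat \<Rightarrow> nat \<Rightarrow> 'e \<times> real) \<Rightarrow> nat \<Rightarrow> bool" where
  "agree s s' v k \<longleftrightarrow> sel (f (run s v k)) (v k) = sel (f (run s' v k)) (v k)"

lemma agree_measurable [measurable (raw)]:
  assumes [measurable]: "s \<in> measurable N (past_space \<pi>)" "s' \<in> measurable N (past_space \<pi>)" "v \<in> measurable N noises"
  shows "Measurable.pred N (\<lambda>x. agree (s x) (s' x) (v x) k)"
proof -
  have v [measurable]: "(\<lambda>x. v x k) \<in> measurable N (noise \<pi>)"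
    by (rule measurable_compose[OF assms(3) measurable_component_singleton]) simp
  have [measurable]: "(\<lambda>x. sel (f (run (s x) (v x) k)) (v x k)) \<in> measurable N (count_space UNIV)"
    "(\<lambda>x. sel (f (run (s' x) (v x) k)) (v x k)) \<in> measurable N (count_space UNIV)"
    by (rule sel_f_measurable[OF _ v], measurable)+
  show ?thesis unfolding agree_def by (rule pred_eq_nat) measurable
qed

lemma restrict_space: "s \<in> space (past_space \<pi>) \<Longrightarrow> restrict s {..<j} \<in> space (word_space \<pi> j)"
  by (auto simp: space_PiM)

lemma nn_integral_abs_diff:
  assumes [measurable]: "\<phi> \<in> borel_measurable \<pi>" "\<psi> \<in> borel_measurable \<pi>"
    and nn: "\<And>a. a \<in> space \<pi> \<Longrightarrow> 0 \<le> \<phi> a" "\<And>a. a \<in> space \<pi> \<Longrightarrow> 0 \<le> \<psi> a"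
    and one: "(\<integral>\<^sup>+ a. ennreal (\<phi> a) \<partial>\<pi>) = 1" "(\<integral>\<^sup>+ a. ennreal (\<psi> a) \<partial>\<pi>) = 1"
  shows "(\<integral>\<^sup>+ a. ennreal \<bar>\<phi> a - \<psi> a\<bar> \<partial>\<pi>) = ennreal (2 * density_dist \<pi> \<phi> \<psi>)"
    and "0 \<le> density_dist \<pi> \<phi> \<psi>" and "density_dist \<pi> \<phi> \<psi> \<le> 1"
proof -
  have "(\<integral>\<^sup>+ a. ennreal \<bar>\<phi> a - \<psi> a\<bar> \<partial>\<pi>) \<le> (\<integral>\<^sup>+ a. ennreal (\<phi> a) + ennreal (\<psi> a) \<partial>\<pi>)"
  proof (rule nn_integral_mono)
    fix a assume "a \<in> space \<pi>"
    then show "ennreal \<bar>\<phi> a - \<psi> a\<bar> \<le> ennreal (\<phi> a) + ennreal (\<psi> a)"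
      using nn[of a] by (subst ennreal_plus[symmetric]) (auto intro!: ennreal_leI simp del: ennreal_plus)
  qed
  also have "\<dots> = 2" by (subst nn_integral_add) (auto simp: one)
  finally have le: "(\<integral>\<^sup>+ a. ennreal \<bar>\<phi> a - \<psi> a\<bar> \<partial>\<pi>) \<le> 2" .
  have "integrable \<pi> (\<lambda>a. \<bar>\<phi> a - \<psi> a\<bar>)"
    using le by (intro integrableI_bounded) (auto simp: less_top[symmetric] top_unique)
  then show *: "(\<integral>\<^sup>+ a. ennreal \<bar>\<phi> a - \<psi> a\<bar> \<partial>\<pi>) = ennreal (2 * density_dist \<pi> \<phi> \<psi>)"
    by (subst nn_integral_eq_integral) (auto simp: density_dist_def)
  show "0 \<le> density_dist \<pi> \<phi> \<psi>" by (simp add: density_dist_def)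
  have "ennreal (2 * density_dist \<pi> \<phi> \<psi>) \<le> ennreal 2"
    using le unfolding * by simp
  then show "density_dist \<pi> \<phi> \<psi> \<le> 1" by (subst (asm) ennreal_le_iff) auto
qed

section \<open>Weights that bound the probability of agreement from below\<close>

definition D :: "nat \<Rightarrow> (nat \<Rightarrow> 'e) \<Rightarrow> real" where
  "D j s = density_dist \<pi> (g j (restrict s {..<j})) (f s)"

lemma D_measurable [measurable (raw)]:
  assumes [measurable]: "s \<in> measurable N (past_space \<pi>)"
  shows "(\<lambda>x. D j (s x)) \<in> borel_measurable N"
  unfolding D_def density_dist_def by measurable

lemma g_measurable1: "w \<in> space (word_space \<pi> n) \<Longrightarrow> g n w \<in> borel_measurable \<pi>"
  by (rule g_measurable) auto

lemma nn_integral_D: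
  assumes s: "s \<in> space (past_space \<pi>)"
  shows "(\<integral>\<^sup>+ a. ennreal \<bar>g j (restrict s {..<j}) a - f s a\<bar> \<partial>\<pi>) = ennreal (2 * D j s)"
    and D_nonneg: "0 \<le> D j s" and D_le_1: "D j s \<le> 1"
  unfolding D_def using restrict_space[OF s, of j] s
  by (auto intro!: nn_integral_abs_diff f_nonneg g_nonneg f_one g_one f_measurable1 g_measurable1)

text \<open>The agreement bound has the denominator 1 + 4 I, where I is the integral of the absolute
  difference of the two densities. The triangle inequality through \<open>g\<close> gives I \<le> 2
  D + 2 D', and 1 + 8 D + 8 D' is at most (1 + 8 D) (1 + 8 D'); thus the weight splits into one
  factor per state. Where \<open>g\<close> vanishes, division by zero makes the weight 0, which is
  harmless under the density \<open>g\<close>.\<close>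

definition beta :: "nat \<Rightarrow> (nat \<Rightarrow> 'e) \<Rightarrow> 'e \<Rightarrow> real" where
  "beta j s a = min 1 (f s a / g j (restrict s {..<j}) a) / (1 + 8 * D j s)"

lemma beta_measurable [measurable (raw)]:
  assumes [measurable]: "s \<in> measurable N (past_space \<pi>)" "a \<in> measurable N \<pi>"
  shows "(\<lambda>x. beta j (s x) (a x)) \<in> borel_measurable N"
  unfolding beta_def by measurable

lemma beta_bounds:
  assumes "s \<in> space (past_space \<pi>)" "a \<in> space \<pi>"
  shows "0 \<le> beta j s a" "beta j s a \<le> 1"
proof -
  have fg: "0 \<le> f s a" "0 \<le> g j (restrict s {..<j}) a" "0 \<le> D j s"
    using assms restrict_space[OF assms(1), of j] by (auto intro: f_nonneg g_nonneg D_nonneg)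
  then show "0 \<le> beta j s a" by (simp add: beta_def)
  show "beta j s a \<le> 1" using fg by (simp add: beta_def divide_le_eq)
qed

text \<open>The common \<open>g\<close> serves as reference: \<open>g\<close> times the two
  truncated ratios is below both densities, hence below their minimum. So one step keeps the chains
  together and hands on a letter distributed at least like \<open>g\<close> times both
  weights.\<close>

lemma agree_step:
  assumes s: "s \<in> space (past_space \<pi>)" "s' \<in> space (past_space \<pi>)"
    and eq: "restrict s {..<j} = restrict s' {..<j}" and [measurable]: "h \<in> borel_measurable \<pi>"
  shows "(\<integral>\<^sup>+ a. ennreal (g j (restrict s {..<j}) a) * (ennreal (beta j s a) * ennreal (beta j s' a) * h a) \<partial>\<pi>)
    \<le> (\<integral>\<^sup>+ u. indicator {u. sel (f s) u = sel (f s') u} u * h (letter (f s) u) \<partial>noise \<pi>)"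
proof -
  let ?g = "g j (restrict s {..<j})"
  let ?I = "\<integral>\<^sup>+ a. ennreal \<bar>f s a - f s' a\<bar> \<partial>\<pi>"
  note [measurable] = f_measurable1[OF s(1)] f_measurable1[OF s(2)] g_measurable1[OF restrict_space[OF s(1)]]
  have Dn: "0 \<le> D j s" "0 \<le> D j s'" using s by (auto intro: D_nonneg)
  have "?I \<le> (\<integral>\<^sup>+ a. ennreal \<bar>?g a - f s a\<bar> + ennreal \<bar>?g a - f s' a\<bar> \<partial>\<pi>)"
    by (intro nn_integral_mono, subst ennreal_plus[symmetric]) (auto intro!: ennreal_leI simp del: ennreal_plus)
  also have "\<dots> = ennreal (2 * D j s) + ennreal (2 * D j s')"
    using nn_integral_D(1)[OF s(1), of j] nn_integral_D(1)[OF s(2), of j, folded eq]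
    by (subst nn_integral_add) auto
  also have "\<dots> = ennreal (2 * D j s + 2 * D j s')"
    using Dn by (intro ennreal_plus[symmetric]) auto
  finally have I: "?I \<le> ennreal (2 * D j s + 2 * D j s')" .
  then obtain i where i: "?I = ennreal i" "0 \<le> i"
    by (cases ?I) (auto simp: top_unique)
  have i_le: "i \<le> 2 * D j s + 2 * D j s'"
    using I Dn unfolding i by (subst (asm) ennreal_le_iff) auto
  have "(\<integral>\<^sup>+ a. ennreal (?g a) * (ennreal (beta j s a) * ennreal (beta j s' a) * h a) \<partial>\<pi>)
    \<le> (\<integral>\<^sup>+ a. ennreal (min (f s a) (f s' a)) / (1 + 4 * ?I) * h a \<partial>\<pi>)"
  proof (rule nn_integral_mono)
    fix a assume a: "a \<in> space \<pi>"
    have fg: "0 \<le> f s a" "0 \<le> f s' a" "0 \<le> ?g a" "0 \<le> beta j s a" "0 \<le> beta j s' a"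
      using s a restrict_space[OF s(1), of j] by (auto intro: f_nonneg g_nonneg beta_bounds)
    let ?m = "min 1 (f s a / ?g a)" and ?m' = "min 1 (f s' a / ?g a)"
    have m: "0 \<le> ?m" "0 \<le> ?m'" using fg by auto
    have "?g a * ?m \<le> f s a" "?g a * ?m' \<le> f s' a"
      using fg by (auto simp: min_def field_simps)
    then have "?g a * ?m * ?m' \<le> f s a" "?g a * ?m * ?m' \<le> f s' a"
      using mult_left_mono[of ?m' 1 "?g a * ?m"] mult_left_mono[of ?m 1 "?g a * ?m'"] fg m
      by (auto simp: mult_ac)
    then have "?g a * ?m * ?m' \<le> min (f s a) (f s' a)" by simp
    moreover have "1 + 4 * i \<le> (1 + 8 * D j s) * (1 + 8 * D j s')"
    proof -
      have "(1 + 8 * D j s) * (1 + 8 * D j s') = 1 + 8 * D j s + 8 * D j s' + 64 * (D j s * D j s')"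
        by (simp add: algebra_simps)
      then show ?thesis using i_le mult_nonneg_nonneg[OF Dn] by linarith
    qed
    ultimately have "(?g a * ?m * ?m') / ((1 + 8 * D j s) * (1 + 8 * D j s')) \<le> min (f s a) (f s' a) / (1 + 4 * i)"
      using i(2) fg m by (intro frac_le) auto
    moreover have "?g a * (beta j s a * beta j s' a) = (?g a * ?m * ?m') / ((1 + 8 * D j s) * (1 + 8 * D j s'))"
      by (simp add: beta_def eq)
    ultimately have "?g a * (beta j s a * beta j s' a) \<le> min (f s a) (f s' a) / (1 + 4 * i)" by simp
    then have "ennreal (?g a * (beta j s a * beta j s' a)) \<le> ennreal (min (f s a) (f s' a) / (1 + 4 * i))"
      by (rule ennreal_leI)
    also have "ennreal (min (f s a) (f s' a) / (1 + 4 * i)) = ennreal (min (f s a) (f s' a)) / (1 + 4 * ?I)"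
      unfolding i(1) ennreal_one_plus_4[OF i(2)] using i(2) fg by (intro divide_ennreal[symmetric]) auto
    also have "ennreal (?g a * (beta j s a * beta j s' a)) = ennreal (?g a) * (ennreal (beta j s a) * ennreal (beta j s' a))"
      using fg by (simp add: ennreal_mult)
    finally show "ennreal (?g a) * (ennreal (beta j s a) * ennreal (beta j s' a) * h a)
        \<le> ennreal (min (f s a) (f s' a)) / (1 + 4 * ?I) * h a"
      by (simp only: mult.assoc[symmetric] mult_right_mono zero_le)
  qed
  also have "\<dots> \<le> (\<integral>\<^sup>+ u. indicator {u. sel (f s) u = sel (f s') u} u * h (letter (f s) u) \<partial>noise \<pi>)"
    using s by (intro nn_integral_agree_ge) (auto intro: f_nonneg f_one)
  finally show ?thesis .
qed

text \<open>A lower bound for the probability that the chains from \<open>s\<close> and \<open>s'\<close>, which share their last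
  \<open>j\<close> letters, choose the same marks during \<open>n\<close> steps.\<close>

primrec L :: "nat \<Rightarrow> nat \<Rightarrow> (nat \<Rightarrow> 'e) \<Rightarrow> (nat \<Rightarrow> 'e) \<Rightarrow> ennreal" where
  "L 0 j s s' = 1"
| "L (Suc n) j s s' = (\<integral>\<^sup>+ a. ennreal (g j (restrict s {..<j}) a) *
     (ennreal (beta j s a) * ennreal (beta j s' a) * L n (Suc j) (case_nat a s) (case_nat a s')) \<partial>\<pi>)"

lemma L_measurable' [measurable]:
  "(\<lambda>p. L n j (fst p) (snd p)) \<in> borel_measurable (past_space \<pi> \<Otimes>\<^sub>M past_space \<pi>)"
proof (induction n arbitrary: j)
  case (Suc n)
  have "(\<lambda>x. (case_nat (snd x) (fst (fst x)), case_nat (snd x) (snd (fst x))))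
      \<in> measurable ((past_space \<pi> \<Otimes>\<^sub>M past_space \<pi>) \<Otimes>\<^sub>M \<pi>) (past_space \<pi> \<Otimes>\<^sub>M past_space \<pi>)"
    by measurable
  from measurable_compose[OF this Suc[of "Suc j"]]
  have [measurable]: "(\<lambda>x. L n (Suc j) (case_nat (snd x) (fst (fst x))) (case_nat (snd x) (snd (fst x))))
      \<in> borel_measurable ((past_space \<pi> \<Otimes>\<^sub>M past_space \<pi>) \<Otimes>\<^sub>M \<pi>)" by simp
  show ?case unfolding L.simps by (rule borel_measurable_nn_integral) (simp add: split_beta')
qed simp

lemma L_measurable [measurable (raw)]:
  assumes "s \<in> measurable N (past_space \<pi>)" "s' \<in> measurable N (past_space \<pi>)"
  shows "(\<lambda>x. L n j (s x) (s' x)) \<in> borel_measurable N"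
  using measurable_compose[OF measurable_Pair[OF assms] L_measurable'] by simp

definition stay :: "nat \<Rightarrow> (nat \<Rightarrow> 'e) \<Rightarrow> (nat \<Rightarrow> 'e) \<Rightarrow> ennreal" where
  "stay n s s' = (\<integral>\<^sup>+ v. indicator {v. \<forall>k<n. agree s s' v k} v \<partial>noises)"

lemma stay_measurable [measurable (raw)]:
  assumes [measurable]: "s \<in> measurable N (past_space \<pi>)" "s' \<in> measurable N (past_space \<pi>)"
  shows "(\<lambda>x. stay n (s x) (s' x)) \<in> borel_measurable N"
  unfolding stay_def by measurable

text \<open>One step of agreement gives both states the same new letter, so they then share
  \<open>Suc j\<close> letters. The induction therefore runs over all \<open>j\<close>, with the
  remaining agreement as the test function in \<open>agree_step\<close>.\<close>

lemma L_le_stay: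
  assumes "s \<in> space (past_space \<pi>)" "s' \<in> space (past_space \<pi>)" "restrict s {..<j} = restrict s' {..<j}"
  shows "L n j s s' \<le> stay n s s'"
  using assms
proof (induction n arbitrary: j s s')
  case 0
  then show ?case by (simp add: stay_def V.P.emeasure_space_1)
next
  case (Suc n)
  note s [simp] = Suc.prems(1,2)
  let ?h = "\<lambda>a. stay n (case_nat a s) (case_nat a s')"
  have [measurable]: "?h \<in> borel_measurable \<pi>" by measurable
  have "L (Suc n) j s s' \<le> (\<integral>\<^sup>+ a. ennreal (g j (restrict s {..<j}) a) * (ennreal (beta j s a) * ennreal (beta j s' a) * ?h a) \<partial>\<pi>)"
    unfolding L.simps
  proof (intro nn_integral_mono mult_left_mono Suc.IH)
    fix a assume a: "a \<in> space \<pi>"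
    show "case_nat a s \<in> space (past_space \<pi>)" "case_nat a s' \<in> space (past_space \<pi>)"
      using s a by (auto simp: space_PiM PiE_iff split: nat.split)
    show "restrict (case_nat a s) {..<Suc j} = restrict (case_nat a s') {..<Suc j}"
    proof -
      have "s i = s' i" if "i < j" for i
        using fun_cong[OF Suc.prems(3), of i] that by simp
      then show ?thesis by (auto simp: restrict_def fun_eq_iff split: nat.split)
    qed
  qed simp_all
  also have "\<dots> \<le> (\<integral>\<^sup>+ u. indicator {u. sel (f s) u = sel (f s') u} u * ?h (letter (f s) u) \<partial>noise \<pi>)"
    by (intro agree_step Suc.prems) measurable
  also have "\<dots> = (\<integral>\<^sup>+ u. \<integral>\<^sup>+ v. indicator {v. \<forall>k<Suc n. agree s s' v k} (case_nat u v) \<partial>noises \<partial>noise \<pi>)"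
  proof (rule nn_integral_cong)
    fix u assume [simp]: "u \<in> space (noise \<pi>)"
    have agree: "(\<forall>k<Suc n. agree s s' (case_nat u v) k) \<longleftrightarrow>
       sel (f s) u = sel (f s') u \<and> (\<forall>k<n. agree (step s u) (step s' u) v k)" for v
      unfolding All_less_Suc2 by (simp add: agree_def run_case_nat del: run.simps(2))
    show "indicator {u. sel (f s) u = sel (f s') u} u * ?h (letter (f s) u) =
        (\<integral>\<^sup>+ v. indicator {v. \<forall>k<Suc n. agree s s' v k} (case_nat u v) \<partial>noises)"
    proof (cases "sel (f s) u = sel (f s') u")
      case True
      then have "letter (f s') u = letter (f s) u" by (simp add: letter_def)
      with True show ?thesis by (auto simp: stay_def agree step_def indicator_def intro!: nn_integral_cong)
    next
      case False
      then show ?thesis by (simp add: agree indicator_def)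
    qed
  qed
  also have "\<dots> = stay (Suc n) s s'"
    unfolding stay_def by (rule nn_integral_noises_iter[symmetric]) measurable
  finally show ?case .
qed

text \<open>The past \<open>x\<close> followed by the letters \<open>X\<^sub>0, \<dots>, X\<^sub>j\<^sub>-\<^sub>1\<close>.\<close>

definition S :: "nat \<Rightarrow> (nat \<Rightarrow> 'e) \<Rightarrow> 'w \<Rightarrow> nat \<Rightarrow> 'e" where
  "S j x \<omega> = comb_seq j (past X (int j - 1) \<omega>) x"

lemma S_measurable [measurable (raw)]:
  assumes [measurable]: "x \<in> measurable N (past_space \<pi>)" "h \<in> measurable N M"
  shows "(\<lambda>y. S j (x y) (h y)) \<in> measurable N (past_space \<pi>)"
  unfolding S_def by measurable

lemma S_0: "S 0 x \<omega> = x"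
  by (simp add: S_def comb_seq_0)

lemma S_Suc: "S (Suc j) x \<omega> = case_nat (X (int j) \<omega>) (S j x \<omega>)"
  by (simp add: S_def case_nat_comb_seq' past_Suc[of X "int j"])

lemma restrict_S: "restrict (S j x \<omega>) {..<j} = wd j \<omega>"
  by (auto simp: S_def wd_def restrict_def comb_seq_def)

lemma S_wd: "S j x \<omega> = comb_seq j (wd j \<omega>) x"
  by (auto simp: S_def wd_def comb_seq_def)

lemma S_space: "x \<in> space (past_space \<pi>) \<Longrightarrow> \<omega> \<in> space M \<Longrightarrow> S j x \<omega> \<in> space (past_space \<pi>)"
  by (rule measurable_space[of "\<lambda>\<omega>. S j x \<omega>" M]) auto

lemma comb_seq_word_measurable [measurable (raw)]:
  assumes w: "w \<in> measurable N (word_space \<pi> j)" and x: "x \<in> measurable N (past_space \<pi>)" and "k \<le> j"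
  shows "(\<lambda>y. comb_seq k (\<lambda>i. w y (i + (j - k))) (x y)) \<in> measurable N (past_space \<pi>)"
proof (rule measurable_PiM_UNIV)
  fix i
  show "(\<lambda>y. comb_seq k (\<lambda>i. w y (i + (j - k))) (x y) i) \<in> measurable N \<pi>"
  proof (cases "i < k")
    case True
    then have "i + (j - k) \<in> {..<j}" using \<open>k \<le> j\<close> by auto
    from measurable_compose[OF w measurable_component_singleton[OF this]] show ?thesis
      using True by (simp add: comb_seq_def)
  next
    case False
    have "(\<lambda>y. x y (i - k)) \<in> measurable N \<pi>"
      by (rule measurable_compose[OF x measurable_component_singleton]) simp
    then show ?thesis using False by (simp add: comb_seq_def)
  qed
qed

definition B :: "nat \<Rightarrow> (nat \<Rightarrow> 'e) \<Rightarrow> 'w \<Rightarrow> real" where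
  "B j x \<omega> = (\<Prod>k<j. beta k (S k x \<omega>) (X (int k) \<omega>))"

text \<open>\<open>B\<close> as a function of the word alone, as needed for conditioning on the
  word. Words run backwards in time: position \<open>j - 1 - k\<close> holds the letter of time
  \<open>k\<close>, and the shift by \<open>j - k\<close> forgets all letters from time
  \<open>k\<close> on.\<close>

definition Bw :: "nat \<Rightarrow> (nat \<Rightarrow> 'e) \<Rightarrow> (nat \<Rightarrow> 'e) \<Rightarrow> real" where
  "Bw j x w = (\<Prod>k<j. beta k (comb_seq k (\<lambda>i. w (i + (j - k))) x) (w (j - 1 - k)))"

lemma B_wd: "B j x \<omega> = Bw j x (wd j \<omega>)"
  unfolding B_def Bw_def
proof (rule prod.cong[OF refl])
  fix k assume "k \<in> {..<j}"
  then have k: "k < j" by simp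
  have "comb_seq k (\<lambda>i. wd j \<omega> (i + (j - k))) x = S k x \<omega>"
  proof
    fix i
    show "comb_seq k (\<lambda>i. wd j \<omega> (i + (j - k))) x i = S k x \<omega> i"
      using k by (auto simp: comb_seq_def S_def wd_def past_def of_nat_diff intro!: arg_cong[where f = "\<lambda>n. X n \<omega>"])
  qed
  moreover have "wd j \<omega> (j - 1 - k) = X (int k) \<omega>"
    using k by (auto simp: wd_def past_def of_nat_diff intro!: arg_cong[where f = "\<lambda>n. X n \<omega>"])
  ultimately show "beta k (S k x \<omega>) (X (int k) \<omega>) = beta k (comb_seq k (\<lambda>i. wd j \<omega> (i + (j - k))) x) (wd j \<omega> (j - 1 - k))"
    by simp
qed

lemma Bw_measurable [measurable (raw)]:
  assumes [measurable]: "w \<in> measurable N (word_space \<pi> j)" "x \<in> measurable N (past_space \<pi>)"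
  shows "(\<lambda>y. Bw j (x y) (w y)) \<in> borel_measurable N"
proof -
  have "(\<lambda>y. beta k (comb_seq k (\<lambda>i. w y (i + (j - k))) (x y)) (w y (j - 1 - k))) \<in> borel_measurable N" if "k < j" for k
  proof (rule beta_measurable)
    show "(\<lambda>y. comb_seq k (\<lambda>i. w y (i + (j - k))) (x y)) \<in> measurable N (past_space \<pi>)"
      using that by (intro comb_seq_word_measurable assms) simp
    show "(\<lambda>y. w y (j - 1 - k)) \<in> measurable N \<pi>"
      by (rule measurable_compose[OF assms(1) measurable_component_singleton]) (use that in auto)
  qed
  then show ?thesis unfolding Bw_def by (intro borel_measurable_prod) simp
qed

lemma B_measurable [measurable (raw)]:
  assumes [measurable]: "x \<in> measurable N (past_space \<pi>)" "h \<in> measurable N M"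
  shows "(\<lambda>y. B j (x y) (h y)) \<in> borel_measurable N"
  unfolding B_wd by measurable

lemma B_Suc: "B (Suc j) x \<omega> = B j x \<omega> * beta j (S j x \<omega>) (X (int j) \<omega>)"
  by (simp add: B_def)

lemma B_bounds:
  assumes "x \<in> space (past_space \<pi>)" "\<omega> \<in> space M"
  shows "0 \<le> B j x \<omega>" "B j x \<omega> \<le> 1"
proof -
  have "X n \<omega> \<in> space \<pi>" for n using assms(2) by (rule measurable_space[OF X_measurable])
  then show "0 \<le> B j x \<omega>" "B j x \<omega> \<le> 1"
    unfolding B_def using assms by (auto intro!: prod_nonneg prod_le_1 beta_bounds S_space)
qed

text \<open>Given the word of length \<open>j\<close>, the next letter of X has density
  \<open>g j\<close>, which is the density in the recursion of \<open>L\<close>. Integrating it out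
  moves one factor per past from \<open>L\<close> into \<open>B\<close>, so the value depends only
  on \<open>j + n\<close>.\<close>

lemma nn_integral_B_L:
  assumes x: "x \<in> space (past_space \<pi>)" "x' \<in> space (past_space \<pi>)"
  shows "(\<integral>\<^sup>+ \<omega>. ennreal (B j x \<omega>) * ennreal (B j x' \<omega>) * L n j (S j x \<omega>) (S j x' \<omega>) \<partial>M)
    = (\<integral>\<^sup>+ \<omega>. ennreal (B (j + n) x \<omega>) * ennreal (B (j + n) x' \<omega>) \<partial>M)"
proof (induction n arbitrary: j)
  case (Suc n)
  define H where "H p = ennreal (Bw j x (fst p)) * ennreal (Bw j x' (fst p)) *
      (ennreal (beta j (comb_seq j (fst p) x) (snd p)) * ennreal (beta j (comb_seq j (fst p) x') (snd p)) *
       L n (Suc j) (case_nat (snd p) (comb_seq j (fst p) x)) (case_nat (snd p) (comb_seq j (fst p) x')))" for p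
  have c [measurable]: "(\<lambda>p. comb_seq j (fst p) y) \<in> measurable (word_space \<pi> j \<Otimes>\<^sub>M \<pi>) (past_space \<pi>)"
    if "y \<in> space (past_space \<pi>)" for y
    using comb_seq_word_measurable[of fst "word_space \<pi> j \<Otimes>\<^sub>M \<pi>" j "\<lambda>_. y" j] that by simp
  note [measurable] = c[OF x(1)] c[OF x(2)]
  have [measurable]: "H \<in> borel_measurable (word_space \<pi> j \<Otimes>\<^sub>M \<pi>)"
    unfolding H_def using x by measurable
  have H1: "(\<lambda>a. H (wd j \<omega>, a)) \<in> borel_measurable \<pi>" if "\<omega> \<in> space M" for \<omega>
    using measurable_space[OF wd_measurable that] by (intro measurable_compose[OF measurable_Pair1']) auto
  have "(\<integral>\<^sup>+ \<omega>. ennreal (B j x \<omega>) * ennreal (B j x' \<omega>) * L (Suc n) j (S j x \<omega>) (S j x' \<omega>) \<partial>M)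
     = (\<integral>\<^sup>+ \<omega>. \<integral>\<^sup>+ a. ennreal (g j (wd j \<omega>) a) * H (wd j \<omega>, a) \<partial>\<pi> \<partial>M)"
  proof (rule nn_integral_cong)
    fix \<omega> assume \<omega>: "\<omega> \<in> space M"
    have sp: "S j x \<omega> \<in> space (past_space \<pi>)" "S j x' \<omega> \<in> space (past_space \<pi>)"
      using x \<omega> by (auto intro: S_space)
    have sw: "wd j \<omega> \<in> space (word_space \<pi> j)" using \<omega> by (rule measurable_space[OF wd_measurable])
    have "ennreal (B j x \<omega>) * ennreal (B j x' \<omega>) * L (Suc n) j (S j x \<omega>) (S j x' \<omega>) =
       (\<integral>\<^sup>+ a. ennreal (B j x \<omega>) * ennreal (B j x' \<omega>) * (ennreal (g j (wd j \<omega>) a) *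
     (ennreal (beta j (S j x \<omega>) a) * ennreal (beta j (S j x' \<omega>) a) * L n (Suc j) (case_nat a (S j x \<omega>)) (case_nat a (S j x' \<omega>)))) \<partial>\<pi>)"
      unfolding L.simps restrict_S using sp sw by (subst nn_integral_cmult) auto
    also have "\<dots> = (\<integral>\<^sup>+ a. ennreal (g j (wd j \<omega>) a) * H (wd j \<omega>, a) \<partial>\<pi>)"
      by (intro nn_integral_cong) (simp add: H_def B_wd S_wd mult_ac)
    finally show "ennreal (B j x \<omega>) * ennreal (B j x' \<omega>) * L (Suc n) j (S j x \<omega>) (S j x' \<omega>) =
        (\<integral>\<^sup>+ a. ennreal (g j (wd j \<omega>) a) * H (wd j \<omega>, a) \<partial>\<pi>)" .
  qed
  also have "\<dots> = (\<integral>\<^sup>+ \<omega>. H (wd j \<omega>, X (int j) \<omega>) \<partial>M)"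
    by (rule nn_integral_word_step[symmetric]) measurable
  also have "\<dots> = (\<integral>\<^sup>+ \<omega>. ennreal (B (Suc j) x \<omega>) * ennreal (B (Suc j) x' \<omega>) * L n (Suc j) (S (Suc j) x \<omega>) (S (Suc j) x' \<omega>) \<partial>M)"
  proof (rule nn_integral_cong)
    fix \<omega> assume \<omega>: "\<omega> \<in> space M"
    have "X n \<omega> \<in> space \<pi>" for n using \<omega> by (rule measurable_space[OF X_measurable])
    then have "0 \<le> beta j (S j x \<omega>) (X (int j) \<omega>)" "0 \<le> beta j (S j x' \<omega>) (X (int j) \<omega>)"
      using x \<omega> by (auto intro!: beta_bounds S_space)
    then show "H (wd j \<omega>, X (int j) \<omega>) = ennreal (B (Suc j) x \<omega>) * ennreal (B (Suc j) x' \<omega>) * L n (Suc j) (S (Suc j) x \<omega>) (S (Suc j) x' \<omega>)"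
      using B_bounds[OF x(1) \<omega>, of j] B_bounds[OF x(2) \<omega>, of j]
      by (simp add: H_def B_Suc S_Suc ennreal_mult mult_ac flip: B_wd S_wd)
  qed
  also have "\<dots> = (\<integral>\<^sup>+ \<omega>. ennreal (B (j + Suc n) x \<omega>) * ennreal (B (j + Suc n) x' \<omega>) \<partial>M)"
    using Suc.IH[of "Suc j"] by simp
  finally show ?case .
qed simp

lemma stay_ge:
  assumes x: "x \<in> space (past_space \<pi>)" "x' \<in> space (past_space \<pi>)"
  shows "(\<integral>\<^sup>+ \<omega>. ennreal (B n x \<omega>) * ennreal (B n x' \<omega>) \<partial>M) \<le> stay n x x'"
proof -
  have "(\<integral>\<^sup>+ \<omega>. ennreal (B n x \<omega>) * ennreal (B n x' \<omega>) \<partial>M) = (\<integral>\<^sup>+ \<omega>. L n 0 x x' \<partial>M)"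
    using nn_integral_B_L[OF x, of 0 n] by (simp add: S_0 B_def)
  also have "\<dots> = L n 0 x x'" by (simp add: M.emeasure_space_1)
  also have "\<dots> \<le> stay n x x'" using x by (intro L_le_stay) auto
  finally show ?thesis .
qed

end

lemma minus_le_divide:
  fixes m d :: real
  assumes "0 \<le> m" "m \<le> 1" "0 \<le> d"
  shows "m - 8 * d \<le> m / (1 + 8 * d)"
proof -
  have "m * (8 * d) \<le> 1 * (8 * d)" using assms by (intro mult_right_mono) auto
  moreover have "(m - 8 * d) * (1 + 8 * d) = m + m * (8 * d) - 8 * d - 64 * (d * d)"
    by (simp add: algebra_simps)
  ultimately have "(m - 8 * d) * (1 + 8 * d) \<le> m"
    using mult_nonneg_nonneg[OF assms(3,3)] by linarith
  then show ?thesis using assms(3) by (simp add: pos_le_divide_eq)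
qed

locale coupled_chain = chain \<pi> M X f g
  for \<pi> :: "'e measure" and M :: "'w measure" and X :: "int \<Rightarrow> 'w \<Rightarrow> 'e"
    and f :: "(nat \<Rightarrow> 'e) \<Rightarrow> 'e \<Rightarrow> real" and g :: "nat \<Rightarrow> (nat \<Rightarrow> 'e) \<Rightarrow> 'e \<Rightarrow> real" +
  assumes pos: "AE a in \<pi>. AE \<omega> in M. f (past X (-1) \<omega>) a > 0"
    and summ: "summable (eta M \<pi> X f g)"
begin

section \<open>Positivity and summability along almost every trajectory\<close>

lemma f_pos: "AE s in mu. AE a in \<pi>. 0 < f s a"
proof -
  interpret P: pair_sigma_finite \<pi> mu ..
  have "snd \<in> measurable (\<pi> \<Otimes>\<^sub>M mu) (past_space \<pi>)"
    using measurable_snd[of \<pi> mu] by (simp only: measurable_cong_sets[OF refl sets_mu])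
  then have [measurable]: "Measurable.pred (\<pi> \<Otimes>\<^sub>M mu) (\<lambda>p. 0 < f (snd p) (fst p))"
    by measurable
  have "AE a in \<pi>. AE s in mu. 0 < f s a"
    using pos AE_space
  proof eventually_elim
    case (elim a)
    then show ?case
      unfolding mu_def by (subst AE_distr_iff) auto
  qed
  then show ?thesis
    by (subst (asm) P.AE_commute) measurable
qed

text \<open>Given the word, the law of the next letter has a density with respect to \<pi>, so the
  letter avoids \<pi>-null sets even if they depend on the word.\<close>

lemma AE_step:
  assumes [measurable]: "Measurable.pred (past_space \<pi> \<Otimes>\<^sub>M \<pi>) (\<lambda>p. Q (fst p) (snd p))"
    and x: "x \<in> space (past_space \<pi>)"
    and ae: "AE \<omega> in M. AE a in \<pi>. Q (S k x \<omega>) a"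
  shows "AE \<omega> in M. Q (S k x \<omega>) (X (int k) \<omega>)"
proof -
  define H :: "_ \<Rightarrow> ennreal" where "H p = (if Q (comb_seq k (fst p) x) (snd p) then 0 else 1)" for p
  have c [measurable]: "(\<lambda>p. comb_seq k (fst p) x) \<in> measurable (word_space \<pi> k \<Otimes>\<^sub>M \<pi>) (past_space \<pi>)"
    using comb_seq_word_measurable[of fst "word_space \<pi> k \<Otimes>\<^sub>M \<pi>" k "\<lambda>_. x" k] x by simp
  have "Measurable.pred (word_space \<pi> k \<Otimes>\<^sub>M \<pi>) (\<lambda>p. Q (comb_seq k (fst p) x) (snd p))"
    using measurable_compose[OF measurable_Pair[OF c measurable_snd] assms(1)] by simp
  then have [measurable]: "H \<in> borel_measurable (word_space \<pi> k \<Otimes>\<^sub>M \<pi>)"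
    unfolding H_def by measurable
  have "(\<integral>\<^sup>+ \<omega>. H (wd k \<omega>, X (int k) \<omega>) \<partial>M) = (\<integral>\<^sup>+ \<omega>. \<integral>\<^sup>+ a. ennreal (g k (wd k \<omega>) a) * H (wd k \<omega>, a) \<partial>\<pi> \<partial>M)"
    by (rule nn_integral_word_step) measurable
  also have "\<dots> = (\<integral>\<^sup>+ \<omega>. 0 \<partial>M)"
  proof (rule nn_integral_cong_AE)
    show "AE \<omega> in M. (\<integral>\<^sup>+ a. ennreal (g k (wd k \<omega>) a) * H (wd k \<omega>, a) \<partial>\<pi>) = 0"
      using ae
    proof eventually_elim
      case (elim \<omega>)
      then have "(\<integral>\<^sup>+ a. ennreal (g k (wd k \<omega>) a) * H (wd k \<omega>, a) \<partial>\<pi>) = (\<integral>\<^sup>+ a. 0 \<partial>\<pi>)"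
        by (intro nn_integral_cong_AE) (auto simp: H_def S_wd)
      then show ?case by simp
    qed
  qed
  also have "\<dots> = 0" by simp
  finally have "AE \<omega> in M. H (wd k \<omega>, X (int k) \<omega>) = 0"
    by (subst (asm) nn_integral_0_iff_AE) auto
  then show ?thesis by (auto simp: H_def S_wd split: if_splits)
qed

text \<open>By positivity of \<open>f\<close>, overwriting the most recent letters by those of an independent copy
  does not charge null sets.\<close>

lemma AE_S:
  assumes "AE s in mu. P s" and "Measurable.pred (past_space \<pi>) P"
  shows "AE x in mu. AE \<omega> in M. P (S k x \<omega>)"
  using assms
proof (induction k arbitrary: P)
  case 0
  then show ?case by (simp add: S_0)
next
  case (Suc k)
  note [measurable] = Suc.prems(2)
  \<comment> \<open>The vanishing of an integral replaces the almost sure statement because it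
    defines a measurable predicate of \<open>s\<close>, to which the induction hypothesis
    applies.\<close>
  define P' where "P' s \<longleftrightarrow> (\<integral>\<^sup>+ a. (if P (case_nat a s) then 0 else 1) \<partial>\<pi>) = (0 :: ennreal)" for s
  have m: "Measurable.pred (past_space \<pi> \<Otimes>\<^sub>M \<pi>) (\<lambda>p. P (case_nat (snd p) (fst p)))"
    by measurable
  have [measurable]: "Measurable.pred (past_space \<pi>) P'"
  proof -
    have "(\<lambda>s. \<integral>\<^sup>+ a. (if P (case_nat a s) then 0 else 1 :: ennreal) \<partial>\<pi>) \<in> borel_measurable (past_space \<pi>)"
      using m by (intro borel_measurable_nn_integral) (simp add: split_beta')
    then show ?thesis unfolding P'_def by measurable
  qed
  have P': "P' s \<longleftrightarrow> (AE a in \<pi>. P (case_nat a s))" if s: "s \<in> space (past_space \<pi>)" for s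
  proof -
    have [measurable]: "Measurable.pred \<pi> (\<lambda>a. P (case_nat a s))"
      using measurable_compose[OF measurable_Pair1'[OF s] m] by simp
    show ?thesis
      unfolding P'_def by (subst nn_integral_0_iff_AE) (auto intro!: AE_cong split: if_splits)
  qed
  \<comment> \<open>A stationary past followed by its next letter is again stationary, so it
    violates \<open>P\<close> with probability 0; positivity of \<open>f\<close> turns this into a
    statement for \<pi>-almost every letter.\<close>
  have "(\<integral>\<^sup>+ s. \<integral>\<^sup>+ a. ennreal (f s a) * (if P (case_nat a s) then 0 else 1) \<partial>\<pi> \<partial>mu)
     = (\<integral>\<^sup>+ \<omega>. (if P (case_nat (X 0 \<omega>) (past X (0 - 1) \<omega>)) then 0 else 1) \<partial>M)"
    using nn_integral_step_law[of "\<lambda>p. if P (case_nat (snd p) (fst p)) then 0 else 1" 0] m by simp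
  also have "\<dots> = (\<integral>\<^sup>+ s. (if P s then 0 else 1) \<partial>mu)"
    unfolding past_Suc[symmetric] by (rule nn_integral_past) measurable
  also have "\<dots> = 0"
    using Suc.prems(1) by (subst nn_integral_0_iff_AE) auto
  finally have "AE s in mu. (\<integral>\<^sup>+ a. ennreal (f s a) * (if P (case_nat a s) then 0 else 1) \<partial>\<pi>) = 0"
    using m by (subst (asm) nn_integral_0_iff_AE) (auto simp: split_beta')
  then have "AE s in mu. P' s"
    using f_pos AE_space
  proof eventually_elim
    case (elim s)
    then have s: "s \<in> space (past_space \<pi>)" by simp
    have [measurable]: "Measurable.pred \<pi> (\<lambda>a. P (case_nat a s))"
      using measurable_compose[OF measurable_Pair1'[OF s] m] by simp
    note [measurable] = f_measurable1[OF s]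
    have "AE a in \<pi>. ennreal (f s a) * (if P (case_nat a s) then 0 else 1) = 0"
      using elim(1) by (subst (asm) nn_integral_0_iff_AE) auto
    with elim(2) show ?case
      unfolding P'[OF s] by eventually_elim (auto split: if_splits)
  qed
  from Suc.IH[OF this] have "AE x in mu. AE \<omega> in M. P' (S k x \<omega>)" by simp
  then show ?case
    using AE_space
  proof eventually_elim
    case (elim x)
    then have x: "x \<in> space (past_space \<pi>)" by simp
    have "AE \<omega> in M. AE a in \<pi>. P (case_nat a (S k x \<omega>))"
      using elim(1) AE_space by eventually_elim (simp add: P' S_space x)
    from AE_step[OF m x, simplified, OF this] show ?case by (simp add: S_Suc)
  qed
qed

text \<open>A letter almost surely avoids the zeros of its own conditional density, which settles
  \<open>g\<close>. For \<open>f\<close> the state is a past glued to an independent trajectory, so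
  the positivity has to be transported by \<open>AE_S\<close> and \<open>AE_step\<close>.\<close>

lemma AE_beta_pos: "AE x in mu. AE \<omega> in M. \<forall>k. 0 < beta k (S k x \<omega>) (X (int k) \<omega>)"
proof -
  have g: "AE \<omega> in M. 0 < g k (wd k \<omega>) (X (int k) \<omega>)" for k
  proof -
    let ?H = "\<lambda>p. if 0 < g k (fst p) (snd p) then 0 else (1 :: ennreal)"
    have "(\<integral>\<^sup>+ \<omega>. ?H (wd k \<omega>, X (int k) \<omega>) \<partial>M) = (\<integral>\<^sup>+ \<omega>. \<integral>\<^sup>+ a. ennreal (g k (wd k \<omega>) a) * ?H (wd k \<omega>, a) \<partial>\<pi> \<partial>M)"
      by (rule nn_integral_word_step) measurable
    also have "\<dots> = (\<integral>\<^sup>+ \<omega>. \<integral>\<^sup>+ a. 0 \<partial>\<pi> \<partial>M)"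
      by (intro nn_integral_cong) (auto simp: ennreal_neg)
    also have "\<dots> = 0" by simp
    finally show ?thesis
      by (subst (asm) nn_integral_0_iff_AE) (auto split: if_splits)
  qed
  have "AE x in mu. AE \<omega> in M. 0 < f (S k x \<omega>) (X (int k) \<omega>)" for k
  proof -
    have m: "Measurable.pred (past_space \<pi> \<Otimes>\<^sub>M \<pi>) (\<lambda>p. 0 < f (fst p) (snd p))" by measurable
    define P where "P s \<longleftrightarrow> (\<integral>\<^sup>+ a. (if 0 < f s a then 0 else 1) \<partial>\<pi>) = (0 :: ennreal)" for s
    have [measurable]: "Measurable.pred (past_space \<pi>) P"
      unfolding P_def by measurable
    have P: "P s \<longleftrightarrow> (AE a in \<pi>. 0 < f s a)" if s: "s \<in> space (past_space \<pi>)" for s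
    proof -
      note [measurable] = f_measurable1[OF s]
      show ?thesis
        unfolding P_def by (subst nn_integral_0_iff_AE) (auto intro!: AE_cong split: if_splits)
    qed
    have "AE s in mu. P s" using f_pos AE_space by eventually_elim (simp add: P)
    from AE_S[OF this, of k] have "AE x in mu. AE \<omega> in M. P (S k x \<omega>)" by simp
    then show ?thesis
      using AE_space
    proof eventually_elim
      case (elim x)
      then have x: "x \<in> space (past_space \<pi>)" by simp
      have "AE \<omega> in M. AE a in \<pi>. 0 < f (S k x \<omega>) a"
        using elim(1) AE_space by eventually_elim (simp add: P S_space x)
      from AE_step[OF m x, simplified, OF this] show ?case .
    qed
  qed
  then have "AE x in mu. \<forall>k. AE \<omega> in M. 0 < f (S k x \<omega>) (X (int k) \<omega>)"
    by (simp add: AE_all_countable)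
  then show ?thesis
    using AE_space
  proof eventually_elim
    case (elim x)
    have "AE \<omega> in M. \<forall>k. 0 < f (S k x \<omega>) (X (int k) \<omega>)" using elim(1) by (simp add: AE_all_countable)
    moreover have "AE \<omega> in M. \<forall>k. 0 < g k (wd k \<omega>) (X (int k) \<omega>)" using g by (simp add: AE_all_countable)
    ultimately show ?case
      using AE_space
    proof eventually_elim
      case (elim \<omega>)
      then have "0 \<le> D k (S k x \<omega>)" for k using \<open>x \<in> space mu\<close> by (auto intro!: D_nonneg S_space)
      then show ?case using elim by (auto simp: beta_def restrict_S intro!: divide_pos_pos add_pos_nonneg)
    qed
  qed
qed

text \<open>The past and the word in \<open>eta\<close> come from independent copies, so
  stationarity may shift them separately: the past becomes a point with law \<open>mu\<close>, the
  word moves to the times 0, ..., k - 1.\<close>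

lemma nn_integral_eta: "(\<integral>\<^sup>+ x. \<integral>\<^sup>+ \<omega>. ennreal (D k (S k x \<omega>)) \<partial>M \<partial>mu) = ennreal (eta M \<pi> X f g k)"
proof -
  interpret MM: pair_prob_space M M ..
  let ?d = "\<lambda>\<omega> \<omega>'. D k (comb_seq k (word X k \<omega>') (past X (- int k - 1) \<omega>))"
  have c [measurable]: "(\<lambda>p. comb_seq k (word X k (snd p)) (past X (- int k - 1) (fst p))) \<in> measurable (M \<Otimes>\<^sub>M M) (past_space \<pi>)"
    using comb_seq_word_measurable[of "\<lambda>p. word X k (snd p)" "M \<Otimes>\<^sub>M M" k "\<lambda>p. past X (- int k - 1) (fst p)" k] by simp
  have d: "?d \<omega> \<omega>' = density_dist \<pi> (g k (word X k \<omega>')) (f (comb_seq k (word X k \<omega>') (past X (- int k - 1) \<omega>)))" for \<omega> \<omega>'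
  proof -
    have "restrict (comb_seq k (word X k \<omega>') (past X (- int k - 1) \<omega>)) {..<k} = word X k \<omega>'"
      by (auto simp: word_def restrict_def comb_seq_def)
    then show ?thesis by (simp add: D_def)
  qed
  have sp: "comb_seq k (word X k (snd p)) (past X (- int k - 1) (fst p)) \<in> space (past_space \<pi>)" if "p \<in> space (M \<Otimes>\<^sub>M M)" for p
    using measurable_space[OF c that] by simp
  have "integrable (M \<Otimes>\<^sub>M M) (\<lambda>p. ?d (fst p) (snd p))"
    by (rule MM.integrable_const_bound[of _ 1]) (auto intro!: AE_I2 simp: D_nonneg D_le_1 sp)
  then have "(\<integral>\<^sup>+ p. ennreal (?d (fst p) (snd p)) \<partial>(M \<Otimes>\<^sub>M M)) = ennreal (\<integral> p. ?d (fst p) (snd p) \<partial>(M \<Otimes>\<^sub>M M))"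
    by (rule nn_integral_eq_integral) (auto simp: D_nonneg sp)
  also have "(\<integral> p. ?d (fst p) (snd p) \<partial>(M \<Otimes>\<^sub>M M)) = eta M \<pi> X f g k"
    unfolding eta_def d by (simp add: split_beta')
  finally have "ennreal (eta M \<pi> X f g k) = (\<integral>\<^sup>+ p. ennreal (?d (fst p) (snd p)) \<partial>(M \<Otimes>\<^sub>M M))" by simp
  also have "\<dots> = (\<integral>\<^sup>+ \<omega>. \<integral>\<^sup>+ \<omega>'. ennreal (?d \<omega> \<omega>') \<partial>M \<partial>M)"
    by (subst M.nn_integral_fst[symmetric]) auto
  also have "\<dots> = (\<integral>\<^sup>+ \<omega>. \<integral>\<^sup>+ \<omega>'. ennreal (D k (S k (past X (- int k - 1) \<omega>) \<omega>')) \<partial>M \<partial>M)"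
  proof (rule nn_integral_cong)
    fix \<omega> assume "\<omega> \<in> space M"
    then have x: "past X (- int k - 1) \<omega> \<in> space (past_space \<pi>)" by (rule measurable_space[OF past_measurable])
    have "(\<lambda>w. comb_seq k w (past X (- int k - 1) \<omega>)) \<in> measurable (word_space \<pi> k) (past_space \<pi>)"
      using comb_seq_word_measurable[of "\<lambda>w. w" "word_space \<pi> k" k "\<lambda>_. past X (- int k - 1) \<omega>" k] x by simp
    then have "(\<lambda>w. ennreal (D k (comb_seq k w (past X (- int k - 1) \<omega>)))) \<in> borel_measurable (word_space \<pi> k)" by measurable
    from nn_integral_wd[OF this] show "(\<integral>\<^sup>+ \<omega>'. ennreal (?d \<omega> \<omega>') \<partial>M) = (\<integral>\<^sup>+ \<omega>'. ennreal (D k (S k (past X (- int k - 1) \<omega>) \<omega>')) \<partial>M)"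
      by (simp add: S_wd)
  qed
  also have "\<dots> = (\<integral>\<^sup>+ x. \<integral>\<^sup>+ \<omega>'. ennreal (D k (S k x \<omega>')) \<partial>M \<partial>mu)"
    by (rule nn_integral_past) measurable
  finally show ?thesis by simp
qed

text \<open>Under the density \<open>g\<close> the defect of the truncated ratio integrates to the
  positive part of g - f, at most \<integral>|g - f| = 2 D. The denominator costs at most 8 D, and
  10 = 2 + 8.\<close>

lemma nn_integral_1_minus_beta:
  assumes x: "x \<in> space (past_space \<pi>)"
  shows "(\<integral>\<^sup>+ \<omega>. ennreal (1 - beta k (S k x \<omega>) (X (int k) \<omega>)) \<partial>M) \<le> 10 * (\<integral>\<^sup>+ \<omega>. ennreal (D k (S k x \<omega>)) \<partial>M)"
proof -
  let ?r = "\<lambda>w a. 1 - min 1 (f (comb_seq k w x) a / g k w a)"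
  have c [measurable]: "(\<lambda>p. comb_seq k (fst p) x) \<in> measurable (word_space \<pi> k \<Otimes>\<^sub>M \<pi>) (past_space \<pi>)"
    using comb_seq_word_measurable[of fst "word_space \<pi> k \<Otimes>\<^sub>M \<pi>" k "\<lambda>_. x" k] x by simp
  have Xs: "X n \<omega> \<in> space \<pi>" if "\<omega> \<in> space M" for n \<omega> using that by (rule measurable_space[OF X_measurable])
  have ws: "wd k \<omega> \<in> space (word_space \<pi> k)" if "\<omega> \<in> space M" for \<omega> using that by (rule measurable_space[OF wd_measurable])
  have "(\<integral>\<^sup>+ \<omega>. ennreal (1 - beta k (S k x \<omega>) (X (int k) \<omega>)) \<partial>M)
      \<le> (\<integral>\<^sup>+ \<omega>. ennreal (?r (wd k \<omega>) (X (int k) \<omega>)) + ennreal (8 * D k (S k x \<omega>)) \<partial>M)"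
  proof (rule nn_integral_mono)
    fix \<omega> assume \<omega>: "\<omega> \<in> space M"
    let ?m = "min 1 (f (S k x \<omega>) (X (int k) \<omega>) / g k (wd k \<omega>) (X (int k) \<omega>))" and ?D = "D k (S k x \<omega>)"
    have D: "0 \<le> ?D" using x \<omega> by (intro D_nonneg S_space)
    have m: "0 \<le> ?m" "?m \<le> 1" using x \<omega> by (auto intro!: divide_nonneg_nonneg f_nonneg g_nonneg S_space Xs ws)
    have "?m - 8 * ?D \<le> ?m / (1 + 8 * ?D)"
      using m D by (rule minus_le_divide)
    then have "1 - beta k (S k x \<omega>) (X (int k) \<omega>) \<le> (1 - ?m) + 8 * ?D"
      by (simp add: beta_def restrict_S)
    then have "ennreal (1 - beta k (S k x \<omega>) (X (int k) \<omega>)) \<le> ennreal ((1 - ?m) + 8 * ?D)"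
      by (rule ennreal_leI)
    also have "\<dots> = ennreal (1 - ?m) + ennreal (8 * ?D)"
      using m D by (intro ennreal_plus) auto
    finally show "ennreal (1 - beta k (S k x \<omega>) (X (int k) \<omega>)) \<le> ennreal (?r (wd k \<omega>) (X (int k) \<omega>)) + ennreal (8 * ?D)"
      by (simp add: S_wd)
  qed
  also have "\<dots> = (\<integral>\<^sup>+ \<omega>. ennreal (?r (wd k \<omega>) (X (int k) \<omega>)) \<partial>M) + (\<integral>\<^sup>+ \<omega>. ennreal (8 * D k (S k x \<omega>)) \<partial>M)"
    using x by (subst nn_integral_add) (auto simp: S_wd[symmetric])
  also have "(\<integral>\<^sup>+ \<omega>. ennreal (?r (wd k \<omega>) (X (int k) \<omega>)) \<partial>M)
      = (\<integral>\<^sup>+ \<omega>. \<integral>\<^sup>+ a. ennreal (g k (wd k \<omega>) a) * ennreal (?r (wd k \<omega>) a) \<partial>\<pi> \<partial>M)"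
    using nn_integral_word_step[of "\<lambda>p. ennreal (?r (fst p) (snd p))" k] by simp
  also have "\<dots> \<le> (\<integral>\<^sup>+ \<omega>. ennreal (2 * D k (S k x \<omega>)) \<partial>M)"
  proof (rule nn_integral_mono)
    fix \<omega> assume \<omega>: "\<omega> \<in> space M"
    have sp: "S k x \<omega> \<in> space (past_space \<pi>)" using x \<omega> by (rule S_space)
    have "(\<integral>\<^sup>+ a. ennreal (g k (wd k \<omega>) a) * ennreal (?r (wd k \<omega>) a) \<partial>\<pi>) \<le> (\<integral>\<^sup>+ a. ennreal \<bar>g k (wd k \<omega>) a - f (S k x \<omega>) a\<bar> \<partial>\<pi>)"
    proof (rule nn_integral_mono)
      fix a assume a: "a \<in> space \<pi>"
      have fg: "0 \<le> g k (wd k \<omega>) a" "0 \<le> f (S k x \<omega>) a" using sp ws[OF \<omega>] a by (auto intro: g_nonneg f_nonneg)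
      then have "g k (wd k \<omega>) a * (1 - min 1 (f (S k x \<omega>) a / g k (wd k \<omega>) a)) \<le> \<bar>g k (wd k \<omega>) a - f (S k x \<omega>) a\<bar>"
        by (cases "g k (wd k \<omega>) a = 0") (auto simp: min_def field_simps)
      then show "ennreal (g k (wd k \<omega>) a) * ennreal (?r (wd k \<omega>) a) \<le> ennreal \<bar>g k (wd k \<omega>) a - f (S k x \<omega>) a\<bar>"
        using fg by (subst ennreal_mult[symmetric]) (auto intro!: ennreal_leI simp: S_wd)
    qed
    also have "\<dots> = ennreal (2 * D k (S k x \<omega>))"
      using nn_integral_D(1)[OF sp, of k] by (simp add: restrict_S)
    finally show "(\<integral>\<^sup>+ a. ennreal (g k (wd k \<omega>) a) * ennreal (?r (wd k \<omega>) a) \<partial>\<pi>) \<le> ennreal (2 * D k (S k x \<omega>))" .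
  qed
  also have "(\<integral>\<^sup>+ \<omega>. ennreal (2 * D k (S k x \<omega>)) \<partial>M) = 2 * (\<integral>\<^sup>+ \<omega>. ennreal (D k (S k x \<omega>)) \<partial>M)"
    using x by (subst nn_integral_cmult[symmetric]) (auto simp: ennreal_mult')
  also have "(\<integral>\<^sup>+ \<omega>. ennreal (8 * D k (S k x \<omega>)) \<partial>M) = 8 * (\<integral>\<^sup>+ \<omega>. ennreal (D k (S k x \<omega>)) \<partial>M)"
    using x by (subst nn_integral_cmult[symmetric]) (auto simp: ennreal_mult')
  also have "2 * (\<integral>\<^sup>+ \<omega>. ennreal (D k (S k x \<omega>)) \<partial>M) + 8 * (\<integral>\<^sup>+ \<omega>. ennreal (D k (S k x \<omega>)) \<partial>M)
     = 10 * (\<integral>\<^sup>+ \<omega>. ennreal (D k (S k x \<omega>)) \<partial>M)"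
    by (simp add: distrib_right[symmetric])
  finally show ?thesis by (simp add: add_right_mono)
qed

lemma eta_nonneg: "0 \<le> eta M \<pi> X f g k"
  unfolding eta_def density_dist_def split_beta' by (intro Bochner_Integration.integral_nonneg) simp

lemma AE_B_bounded_below: "AE x in mu. AE \<omega> in M. \<exists>\<epsilon>>0. \<forall>n. \<epsilon> \<le> B n x \<omega>"
proof -
  let ?c = "\<lambda>k x \<omega>. ennreal (1 - beta k (S k x \<omega>) (X (int k) \<omega>))"
  have "(\<integral>\<^sup>+ x. \<integral>\<^sup>+ \<omega>. (\<Sum>k. ?c k x \<omega>) \<partial>M \<partial>mu) = (\<integral>\<^sup>+ x. (\<Sum>k. \<integral>\<^sup>+ \<omega>. ?c k x \<omega> \<partial>M) \<partial>mu)"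
    by (intro nn_integral_cong nn_integral_suminf) measurable
  also have "\<dots> = (\<Sum>k. \<integral>\<^sup>+ x. \<integral>\<^sup>+ \<omega>. ?c k x \<omega> \<partial>M \<partial>mu)"
    by (intro nn_integral_suminf) measurable
  also have "\<dots> \<le> (\<Sum>k. ennreal (10 * eta M \<pi> X f g k))"
  proof (rule suminf_le)
    fix k
    have "(\<integral>\<^sup>+ x. \<integral>\<^sup>+ \<omega>. ?c k x \<omega> \<partial>M \<partial>mu) \<le> (\<integral>\<^sup>+ x. 10 * (\<integral>\<^sup>+ \<omega>. ennreal (D k (S k x \<omega>)) \<partial>M) \<partial>mu)"
      by (intro nn_integral_mono nn_integral_1_minus_beta) simp
    also have "\<dots> = 10 * ennreal (eta M \<pi> X f g k)"
      unfolding nn_integral_eta[symmetric] by (rule nn_integral_cmult) measurable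
    finally show "(\<integral>\<^sup>+ x. \<integral>\<^sup>+ \<omega>. ?c k x \<omega> \<partial>M \<partial>mu) \<le> ennreal (10 * eta M \<pi> X f g k)"
      by (simp add: ennreal_mult')
  qed auto
  also have "\<dots> < \<top>"
    using summ eta_nonneg by (subst suminf_ennreal2) (auto intro!: summable_mult)
  finally have "AE x in mu. (\<integral>\<^sup>+ \<omega>. (\<Sum>k. ?c k x \<omega>) \<partial>M) \<noteq> \<infinity>"
    by (intro nn_integral_PInf_AE) (auto simp: less_top)
  then show ?thesis
    using AE_beta_pos AE_space
  proof eventually_elim
    case (elim x)
    then have x [simp]: "x \<in> space (past_space \<pi>)" by simp
    have "AE \<omega> in M. (\<Sum>k. ?c k x \<omega>) \<noteq> \<infinity>"
      using elim(1) by (intro nn_integral_PInf_AE) auto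
    then show ?case
      using elim(2) AE_space
    proof eventually_elim
      case (elim \<omega>)
      have "X n \<omega> \<in> space \<pi>" for n using elim(3) by (rule measurable_space[OF X_measurable])
      then have le: "beta k (S k x \<omega>) (X (int k) \<omega>) \<le> 1" for k using elim(3) by (auto intro!: beta_bounds S_space)
      have "summable (\<lambda>k. 1 - beta k (S k x \<omega>) (X (int k) \<omega>))"
        using elim(1) le by (intro summable_suminf_not_top) auto
      from prod_bounded_below[of "\<lambda>k. beta k (S k x \<omega>) (X (int k) \<omega>)", OF _ le this] elim(2)
      show ?case by (simp add: B_def)
    qed
  qed
qed

end

section \<open>Eventual agreement of two stationary chains\<close>

lemma emeasure_Collect_if:
  assumes "{p \<in> space N. P p} \<in> sets N"
  shows "emeasure N {p \<in> space N. P p} = (\<integral>\<^sup>+ p. (if P p then 1 else 0) \<partial>N)"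
proof -
  have "emeasure N {p \<in> space N. P p} = (\<integral>\<^sup>+ p. indicator {p \<in> space N. P p} p \<partial>N)"
    using assms by (rule nn_integral_indicator[symmetric])
  also have "\<dots> = (\<integral>\<^sup>+ p. (if P p then 1 else 0) \<partial>N)"
    by (intro nn_integral_cong) (simp add: indicator_def)
  finally show ?thesis .
qed

lemma real_le_if_ennreal_le:
  fixes c x y z :: real
  assumes nn: "0 \<le> c" "0 \<le> x" "0 \<le> y" "0 \<le> z"
    and le: "ennreal c * ennreal x \<le> ennreal y + ennreal c * (2 * ennreal z)"
  shows "c * x \<le> y + c * (2 * z)"
proof -
  have "2 * ennreal z = ennreal (2 * z)" using nn by (simp add: ennreal_mult')
  then have "ennreal c * (2 * ennreal z) = ennreal (c * (2 * z))"
    using nn by (simp only: ennreal_mult mult_nonneg_nonneg zero_le_numeral)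
  moreover have "ennreal c * ennreal x = ennreal (c * x)"
    using nn by (simp add: ennreal_mult)
  ultimately have "ennreal (c * x) \<le> ennreal (y + c * (2 * z))"
    using le nn by (simp only: ennreal_plus mult_nonneg_nonneg zero_le_numeral)
  then show ?thesis using nn by (subst (asm) ennreal_le_iff) simp_all
qed

lemma (in prob_space) ex_le_nn_integral:
  assumes "(\<integral>\<^sup>+ x. h x \<partial>M) \<le> ennreal c" "0 \<le> c" "0 < d"
  shows "\<exists>x\<in>space M. h x \<le> ennreal (c + d)"
proof (rule ccontr)
  assume "\<not> (\<exists>x\<in>space M. h x \<le> ennreal (c + d))"
  then have "(\<integral>\<^sup>+ x. ennreal (c + d) \<partial>M) \<le> (\<integral>\<^sup>+ x. h x \<partial>M)"
    by (intro nn_integral_mono) (auto simp: not_le intro: less_imp_le)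
  then have "ennreal (c + d) \<le> ennreal c"
    using assms(1) by (simp add: emeasure_space_1 del: ennreal_plus)
  then show False using assms(2,3) by (simp del: ennreal_plus)
qed

lemma if_conj_mult: "(if P \<and> Q then 1 else 0 :: ennreal) = (if Q then 1 else 0) * (if P then 1 else 0)"
  by simp

context coupled_chain
begin

lemma emeasure_mu_space [simp]: "emeasure mu (space (past_space \<pi>)) = 1"
  using mu.emeasure_space_1 by simp

text \<open>The level 1/3 is made for pairs: for two pasts outside \<open>bad n\<close> the
  exceptional events together have probability below 2/3, so with probability at least 1/3 neither
  product ever drops below 1 / (n + 1).\<close>

definition bad :: "nat \<Rightarrow> (nat \<Rightarrow> 'e) set" where
  "bad n = {x \<in> space (past_space \<pi>). 1 / 3 \<le> emeasure M {\<omega> \<in> space M. \<exists>T. B T x \<omega> < 1 / (real n + 1)}}"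

lemma sets_bad [measurable]: "bad n \<in> sets (past_space \<pi>)"
  unfolding bad_def by measurable

text \<open>Continuity from above is used twice: over the trajectories, to see that almost every
  past leaves some \<open>bad n\<close>, and then over the pasts, since the sets
  \<open>bad n\<close> decrease.\<close>

lemma bad_tendsto: "(\<lambda>n. emeasure mu (bad n)) \<longlonglongrightarrow> 0"
proof -
  let ?E = "\<lambda>x n. {\<omega> \<in> space M. \<exists>T. B T x \<omega> < 1 / (real n + 1)}"
  have mono: "?E x m \<subseteq> ?E x n" if "n \<le> m" for x n m
  proof -
    have "1 / (real m + 1) \<le> 1 / (real n + 1)" using that by (intro divide_left_mono) auto
    then show ?thesis by (auto intro: less_le_trans)
  qed
  have meas: "?E x n \<in> sets M" if "x \<in> space (past_space \<pi>)" for x n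
    using that by measurable
  have "AE x in mu. x \<notin> (\<Inter>n. bad n)"
    using AE_B_bounded_below AE_space
  proof eventually_elim
    case (elim x)
    then have x: "x \<in> space (past_space \<pi>)" by simp
    have "(\<lambda>n. emeasure M (?E x n)) \<longlonglongrightarrow> emeasure M (\<Inter>n. ?E x n)"
      using meas[OF x] mono by (intro Lim_emeasure_decseq) (auto simp: decseq_def)
    also have "emeasure M (\<Inter>n. ?E x n) = 0"
    proof (rule emeasure_eq_0_AE[of "\<lambda>\<omega>. \<forall>n. \<exists>T. B T x \<omega> < 1 / (real n + 1)" M, unfolded Collect_conj_eq, THEN trans[rotated]])
      show "AE \<omega> in M. \<not> (\<forall>n. \<exists>T. B T x \<omega> < 1 / (real n + 1))"
        using elim(1)
      proof eventually_elim
        case (elim \<omega>)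
        then obtain \<epsilon> where \<epsilon>: "0 < \<epsilon>" "\<And>n. \<epsilon> \<le> B n x \<omega>" by auto
        obtain n where "inverse (real (Suc n)) < \<epsilon>"
          using reals_Archimedean[OF \<epsilon>(1)] by blast
        then have n: "1 / (real n + 1) < \<epsilon>" by (simp add: inverse_eq_divide add.commute)
        have "\<not> B T x \<omega> < 1 / (real n + 1)" for T
          using \<epsilon>(2)[of T] n by linarith
        then show ?case by blast
      qed
      show "emeasure M (\<Inter>n. ?E x n) = emeasure M ({\<omega>. \<omega> \<in> space M} \<inter> {\<omega>. \<forall>n. \<exists>T. B T x \<omega> < 1 / (real n + 1)})"
        by (rule arg_cong[where f = "emeasure M"]) auto
    qed
    finally have "\<forall>\<^sub>F n in sequentially. emeasure M (?E x n) < 1 / 3"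
      by (rule order_tendstoD) (simp add: ennreal_zero_less_divide)
    then obtain n where "emeasure M (?E x n) < 1 / 3" by (auto simp: eventually_sequentially)
    then show ?case by (auto simp: bad_def not_le)
  qed
  then have "emeasure mu (\<Inter>n. bad n) = 0"
    by (subst (asm) AE_iff_measurable[of "\<Inter>n. bad n"]) (auto simp: bad_def)
  moreover have "(\<lambda>n. emeasure mu (bad n)) \<longlonglongrightarrow> emeasure mu (\<Inter>n. bad n)"
  proof (rule Lim_emeasure_decseq)
    show "decseq bad"
      unfolding decseq_def
    proof (intro allI impI)
      fix m n :: nat assume mn: "m \<le> n"
      show "bad n \<subseteq> bad m"
        unfolding bad_def
      proof (intro Collect_mono impI conjI; elim conjE; assumption?)
        fix x assume x: "x \<in> space (past_space \<pi>)" "1 / 3 \<le> emeasure M (?E x n)"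
        have "emeasure M (?E x n) \<le> emeasure M (?E x m)"
          using mono[OF mn] meas[OF x(1)] by (intro emeasure_mono) auto
        with x(2) show "1 / 3 \<le> emeasure M (?E x m)" by (rule order_trans)
      qed
    qed
  qed auto
  ultimately show ?thesis by simp
qed

text \<open>The bound is uniform in \<open>T\<close>, since the exceptional sets already quantify
  over all times; this lets it pass to infinitely many steps. The square comes from one factor 1 /
  (n + 1) for each past.\<close>

lemma stay_ge_good:
  assumes x: "x \<in> space (past_space \<pi>)" "x' \<in> space (past_space \<pi>)" and nb: "x \<notin> bad n" "x' \<notin> bad n"
  shows "ennreal ((1 / (real n + 1))\<^sup>2 / 3) \<le> stay T x x'"
proof -
  let ?\<epsilon> = "1 / (real n + 1)"
  let ?E = "\<lambda>x. {\<omega> \<in> space M. \<exists>T. B T x \<omega> < ?\<epsilon>}"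
  have [measurable]: "?E x \<in> sets M" "?E x' \<in> sets M" using x by measurable
  have lt: "M.prob (?E y) < 1 / 3" if "y \<in> space (past_space \<pi>)" "y \<notin> bad n" for y
  proof -
    have "emeasure M (?E y) < ennreal (1 / 3)"
      using that divide_ennreal[of 1 3] by (auto simp: bad_def not_le)
    then show ?thesis
      unfolding M.emeasure_eq_measure by (subst (asm) ennreal_less_iff) auto
  qed
  have "M.prob (?E x \<union> ?E x') \<le> M.prob (?E x) + M.prob (?E x')"
    by (rule measure_Un_le) measurable
  then have "1 / 3 \<le> M.prob (space M - (?E x \<union> ?E x'))"
    using lt[OF x(1) nb(1)] lt[OF x(2) nb(2)] by (subst M.prob_compl) auto
  then have "ennreal (?\<epsilon>\<^sup>2 * (1 / 3)) \<le> ennreal (?\<epsilon>\<^sup>2 * M.prob (space M - (?E x \<union> ?E x')))"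
    by (intro ennreal_leI mult_left_mono) auto
  also have "\<dots> = ennreal (?\<epsilon>\<^sup>2) * emeasure M (space M - (?E x \<union> ?E x'))"
    unfolding M.emeasure_eq_measure by (rule ennreal_mult) auto
  also have "\<dots> = (\<integral>\<^sup>+ \<omega>. ennreal (?\<epsilon>\<^sup>2) * indicator (space M - (?E x \<union> ?E x')) \<omega> \<partial>M)"
    by (subst nn_integral_cmult) auto
  also have "\<dots> \<le> (\<integral>\<^sup>+ \<omega>. ennreal (B T x \<omega>) * ennreal (B T x' \<omega>) \<partial>M)"
  proof (rule nn_integral_mono)
    fix \<omega> assume \<omega>: "\<omega> \<in> space M"
    show "ennreal (?\<epsilon>\<^sup>2) * indicator (space M - (?E x \<union> ?E x')) \<omega> \<le> ennreal (B T x \<omega>) * ennreal (B T x' \<omega>)"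
    proof (cases "\<omega> \<in> ?E x \<union> ?E x'")
      case False
      then have "?\<epsilon> \<le> B T x \<omega>" "?\<epsilon> \<le> B T x' \<omega>" using \<omega> by (auto simp: not_less)
      then have "ennreal ?\<epsilon> * ennreal ?\<epsilon> \<le> ennreal (B T x \<omega>) * ennreal (B T x' \<omega>)"
        by (intro mult_mono ennreal_leI) auto
      moreover have "ennreal ?\<epsilon> * ennreal ?\<epsilon> = ennreal (?\<epsilon>\<^sup>2)"
        unfolding power2_eq_square by (rule ennreal_mult[symmetric]) auto
      ultimately show ?thesis using False \<omega> by simp
    qed simp
  qed
  also have "\<dots> \<le> stay T x x'" using x by (rule stay_ge)
  finally show ?thesis by simp
qed

definition stay_forever :: "(nat \<Rightarrow> 'e) \<Rightarrow> (nat \<Rightarrow> 'e) \<Rightarrow> ennreal" where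
  "stay_forever s s' = (\<integral>\<^sup>+ v. indicator {v. \<forall>k. agree s s' v k} v \<partial>noises)"

lemma stay_forever_measurable [measurable (raw)]:
  assumes [measurable]: "s \<in> measurable N (past_space \<pi>)" "s' \<in> measurable N (past_space \<pi>)"
  shows "(\<lambda>x. stay_forever (s x) (s' x)) \<in> borel_measurable N"
  unfolding stay_forever_def by measurable

lemma stay_forever_ge:
  assumes x: "x \<in> space (past_space \<pi>)" "x' \<in> space (past_space \<pi>)" and nb: "x \<notin> bad n" "x' \<notin> bad n"
  shows "ennreal ((1 / (real n + 1))\<^sup>2 / 3) \<le> stay_forever x x'"
proof -
  let ?A = "\<lambda>T. {v \<in> space noises. \<forall>k<T. agree x x' v k}"
  have A [measurable]: "?A T \<in> sets noises" for T using x by measurable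
  have st: "stay T x x' = emeasure noises (?A T)" for T
  proof -
    have "stay T x x' = (\<integral>\<^sup>+ v. indicator (?A T) v \<partial>noises)"
      unfolding stay_def by (intro nn_integral_cong) (simp add: indicator_def)
    also have "\<dots> = emeasure noises (?A T)"
      by (rule nn_integral_indicator[OF A])
    finally show ?thesis .
  qed
  have "(\<lambda>T. emeasure noises (?A T)) \<longlonglongrightarrow> emeasure noises (\<Inter>T. ?A T)"
  proof (rule Lim_emeasure_decseq)
    show "range ?A \<subseteq> sets noises" using A by blast
    show "decseq ?A" by (auto simp: decseq_def)
    show "emeasure noises (?A T) \<noteq> \<infinity>" for T by simp
  qed
  moreover have "emeasure noises (\<Inter>T. ?A T) = stay_forever x x'"
  proof -
    have "?A ` UNIV \<subseteq> sets noises" using A by blast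
    then have "(\<Inter>T. ?A T) \<in> sets noises" by (rule sets.countable_INT) simp
    then have "emeasure noises (\<Inter>T. ?A T) = (\<integral>\<^sup>+ v. indicator (\<Inter>T. ?A T) v \<partial>noises)"
      by (rule nn_integral_indicator[symmetric])
    also have "\<dots> = stay_forever x x'"
    proof -
      have "indicator (\<Inter>T. ?A T) v = (indicator {v. \<forall>k. agree x x' v k} v :: ennreal)" if "v \<in> space noises" for v
      proof -
        have "v \<in> (\<Inter>T. ?A T) \<longleftrightarrow> (\<forall>k. agree x x' v k)" using that by blast
        then show ?thesis by (simp only: indicator_def mem_Collect_eq)
      qed
      then show ?thesis unfolding stay_forever_def by (rule nn_integral_cong)
    qed
    finally show ?thesis .
  qed
  ultimately have "(\<lambda>T. stay T x x') \<longlonglongrightarrow> stay_forever x x'" by (simp add: st)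
  then show ?thesis
    using stay_ge_good[OF assms] by (intro LIMSEQ_le_const) auto
qed

abbreviation trials :: "(((nat \<Rightarrow> 'e) \<times> (nat \<Rightarrow> 'e)) \<times> (nat \<Rightarrow> nat \<Rightarrow> 'e \<times> real)) measure" where
  "trials \<equiv> (mu \<Otimes>\<^sub>M mu) \<Otimes>\<^sub>M noises"

text \<open>The component \<open>fst (fst p)\<close>, integrated outermost in
  \<open>nn_integral_trials\<close>, is the past that \<open>ex_seeds\<close> will freeze; the other
  one keeps the law \<open>mu\<close>.\<close>

abbreviation agree' :: "((nat \<Rightarrow> 'e) \<times> (nat \<Rightarrow> 'e)) \<times> (nat \<Rightarrow> nat \<Rightarrow> 'e \<times> real) \<Rightarrow> nat \<Rightarrow> bool" where
  "agree' p k \<equiv> agree (snd (fst p)) (fst (fst p)) (snd p) k"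

sublocale mm: pair_prob_space mu mu ..

sublocale trials: pair_prob_space "mu \<Otimes>\<^sub>M mu" noises ..

lemma measurable_to_mu: "h \<in> measurable N mu \<Longrightarrow> h \<in> measurable N (past_space \<pi>)"
  by (simp only: measurable_cong_sets[OF refl sets_mu])

lemma trials_fst_measurable [measurable]:
  "(\<lambda>p. fst (fst p)) \<in> measurable trials (past_space \<pi>)" "(\<lambda>p. snd (fst p)) \<in> measurable trials (past_space \<pi>)"
  by (intro measurable_to_mu measurable_fst'' measurable_snd'' measurable_fst measurable_snd)+

lemma nn_integral_trials:
  assumes "H \<in> borel_measurable trials"
  shows "(\<integral>\<^sup>+ p. H p \<partial>trials) = (\<integral>\<^sup>+ x'. \<integral>\<^sup>+ x. \<integral>\<^sup>+ v. H ((x', x), v) \<partial>noises \<partial>mu \<partial>mu)"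
proof -
  note [measurable] = assms
  have "(\<integral>\<^sup>+ p. H p \<partial>trials) = (\<integral>\<^sup>+ q. \<integral>\<^sup>+ v. H (q, v) \<partial>noises \<partial>(mu \<Otimes>\<^sub>M mu))"
    by (rule V.P.nn_integral_fst[symmetric]) measurable
  also have "\<dots> = (\<integral>\<^sup>+ x'. \<integral>\<^sup>+ x. \<integral>\<^sup>+ v. H ((x', x), v) \<partial>noises \<partial>mu \<partial>mu)"
    by (rule mu.nn_integral_fst[symmetric, of "\<lambda>q. \<integral>\<^sup>+ v. H (q, v) \<partial>noises"]) measurable
  finally show ?thesis .
qed

lemma agree_comb_seq: "agree s s' (comb_seq m v v') (m + k) \<longleftrightarrow> agree (run s v m) (run s' v m) v' k"
proof -
  have "comb_seq m v v' (m + k) = v' k" using comb_seq_add[of m v v' k] by (simp add: add.commute)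
  then show ?thesis by (simp add: agree_def run_comb_seq)
qed

lemma agree_comb_seq_less: "k < m \<Longrightarrow> agree s s' (comb_seq m v v') k \<longleftrightarrow> agree s s' v k"
proof -
  assume k: "k < m"
  have "run t (comb_seq m v v') k = run t v k" for t
    using k by (intro run_cong) (simp add: comb_seq_less)
  then show ?thesis using k by (simp add: agree_def comb_seq_less)
qed

text \<open>Whatever happened before time \<open>m\<close>, the states at time \<open>m\<close> have law \<open>mu\<close>, so both are good with
  high probability, and then agreement from time \<open>m\<close> onwards has probability at least \<open>c\<close>.\<close>

lemma emeasure_late_agreement:
  fixes n m j :: nat
  defines "c \<equiv> ennreal ((1 / (real j + 1))\<^sup>2 / 3)"
  shows "c * emeasure trials {p \<in> space trials. \<exists>k. n \<le> k \<and> k < m \<and> \<not> agree' p k}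
    \<le> emeasure trials {p \<in> space trials. (\<forall>k\<ge>m. agree' p k) \<and> (\<exists>k. n \<le> k \<and> k < m \<and> \<not> agree' p k)} + c * (2 * emeasure mu (bad j))"
proof -
  let ?D = "\<lambda>s s' v. \<exists>k. n \<le> k \<and> k < m \<and> \<not> agree s s' v k"
  let ?i = "\<lambda>P. if P then 1 else 0 :: ennreal"
  let ?X = "{p \<in> space trials. \<exists>k. n \<le> k \<and> k < m \<and> \<not> agree' p k}"
  let ?Y = "{p \<in> space trials. (\<forall>k\<ge>m. agree' p k) \<and> (\<exists>k. n \<le> k \<and> k < m \<and> \<not> agree' p k)}"
  let ?s = "\<lambda>p. run (snd (fst p)) (snd p) m" and ?s' = "\<lambda>p. run (fst (fst p)) (snd p) m"
  let ?F = "\<lambda>p. ?i (?D (snd (fst p)) (fst (fst p)) (snd p))"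
  have s [measurable]: "?s \<in> measurable trials (past_space \<pi>)" "?s' \<in> measurable trials (past_space \<pi>)"
    by (rule run_measurable, measurable)+
  have F [measurable]: "?F \<in> borel_measurable trials" by measurable
  have X: "emeasure trials ?X = (\<integral>\<^sup>+ p. ?i (?D (snd (fst p)) (fst (fst p)) (snd p)) \<partial>trials)"
    by (rule emeasure_Collect_if) measurable
  have "emeasure trials ?Y = (\<integral>\<^sup>+ p. ?i ((\<forall>k\<ge>m. agree' p k) \<and> ?D (snd (fst p)) (fst (fst p)) (snd p)) \<partial>trials)"
    by (rule emeasure_Collect_if) measurable
  also have "\<dots> = (\<integral>\<^sup>+ x'. \<integral>\<^sup>+ x. \<integral>\<^sup>+ v. ?i ((\<forall>k\<ge>m. agree x x' v k) \<and> ?D x x' v) \<partial>noises \<partial>mu \<partial>mu)"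
    by (subst nn_integral_trials) simp_all
  \<comment> \<open>The noise is cut at time \<open>m\<close>: disagreement between \<open>n\<close>
    and \<open>m\<close> reads only the first piece, and the second piece is fresh and drives both
    chains on from their states at time \<open>m\<close>.\<close>
  also have "\<dots> = (\<integral>\<^sup>+ x'. \<integral>\<^sup>+ x. \<integral>\<^sup>+ v. ?i (?D x x' v) * stay_forever (run x v m) (run x' v m) \<partial>noises \<partial>mu \<partial>mu)"
  proof (rule nn_integral_cong, rule nn_integral_cong)
    fix x' x assume "x' \<in> space mu" "x \<in> space mu"
    then have x [simp]: "x \<in> space (past_space \<pi>)" "x' \<in> space (past_space \<pi>)" by simp_all
    have "(\<integral>\<^sup>+ v. ?i ((\<forall>k\<ge>m. agree x x' v k) \<and> ?D x x' v) \<partial>noises)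
        = (\<integral>\<^sup>+ v. \<integral>\<^sup>+ v'. ?i ((\<forall>k\<ge>m. agree x x' (comb_seq m v v') k) \<and> ?D x x' (comb_seq m v v')) \<partial>noises \<partial>noises)"
      by (rule nn_integral_noises_comb) measurable
    also have "\<dots> = (\<integral>\<^sup>+ v. ?i (?D x x' v) * stay_forever (run x v m) (run x' v m) \<partial>noises)"
    proof (rule nn_integral_cong)
      fix v assume v [simp]: "v \<in> space noises"
      have "(\<forall>k\<ge>m. agree x x' (comb_seq m v v') k) \<longleftrightarrow> (\<forall>k. agree (run x v m) (run x' v m) v' k)" for v'
        unfolding agree_comb_seq[symmetric] by (metis le_Suc_ex le_add1)
      note eq1 = this
      have eq2: "?D x x' (comb_seq m v v') \<longleftrightarrow> ?D x x' v" for v'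
        using agree_comb_seq_less by blast
      have "(\<integral>\<^sup>+ v'. ?i ((\<forall>k\<ge>m. agree x x' (comb_seq m v v') k) \<and> ?D x x' (comb_seq m v v')) \<partial>noises)
         = (\<integral>\<^sup>+ v'. ?i (?D x x' v) * indicator {v'. \<forall>k. agree (run x v m) (run x' v m) v' k} v' \<partial>noises)"
        unfolding eq1 eq2 indicator_def of_bool_def mem_Collect_eq by (simp only: if_conj_mult)
      also have "\<dots> = ?i (?D x x' v) * stay_forever (run x v m) (run x' v m)"
        unfolding stay_forever_def by (rule nn_integral_cmult) measurable
      finally show "(\<integral>\<^sup>+ v'. ?i ((\<forall>k\<ge>m. agree x x' (comb_seq m v v') k) \<and> ?D x x' (comb_seq m v v')) \<partial>noises)
        = ?i (?D x x' v) * stay_forever (run x v m) (run x' v m)" .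
    qed
    finally show "(\<integral>\<^sup>+ v. ?i ((\<forall>k\<ge>m. agree x x' v k) \<and> ?D x x' v) \<partial>noises) = (\<integral>\<^sup>+ v. ?i (?D x x' v) * stay_forever (run x v m) (run x' v m) \<partial>noises)" .
  qed
  also have "\<dots> = (\<integral>\<^sup>+ p. ?F p * stay_forever (?s p) (?s' p) \<partial>trials)"
    by (subst nn_integral_trials) simp_all
  finally have Y: "emeasure trials ?Y = (\<integral>\<^sup>+ p. ?F p * stay_forever (?s p) (?s' p) \<partial>trials)" .
  have b: "(\<integral>\<^sup>+ x. \<integral>\<^sup>+ v. indicator (bad j) (run x v m) \<partial>noises \<partial>mu) = emeasure mu (bad j)"
    by (subst nn_integral_run) auto
  have b1: "(\<integral>\<^sup>+ p. indicator (bad j) (?s p) \<partial>trials) = emeasure mu (bad j)"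
    by (subst nn_integral_trials) (simp_all add: b)
  have b2: "(\<integral>\<^sup>+ p. indicator (bad j) (?s' p) \<partial>trials) = emeasure mu (bad j)"
    by (subst nn_integral_trials) (simp_all add: b)
  have "c * emeasure trials ?X = (\<integral>\<^sup>+ p. c * ?F p \<partial>trials)"
    unfolding X by (rule nn_integral_cmult[symmetric]) measurable
  \<comment> \<open>On bad states the constant \<open>c\<close> is charged to the error, on the
    others \<open>stay_forever_ge\<close> provides it. Both error terms have mass
    \<open>emeasure mu (bad j)\<close> because \<open>mu\<close> is invariant under
    \<open>run\<close>.\<close>
  also have "\<dots> \<le> (\<integral>\<^sup>+ p. ?F p * stay_forever (?s p) (?s' p) + (c * indicator (bad j) (?s p) + c * indicator (bad j) (?s' p)) \<partial>trials)"
  proof (rule nn_integral_mono)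
    fix p assume "p \<in> space trials"
    then have sp: "?s p \<in> space (past_space \<pi>)" "?s' p \<in> space (past_space \<pi>)"
      by (rule measurable_space[OF s(1)], rule measurable_space[OF s(2)])
    show "c * ?F p \<le> ?F p * stay_forever (?s p) (?s' p) + (c * indicator (bad j) (?s p) + c * indicator (bad j) (?s' p))"
    proof (cases "?s p \<in> bad j \<or> ?s' p \<in> bad j")
      case True
      have "c * ?F p \<le> c * 1" by (intro mult_left_mono) simp_all
      also have "\<dots> \<le> c * indicator (bad j) (?s p) + c * indicator (bad j) (?s' p)"
        using True by (auto simp: indicator_def)
      finally show ?thesis by (rule order_trans) simp
    next
      case False
      then have "c \<le> stay_forever (?s p) (?s' p)" unfolding c_def using sp by (intro stay_forever_ge) simp_all
      then have "?F p * c \<le> ?F p * stay_forever (?s p) (?s' p)" by (rule mult_left_mono) simp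
      then show ?thesis unfolding mult.commute[of c "?F p"] by (rule add_increasing2[rotated]) simp
    qed
  qed
  also have "\<dots> = emeasure trials ?Y + (\<integral>\<^sup>+ p. c * indicator (bad j) (?s p) + c * indicator (bad j) (?s' p) \<partial>trials)"
    unfolding Y by (rule nn_integral_add) measurable
  also have "(\<integral>\<^sup>+ p. c * indicator (bad j) (?s p) + c * indicator (bad j) (?s' p) \<partial>trials)
      = (\<integral>\<^sup>+ p. c * indicator (bad j) (?s p) \<partial>trials) + (\<integral>\<^sup>+ p. c * indicator (bad j) (?s' p) \<partial>trials)"
    by (rule nn_integral_add) measurable
  also have "(\<integral>\<^sup>+ p. c * indicator (bad j) (?s p) \<partial>trials) = c * emeasure mu (bad j)"
    unfolding b1[symmetric] by (rule nn_integral_cmult) measurable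
  also have "(\<integral>\<^sup>+ p. c * indicator (bad j) (?s' p) \<partial>trials) = c * emeasure mu (bad j)"
    unfolding b2[symmetric] by (rule nn_integral_cmult) measurable
  finally show ?thesis by (simp only: mult_2 distrib_left)
qed

text \<open>Let \<open>m\<close>, then \<open>n\<close> and finally \<open>j\<close> tend to infinity in the preceding lemma.\<close>

lemma disagreement_tendsto:
  "(\<lambda>k. trials.prob {p \<in> space trials. \<not> agree' p k}) \<longlonglongrightarrow> 0"
proof -
  define A where "A n = {p \<in> space trials. \<forall>k\<ge>n. agree' p k}" for n
  define A' where "A' = (\<Union>n. A n)"
  have A_sets [measurable]: "A n \<in> sets trials" for n
    unfolding A_def by measurable
  have [measurable]: "A' \<in> sets trials"
    unfolding A'_def by measurable
  have inc: "incseq A" by (auto simp: incseq_def A_def)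
  have limA: "(\<lambda>n. trials.prob (A n)) \<longlonglongrightarrow> trials.prob A'"
    unfolding A'_def
  proof (rule trials.finite_Lim_measure_incseq[OF _ inc])
    show "range A \<subseteq> sets trials" using A_sets by blast
  qed
  \<comment> \<open>For fixed \<open>j\<close> the probability between \<open>A n\<close> and
    \<open>A'\<close> vanishes as \<open>n\<close> grows, and the positive constant
    \<open>?c\<close> can then be divided out; only the mass of the bad pasts is left, in a bound
    free of \<open>?c\<close>.\<close>
  have key: "1 - trials.prob A' \<le> 2 * mu.prob (bad j)" for j
  proof -
    let ?c = "(1 / (real j + 1))\<^sup>2 / 3"
    have c: "0 < ?c" by simp
    have "?c * (1 - trials.prob (A n)) \<le> (trials.prob A' - trials.prob (A n)) + ?c * (2 * mu.prob (bad j))" for n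
    proof -
      let ?X = "\<lambda>m. {p \<in> space trials. \<exists>k. n \<le> k \<and> k < m \<and> \<not> agree' p k}"
      let ?Y = "\<lambda>m. {p \<in> space trials. (\<forall>k\<ge>m. agree' p k) \<and> (\<exists>k. n \<le> k \<and> k < m \<and> \<not> agree' p k)}"
      have XY [measurable]: "?X m \<in> sets trials" "?Y m \<in> sets trials" for m by measurable
      have 1: "?c * trials.prob (?X m) \<le> trials.prob (?Y m) + ?c * (2 * mu.prob (bad j))" for m
        by (rule real_le_if_ennreal_le[OF less_imp_le[OF c] measure_nonneg measure_nonneg measure_nonneg
            emeasure_late_agreement[of j n m, unfolded trials.emeasure_eq_measure mu.emeasure_eq_measure]])
      \<comment> \<open>Trials that disagree after \<open>n\<close> but agree from \<open>m\<close>
        on agree eventually without belonging to \<open>A n\<close>; for large \<open>n\<close> few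
        such trials are left, whatever \<open>m\<close> is.\<close>
      have 2: "trials.prob (?Y m) \<le> trials.prob A' - trials.prob (A n)" for m
      proof -
        have "?Y m \<subseteq> A' - A n" unfolding A_def A'_def by blast
        then have "trials.prob (?Y m) \<le> trials.prob (A' - A n)"
          by (rule trials.finite_measure_mono) measurable
        also have "\<dots> = trials.prob A' - trials.prob (A n)"
          by (rule trials.finite_measure_Diff) (measurable, auto simp: A'_def)
        finally show ?thesis .
      qed
      have "?c * trials.prob (?X m) \<le> (trials.prob A' - trials.prob (A n)) + ?c * (2 * mu.prob (bad j))" for m
        using 1[of m] 2[of m] by linarith
      moreover have "(\<lambda>m. trials.prob (?X m)) \<longlonglongrightarrow> trials.prob (\<Union>m. ?X m)"
      proof (rule trials.finite_Lim_measure_incseq)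
        show "range ?X \<subseteq> sets trials" using XY(1) by blast
        show "incseq ?X" unfolding incseq_def by (blast intro: less_le_trans)
      qed
      moreover have "(\<Union>m. ?X m) = space trials - A n" unfolding A_def by blast
      moreover have "trials.prob (space trials - A n) = 1 - trials.prob (A n)"
        by (rule trials.prob_compl) measurable
      ultimately show ?thesis
        by (intro LIMSEQ_le_const2[of "\<lambda>m. ?c * trials.prob (?X m)"] tendsto_mult_left) auto
    qed
    moreover have "(\<lambda>n. ?c * (1 - trials.prob (A n))) \<longlonglongrightarrow> ?c * (1 - trials.prob A')"
      by (intro tendsto_intros limA)
    moreover have "(\<lambda>n. (trials.prob A' - trials.prob (A n)) + ?c * (2 * mu.prob (bad j)))
        \<longlonglongrightarrow> (trials.prob A' - trials.prob A') + ?c * (2 * mu.prob (bad j))"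
      by (intro tendsto_intros limA)
    ultimately have "?c * (1 - trials.prob A') \<le> (trials.prob A' - trials.prob A') + ?c * (2 * mu.prob (bad j))"
      by (intro LIMSEQ_le) auto
    then have "?c * (1 - trials.prob A') \<le> ?c * (2 * mu.prob (bad j))" by simp
    then show ?thesis using c by (rule mult_left_le_imp_le)
  qed
  have "(\<lambda>j. mu.prob (bad j)) \<longlonglongrightarrow> 0"
    using bad_tendsto unfolding mu.emeasure_eq_measure by (subst (asm) tendsto_ennreal_iff[of _ _ 0, simplified]) auto
  then have "(\<lambda>j. 2 * mu.prob (bad j)) \<longlonglongrightarrow> 2 * 0" by (intro tendsto_intros)
  then have "1 - trials.prob A' \<le> 2 * 0"
    by (rule LIMSEQ_le_const) (use key in blast)
  then have "trials.prob A' = 1" using trials.prob_le_1[of A'] by simp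
  with limA have "(\<lambda>n. 1 - trials.prob (A n)) \<longlonglongrightarrow> 1 - 1" by (intro tendsto_intros) simp
  then have lim: "(\<lambda>n. 1 - trials.prob (A n)) \<longlonglongrightarrow> 0" by simp
  have le: "trials.prob {p \<in> space trials. \<not> agree' p k} \<le> 1 - trials.prob (A k)" for k
  proof -
    have "{p \<in> space trials. \<not> agree' p k} \<subseteq> space trials - A k" unfolding A_def by blast
    then have "trials.prob {p \<in> space trials. \<not> agree' p k} \<le> trials.prob (space trials - A k)"
      by (rule trials.finite_measure_mono) measurable
    then show ?thesis by (simp only: trials.prob_compl[OF A_sets])
  qed
  show ?thesis
    by (rule tendsto_sandwich[OF _ _ tendsto_const lim]) (simp_all only: le measure_nonneg eventually_sequentially, blast+)
qed

text \<open>The disagreement probability at time \<open>k\<close> is an average over the starting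
  past of one chain, so some past does no worse than the average plus 1 / (k + 1). The seed may
  depend on \<open>k\<close> because a separate chain is started for each \<open>k\<close>.\<close>

lemma ex_seeds:
  "\<exists>x. (\<forall>k. x k \<in> space (past_space \<pi>)) \<and>
    (\<lambda>k. \<integral>\<^sup>+ s. \<integral>\<^sup>+ v. (if agree s (x k) v k then 0 else 1) \<partial>noises \<partial>mu) \<longlonglongrightarrow> 0"
proof -
  let ?I = "\<lambda>x k. \<integral>\<^sup>+ s. \<integral>\<^sup>+ v. (if agree s x v k then 0 else 1 :: ennreal) \<partial>noises \<partial>mu"
  let ?p = "\<lambda>k. trials.prob {p \<in> space trials. \<not> agree' p k}"
  have avg: "(\<integral>\<^sup>+ x. ?I x k \<partial>mu) = ennreal (?p k)" for k
  proof -
    have "ennreal (?p k) = (\<integral>\<^sup>+ p. (if \<not> agree' p k then 1 else 0) \<partial>trials)"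
      unfolding trials.emeasure_eq_measure[symmetric] by (rule emeasure_Collect_if) measurable
    also have "\<dots> = (\<integral>\<^sup>+ p. (if agree' p k then 0 else 1) \<partial>trials)"
      by (intro nn_integral_cong) simp
    also have "\<dots> = (\<integral>\<^sup>+ x. ?I x k \<partial>mu)"
      by (subst nn_integral_trials) simp_all
    finally show ?thesis by simp
  qed
  define I where "I x k = ?I x k" for x k
  define q where "q k = ?p k" for k
  have q: "0 \<le> q k" "(\<integral>\<^sup>+ x. I x k \<partial>mu) \<le> ennreal (q k)" "q \<longlonglongrightarrow> 0" for k
    unfolding q_def I_def by (rule measure_nonneg, rule eq_refl[OF avg], rule disagreement_tendsto)
  have "\<exists>x\<in>space mu. I x k \<le> ennreal (q k + 1 / (real k + 1))" for k
    by (rule mu.ex_le_nn_integral[OF q(2,1)]) simp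
  then have "\<forall>k. \<exists>x. x \<in> space (past_space \<pi>) \<and> I x k \<le> ennreal (q k + 1 / (real k + 1))"
    unfolding space_mu by blast
  from choice[OF this] obtain x where x: "\<And>k. x k \<in> space (past_space \<pi>)"
      "\<And>k. I (x k) k \<le> ennreal (q k + 1 / (real k + 1))"
    by blast
  have "(\<lambda>k. q k + 1 / (real k + 1)) \<longlonglongrightarrow> 0 + 0"
    using LIMSEQ_inverse_real_of_nat
    by (intro tendsto_add q) (simp add: inverse_eq_divide add.commute)
  then have "(\<lambda>k. ennreal (q k + 1 / (real k + 1))) \<longlonglongrightarrow> ennreal 0"
    by (intro tendsto_ennrealI) simp
  then have lim: "(\<lambda>k. ennreal (q k + 1 / (real k + 1))) \<longlonglongrightarrow> 0" by (simp only: ennreal_0)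
  have "(\<lambda>k. I (x k) k) \<longlonglongrightarrow> 0"
    by (rule tendsto_sandwich[OF _ _ tendsto_const lim]) (use x(2) in \<open>simp_all only: zero_le eventually_True\<close>)
  then have "(\<forall>k. x k \<in> space (past_space \<pi>)) \<and> (\<lambda>k. I (x k) k) \<longlonglongrightarrow> 0"
    using x(1) by simp
  then show ?thesis unfolding I_def by (rule exI[of _ x])
qed

end

section \<open>The conditional law of the noise\<close>

lemma emeasure_kernel_measurable:
  assumes "\<kappa> \<in> measurable M (prob_algebra S)" "A \<in> sets S"
  shows "(\<lambda>\<omega>. emeasure (\<kappa> \<omega>) A) \<in> borel_measurable M"
  using measurable_compose[OF measurable_prob_algebraD[OF assms(1)] measurable_emeasure_subprob_algebra[OF assms(2)]] .

lemma kernel_space: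
  assumes "\<kappa> \<in> measurable M (prob_algebra S)" "\<omega> \<in> space M"
  shows "prob_space (\<kappa> \<omega>)" "sets (\<kappa> \<omega>) = sets S" "space (\<kappa> \<omega>) = space S"
  using measurable_space[OF assms] by (auto simp: space_prob_algebra dest: sets_eq_imp_space_eq)

lemma emeasure_PiM_kernel:
  assumes \<kappa>: "\<And>i. \<kappa> i \<in> measurable M (prob_algebra (S i))" and \<omega>: "\<omega> \<in> space M"
    and J: "finite J" "\<And>i. i \<in> J \<Longrightarrow> A i \<in> sets (S i)"
  shows "emeasure (Pi\<^sub>M UNIV (\<lambda>i. \<kappa> i \<omega>)) (prod_emb UNIV S J (Pi\<^sub>E J A)) = (\<Prod>i\<in>J. emeasure (\<kappa> i \<omega>) (A i))"
proof -
  note ks = kernel_space[OF \<kappa> \<omega>]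
  have "prod_emb UNIV S J (Pi\<^sub>E J A) = prod_emb UNIV (\<lambda>i. \<kappa> i \<omega>) J (Pi\<^sub>E J A)"
    by (simp add: prod_emb_def ks)
  then show ?thesis
    using J by (simp add: emeasure_PiM_emb ks)
qed

text \<open>Cylinders generate the product and are stable under intersection; on them the kernel is
  a finite product of measurable functions. This allows all noises to be drawn at once,
  independently given the trajectory.\<close>

lemma measurable_PiM_kernel:
  assumes \<kappa>: "\<And>i. \<kappa> i \<in> measurable M (prob_algebra (S i))"
  shows "(\<lambda>\<omega>. Pi\<^sub>M UNIV (\<lambda>i. \<kappa> i \<omega>)) \<in> measurable M (prob_algebra (Pi\<^sub>M UNIV S))"
proof (rule measurable_prob_algebra_generated[OF sets_PiM Int_stable_prod_algebra prod_algebra_sets_into_space])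
  fix \<omega> assume \<omega>: "\<omega> \<in> space M"
  show "prob_space (Pi\<^sub>M UNIV (\<lambda>i. \<kappa> i \<omega>))"
    by (intro prob_space_PiM kernel_space[OF \<kappa> \<omega>])
  show "sets (Pi\<^sub>M UNIV (\<lambda>i. \<kappa> i \<omega>)) = sets (Pi\<^sub>M UNIV S)"
    by (intro sets_PiM_cong refl kernel_space[OF \<kappa> \<omega>])
next
  fix A assume "A \<in> prod_algebra UNIV S"
  then obtain J E where A: "A = prod_emb UNIV S J (Pi\<^sub>E J E)" "finite J" "\<And>i. i \<in> J \<Longrightarrow> E i \<in> sets (S i)"
    by (auto elim!: prod_algebraE)
  have "(\<lambda>\<omega>. \<Prod>i\<in>J. emeasure (\<kappa> i \<omega>) (E i)) \<in> borel_measurable M"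
    by (intro borel_measurable_prod_ennreal emeasure_kernel_measurable[OF \<kappa>] A(3))
  then show "(\<lambda>\<omega>. emeasure (Pi\<^sub>M UNIV (\<lambda>i. \<kappa> i \<omega>)) A) \<in> borel_measurable M"
    by (rule measurable_cong[THEN iffD1, rotated]) (simp only: A emeasure_PiM_kernel[OF \<kappa>])
qed

text \<open>The law of a pair whose first component follows \<open>M\<close> and whose second is
  drawn from the kernel at the first, written in the Giry monad.\<close>

definition semidirect :: "'a measure \<Rightarrow> 'b measure \<Rightarrow> ('a \<Rightarrow> 'b measure) \<Rightarrow> ('a \<times> 'b) measure" where
  "semidirect M S \<kappa> = M \<bind> (\<lambda>\<omega>. distr (\<kappa> \<omega>) (M \<Otimes>\<^sub>M S) (Pair \<omega>))"

context
  fixes M :: "'a measure" and S :: "'b measure" and \<kappa> :: "'a \<Rightarrow> 'b measure"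
  assumes M: "prob_space M" and \<kappa>: "\<kappa> \<in> measurable M (prob_algebra S)"
begin

lemma semidirect_kernel: "(\<lambda>\<omega>. distr (\<kappa> \<omega>) (M \<Otimes>\<^sub>M S) (Pair \<omega>)) \<in> measurable M (prob_algebra (M \<Otimes>\<^sub>M S))"
proof (rule measurable_prob_algebraI)
  show "(\<lambda>\<omega>. distr (\<kappa> \<omega>) (M \<Otimes>\<^sub>M S) (Pair \<omega>)) \<in> measurable M (subprob_algebra (M \<Otimes>\<^sub>M S))"
    by (rule measurable_distr2[OF _ measurable_prob_algebraD[OF \<kappa>]]) simp
  fix \<omega> assume \<omega>: "\<omega> \<in> space M"
  have "Pair \<omega> \<in> measurable (\<kappa> \<omega>) (M \<Otimes>\<^sub>M S)"
    unfolding measurable_cong_sets[OF kernel_space(2)[OF \<kappa> \<omega>] refl] using \<omega> by (rule measurable_Pair1')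
  then show "prob_space (distr (\<kappa> \<omega>) (M \<Otimes>\<^sub>M S) (Pair \<omega>))"
    by (rule prob_space.prob_space_distr[OF kernel_space(1)[OF \<kappa> \<omega>]])
qed

lemma M_in_prob_algebra: "M \<in> space (prob_algebra M)"
  using M by (simp add: space_prob_algebra)

lemma prob_space_semidirect: "prob_space (semidirect M S \<kappa>)"
  unfolding semidirect_def by (rule prob_space_bind'[OF M_in_prob_algebra semidirect_kernel])

lemma sets_semidirect: "sets (semidirect M S \<kappa>) = sets (M \<Otimes>\<^sub>M S)"
  unfolding semidirect_def by (rule sets_bind'[OF M_in_prob_algebra semidirect_kernel])

lemma nn_integral_semidirect:
  assumes H: "H \<in> borel_measurable (M \<Otimes>\<^sub>M S)"
  shows "(\<integral>\<^sup>+ p. H p \<partial>semidirect M S \<kappa>) = (\<integral>\<^sup>+ \<omega>. \<integral>\<^sup>+ u. H (\<omega>, u) \<partial>\<kappa> \<omega> \<partial>M)"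
proof -
  have "(\<integral>\<^sup>+ p. H p \<partial>semidirect M S \<kappa>) = (\<integral>\<^sup>+ \<omega>. \<integral>\<^sup>+ p. H p \<partial>distr (\<kappa> \<omega>) (M \<Otimes>\<^sub>M S) (Pair \<omega>) \<partial>M)"
    unfolding semidirect_def by (rule nn_integral_bind[OF H measurable_prob_algebraD[OF semidirect_kernel]])
  also have "\<dots> = (\<integral>\<^sup>+ \<omega>. \<integral>\<^sup>+ u. H (\<omega>, u) \<partial>\<kappa> \<omega> \<partial>M)"
  proof (rule nn_integral_cong)
    fix \<omega> assume \<omega>: "\<omega> \<in> space M"
    have "Pair \<omega> \<in> measurable (\<kappa> \<omega>) (M \<Otimes>\<^sub>M S)"
      unfolding measurable_cong_sets[OF kernel_space(2)[OF \<kappa> \<omega>] refl] using \<omega> by (rule measurable_Pair1')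
    then show "(\<integral>\<^sup>+ p. H p \<partial>distr (\<kappa> \<omega>) (M \<Otimes>\<^sub>M S) (Pair \<omega>)) = (\<integral>\<^sup>+ u. H (\<omega>, u) \<partial>\<kappa> \<omega>)"
      using H by (simp add: nn_integral_distr)
  qed
  finally show ?thesis .
qed

end

section \<open>Disintegration of the noise along the chosen letter\<close>

context chain
begin

text \<open>Only the letter of the mark is exchanged. Its height stays: it is independent of the
  letter and takes part in the acceptance test.\<close>

definition mk :: "nat \<Rightarrow> 'e \<Rightarrow> (nat \<Rightarrow> 'e \<times> real) \<Rightarrow> nat \<Rightarrow> 'e \<times> real" where
  "mk j b u = u(j := (b, snd (u j)))"

lemma mk_measurable [measurable (raw)]:
  assumes b: "b \<in> measurable N \<pi>" and u: "u \<in> measurable N (noise \<pi>)"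
  shows "(\<lambda>x. mk j (b x) (u x)) \<in> measurable N (noise \<pi>)"
proof (rule measurable_PiM_UNIV)
  fix i
  have ui: "(\<lambda>x. u x k) \<in> measurable N (mark \<pi>)" for k
    by (rule measurable_compose[OF u measurable_component_singleton]) simp
  have "(\<lambda>x. (b x, snd (u x j))) \<in> measurable N (mark \<pi>)"
    unfolding measurable_cong_sets[OF refl sets_mark]
    by (rule measurable_Pair[OF b measurable_snd'[OF ui[unfolded measurable_cong_sets[OF refl sets_mark]]]])
  then show "(\<lambda>x. mk j (b x) (u x) i) \<in> measurable N (mark \<pi>)"
    using ui by (cases "i = j") (simp_all add: mk_def)
qed

lemma nn_integral_mark:
  assumes "G \<in> borel_measurable (mark \<pi>)"
  shows "(\<integral>\<^sup>+ z. G z \<partial>mark \<pi>) = (\<integral>\<^sup>+ t. \<integral>\<^sup>+ a. G (a, t) \<partial>\<pi> \<partial>uniform_measure lborel {0..4})"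
  using assms unfolding mark_def by (subst marks.nn_integral_snd) simp_all

text \<open>Letter and height of a mark are independent, so redrawing the letter alone preserves the
  law of the noise. The mark is resampled as a whole, after which its previous letter no longer
  occurs in the integrand.\<close>

lemma nn_integral_mk:
  assumes H [measurable]: "H \<in> borel_measurable (noise \<pi>)"
  shows "(\<integral>\<^sup>+ u. H u \<partial>noise \<pi>) = (\<integral>\<^sup>+ b. \<integral>\<^sup>+ u. H (mk j b u) \<partial>noise \<pi> \<partial>\<pi>)"
proof -
  interpret P: pair_sigma_finite \<pi> "noise \<pi>" ..
  have [measurable]: "(\<lambda>p. H (mk j (fst p) (snd p))) \<in> borel_measurable (\<pi> \<Otimes>\<^sub>M noise \<pi>)"
    by measurable
  have G [measurable]: "(\<lambda>u. \<integral>\<^sup>+ b. H (mk j b u) \<partial>\<pi>) \<in> borel_measurable (noise \<pi>)"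
    by measurable
  have upd: "(\<lambda>z. u(j := z)) \<in> measurable (mark \<pi>) (noise \<pi>)" if "u \<in> space (noise \<pi>)" for u
  proof (rule measurable_PiM_UNIV)
    fix i
    have "u i \<in> space (mark \<pi>)" using that by (auto simp: space_PiM)
    then show "(\<lambda>z. (u(j := z)) i) \<in> measurable (mark \<pi>) (mark \<pi>)" by (cases "i = j") simp_all
  qed
  have "(\<integral>\<^sup>+ b. \<integral>\<^sup>+ u. H (mk j b u) \<partial>noise \<pi> \<partial>\<pi>) = (\<integral>\<^sup>+ u. \<integral>\<^sup>+ b. H (mk j b u) \<partial>\<pi> \<partial>noise \<pi>)"
    using P.Fubini[of "\<lambda>p. H (mk j (fst p) (snd p))"] by simp
  also have "\<dots> = (\<integral>\<^sup>+ u. \<integral>\<^sup>+ z. \<integral>\<^sup>+ b. H (mk j b (u(j := z))) \<partial>\<pi> \<partial>mark \<pi> \<partial>noise \<pi>)"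
    by (rule noise.nn_integral_resample[OF G])
  also have "\<dots> = (\<integral>\<^sup>+ u. \<integral>\<^sup>+ z. H (u(j := z)) \<partial>mark \<pi> \<partial>noise \<pi>)"
  proof (rule nn_integral_cong)
    fix u assume u: "u \<in> space (noise \<pi>)"
    have "(\<integral>\<^sup>+ z. \<integral>\<^sup>+ b. H (mk j b (u(j := z))) \<partial>\<pi> \<partial>mark \<pi>)
        = (\<integral>\<^sup>+ t. \<integral>\<^sup>+ a. \<integral>\<^sup>+ b. H (mk j b (u(j := (a, t)))) \<partial>\<pi> \<partial>\<pi> \<partial>uniform_measure lborel {0..4})"
      by (rule nn_integral_mark) (rule measurable_compose[OF upd[OF u] G])
    also have "\<dots> = (\<integral>\<^sup>+ t. \<integral>\<^sup>+ b. H (u(j := (b, t))) \<partial>\<pi> \<partial>uniform_measure lborel {0..4})"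
      by (simp add: mk_def emeasure_space_1)
    also have "\<dots> = (\<integral>\<^sup>+ z. H (u(j := z)) \<partial>mark \<pi>)"
      by (rule nn_integral_mark[symmetric]) (rule measurable_compose[OF upd[OF u] H])
    finally show "(\<integral>\<^sup>+ z. \<integral>\<^sup>+ b. H (mk j b (u(j := z))) \<partial>\<pi> \<partial>mark \<pi>) = (\<integral>\<^sup>+ z. H (u(j := z)) \<partial>mark \<pi>)" .
  qed
  also have "\<dots> = (\<integral>\<^sup>+ u. H u \<partial>noise \<pi>)"
    by (rule noise.nn_integral_resample[symmetric]) measurable
  finally show ?thesis by simp
qed

text \<open>For fixed \<open>H\<close>, the density with respect to \<pi> of the measure that
  weights a set of letters by the integral of \<open>H\<close> over the noises choosing from it: an
  unnormalised conditional expectation. The sum over positions makes it explicit, so no regularity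
  of the state space enters.\<close>

definition part :: "(nat \<Rightarrow> 'e) \<Rightarrow> 'e \<Rightarrow> ((nat \<Rightarrow> 'e \<times> real) \<Rightarrow> ennreal) \<Rightarrow> ennreal" where
  "part s b H = (\<Sum>j. \<integral>\<^sup>+ u. (if sel (f s) (mk j b u) = j then H (mk j b u) else 0) \<partial>noise \<pi>)"

lemma part_measurable:
  assumes [measurable]: "(\<lambda>(x, u). H x u) \<in> borel_measurable (N \<Otimes>\<^sub>M noise \<pi>)"
    "s \<in> measurable N (past_space \<pi>)" "b \<in> measurable N \<pi>"
  shows "(\<lambda>x. part (s x) (b x) (H x)) \<in> borel_measurable N"
proof -
  have "(\<lambda>p. (fst p, mk j (b (fst p)) (snd p))) \<in> measurable (N \<Otimes>\<^sub>M noise \<pi>) (N \<Otimes>\<^sub>M noise \<pi>)" for j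
    by measurable
  from measurable_compose[OF this assms(1)]
  have [measurable]: "(\<lambda>p. H (fst p) (mk j (b (fst p)) (snd p))) \<in> borel_measurable (N \<Otimes>\<^sub>M noise \<pi>)" for j
    by simp
  have [measurable]: "Measurable.pred (N \<Otimes>\<^sub>M noise \<pi>) (\<lambda>p. sel (f (s (fst p))) (mk j (b (fst p)) (snd p)) = j)" for j
    by measurable
  have "(\<lambda>p. if sel (f (s (fst p))) (mk j (b (fst p)) (snd p)) = j then H (fst p) (mk j (b (fst p)) (snd p)) else 0)
      \<in> borel_measurable (N \<Otimes>\<^sub>M noise \<pi>)" for j by measurable
  then have "(\<lambda>x. \<integral>\<^sup>+ u. (if sel (f (s x)) (mk j (b x) u) = j then H x (mk j (b x) u) else 0) \<partial>noise \<pi>)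
      \<in> borel_measurable N" for j
    by (intro noise.P.borel_measurable_nn_integral) (simp add: split_beta')
  then show ?thesis unfolding part_def by (rule borel_measurable_suminf_order)
qed

text \<open>\<open>sel (f s)\<close> takes the value \<open>j\<close> on a set of noises, on which the letter is the one of the
  \<open>j\<close>-th mark; this letter is resampled.\<close>

lemma nn_integral_part:
  assumes s: "s \<in> space (past_space \<pi>)" and [measurable]: "H \<in> borel_measurable (\<pi> \<Otimes>\<^sub>M noise \<pi>)"
  shows "(\<integral>\<^sup>+ u. H (letter (f s) u, u) \<partial>noise \<pi>) = (\<integral>\<^sup>+ b. part s b (\<lambda>u. H (b, u)) \<partial>\<pi>)"
proof -
  note [measurable] = f_measurable1[OF s]
  have m [measurable]: "(\<lambda>u. H (letter (f s) u, u)) \<in> borel_measurable (noise \<pi>)" by measurable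
  have sel [measurable]: "Measurable.pred (noise \<pi>) (\<lambda>u. sel (f s) u = j)" for j by measurable
  have "(\<integral>\<^sup>+ u. H (letter (f s) u, u) \<partial>noise \<pi>)
      = (\<integral>\<^sup>+ u. (\<Sum>j. if sel (f s) u = j then H (letter (f s) u, u) else 0) \<partial>noise \<pi>)"
  proof (rule nn_integral_cong)
    fix u
    show "H (letter (f s) u, u) = (\<Sum>j. if sel (f s) u = j then H (letter (f s) u, u) else 0)"
      by (subst suminf_finite[of "{sel (f s) u}"]) auto
  qed
  also have "\<dots> = (\<Sum>j. \<integral>\<^sup>+ u. (if sel (f s) u = j then H (letter (f s) u, u) else 0) \<partial>noise \<pi>)"
    by (rule nn_integral_suminf) measurable
  also have "\<dots> = (\<Sum>j. \<integral>\<^sup>+ b. \<integral>\<^sup>+ u. (if sel (f s) (mk j b u) = j then H (b, mk j b u) else 0) \<partial>noise \<pi> \<partial>\<pi>)"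
  proof (rule suminf_cong)
    fix j
    have "(\<integral>\<^sup>+ u. (if sel (f s) u = j then H (letter (f s) u, u) else 0) \<partial>noise \<pi>)
      = (\<integral>\<^sup>+ b. \<integral>\<^sup>+ u. (if sel (f s) (mk j b u) = j then H (letter (f s) (mk j b u), mk j b u) else 0) \<partial>noise \<pi> \<partial>\<pi>)"
      by (rule nn_integral_mk) measurable
    also have "\<dots> = (\<integral>\<^sup>+ b. \<integral>\<^sup>+ u. (if sel (f s) (mk j b u) = j then H (b, mk j b u) else 0) \<partial>noise \<pi> \<partial>\<pi>)"
      by (rule nn_integral_cong, rule nn_integral_cong) (simp add: letter_def mk_def)
    finally show "(\<integral>\<^sup>+ u. (if sel (f s) u = j then H (letter (f s) u, u) else 0) \<partial>noise \<pi>)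
      = (\<integral>\<^sup>+ b. \<integral>\<^sup>+ u. (if sel (f s) (mk j b u) = j then H (b, mk j b u) else 0) \<partial>noise \<pi> \<partial>\<pi>)" .
  qed
  also have "\<dots> = (\<integral>\<^sup>+ b. part s b (\<lambda>u. H (b, u)) \<partial>\<pi>)"
    unfolding part_def
  proof (rule nn_integral_suminf[symmetric])
    fix j
    have [measurable]: "(\<lambda>p. H (fst p, mk j (fst p) (snd p))) \<in> borel_measurable (\<pi> \<Otimes>\<^sub>M noise \<pi>)" by measurable
    have [measurable]: "Measurable.pred (\<pi> \<Otimes>\<^sub>M noise \<pi>) (\<lambda>p. sel (f s) (mk j (fst p) (snd p)) = j)"
      using s by measurable
    have "(\<lambda>p. if sel (f s) (mk j (fst p) (snd p)) = j then H (fst p, mk j (fst p) (snd p)) else 0) \<in> borel_measurable (\<pi> \<Otimes>\<^sub>M noise \<pi>)"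
      by measurable
    then show "(\<lambda>b. \<integral>\<^sup>+ u. (if sel (f s) (mk j b u) = j then H (b, mk j b u) else 0) \<partial>noise \<pi>) \<in> borel_measurable \<pi>"
      by (intro noise.P.borel_measurable_nn_integral) (simp add: split_beta')
  qed
  finally show ?thesis .
qed

definition tot :: "(nat \<Rightarrow> 'e) \<Rightarrow> 'e \<Rightarrow> ennreal" where
  "tot s b = part s b (\<lambda>_. 1)"

lemma tot_measurable [measurable (raw)]:
  assumes [measurable]: "s \<in> measurable N (past_space \<pi>)" "b \<in> measurable N \<pi>"
  shows "(\<lambda>x. tot (s x) (b x)) \<in> borel_measurable N"
  unfolding tot_def by (rule part_measurable) measurable

text \<open>Both functions are densities of the law of the chosen letter. Equality is obtained only
  almost everywhere, which is why \<open>K\<close> is normalised by \<open>tot\<close> and not by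
  \<open>f\<close>.\<close>

lemma AE_tot:
  assumes s: "s \<in> space (past_space \<pi>)"
  shows "AE b in \<pi>. tot s b = ennreal (f s b)"
proof -
  note [measurable] = f_measurable1[OF s]
  have [measurable]: "tot s \<in> borel_measurable \<pi>" by (rule tot_measurable) (use s in auto)
  have "density \<pi> (tot s) = density \<pi> (\<lambda>b. ennreal (f s b))"
  proof (rule measure_eqI)
    fix A assume "A \<in> sets (density \<pi> (tot s))"
    then have A [measurable]: "A \<in> sets \<pi>" by simp
    have "emeasure (density \<pi> (tot s)) A = (\<integral>\<^sup>+ b. part s b (\<lambda>u. indicator A b) \<partial>\<pi>)"
      by (subst emeasure_density) (auto intro!: nn_integral_cong simp: tot_def part_def indicator_def cong: if_cong)
    also have "\<dots> = (\<integral>\<^sup>+ u. indicator A (letter (f s) u) \<partial>noise \<pi>)"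
      using nn_integral_part[OF s, of "\<lambda>p. indicator A (fst p)"] by simp
    also have "\<dots> = (\<integral>\<^sup>+ b. ennreal (f s b) * indicator A b \<partial>\<pi>)"
      by (rule nn_integral_letter) (auto simp: f_nonneg f_one s)
    also have "\<dots> = emeasure (density \<pi> (\<lambda>b. ennreal (f s b))) A"
      by (simp add: emeasure_density)
    finally show "emeasure (density \<pi> (tot s)) A = emeasure (density \<pi> (\<lambda>b. ennreal (f s b))) A" .
  qed simp
  then show ?thesis by (subst (asm) density_unique_iff) auto
qed

text \<open>A regular version of the conditional law of the noise \<open>u\<close> given that \<open>letter (f s) u = b\<close>.\<close>

definition K :: "(nat \<Rightarrow> 'e) \<Rightarrow> 'e \<Rightarrow> (nat \<Rightarrow> 'e \<times> real) measure" where
  "K s b = (if 0 < tot s b \<and> tot s b < \<top>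
     then distr (density (count_space UNIV \<Otimes>\<^sub>M noise \<pi>) (\<lambda>p. (if sel (f s) (mk (fst p) b (snd p)) = fst p then 1 else 0) / tot s b))
            (noise \<pi>) (\<lambda>p. mk (fst p) b (snd p))
     else noise \<pi>)"

lemma sets_K: "sets (K s b) = sets (noise \<pi>)"
  by (simp add: K_def)

lemma nn_integral_K:
  assumes s: "s \<in> space (past_space \<pi>)" and b: "b \<in> space \<pi>" and t: "0 < tot s b" "tot s b < \<top>"
    and H [measurable]: "H \<in> borel_measurable (noise \<pi>)"
  shows "(\<integral>\<^sup>+ u. H u \<partial>K s b) = part s b H / tot s b"
proof -
  let ?C = "count_space (UNIV :: nat set)"
  interpret C: sigma_finite_measure ?C by (rule sigma_finite_measure_count_space_countable) simp
  have mkm [measurable]: "(\<lambda>p. mk (fst p) b (snd p)) \<in> measurable (?C \<Otimes>\<^sub>M noise \<pi>) (noise \<pi>)"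
  proof (rule measurable_compose_countable[where g = fst])
    show "(\<lambda>p. mk i b (snd p)) \<in> measurable (?C \<Otimes>\<^sub>M noise \<pi>) (noise \<pi>)" for i
      by (rule mk_measurable) (use b in simp_all)
  qed (rule measurable_fst)
  have [measurable]: "(\<lambda>p. sel (f s) (mk (fst p) b (snd p))) \<in> measurable (?C \<Otimes>\<^sub>M noise \<pi>) ?C"
    by (rule sel_f_measurable[OF _ mkm]) (use s in simp)
  let ?d = "\<lambda>p. (if sel (f s) (mk (fst p) b (snd p)) = fst p then 1 else 0) / tot s b"
  have [measurable]: "Measurable.pred (?C \<Otimes>\<^sub>M noise \<pi>) (\<lambda>p. sel (f s) (mk (fst p) b (snd p)) = fst p)"
    by (rule pred_eq_nat) measurable
  have [measurable]: "?d \<in> borel_measurable (?C \<Otimes>\<^sub>M noise \<pi>)" by measurable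
  have [measurable]: "(\<lambda>p. H (mk (fst p) b (snd p))) \<in> borel_measurable (?C \<Otimes>\<^sub>M noise \<pi>)" by measurable
  have "(\<integral>\<^sup>+ u. H u \<partial>K s b) = (\<integral>\<^sup>+ p. ?d p * H (mk (fst p) b (snd p)) \<partial>(?C \<Otimes>\<^sub>M noise \<pi>))"
    using t unfolding K_def by (simp add: nn_integral_distr nn_integral_density)
  also have "\<dots> = (\<integral>\<^sup>+ j. \<integral>\<^sup>+ u. ?d (j, u) * H (mk j b u) \<partial>noise \<pi> \<partial>?C)"
    by (subst noise.P.nn_integral_fst[symmetric]) auto
  also have "\<dots> = (\<Sum>j. \<integral>\<^sup>+ u. ?d (j, u) * H (mk j b u) \<partial>noise \<pi>)"
    by (rule nn_integral_count_space_nat)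
  also have "\<dots> = (\<Sum>j. (\<integral>\<^sup>+ u. (if sel (f s) (mk j b u) = j then H (mk j b u) else 0) \<partial>noise \<pi>) * inverse (tot s b))"
  proof (rule suminf_cong)
    fix j
    have "(\<integral>\<^sup>+ u. ?d (j, u) * H (mk j b u) \<partial>noise \<pi>)
        = (\<integral>\<^sup>+ u. (if sel (f s) (mk j b u) = j then H (mk j b u) else 0) * inverse (tot s b) \<partial>noise \<pi>)"
      by (intro nn_integral_cong) (simp add: divide_ennreal_def mult.commute)
    also have "\<dots> = (\<integral>\<^sup>+ u. (if sel (f s) (mk j b u) = j then H (mk j b u) else 0) \<partial>noise \<pi>) * inverse (tot s b)"
      using s b by (intro nn_integral_multc) measurable
    finally show "(\<integral>\<^sup>+ u. ?d (j, u) * H (mk j b u) \<partial>noise \<pi>)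
        = (\<integral>\<^sup>+ u. (if sel (f s) (mk j b u) = j then H (mk j b u) else 0) \<partial>noise \<pi>) * inverse (tot s b)" .
  qed
  also have "\<dots> = part s b H / tot s b"
    unfolding part_def divide_ennreal_def by (rule ennreal_suminf_multc)
  finally show ?thesis .
qed

lemma prob_space_K:
  assumes s: "s \<in> space (past_space \<pi>)" and b: "b \<in> space \<pi>"
  shows "prob_space (K s b)"
proof (cases "0 < tot s b \<and> tot s b < \<top>")
  case True
  have "emeasure (K s b) (space (K s b)) = (\<integral>\<^sup>+ u. 1 \<partial>K s b)" by simp
  also have "\<dots> = 1"
    using True s b by (subst nn_integral_K) (auto simp: tot_def[symmetric] intro!: ennreal_divide_self)
  finally show ?thesis by (rule prob_spaceI)
next
  \<comment> \<open>The default value \<open>noise \<pi>\<close> keeps the kernel a probability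
    measure at the points where the normalisation is impossible.\<close>
  case False
  then have "K s b = noise \<pi>" by (auto simp: K_def)
  then show ?thesis using noise.P.prob_space_axioms by simp
qed

lemma K_measurable: "(\<lambda>p. K (fst p) (snd p)) \<in> measurable (past_space \<pi> \<Otimes>\<^sub>M \<pi>) (prob_algebra (noise \<pi>))"
proof (rule measurable_prob_algebra_generated[where G = "sets (noise \<pi>)" and \<Omega> = "space (noise \<pi>)"])
  show "sets (noise \<pi>) = sigma_sets (space (noise \<pi>)) (sets (noise \<pi>))" by (rule sets.sigma_sets_eq[symmetric])
  show "Int_stable (sets (noise \<pi>))" by (rule sets.Int_stable)
  show "sets (noise \<pi>) \<subseteq> Pow (space (noise \<pi>))" by (rule sets.space_closed)
  show "prob_space (K (fst p) (snd p))" if "p \<in> space (past_space \<pi> \<Otimes>\<^sub>M \<pi>)" for p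
    using that by (intro prob_space_K) (auto simp: space_pair_measure)
  show "sets (K (fst p) (snd p)) = sets (noise \<pi>)" for p by (rule sets_K)
  fix A assume A [measurable]: "A \<in> sets (noise \<pi>)"
  have "(\<lambda>p. if 0 < tot (fst p) (snd p) \<and> tot (fst p) (snd p) < \<top>
      then part (fst p) (snd p) (indicator A) / tot (fst p) (snd p) else emeasure (noise \<pi>) A)
    \<in> borel_measurable (past_space \<pi> \<Otimes>\<^sub>M \<pi>)"
  proof -
    have [measurable]: "(\<lambda>p. part (fst p) (snd p) (indicator A)) \<in> borel_measurable (past_space \<pi> \<Otimes>\<^sub>M \<pi>)"
      by (rule part_measurable) measurable
    show ?thesis by measurable
  qed
  then show "(\<lambda>p. emeasure (K (fst p) (snd p)) A) \<in> borel_measurable (past_space \<pi> \<Otimes>\<^sub>M \<pi>)"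
  proof (rule measurable_cong[THEN iffD1, rotated])
    fix p assume "p \<in> space (past_space \<pi> \<Otimes>\<^sub>M \<pi>)"
    then have p: "fst p \<in> space (past_space \<pi>)" "snd p \<in> space \<pi>" by (auto simp: space_pair_measure)
    have "emeasure (K (fst p) (snd p)) A = part (fst p) (snd p) (indicator A) / tot (fst p) (snd p)"
      if "0 < tot (fst p) (snd p)" "tot (fst p) (snd p) < \<top>"
      using nn_integral_K[OF p that, of "indicator A"] A by (simp add: sets_K)
    moreover have "K (fst p) (snd p) = noise \<pi>" if "\<not> (0 < tot (fst p) (snd p) \<and> tot (fst p) (snd p) < \<top>)"
      using that unfolding K_def by (simp only: if_False)
    ultimately show "(if 0 < tot (fst p) (snd p) \<and> tot (fst p) (snd p) < \<top>
      then part (fst p) (snd p) (indicator A) / tot (fst p) (snd p) else emeasure (noise \<pi>) A) = emeasure (K (fst p) (snd p)) A"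
      by (cases "0 < tot (fst p) (snd p) \<and> tot (fst p) (snd p) < \<top>") simp_all
  qed
qed

text \<open>Where \<open>tot\<close> equals \<open>f\<close> the normalisation cancels. Where
  \<open>tot\<close> is 0, the noises that choose this letter form a null set for each position, so
  \<open>part\<close> vanishes for every \<open>H\<close> and the default value of \<open>K\<close>
  is not seen.\<close>

lemma K_disintegrate:
  assumes s: "s \<in> space (past_space \<pi>)" and H [measurable]: "H \<in> borel_measurable (\<pi> \<Otimes>\<^sub>M noise \<pi>)"
  shows "(\<integral>\<^sup>+ b. ennreal (f s b) * (\<integral>\<^sup>+ u. H (b, u) \<partial>K s b) \<partial>\<pi>) = (\<integral>\<^sup>+ u. H (letter (f s) u, u) \<partial>noise \<pi>)"
  unfolding nn_integral_part[OF s H]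
proof (rule nn_integral_cong_AE)
  show "AE b in \<pi>. ennreal (f s b) * (\<integral>\<^sup>+ u. H (b, u) \<partial>K s b) = part s b (\<lambda>u. H (b, u))"
    using AE_tot[OF s] AE_space
  proof eventually_elim
    case (elim b)
    have Hb: "(\<lambda>u. H (b, u)) \<in> borel_measurable (noise \<pi>)"
      using elim(2) by measurable
    show ?case
    proof (cases "tot s b = 0")
      case True
      have z: "(\<integral>\<^sup>+ u. (if sel (f s) (mk j b u) = j then 1 else 0) \<partial>noise \<pi>) = (0 :: ennreal)" for j
        using True unfolding tot_def part_def
        by (subst (asm) suminf_eq_zero_iff) (simp_all add: summableI)
      have "(\<integral>\<^sup>+ u. (if sel (f s) (mk j b u) = j then H (b, mk j b u) else 0) \<partial>noise \<pi>) = 0" for j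
      proof -
        have "AE u in noise \<pi>. (if sel (f s) (mk j b u) = j then 1 else 0) = (0 :: ennreal)"
          using z[of j] s elim(2) by (subst (asm) nn_integral_0_iff_AE) measurable
        then have "(\<integral>\<^sup>+ u. (if sel (f s) (mk j b u) = j then H (b, mk j b u) else 0) \<partial>noise \<pi>) = (\<integral>\<^sup>+ u. 0 \<partial>noise \<pi>)"
          by (intro nn_integral_cong_AE) (auto split: if_splits)
        then show ?thesis by simp
      qed
      then have "part s b (\<lambda>u. H (b, u)) = 0" by (simp add: part_def)
      then show ?thesis using True elim(1) by simp
    next
      case False
      have t: "0 < tot s b" "tot s b < \<top>" using False elim(1) by (auto simp: zero_less_iff_neq_zero)
      have "ennreal (f s b) * (\<integral>\<^sup>+ u. H (b, u) \<partial>K s b) = tot s b * (part s b (\<lambda>u. H (b, u)) / tot s b)"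
        using nn_integral_K[OF s elim(2) t Hb] elim(1) by simp
      also have "\<dots> = part s b (\<lambda>u. H (b, u))"
        using t by (subst ennreal_times_divide) (simp add: mult.commute[of "tot s b"] ennreal_mult_divide_eq)
      finally show ?thesis .
    qed
  qed
qed

end

text \<open>Weak equality: since the diagonal of the state space need not be measurable, "almost surely equal" is
  expressed by the events that the two variables define.\<close>

definition weq :: "'a measure \<Rightarrow> 'b measure \<Rightarrow> ('a \<Rightarrow> 'b) \<Rightarrow> ('a \<Rightarrow> 'b) \<Rightarrow> bool" where
  "weq N P Z Z' \<longleftrightarrow> (\<forall>A\<in>sets P. {p \<in> space N. (Z p \<in> A) \<noteq> (Z' p \<in> A)} \<in> null_sets N)"

lemma weq_refl: "weq N P Z Z"
  by (simp add: weq_def)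

lemma null_sets_subset:
  assumes "A \<in> null_sets N" "Y \<in> sets N" "Y \<subseteq> A"
  shows "Y \<in> null_sets N"
  using assms by (metis emeasure_mono null_setsD1 null_setsD2 null_setsI le_zero_eq)

lemma weq_trans:
  assumes "weq N P Z Z'" "weq N P Z' Z''" and [measurable]: "Z \<in> measurable N P" "Z'' \<in> measurable N P"
  shows "weq N P Z Z''"
  unfolding weq_def
proof
  fix A assume A [measurable]: "A \<in> sets P"
  have "{p \<in> space N. (Z p \<in> A) \<noteq> (Z' p \<in> A)} \<union> {p \<in> space N. (Z' p \<in> A) \<noteq> (Z'' p \<in> A)} \<in> null_sets N"
    using assms A by (auto simp: weq_def intro: null_sets.Un)
  then show "{p \<in> space N. (Z p \<in> A) \<noteq> (Z'' p \<in> A)} \<in> null_sets N"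
    by (rule null_sets_subset) (measurable, auto)
qed

text \<open>The sets that contain both pairs or neither, up to a null event, form a sigma-algebra,
  and rectangles belong to it because the second components coincide. Working with one set at a time
  avoids the event that the two values are equal.\<close>

lemma weq_compose:
  assumes Z [measurable]: "Z \<in> measurable N P" "Z' \<in> measurable N P" and W [measurable]: "W \<in> measurable N R"
    and eq: "weq N P Z Z'" and h: "h \<in> measurable (P \<Otimes>\<^sub>M R) Q"
  shows "weq N Q (\<lambda>p. h (Z p, W p)) (\<lambda>p. h (Z' p, W p))"
proof -
  have *: "{p \<in> space N. ((Z p, W p) \<in> C) \<noteq> ((Z' p, W p) \<in> C)} \<in> null_sets N"
    if "C \<in> sets (P \<Otimes>\<^sub>M R)" for C
    using that unfolding sets_pair_measure
  proof (induction rule: sigma_sets.induct)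
    case (Basic C)
    then obtain a b where C: "C = a \<times> b" and [measurable]: "a \<in> sets P" "b \<in> sets R" by auto
    have "{p \<in> space N. (Z p \<in> a) \<noteq> (Z' p \<in> a)} \<in> null_sets N"
      using eq \<open>a \<in> sets P\<close> by (simp add: weq_def)
    then show ?case
      unfolding C by (rule null_sets_subset) (measurable, auto)
  next
    case Empty
    then show ?case by simp
  next
    case (Compl C)
    have "(Z p, W p) \<in> space P \<times> space R" "(Z' p, W p) \<in> space P \<times> space R" if "p \<in> space N" for p
      using measurable_space[OF Z(1) that] measurable_space[OF Z(2) that] measurable_space[OF W that] by auto
    then have "{p \<in> space N. ((Z p, W p) \<in> space P \<times> space R - C) \<noteq> ((Z' p, W p) \<in> space P \<times> space R - C)}
        = {p \<in> space N. ((Z p, W p) \<in> C) \<noteq> ((Z' p, W p) \<in> C)}"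
      by blast
    with Compl show ?case by simp
  next
    case (Union C)
    have m: "C i \<in> sets (P \<Otimes>\<^sub>M R)" for i
      using Union(1) by (simp add: sets_pair_measure)
    have [measurable]: "(\<Union>i. C i) \<in> sets (P \<Otimes>\<^sub>M R)" using m by blast
    have "(\<Union>i. {p \<in> space N. ((Z p, W p) \<in> C i) \<noteq> ((Z' p, W p) \<in> C i)}) \<in> null_sets N"
      using Union(2) by (intro null_sets_UN)
    then show ?case
      by (rule null_sets_subset) (measurable, blast)
  qed
  show ?thesis
    unfolding weq_def
  proof
    fix A assume A: "A \<in> sets Q"
    have "h -` A \<inter> space (P \<Otimes>\<^sub>M R) \<in> sets (P \<Otimes>\<^sub>M R)" using h A by (rule measurable_sets)
    from *[OF this]
    have "{p \<in> space N. ((Z p, W p) \<in> h -` A \<inter> space (P \<Otimes>\<^sub>M R)) \<noteq> ((Z' p, W p) \<in> h -` A \<inter> space (P \<Otimes>\<^sub>M R))} \<in> null_sets N" .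
    moreover have "(Z p, W p) \<in> space (P \<Otimes>\<^sub>M R)" "(Z' p, W p) \<in> space (P \<Otimes>\<^sub>M R)" if "p \<in> space N" for p
      using measurable_space[OF Z(1) that] measurable_space[OF Z(2) that] measurable_space[OF W that]
      by (auto simp: space_pair_measure)
    then have "{p \<in> space N. ((Z p, W p) \<in> h -` A \<inter> space (P \<Otimes>\<^sub>M R)) \<noteq> ((Z' p, W p) \<in> h -` A \<inter> space (P \<Otimes>\<^sub>M R))}
       = {p \<in> space N. (h (Z p, W p) \<in> A) \<noteq> (h (Z' p, W p) \<in> A)}"
      by blast
    ultimately show "{p \<in> space N. (h (Z p, W p) \<in> A) \<noteq> (h (Z' p, W p) \<in> A)} \<in> null_sets N" by simp
  qed
qed

text \<open>For each set the two preimages differ inside a null event, and \<open>T\<close> contains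
  all subsets of that event.\<close>

lemma measurable_if_weq:
  assumes "space T = space N" and null: "null_sets (completion N) \<subseteq> sets T" and "weq N P Z Z'"
    and Z: "Z \<in> space N \<rightarrow> space P" and Z': "Z' \<in> measurable T P"
  shows "Z \<in> measurable T P"
proof (rule measurableI)
  show "Z p \<in> space P" if "p \<in> space T" for p using Z that assms(1) by auto
  fix A assume A: "A \<in> sets P"
  let ?D = "{p \<in> space N. (Z p \<in> A) \<noteq> (Z' p \<in> A)}"
  have D: "?D \<in> null_sets N" using assms(3) A by (simp add: weq_def)
  have sub: "Y \<in> sets T" if "Y \<subseteq> ?D" for Y
    using null null_sets_completion_subset[OF that null_sets_completionI[OF D]] by blast
  have 1: "Z' -` A \<inter> space T \<in> sets T" using Z' A by (rule measurable_sets)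
  have 2: "?D - Z -` A \<in> sets T" by (rule sub) blast
  have 3: "?D \<inter> Z -` A \<in> sets T" by (rule sub) blast
  have "(Z' -` A \<inter> space T - (?D - Z -` A)) \<union> (?D \<inter> Z -` A) \<in> sets T"
    by (rule sets.Un[OF sets.Diff[OF 1 2] 3])
  also have "(Z' -` A \<inter> space T - (?D - Z -` A)) \<union> (?D \<inter> Z -` A) = Z -` A \<inter> space T"
    unfolding assms(1) by blast
  finally show "Z -` A \<inter> space T \<in> sets T" .
qed

text \<open>Reduces statements about a completed sigma-field to the sigma-field before completion,
  where intersection-stable generators are available.\<close>

lemma sigma_sets_null_approx:
  assumes G: "G \<subseteq> Pow (space N)" and "Y \<in> sigma_sets (space N) (G \<union> null_sets (completion N))"
  shows "\<exists>Y'\<in>sigma_sets (space N) G. (Y - Y') \<union> (Y' - Y) \<in> null_sets (completion N)"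
  using assms(2)
proof (induction rule: sigma_sets.induct)
  case (Basic Y)
  then show ?case
  proof
    assume "Y \<in> G"
    then show ?thesis by (intro bexI[of _ Y]) (auto intro: sigma_sets.Basic)
  next
    assume "Y \<in> null_sets (completion N)"
    then show ?thesis by (intro bexI[of _ "{}"]) (auto intro: sigma_sets.Empty)
  qed
next
  case Empty
  show ?case by (intro bexI[of _ "{}"]) (auto intro: sigma_sets.Empty)
next
  case (Compl Y)
  then obtain Y' where Y': "Y' \<in> sigma_sets (space N) G" "(Y - Y') \<union> (Y' - Y) \<in> null_sets (completion N)" by blast
  have "(space N - Y - (space N - Y')) \<union> (space N - Y' - (space N - Y)) \<in> null_sets (completion N)"
    by (rule null_sets_completion_subset[OF _ Y'(2)]) blast
  then show ?case using Y'(1) by (intro bexI[of _ "space N - Y'"] sigma_sets.Compl)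
next
  case (Union Y)
  then have "\<forall>i. \<exists>Y'. Y' \<in> sigma_sets (space N) G \<and> (Y i - Y') \<union> (Y' - Y i) \<in> null_sets (completion N)" by blast
  from choice[OF this] obtain Y' where Y': "\<And>i. Y' i \<in> sigma_sets (space N) G"
      "\<And>i. (Y i - Y' i) \<union> (Y' i - Y i) \<in> null_sets (completion N)" by blast
  have "(\<Union>i. (Y i - Y' i) \<union> (Y' i - Y i)) \<in> null_sets (completion N)"
    by (intro null_sets_UN Y'(2))
  then have "((\<Union>i. Y i) - (\<Union>i. Y' i)) \<union> ((\<Union>i. Y' i) - (\<Union>i. Y i)) \<in> null_sets (completion N)"
    by (rule null_sets_completion_subset[rotated]) blast
  then show ?case using Y'(1) by (intro bexI[of _ "\<Union>i. Y' i"] sigma_sets.Union)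
qed

lemma null_sets_completion_space: "null_sets (completion N) \<subseteq> Pow (space N)"
  using sets.sets_into_space[of _ "completion N"] by auto

lemma sets_natural_filtration:
  "sets (natural_filtration N E X n) =
    sigma_sets (space N) ({X k -` A \<inter> space N | k A. k \<le> n \<and> A \<in> sets E} \<union> null_sets (completion N))"
  and space_natural_filtration: "space (natural_filtration N E X n) = space N"
proof -
  have "{X k -` A \<inter> space N | k A. k \<le> n \<and> A \<in> sets E} \<union> null_sets (completion N) \<subseteq> Pow (space N)"
    using null_sets_completion_space[of N] by blast
  then show "sets (natural_filtration N E X n) =
    sigma_sets (space N) ({X k -` A \<inter> space N | k A. k \<le> n \<and> A \<in> sets E} \<union> null_sets (completion N))"
    "space (natural_filtration N E X n) = space N"
    unfolding natural_filtration_def by (rule sets_measure_of, rule space_measure_of)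
qed

lemma null_sets_natural_filtration: "null_sets (completion N) \<subseteq> sets (natural_filtration N E X n)"
  unfolding sets_natural_filtration by (auto intro: sigma_sets.Basic)

lemma measurable_natural_filtration:
  assumes "k \<le> n" "X k \<in> measurable N E"
  shows "X k \<in> measurable (natural_filtration N E X n) E"
proof (rule measurableI)
  show "X k p \<in> space E" if "p \<in> space (natural_filtration N E X n)" for p
    using that assms(2) by (auto simp: space_natural_filtration dest: measurable_space)
  show "X k -` A \<inter> space (natural_filtration N E X n) \<in> sets (natural_filtration N E X n)" if "A \<in> sets E" for A
    unfolding space_natural_filtration sets_natural_filtration
    using that assms(1) by (intro sigma_sets.Basic) blast
qed

lemma natural_filtration_le:
  assumes "space T = space N" and "null_sets (completion N) \<subseteq> sets T"
    and "\<And>k. k \<le> n \<Longrightarrow> X k \<in> measurable T E"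
  shows "sets (natural_filtration N E X n) \<subseteq> sets T"
  unfolding sets_natural_filtration assms(1)[symmetric]
  by (rule sets.sigma_sets_subset) (use assms(2,3) in \<open>auto intro: measurable_sets\<close>)

section \<open>The enlarged probability space\<close>

context chain
begin

definition kap :: "int \<Rightarrow> 'w \<Rightarrow> (nat \<Rightarrow> 'e \<times> real) measure" where
  "kap n \<omega> = K (past X (n - 1) \<omega>) (X n \<omega>)"

lemma kap_measurable: "kap n \<in> measurable M (prob_algebra (noise \<pi>))"
  unfolding kap_def[abs_def]
  using measurable_compose[OF measurable_Pair[OF past_measurable X_measurable] K_measurable, of "n - 1" n] by simp

abbreviation noises\<^sub>Z :: "(int \<Rightarrow> nat \<Rightarrow> 'e \<times> real) measure" where
  "noises\<^sub>Z \<equiv> Pi\<^sub>M UNIV (\<lambda>_. noise \<pi>)"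

definition kaps :: "'w \<Rightarrow> (int \<Rightarrow> nat \<Rightarrow> 'e \<times> real) measure" where
  "kaps \<omega> = Pi\<^sub>M UNIV (\<lambda>n. kap n \<omega>)"

lemma kaps_measurable: "kaps \<in> measurable M (prob_algebra noises\<^sub>Z)"
  unfolding kaps_def[abs_def] by (rule measurable_PiM_kernel[OF kap_measurable])

definition NN :: "('w \<times> (int \<Rightarrow> nat \<Rightarrow> 'e \<times> real)) measure" where
  "NN = semidirect M noises\<^sub>Z kaps"

sublocale NN: prob_space NN
  unfolding NN_def by (rule prob_space_semidirect[OF M.prob_space_axioms kaps_measurable])

lemma sets_NN [measurable_cong]: "sets NN = sets (M \<Otimes>\<^sub>M noises\<^sub>Z)"
  unfolding NN_def by (rule sets_semidirect[OF M.prob_space_axioms kaps_measurable])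

lemma space_NN: "space NN = space M \<times> space noises\<^sub>Z"
  using sets_eq_imp_space_eq[OF sets_NN] by (simp add: space_pair_measure)

lemma nn_integral_NN:
  assumes "H \<in> borel_measurable NN"
  shows "(\<integral>\<^sup>+ p. H p \<partial>NN) = (\<integral>\<^sup>+ \<omega>. \<integral>\<^sup>+ u. H (\<omega>, u) \<partial>kaps \<omega> \<partial>M)"
  unfolding NN_def
  using assms by (intro nn_integral_semidirect[OF M.prob_space_axioms kaps_measurable])
    (simp only: measurable_cong_sets[OF sets_NN refl])

lemma fst_NN [measurable]: "fst \<in> measurable NN M"
  unfolding measurable_cong_sets[OF sets_NN refl] by (rule measurable_fst)

lemma snd_NN [measurable]: "(\<lambda>p. snd p n) \<in> measurable NN (noise \<pi>)"
  unfolding measurable_cong_sets[OF sets_NN refl]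
  by (rule measurable_compose[OF measurable_snd measurable_component_singleton]) simp

lemma XN_measurable [measurable]: "(\<lambda>p. X n (fst p)) \<in> measurable NN \<pi>"
  by (rule measurable_compose[OF fst_NN X_measurable])

lemma pastN_measurable [measurable]: "(\<lambda>p. past X n (fst p)) \<in> measurable NN (past_space \<pi>)"
  by (rule measurable_compose[OF fst_NN past_measurable])

lemma distr_NN_fst: "distr NN M fst = M"
proof (rule measure_eqI)
  fix A assume "A \<in> sets (distr NN M fst)"
  then have [measurable]: "A \<in> sets M" by simp
  have m: "(\<lambda>p. indicator A (fst p) :: ennreal) \<in> borel_measurable NN" by measurable
  have "emeasure (distr NN M fst) A = (\<integral>\<^sup>+ \<omega>. indicator A \<omega> \<partial>distr NN M fst)" by simp
  also have "\<dots> = (\<integral>\<^sup>+ p. indicator A (fst p) \<partial>NN)"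
    by (rule nn_integral_distr) measurable
  also have "\<dots> = (\<integral>\<^sup>+ \<omega>. \<integral>\<^sup>+ u. indicator A \<omega> \<partial>kaps \<omega> \<partial>M)"
    by (subst nn_integral_NN[OF m]) simp
  also have "\<dots> = (\<integral>\<^sup>+ \<omega>. indicator A \<omega> \<partial>M)"
  proof (rule nn_integral_cong)
    fix \<omega> assume "\<omega> \<in> space M"
    then have "emeasure (kaps \<omega>) (space (kaps \<omega>)) = 1"
      by (rule prob_space.emeasure_space_1[OF kernel_space(1)[OF kaps_measurable]])
    then show "(\<integral>\<^sup>+ u. indicator A \<omega> \<partial>kaps \<omega>) = (indicator A \<omega> :: ennreal)" by simp
  qed
  finally show "emeasure (distr NN M fst) A = emeasure M A" by simp
qed simp

text \<open>Given the trajectory the noises are independent, so finitely many conditions on them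
  contribute the product of their conditional probabilities.\<close>

lemma nn_integral_NN_box:
  assumes h [measurable]: "h \<in> borel_measurable M" and J: "finite J" and C [measurable]: "\<And>k. C k \<in> sets (noise \<pi>)"
  shows "(\<integral>\<^sup>+ p. h (fst p) * (if \<forall>k\<in>J. snd p k \<in> C k then 1 else 0) \<partial>NN) = (\<integral>\<^sup>+ \<omega>. h \<omega> * (\<Prod>k\<in>J. emeasure (kap k \<omega>) (C k)) \<partial>M)"
proof -
  have m: "(\<lambda>p. h (fst p) * (if \<forall>k\<in>J. snd p k \<in> C k then 1 else 0)) \<in> borel_measurable NN"
    using J by measurable
  have "(\<integral>\<^sup>+ p. h (fst p) * (if \<forall>k\<in>J. snd p k \<in> C k then 1 else 0) \<partial>NN)
      = (\<integral>\<^sup>+ \<omega>. \<integral>\<^sup>+ u. h \<omega> * (if \<forall>k\<in>J. u k \<in> C k then 1 else 0) \<partial>kaps \<omega> \<partial>M)"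
    using nn_integral_NN[OF m] by simp
  also have "\<dots> = (\<integral>\<^sup>+ \<omega>. h \<omega> * (\<Prod>k\<in>J. emeasure (kap k \<omega>) (C k)) \<partial>M)"
  proof (rule nn_integral_cong)
    fix \<omega> assume \<omega>: "\<omega> \<in> space M"
    let ?E = "prod_emb UNIV (\<lambda>_. noise \<pi>) J (Pi\<^sub>E J C)"
    have E: "?E \<in> sets (kaps \<omega>)"
      unfolding kernel_space(2)[OF kaps_measurable \<omega>] using J C by (intro sets_PiM_I) auto
    have ind: "(if \<forall>k\<in>J. u k \<in> C k then 1 else 0) = (indicator ?E u :: ennreal)" if "u \<in> space (kaps \<omega>)" for u
    proof -
      have "u \<in> space noises\<^sub>Z" using that unfolding kernel_space(3)[OF kaps_measurable \<omega>] .
      then have "u \<in> ?E \<longleftrightarrow> (\<forall>k\<in>J. u k \<in> C k)" by (simp add: prod_emb_def space_PiM PiE_iff)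
      then show ?thesis by (simp add: indicator_def)
    qed
    have "(\<integral>\<^sup>+ u. h \<omega> * (if \<forall>k\<in>J. u k \<in> C k then 1 else 0) \<partial>kaps \<omega>) = (\<integral>\<^sup>+ u. h \<omega> * indicator ?E u \<partial>kaps \<omega>)"
      by (intro nn_integral_cong arg_cong[where f = "(*) (h \<omega>)"] ind)
    also have "\<dots> = h \<omega> * emeasure (kaps \<omega>) ?E"
      using E by (simp add: nn_integral_cmult)
    also have "emeasure (kaps \<omega>) ?E = (\<Prod>k\<in>J. emeasure (kap k \<omega>) (C k))"
      unfolding kaps_def using emeasure_PiM_kernel[OF kap_measurable \<omega> J C] .
    finally show "(\<integral>\<^sup>+ u. h \<omega> * (if \<forall>k\<in>J. u k \<in> C k then 1 else 0) \<partial>kaps \<omega>) = h \<omega> * (\<Prod>k\<in>J. emeasure (kap k \<omega>) (C k))" .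
  qed
  finally show ?thesis .
qed

text \<open>Drawing the letter from \<open>f\<close> and then the noise from its conditional law
  \<open>K\<close> amounts to drawing the noise first and reading off the letter. After this
  exchange the noise is independent of the past.\<close>

lemma nn_integral_NN_step:
  assumes H [measurable]: "H \<in> borel_measurable ((past_space \<pi> \<Otimes>\<^sub>M \<pi>) \<Otimes>\<^sub>M noise \<pi>)"
  shows "(\<integral>\<^sup>+ p. H ((past X (m - 1) (fst p), X m (fst p)), snd p m) \<partial>NN)
    = (\<integral>\<^sup>+ s. \<integral>\<^sup>+ u. H ((s, letter (f s) u), u) \<partial>noise \<pi> \<partial>mu)"
proof -
  have m: "(\<lambda>p. H ((past X (m - 1) (fst p), X m (fst p)), snd p m)) \<in> borel_measurable NN" by measurable
  let ?H = "\<lambda>q. \<integral>\<^sup>+ u. H (q, u) \<partial>K (fst q) (snd q)"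
  have H' [measurable]: "?H \<in> borel_measurable (past_space \<pi> \<Otimes>\<^sub>M \<pi>)"
    by (rule nn_integral_measurable_subprob_algebra2[OF _ measurable_prob_algebraD[OF K_measurable]]) measurable
  have "(\<integral>\<^sup>+ p. H ((past X (m - 1) (fst p), X m (fst p)), snd p m) \<partial>NN)
     = (\<integral>\<^sup>+ \<omega>. \<integral>\<^sup>+ u. H ((past X (m - 1) \<omega>, X m \<omega>), u m) \<partial>kaps \<omega> \<partial>M)"
    using nn_integral_NN[OF m] by simp
  also have "\<dots> = (\<integral>\<^sup>+ \<omega>. ?H (past X (m - 1) \<omega>, X m \<omega>) \<partial>M)"
  proof (rule nn_integral_cong)
    fix \<omega> assume \<omega>: "\<omega> \<in> space M"
    have q: "(past X (m - 1) \<omega>, X m \<omega>) \<in> space (past_space \<pi> \<Otimes>\<^sub>M \<pi>)"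
      using \<omega> by (rule measurable_space[OF measurable_Pair[OF past_measurable X_measurable]])
    have Hq: "(\<lambda>u. H ((past X (m - 1) \<omega>, X m \<omega>), u)) \<in> borel_measurable (noise \<pi>)"
      by (rule measurable_compose[OF measurable_Pair1'[OF q] H])
    have "(\<integral>\<^sup>+ u. H ((past X (m - 1) \<omega>, X m \<omega>), u) \<partial>kap m \<omega>)
        = (\<integral>\<^sup>+ u. H ((past X (m - 1) \<omega>, X m \<omega>), u) \<partial>distr (kaps \<omega>) (kap m \<omega>) (\<lambda>u. u m))"
      unfolding kaps_def
      by (subst distr_PiM_component) (auto intro: kernel_space[OF kap_measurable \<omega>])
    also have "\<dots> = (\<integral>\<^sup>+ u. H ((past X (m - 1) \<omega>, X m \<omega>), u m) \<partial>kaps \<omega>)"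
    proof -
      have cm: "(\<lambda>u. u m) \<in> measurable (kaps \<omega>) (kap m \<omega>)"
        unfolding kaps_def by (rule measurable_component_singleton) simp
      have hm: "(\<lambda>u. H ((past X (m - 1) \<omega>, X m \<omega>), u)) \<in> borel_measurable (kap m \<omega>)"
        unfolding measurable_cong_sets[OF kernel_space(2)[OF kap_measurable \<omega>] refl] by (rule Hq)
      show ?thesis using nn_integral_distr[OF cm, of "\<lambda>u. H ((past X (m - 1) \<omega>, X m \<omega>), u)"] hm by simp
    qed
    finally show "(\<integral>\<^sup>+ u. H ((past X (m - 1) \<omega>, X m \<omega>), u m) \<partial>kaps \<omega>) = ?H (past X (m - 1) \<omega>, X m \<omega>)"
      by (simp add: kap_def)
  qed
  also have "\<dots> = (\<integral>\<^sup>+ s. \<integral>\<^sup>+ a. ennreal (f s a) * ?H (s, a) \<partial>\<pi> \<partial>mu)"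
    by (rule nn_integral_step_law[OF H'])
  also have "\<dots> = (\<integral>\<^sup>+ s. \<integral>\<^sup>+ u. H ((s, letter (f s) u), u) \<partial>noise \<pi> \<partial>mu)"
  proof (rule nn_integral_cong)
    fix s assume "s \<in> space mu"
    then have s: "s \<in> space (past_space \<pi>)" by simp
    have "(\<lambda>q. ((s, fst q), snd q)) \<in> measurable (\<pi> \<Otimes>\<^sub>M noise \<pi>) ((past_space \<pi> \<Otimes>\<^sub>M \<pi>) \<Otimes>\<^sub>M noise \<pi>)"
      using s by measurable
    from K_disintegrate[OF s measurable_compose[OF this H]]
    show "(\<integral>\<^sup>+ a. ennreal (f s a) * ?H (s, a) \<partial>\<pi>) = (\<integral>\<^sup>+ u. H ((s, letter (f s) u), u) \<partial>noise \<pi>)" by simp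
  qed
  finally show ?thesis .
qed

text \<open>With the noise drawn first, the letter is the chosen one by construction, so the
  indicator of a discrepancy is identically 0.\<close>

lemma weq_letter: "weq NN \<pi> (\<lambda>p. X m (fst p)) (\<lambda>p. letter (f (past X (m - 1) (fst p))) (snd p m))"
  unfolding weq_def
proof
  fix A assume [measurable]: "A \<in> sets \<pi>"
  let ?H = "\<lambda>q. if (snd (fst q) \<in> A) \<noteq> (letter (f (fst (fst q))) (snd q) \<in> A) then 1 else 0 :: ennreal"
  let ?Y = "{p \<in> space NN. (X m (fst p) \<in> A) \<noteq> (letter (f (past X (m - 1) (fst p))) (snd p m) \<in> A)}"
  have H: "?H \<in> borel_measurable ((past_space \<pi> \<Otimes>\<^sub>M \<pi>) \<Otimes>\<^sub>M noise \<pi>)"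
  proof -
    have [measurable]: "(\<lambda>q. letter (f (fst (fst q))) (snd q)) \<in> measurable ((past_space \<pi> \<Otimes>\<^sub>M \<pi>) \<Otimes>\<^sub>M noise \<pi>) \<pi>"
      by (rule letter_f_measurable) measurable
    show ?thesis by measurable
  qed
  have [measurable]: "(\<lambda>p. letter (f (past X (m - 1) (fst p))) (snd p m)) \<in> measurable NN \<pi>"
    by (rule letter_f_measurable) measurable
  have Y: "?Y \<in> sets NN" by measurable
  have "emeasure NN ?Y = (\<integral>\<^sup>+ p. ?H ((past X (m - 1) (fst p), X m (fst p)), snd p m) \<partial>NN)"
    using emeasure_Collect_if[OF Y] by simp
  also have "\<dots> = (\<integral>\<^sup>+ s. \<integral>\<^sup>+ u. ?H ((s, letter (f s) u), u) \<partial>noise \<pi> \<partial>mu)"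
    by (rule nn_integral_NN_step[OF H])
  also have "\<dots> = 0" by simp
  finally show "?Y \<in> null_sets NN" using Y by (rule null_setsI)
qed

text \<open>An intersection-stable generator of the information at time \<open>n\<close>. Since only
  the past of X and finitely many noises are constrained, probabilities reduce to finite products of
  kernels.\<close>

definition boxes :: "int \<Rightarrow> ('w \<times> (int \<Rightarrow> nat \<Rightarrow> 'e \<times> real)) set set" where
  "boxes n = {{p \<in> space NN. past X n (fst p) \<in> A \<and> (\<forall>k\<in>J. snd p k \<in> C k)} | A J C.
     A \<in> sets (past_space \<pi>) \<and> finite J \<and> J \<subseteq> {..n} \<and> (\<forall>k. C k \<in> sets (noise \<pi>))}"

lemma boxes_sets: "boxes n \<subseteq> sets NN"
proof
  fix Y assume "Y \<in> boxes n"
  then obtain A J C where Y: "Y = {p \<in> space NN. past X n (fst p) \<in> A \<and> (\<forall>k\<in>J. snd p k \<in> C k)}"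
    and [measurable]: "A \<in> sets (past_space \<pi>)" and J: "finite J" and C [measurable]: "\<And>k. C k \<in> sets (noise \<pi>)"
    by (auto simp: boxes_def)
  show "Y \<in> sets NN" unfolding Y using J by measurable
qed

lemma Int_stable_boxes: "Int_stable (boxes n)"
  unfolding Int_stable_def
proof (intro ballI)
  fix Y Y' assume "Y \<in> boxes n" "Y' \<in> boxes n"
  then obtain A J C A' J' C' where
    Y: "Y = {p \<in> space NN. past X n (fst p) \<in> A \<and> (\<forall>k\<in>J. snd p k \<in> C k)}"
    "A \<in> sets (past_space \<pi>)" "finite J" "J \<subseteq> {..n}" "\<And>k. C k \<in> sets (noise \<pi>)" and
    Y': "Y' = {p \<in> space NN. past X n (fst p) \<in> A' \<and> (\<forall>k\<in>J'. snd p k \<in> C' k)}"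
    "A' \<in> sets (past_space \<pi>)" "finite J'" "J' \<subseteq> {..n}" "\<And>k. C' k \<in> sets (noise \<pi>)"
    unfolding boxes_def by blast
  let ?C = "\<lambda>k. (if k \<in> J then C k else space (noise \<pi>)) \<inter> (if k \<in> J' then C' k else space (noise \<pi>))"
  have sp: "snd p k \<in> space (noise \<pi>)" if "p \<in> space NN" for p k
    using measurable_space[OF snd_NN that] .
  have "Y \<inter> Y' = {p \<in> space NN. past X n (fst p) \<in> A \<inter> A' \<and> (\<forall>k\<in>J \<union> J'. snd p k \<in> ?C k)}"
    unfolding Y Y' using sp by auto
  moreover have "?C k \<in> sets (noise \<pi>)" for k using Y(5)[of k] Y'(5)[of k] by auto
  ultimately show "Y \<inter> Y' \<in> boxes n"
    unfolding boxes_def using Y(2-4) Y'(2-4)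
    by (intro CollectI exI[of _ "A \<inter> A'"] exI[of _ "J \<union> J'"] exI[of _ ?C]) auto
qed

text \<open>Given the trajectory, the probability of the box depends on X only up to time
  \<open>n\<close>, while the next noise has law \<open>K\<close> of the past and the next letter.
  Averaging this kernel over the next letter with density \<open>f\<close> gives
  \<open>noise \<pi>\<close> for every past, hence independence.\<close>

lemma emeasure_box_step:
  assumes "Y \<in> boxes n" and G [measurable]: "G \<in> sets (noise \<pi>)"
  shows "emeasure NN (Y \<inter> {p \<in> space NN. snd p (n + 1) \<in> G}) = emeasure NN Y * emeasure (noise \<pi>) G"
proof -
  obtain A J C where Y: "Y = {p \<in> space NN. past X n (fst p) \<in> A \<and> (\<forall>k\<in>J. snd p k \<in> C k)}"
    and A [measurable]: "A \<in> sets (past_space \<pi>)" and J: "finite J" "J \<subseteq> {..n}"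
    and C [measurable]: "\<And>k. C k \<in> sets (noise \<pi>)"
    using assms(1) by (auto simp: boxes_def)
  \<comment> \<open>The conditional probability of the box, rewritten as a function of the past at
    time \<open>n\<close>: in the backward indexing the letter of time \<open>k\<close> sits at
    \<open>n - k\<close>, and the past before it starts at \<open>n - k + 1\<close>.\<close>
  define \<Phi> where "\<Phi> s = (if s \<in> A then 1 else 0) *
      (\<Prod>k\<in>J. emeasure (K (\<lambda>j. s (j + nat (n - k + 1))) (s (nat (n - k)))) (C k))" for s
  have [measurable]: "\<Phi> \<in> borel_measurable (past_space \<pi>)"
  proof -
    have "(\<lambda>s. emeasure (K (\<lambda>j. s (j + nat (n - k + 1))) (s (nat (n - k)))) (C k)) \<in> borel_measurable (past_space \<pi>)" for k
    proof -
      have "(\<lambda>s. ((\<lambda>j. s (j + nat (n - k + 1))), s (nat (n - k)))) \<in> measurable (past_space \<pi>) (past_space \<pi> \<Otimes>\<^sub>M \<pi>)"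
        by (intro measurable_Pair measurable_PiM_UNIV measurable_component_singleton) simp_all
      from measurable_compose[OF this emeasure_kernel_measurable[OF K_measurable C]] show ?thesis by simp
    qed
    then show ?thesis unfolding \<Phi>_def by measurable
  qed
  have \<Phi>: "\<Phi> (past X n \<omega>) = (if past X n \<omega> \<in> A then 1 else 0) * (\<Prod>k\<in>J. emeasure (kap k \<omega>) (C k))" for \<omega>
  proof -
    have "kap k \<omega> = K (\<lambda>j. past X n \<omega> (j + nat (n - k + 1))) (past X n \<omega> (nat (n - k)))" if "k \<in> J" for k
    proof -
      have k: "k \<le> n" using that J by auto
      have "past X (k - 1) \<omega> = (\<lambda>j. past X n \<omega> (j + nat (n - k + 1)))"
        using k by (simp add: past_def fun_eq_iff algebra_simps)
      moreover have "X k \<omega> = past X n \<omega> (nat (n - k))" using k by (simp add: past_def)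
      ultimately show ?thesis by (simp add: kap_def)
    qed
    then show ?thesis by (simp add: \<Phi>_def)
  qed
  have Ym: "{p \<in> space NN. past X n (fst p) \<in> A \<and> (\<forall>k\<in>J. snd p k \<in> C k)} \<in> sets NN"
    using boxes_sets assms(1) Y by blast
  have "emeasure NN Y = (\<integral>\<^sup>+ p. (if past X n (fst p) \<in> A then 1 else 0) * (if \<forall>k\<in>J. snd p k \<in> C k then 1 else 0) \<partial>NN)"
    unfolding Y emeasure_Collect_if[OF Ym] by (intro nn_integral_cong) simp
  also have "\<dots> = (\<integral>\<^sup>+ \<omega>. \<Phi> (past X n \<omega>) \<partial>M)"
    unfolding \<Phi> using J C by (intro nn_integral_NN_box[of "\<lambda>\<omega>. if past X n \<omega> \<in> A then 1 else 0"]) measurable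
  also have "\<dots> = (\<integral>\<^sup>+ s. \<Phi> s \<partial>mu)" by (rule nn_integral_past) measurable
  finally have eY: "emeasure NN Y = (\<integral>\<^sup>+ s. \<Phi> s \<partial>mu)" .
  have n1: "n + 1 \<notin> J" using J by auto
  let ?C = "C(n + 1 := G)"
  have YG: "Y \<inter> {p \<in> space NN. snd p (n + 1) \<in> G} = {p \<in> space NN. past X n (fst p) \<in> A \<and> (\<forall>k\<in>insert (n + 1) J. snd p k \<in> ?C k)}"
    unfolding Y using n1 by auto
  have YGm: "{p \<in> space NN. past X n (fst p) \<in> A \<and> (\<forall>k\<in>insert (n + 1) J. snd p k \<in> ?C k)} \<in> sets NN"
    unfolding YG[symmetric] using Ym Y by (intro sets.Int) simp_all
  have pr: "(\<Prod>k\<in>insert (n + 1) J. emeasure (kap k \<omega>) (?C k)) = emeasure (kap (n + 1) \<omega>) G * (\<Prod>k\<in>J. emeasure (kap k \<omega>) (C k))" for \<omega>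
  proof -
    have "(\<Prod>k\<in>J. emeasure (kap k \<omega>) (?C k)) = (\<Prod>k\<in>J. emeasure (kap k \<omega>) (C k))"
      using n1 by (intro prod.cong) auto
    then show ?thesis using J(1) n1 by simp
  qed
  have "emeasure NN (Y \<inter> {p \<in> space NN. snd p (n + 1) \<in> G})
      = (\<integral>\<^sup>+ p. (if past X n (fst p) \<in> A then 1 else 0) * (if \<forall>k\<in>insert (n + 1) J. snd p k \<in> ?C k then 1 else 0) \<partial>NN)"
    unfolding YG emeasure_Collect_if[OF YGm] by (intro nn_integral_cong) (simp del: ball_simps)
  also have "\<dots> = (\<integral>\<^sup>+ \<omega>. (if past X n \<omega> \<in> A then 1 else 0) * (\<Prod>k\<in>insert (n + 1) J. emeasure (kap k \<omega>) (?C k)) \<partial>M)"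
  proof (rule nn_integral_NN_box[of "\<lambda>\<omega>. if past X n \<omega> \<in> A then 1 else 0"])
    show "finite (insert (n + 1) J)" using J by simp
    show "?C k \<in> sets (noise \<pi>)" for k using C[of k] G by (cases "k = n + 1") simp_all
  qed measurable
  also have "\<dots> = (\<integral>\<^sup>+ \<omega>. \<Phi> (past X n \<omega>) * emeasure (kap (n + 1) \<omega>) G \<partial>M)"
    unfolding \<Phi> pr by (intro nn_integral_cong) (simp only: mult_ac)
  also have "\<dots> = (\<integral>\<^sup>+ \<omega>. \<Phi> (past X (n + 1 - 1) \<omega>) * emeasure (K (past X (n + 1 - 1) \<omega>) (X (n + 1) \<omega>)) G \<partial>M)"
    by (simp add: kap_def)
  also have "\<dots> = (\<integral>\<^sup>+ s. \<integral>\<^sup>+ a. ennreal (f s a) * (\<Phi> s * emeasure (K s a) G) \<partial>\<pi> \<partial>mu)"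
  proof -
    have "(\<lambda>q. \<Phi> (fst q) * emeasure (K (fst q) (snd q)) G) \<in> borel_measurable (past_space \<pi> \<Otimes>\<^sub>M \<pi>)"
      using emeasure_kernel_measurable[OF K_measurable G] by measurable
    from nn_integral_step_law[OF this, of "n + 1"] show ?thesis by simp
  qed
  also have "\<dots> = (\<integral>\<^sup>+ s. \<Phi> s * emeasure (noise \<pi>) G \<partial>mu)"
  proof (rule nn_integral_cong)
    fix s assume "s \<in> space mu"
    then have s: "s \<in> space (past_space \<pi>)" by simp
    have m: "(\<lambda>a. ennreal (f s a) * emeasure (K s a) G) \<in> borel_measurable \<pi>"
      using measurable_compose[OF measurable_Pair1'[OF s] emeasure_kernel_measurable[OF K_measurable G]] f_measurable1[OF s]
      by simp
    have "(\<integral>\<^sup>+ a. ennreal (f s a) * (\<Phi> s * emeasure (K s a) G) \<partial>\<pi>) = (\<integral>\<^sup>+ a. \<Phi> s * (ennreal (f s a) * emeasure (K s a) G) \<partial>\<pi>)"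
      by (intro nn_integral_cong) (simp only: mult_ac)
    also have "\<dots> = \<Phi> s * (\<integral>\<^sup>+ a. ennreal (f s a) * emeasure (K s a) G \<partial>\<pi>)"
      by (rule nn_integral_cmult[OF m])
    also have "(\<integral>\<^sup>+ a. ennreal (f s a) * emeasure (K s a) G \<partial>\<pi>) = (\<integral>\<^sup>+ u. indicator G u \<partial>noise \<pi>)"
      using K_disintegrate[OF s, of "\<lambda>q. indicator G (snd q)"] by (simp add: sets_K)
    finally show "(\<integral>\<^sup>+ a. ennreal (f s a) * (\<Phi> s * emeasure (K s a) G) \<partial>\<pi>) = \<Phi> s * emeasure (noise \<pi>) G" by simp
  qed
  also have "\<dots> = emeasure NN Y * emeasure (noise \<pi>) G"
    unfolding eY by (rule nn_integral_multc) measurable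
  finally show ?thesis .
qed

end

section \<open>Approximation of events in completed sigma-fields\<close>

lemma completion_null_diff:
  assumes "prob_space N" "Y \<in> sets (completion N)" "Y' \<in> sets N" "(Y - Y') \<union> (Y' - Y) \<in> null_sets (completion N)"
  shows "measure (completion N) Y = measure N Y'"
proof -
  have "AE p in completion N. p \<in> Y \<longleftrightarrow> p \<in> Y'"
    by (rule AE_I'[OF assms(4)]) auto
  then have "measure (completion N) Y = measure (completion N) Y'"
    using assms(2,3) by (intro measure_eq_AE) auto
  then show ?thesis using assms(3) by simp
qed

lemma sets_natural_filtration_completion:
  assumes "\<And>k. X k \<in> measurable N E"
  shows "sets (natural_filtration N E X n) \<subseteq> sets (completion N)"
  by (rule natural_filtration_le) (auto intro: measurable_completion assms)

text \<open>By Borel-Cantelli a subsequence of the approximating events converges almost surely.\<close>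

lemma sets_if_approx:
  assumes "prob_space N" and T: "space T = space N" "null_sets (completion N) \<subseteq> sets T"
    and Y: "Y \<in> sets N" and C: "\<And>k. C k \<in> sets T" "\<And>k. C k \<in> sets N"
    and lim: "(\<lambda>k. emeasure N ((Y - C k) \<union> (C k - Y))) \<longlonglongrightarrow> 0"
  shows "Y \<in> sets T"
proof -
  interpret prob_space N by fact
  have "\<exists>k. emeasure N ((Y - C k) \<union> (C k - Y)) < ennreal ((1 / 2) ^ i)" for i
  proof -
    have "\<forall>\<^sub>F k in sequentially. emeasure N ((Y - C k) \<union> (C k - Y)) < ennreal ((1 / 2) ^ i)"
      using lim by (rule order_tendstoD) simp
    then show ?thesis by (auto simp: eventually_sequentially)
  qed
  then obtain r where r: "\<And>i. emeasure N ((Y - C (r i)) \<union> (C (r i) - Y)) < ennreal ((1 / 2) ^ i)" by metis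
  let ?A = "\<lambda>i. (Y - C (r i)) \<union> (C (r i) - Y)"
  have A: "?A i \<in> sets N" for i using Y C(2) by auto
  have "limsup ?A \<in> null_sets N"
  proof (rule borel_cantelli_limsup1)
    show "?A i \<in> sets N" for i by (rule A)
    show "emeasure N (?A i) < \<infinity>" for i by (simp add: less_top[symmetric])
    have "measure N (?A i) \<le> (1 / 2) ^ i" for i
    proof -
      have "ennreal (measure N (?A i)) < ennreal ((1 / 2) ^ i)"
        using r[of i] by (simp add: emeasure_eq_measure)
      then show ?thesis by (subst (asm) ennreal_less_iff) auto
    qed
    then show "summable (\<lambda>i. measure N (?A i))"
      by (intro summable_comparison_test'[OF summable_geometric[of "1 / 2 :: real"], of 0]) auto
  qed
  then have null: "limsup ?A \<in> null_sets (completion N)" by (rule null_sets_completionI)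
  \<comment> \<open>The upper limit of the approximating events differs from \<open>Y\<close> only
    inside the upper limit of the differences, a null event whose subsets all lie in
    \<open>T\<close>.\<close>
  let ?L = "\<Inter>i. \<Union>j\<in>{i..}. C (r j)"
  have L: "?L \<in> sets T" using C(1) by (intro sets.countable_INT' sets.countable_UN') auto
  have sub: "Z \<in> sets T" if "Z \<subseteq> limsup ?A" for Z
    using T(2) null_sets_completion_subset[OF that null] by blast
  have ls: "limsup ?A = (\<Inter>i. \<Union>j\<in>{i..}. ?A j)"
    by (simp add: limsup_INF_SUP)
  have "?L - Y \<in> sets T" by (rule sub) (unfold ls, blast)
  moreover have "Y - ?L \<in> sets T"
  proof (rule sub)
    show "Y - ?L \<subseteq> limsup ?A"
    proof
      fix p assume p: "p \<in> Y - ?L"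
      then obtain i where i: "\<And>j. i \<le> j \<Longrightarrow> p \<notin> C (r j)" by auto
      have "\<exists>j\<in>{i'..}. p \<in> ?A j" for i'
        using p i[of "max i i'"] by (intro bexI[of _ "max i i'"]) auto
      then show "p \<in> limsup ?A" unfolding ls by blast
    qed
  qed
  ultimately have "(?L - (?L - Y)) \<union> (Y - ?L) \<in> sets T" using L by auto
  moreover have "(?L - (?L - Y)) \<union> (Y - ?L) = Y" by blast
  ultimately show ?thesis by simp
qed

lemma emeasure_density_indicator:
  assumes Z: "Z \<in> sets N" and W: "W \<in> sets N"
  shows "emeasure (density N (indicator Z)) W = emeasure N (Z \<inter> W)"
proof -
  have "emeasure (density N (indicator Z)) W = (\<integral>\<^sup>+ p. indicator Z p * indicator W p \<partial>N)"
    using W Z by (intro emeasure_density) simp_all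
  also have "\<dots> = (\<integral>\<^sup>+ p. indicator (Z \<inter> W) p \<partial>N)"
    by (intro nn_integral_cong) (simp add: indicator_def)
  finally show ?thesis using Z W by simp
qed

section \<open>The noises parametrize the process\<close>

context chain
begin

text \<open>The information at time \<open>n\<close> before completion. Independence is proved here
  from an intersection-stable generator; the completed filtration follows because each of its sets
  differs from one in \<open>Wm n\<close> by a null event.\<close>

definition Wm :: "int \<Rightarrow> ('w \<times> (int \<Rightarrow> nat \<Rightarrow> 'e \<times> real)) measure" where
  "Wm n = sigma (space NN) (boxes n)"

lemma boxes_space: "boxes n \<subseteq> Pow (space NN)"
  using boxes_sets sets.sets_into_space by blast

lemma space_Wm: "space (Wm n) = space NN" and sets_Wm: "sets (Wm n) = sigma_sets (space NN) (boxes n)"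
  unfolding Wm_def using boxes_space by (auto intro: space_measure_of sets_measure_of)

lemma sets_Wm_NN: "sets (Wm n) \<subseteq> sets NN"
  unfolding sets_Wm using boxes_sets by (rule sets.sigma_sets_subset)

lemma box_in_boxes:
  assumes "A \<in> sets (past_space \<pi>)" "finite J" "J \<subseteq> {..n}" "\<And>k. C k \<in> sets (noise \<pi>)"
  shows "{p \<in> space NN. past X n (fst p) \<in> A \<and> (\<forall>k\<in>J. snd p k \<in> C k)} \<in> boxes n"
  unfolding boxes_def using assms by blast

lemma past_Wm: "(\<lambda>p. past X n (fst p)) \<in> measurable (Wm n) (past_space \<pi>)"
proof (rule measurableI)
  show "past X n (fst p) \<in> space (past_space \<pi>)" if "p \<in> space (Wm n)" for p
    using measurable_space[OF pastN_measurable] that unfolding space_Wm .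
  fix A assume "A \<in> sets (past_space \<pi>)"
  from box_in_boxes[OF this, of "{}" n "\<lambda>_. {}"]
  have "{p \<in> space NN. past X n (fst p) \<in> A} \<in> boxes n" by simp
  then show "(\<lambda>p. past X n (fst p)) -` A \<inter> space (Wm n) \<in> sets (Wm n)"
    unfolding sets_Wm space_Wm by (intro sigma_sets.Basic) (simp add: vimage_def Int_def conj_commute)
qed

lemma noise_Wm: "k \<le> n \<Longrightarrow> (\<lambda>p. snd p k) \<in> measurable (Wm n) (noise \<pi>)"
proof (rule measurableI)
  show "snd p k \<in> space (noise \<pi>)" if "p \<in> space (Wm n)" for p
    using measurable_space[OF snd_NN] that unfolding space_Wm .
  fix A assume k: "k \<le> n" and A: "A \<in> sets (noise \<pi>)"
  have "{p \<in> space NN. past X n (fst p) \<in> space (past_space \<pi>) \<and> (\<forall>k\<in>{k}. snd p k \<in> A)} \<in> boxes n"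
    using k A by (intro box_in_boxes) auto
  moreover have "{p \<in> space NN. past X n (fst p) \<in> space (past_space \<pi>) \<and> (\<forall>k\<in>{k}. snd p k \<in> A)}
      = (\<lambda>p. snd p k) -` A \<inter> space (Wm n)"
    unfolding space_Wm using measurable_space[OF pastN_measurable] by auto
  ultimately show "(\<lambda>p. snd p k) -` A \<inter> space (Wm n) \<in> sets (Wm n)"
    unfolding sets_Wm by (simp add: sigma_sets.Basic)
qed

lemma X_Wm:
  assumes "k \<le> n"
  shows "(\<lambda>p. X k (fst p)) \<in> measurable (Wm n) \<pi>"
proof -
  have "X k \<omega> = past X n \<omega> (nat (n - k))" for \<omega> using assms by (simp add: past_def)
  then show ?thesis
    using measurable_compose[OF past_Wm measurable_component_singleton, of "nat (n - k)"] by simp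
qed

lemma emeasure_noise_NN:
  assumes "G \<in> sets (noise \<pi>)"
  shows "emeasure NN {p \<in> space NN. snd p n \<in> G} = emeasure (noise \<pi>) G"
proof -
  have "{p \<in> space NN. past X (n - 1) (fst p) \<in> space (past_space \<pi>) \<and> (\<forall>k\<in>{}. snd p k \<in> {})} \<in> boxes (n - 1)"
    by (intro box_in_boxes) auto
  moreover have "{p \<in> space NN. past X (n - 1) (fst p) \<in> space (past_space \<pi>) \<and> (\<forall>k\<in>{}. snd p k \<in> {})} = space NN"
    using measurable_space[OF pastN_measurable] by auto
  ultimately have "space NN \<in> boxes (n - 1)" by simp
  from emeasure_box_step[OF this assms] show ?thesis
    by (simp add: NN.emeasure_space_1 Int_absorb1)
qed

lemma distr_noise_NN: "distr NN (noise \<pi>) (\<lambda>p. snd p n) = noise \<pi>"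
proof (rule measure_eqI)
  fix G assume "G \<in> sets (distr NN (noise \<pi>) (\<lambda>p. snd p n))"
  then have G: "G \<in> sets (noise \<pi>)" by simp
  show "emeasure (distr NN (noise \<pi>) (\<lambda>p. snd p n)) G = emeasure (noise \<pi>) G"
    using emeasure_noise_NN[OF G, of n] G
    by (simp add: emeasure_distr[OF snd_NN] vimage_def Int_def conj_commute)
qed simp

lemma prob_Wm_step:
  assumes "Y \<in> sets (Wm n)" "G \<in> sets (noise \<pi>)"
  shows "NN.prob (Y \<inter> {p \<in> space NN. snd p (n + 1) \<in> G}) = NN.prob Y * NN.prob {p \<in> space NN. snd p (n + 1) \<in> G}"
proof -
  let ?U = "\<lambda>G. {p \<in> space NN. snd p (n + 1) \<in> G}"
  let ?S = "{?U G | G. G \<in> sets (noise \<pi>)}"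
  have U: "?U G \<in> sets NN" if [measurable]: "G \<in> sets (noise \<pi>)" for G by measurable
  have "NN.indep_set (boxes n) ?S"
  proof (rule NN.indep_setI)
    show "boxes n \<subseteq> sets NN" by (rule boxes_sets)
    show "?S \<subseteq> sets NN" using U by blast
    fix a b assume a: "a \<in> boxes n" and "b \<in> ?S"
    then obtain G where G: "b = ?U G" "G \<in> sets (noise \<pi>)" by blast
    have "ennreal (NN.prob (a \<inter> b)) = ennreal (NN.prob a * NN.prob b)"
      using emeasure_box_step[OF a G(2)] emeasure_noise_NN[OF G(2), of "n + 1"]
      by (simp add: G(1) NN.emeasure_eq_measure ennreal_mult' flip: ennreal_mult)
    then show "NN.prob (a \<inter> b) = NN.prob a * NN.prob b" by (subst (asm) ennreal_inj) auto
  qed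
  moreover have "Int_stable ?S"
    unfolding Int_stable_def
  proof (intro ballI)
    fix a b assume "a \<in> ?S" "b \<in> ?S"
    then obtain G G' where "a = ?U G" "b = ?U G'" "G \<in> sets (noise \<pi>)" "G' \<in> sets (noise \<pi>)" by blast
    then have "a \<inter> b = ?U (G \<inter> G')" "G \<inter> G' \<in> sets (noise \<pi>)" by auto
    then show "a \<inter> b \<in> ?S" by blast
  qed
  ultimately have "NN.indep_set (sigma_sets (space NN) (boxes n)) (sigma_sets (space NN) ?S)"
    by (intro NN.indep_set_sigma_sets Int_stable_boxes)
  moreover have "?U G \<in> sigma_sets (space NN) ?S" using assms(2) by (intro sigma_sets.Basic) blast
  ultimately show ?thesis
    using assms(1) unfolding sets_Wm by (metis (no_types, lifting) NN.indep_setD)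
qed

abbreviation XN :: "int \<Rightarrow> 'w \<times> (int \<Rightarrow> nat \<Rightarrow> 'e \<times> real) \<Rightarrow> 'e" where
  "XN n \<equiv> X n \<circ> fst"

abbreviation UU :: "int \<Rightarrow> 'w \<times> (int \<Rightarrow> nat \<Rightarrow> 'e \<times> real) \<Rightarrow> nat \<Rightarrow> 'e \<times> real" where
  "UU n \<equiv> (\<lambda>p. snd p n)"

lemma XN_meas: "XN n \<in> measurable NN \<pi>"
  using XN_measurable by (simp add: comp_def)

lemma indep_natural_filtration:
  "prob_space.indep_set (completion NN) {UU (n + 1) -` A \<inter> space NN | A. A \<in> sets (noise \<pi>)}
     (sets (natural_filtration NN (\<pi> \<Otimes>\<^sub>M noise \<pi>) (\<lambda>k \<omega>. (XN k \<omega>, UU k \<omega>)) n))"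
proof -
  let ?F = "natural_filtration NN (\<pi> \<Otimes>\<^sub>M noise \<pi>) (\<lambda>k \<omega>. (XN k \<omega>, UU k \<omega>)) n"
  interpret C: prob_space "completion NN" by (rule NN.prob_space_completion)
  have XU: "(\<lambda>\<omega>. (XN k \<omega>, UU k \<omega>)) \<in> measurable NN (\<pi> \<Otimes>\<^sub>M noise \<pi>)" for k
    by (rule measurable_Pair[OF XN_meas snd_NN])
  have XU': "(\<lambda>\<omega>. (XN k \<omega>, UU k \<omega>)) \<in> measurable (Wm n) (\<pi> \<Otimes>\<^sub>M noise \<pi>)" if "k \<le> n" for k
    using measurable_Pair[OF X_Wm[OF that] noise_Wm[OF that]] by (simp add: comp_def)
  show ?thesis
  proof (rule C.indep_setI)
    show "{UU (n + 1) -` A \<inter> space NN | A. A \<in> sets (noise \<pi>)} \<subseteq> sets (completion NN)"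
      using measurable_sets[OF snd_NN] by auto
    show F: "sets ?F \<subseteq> sets (completion NN)"
      by (rule sets_natural_filtration_completion[OF XU])
    fix a y assume "a \<in> {UU (n + 1) -` A \<inter> space NN | A. A \<in> sets (noise \<pi>)}" and y: "y \<in> sets ?F"
    then obtain G where G: "G \<in> sets (noise \<pi>)" "a = UU (n + 1) -` G \<inter> space NN" by auto
    then have a: "a = {p \<in> space NN. snd p (n + 1) \<in> G}" by auto
    have aN: "a \<in> sets NN" unfolding G(2) using snd_NN G(1) by (rule measurable_sets)
    let ?G = "sets (Wm n)"
    have "sigma_sets (space NN) ({(\<lambda>\<omega>. (XN k \<omega>, UU k \<omega>)) -` A \<inter> space NN | k A. k \<le> n \<and> A \<in> sets (\<pi> \<Otimes>\<^sub>M noise \<pi>)} \<union> null_sets (completion NN))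
        \<subseteq> sigma_sets (space NN) (?G \<union> null_sets (completion NN))"
      using measurable_sets[OF XU'] unfolding space_Wm by (intro sigma_sets_mono') blast
    then have ysig: "y \<in> sigma_sets (space NN) (?G \<union> null_sets (completion NN))"
      using y unfolding sets_natural_filtration by (rule subsetD)
    have Gs: "?G \<subseteq> Pow (space NN)" using sets.space_closed[of "Wm n"] unfolding space_Wm .
    from sigma_sets_null_approx[OF Gs ysig] obtain y' where y's: "y' \<in> sigma_sets (space NN) ?G"
      and null: "(y - y') \<union> (y' - y) \<in> null_sets (completion NN)"
      by (rule bexE)
    from y's have y': "y' \<in> sets (Wm n)" using sets.sigma_sets_eq[of "Wm n"] unfolding space_Wm by simp
    then have y'N: "y' \<in> sets NN" using sets_Wm_NN by blast
    have "C.prob (a \<inter> y) = NN.prob (a \<inter> y')"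
    proof (rule completion_null_diff[OF NN.prob_space_axioms])
      show "a \<inter> y \<in> sets (completion NN)" using aN y F by auto
      show "a \<inter> y' \<in> sets NN" using aN y'N by auto
      show "(a \<inter> y - a \<inter> y') \<union> (a \<inter> y' - a \<inter> y) \<in> null_sets (completion NN)"
        by (rule null_sets_completion_subset[OF _ null]) blast
    qed
    also have "\<dots> = NN.prob y' * NN.prob a"
      using prob_Wm_step[OF y' G(1)] unfolding a by (simp add: Int_commute)
    also have "NN.prob y' = C.prob y"
      using y F by (intro completion_null_diff[OF NN.prob_space_axioms _ y'N null, symmetric]) auto
    also have "NN.prob a = C.prob a" using aN by simp
    finally show "C.prob (a \<inter> y) = C.prob a * C.prob y" by simp
  qed
qed

text \<open>The next letter is weakly equal to a measurable function of the past and the next noise;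
  completeness of the sigma-field turns weak equality into measurability.\<close>

lemma parametrization_NN: "parametrization NN \<pi> XN (noise \<pi>) UU"
  unfolding parametrization_def
proof (intro conjI allI)
  show "UU n \<in> measurable NN (noise \<pi>)" for n by (rule snd_NN)
  show "prob_space.indep_set (completion NN) {UU (n + 1) -` A \<inter> space NN | A. A \<in> sets (noise \<pi>)}
     (sets (natural_filtration NN (\<pi> \<Otimes>\<^sub>M noise \<pi>) (\<lambda>k \<omega>. (XN k \<omega>, UU k \<omega>)) n))" for n
    by (rule indep_natural_filtration)
  fix n
  let ?gen = "{UU (n + 1) -` A \<inter> space NN | A. A \<in> sets (noise \<pi>)} \<union> sets (natural_filtration NN \<pi> XN n)"
  let ?T = "sigma (space NN) ?gen"
  have gen: "?gen \<subseteq> Pow (space NN)"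
    using sets.space_closed[of "natural_filtration NN \<pi> XN n"] unfolding space_natural_filtration by auto
  then have sp: "space ?T = space NN" and st: "sets ?T = sigma_sets (space NN) ?gen"
    by (auto intro: space_measure_of sets_measure_of)
  have FT: "sets (natural_filtration NN \<pi> XN n) \<subseteq> sets ?T" unfolding st by auto
  have XT: "XN k \<in> measurable ?T \<pi>" if "k \<le> n" for k
  proof (rule measurableI)
    show "XN k p \<in> space \<pi>" if "p \<in> space ?T" for p
      using measurable_space[OF XN_meas] that unfolding sp .
    fix A assume "A \<in> sets \<pi>"
    from measurable_sets[OF measurable_natural_filtration[where X = XN, OF \<open>k \<le> n\<close> XN_meas] this]
    show "XN k -` A \<inter> space ?T \<in> sets ?T"
      using FT unfolding sp space_natural_filtration by blast
  qed
  have pT [measurable]: "(\<lambda>p. past X n (fst p)) \<in> measurable ?T (past_space \<pi>)"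
    unfolding past_def by (rule measurable_PiM_UNIV) (use XT in \<open>simp add: comp_def\<close>)
  have uT [measurable]: "UU (n + 1) \<in> measurable ?T (noise \<pi>)"
  proof (rule measurableI)
    show "UU (n + 1) p \<in> space (noise \<pi>)" if "p \<in> space ?T" for p
      using measurable_space[OF snd_NN] that unfolding sp .
    show "UU (n + 1) -` A \<inter> space ?T \<in> sets ?T" if "A \<in> sets (noise \<pi>)" for A
      unfolding st sp using that by (intro sigma_sets.Basic) blast
  qed
  show "XN (n + 1) \<in> measurable ?T \<pi>"
  proof (rule measurable_if_weq[OF sp _ weq_letter[of "n + 1", folded comp_def]])
    show "null_sets (completion NN) \<subseteq> sets ?T"
      using null_sets_natural_filtration FT by blast
    show "XN (n + 1) \<in> space NN \<rightarrow> space \<pi>"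
      using measurable_space[OF XN_meas] by blast
    show "(\<lambda>p. letter (f (past X (n + 1 - 1) (fst p))) (snd p (n + 1))) \<in> measurable ?T \<pi>"
      by (rule letter_f_measurable) (use pT uT in simp_all)
  qed
qed

section \<open>The process as a chain driven by its own noises\<close>

definition fut :: "int \<Rightarrow> 'w \<times> (int \<Rightarrow> nat \<Rightarrow> 'e \<times> real) \<Rightarrow> nat \<Rightarrow> nat \<Rightarrow> 'e \<times> real" where
  "fut m p i = snd p (m + 1 + int i)"

lemma fut_measurable [measurable]: "fut m \<in> measurable NN noises"
  by (rule measurable_PiM_UNIV) (simp add: fut_def)

text \<open>Later noises are added one at a time: the past and the earlier noises form a box at time
  m + n, and \<open>emeasure_box_step\<close> splits off the next factor.\<close>

lemma emeasure_past_fut: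
  assumes A [measurable]: "A \<in> sets (past_space \<pi>)" and C [measurable]: "\<And>i. C i \<in> sets (noise \<pi>)"
  shows "emeasure NN {p \<in> space NN. past X m (fst p) \<in> A \<and> (\<forall>i<n. fut m p i \<in> C i)}
     = emeasure mu A * (\<Prod>i<n. emeasure (noise \<pi>) (C i))"
proof (induction n)
  case 0
  have Am: "{p \<in> space NN. past X m (fst p) \<in> A} \<in> sets NN" by measurable
  have "emeasure NN {p \<in> space NN. past X m (fst p) \<in> A} = emeasure NN (fst -` {\<omega> \<in> space M. past X m \<omega> \<in> A} \<inter> space NN)"
    by (rule arg_cong[where f = "emeasure NN"]) (auto simp: space_NN)
  also have "\<dots> = emeasure (distr NN M fst) {\<omega> \<in> space M. past X m \<omega> \<in> A}"
    by (rule emeasure_distr[symmetric]) measurable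
  also have "\<dots> = emeasure (distr M (past_space \<pi>) (past X m)) A"
    unfolding distr_NN_fst by (subst emeasure_distr) (auto intro!: arg_cong[where f = "emeasure M"])
  finally show ?case by (simp add: distr_past)
next
  case (Suc n)
  let ?Y = "{p \<in> space NN. past X m (fst p) \<in> A \<and> (\<forall>i<n. fut m p i \<in> C i)}"
  let ?A = "(\<lambda>s j. s (j + n)) -` A \<inter> space (past_space \<pi>)"
  let ?J = "(\<lambda>i. m + 1 + int i) ` {..<n}"
  let ?C = "\<lambda>k. C (nat (k - (m + 1)))"
  have "(\<lambda>s (j::nat). s (j + n)) \<in> measurable (past_space \<pi>) (past_space \<pi>)"
    by (rule measurable_PiM_UNIV) (rule measurable_component_singleton, simp)
  then have "?A \<in> sets (past_space \<pi>)" using A by (rule measurable_sets)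
  moreover have "?J \<subseteq> {..m + int n}" by auto
  ultimately have "{p \<in> space NN. past X (m + int n) (fst p) \<in> ?A \<and> (\<forall>k\<in>?J. snd p k \<in> ?C k)} \<in> boxes (m + int n)"
    by (intro box_in_boxes) auto
  moreover have "{p \<in> space NN. past X (m + int n) (fst p) \<in> ?A \<and> (\<forall>k\<in>?J. snd p k \<in> ?C k)} = ?Y"
  proof -
    have "past X (m + int n) (fst p) \<in> ?A \<longleftrightarrow> past X m (fst p) \<in> A" if "p \<in> space NN" for p
    proof -
      have "(\<lambda>j. past X (m + int n) (fst p) (j + n)) = past X m (fst p)"
        by (simp add: past_def fun_eq_iff algebra_simps)
      then show ?thesis using measurable_space[OF pastN_measurable that, of "m + int n"] by simp
    qed
    then show ?thesis by (auto simp: fut_def)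
  qed
  ultimately have Y: "?Y \<in> boxes (m + int n)" by simp
  have "{p \<in> space NN. past X m (fst p) \<in> A \<and> (\<forall>i<Suc n. fut m p i \<in> C i)}
      = ?Y \<inter> {p \<in> space NN. snd p (m + int n + 1) \<in> C n}"
    by (auto simp: less_Suc_eq fut_def algebra_simps)
  also have "emeasure NN \<dots> = emeasure NN ?Y * emeasure (noise \<pi>) (C n)"
    by (rule emeasure_box_step[OF Y C])
  finally show ?case using Suc by (simp add: mult.assoc)
qed

text \<open>For a fixed set of pasts both sides are finite measures in the noises, and
  \<open>emeasure_past_fut\<close> compares them on cylinders. The result identifies the pair with
  the starting point and the noise that are integrated in \<open>ex_seeds\<close>.\<close>

lemma distr_past_fut: "distr NN (past_space \<pi> \<Otimes>\<^sub>M noises) (\<lambda>p. (past X m (fst p), fut m p)) = mu \<Otimes>\<^sub>M noises"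
proof (rule measure_eqI_rectangles[where P = "past_space \<pi>" and Q = noises])
  let ?D = "distr NN (past_space \<pi> \<Otimes>\<^sub>M noises) (\<lambda>p. (past X m (fst p), fut m p))"
  interpret D: prob_space ?D by (rule NN.prob_space_distr) measurable
  show "finite_measure ?D" by unfold_locales
  show "sets (mu \<Otimes>\<^sub>M noises) = sets (past_space \<pi> \<Otimes>\<^sub>M noises)"
    by (rule sets_pair_measure_cong) simp_all
  fix A G assume A [measurable]: "A \<in> sets (past_space \<pi>)" and G [measurable]: "G \<in> sets noises"
  let ?\<nu> = "distr (density NN (indicator {p \<in> space NN. past X m (fst p) \<in> A})) noises (fut m)"
  have Am [measurable]: "{p \<in> space NN. past X m (fst p) \<in> A} \<in> sets NN" by measurable
  have \<nu>: "emeasure ?\<nu> G' = emeasure NN {p \<in> space NN. past X m (fst p) \<in> A \<and> fut m p \<in> G'}" if G' [measurable]: "G' \<in> sets noises" for G'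
  proof -
    have "emeasure ?\<nu> G' = emeasure (density NN (indicator {p \<in> space NN. past X m (fst p) \<in> A})) (fut m -` G' \<inter> space NN)"
      by (subst emeasure_distr) auto
    also have "\<dots> = emeasure NN ({p \<in> space NN. past X m (fst p) \<in> A} \<inter> (fut m -` G' \<inter> space NN))"
      by (rule emeasure_density_indicator) measurable
    finally show ?thesis by (simp add: Int_def vimage_def conj_ac cong: conj_cong)
  qed
  have "?\<nu> = scale_measure (emeasure mu A) noises"
  proof (rule measure_eqI_PiM_infinite)
    show "sets ?\<nu> = sets noises" "sets (scale_measure (emeasure mu A) noises) = sets noises" by simp_all
    have "emeasure ?\<nu> (space noises) \<noteq> \<infinity>" by (subst \<nu>) auto
    then show "finite_measure ?\<nu>" by (intro finite_measureI) simp
    fix C and J :: "nat set" assume J: "finite J" "J \<subseteq> UNIV" and C: "\<And>i. i \<in> J \<Longrightarrow> C i \<in> sets (noise \<pi>)"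
    let ?C = "\<lambda>i. if i \<in> J then C i else space (noise \<pi>)"
    obtain n where n: "J \<subseteq> {..<n}" using J(1) finite_nat_iff_bounded by blast
    have sp: "snd p k \<in> space (noise \<pi>)" if "p \<in> space NN" for p k by (rule measurable_space[OF snd_NN that])
    have E: "prod_emb UNIV (\<lambda>_. noise \<pi>) J (Pi\<^sub>E J C) \<in> sets noises" using J C by (intro sets_PiM_I) auto
    have "emeasure ?\<nu> (prod_emb UNIV (\<lambda>_. noise \<pi>) J (Pi\<^sub>E J C))
        = emeasure NN {p \<in> space NN. past X m (fst p) \<in> A \<and> (\<forall>i<n. fut m p i \<in> ?C i)}"
      unfolding \<nu>[OF E]
    proof (rule arg_cong[where f = "emeasure NN"], intro Collect_cong conj_cong refl)
      fix p assume p: "p \<in> space NN"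
      have "fut m p \<in> space noises" by (rule measurable_space[OF fut_measurable p])
      then have "fut m p \<in> prod_emb UNIV (\<lambda>_. noise \<pi>) J (Pi\<^sub>E J C) \<longleftrightarrow> (\<forall>i\<in>J. fut m p i \<in> C i)"
        by (simp add: prod_emb_def space_PiM PiE_iff)
      also have "\<dots> \<longleftrightarrow> (\<forall>i<n. fut m p i \<in> ?C i)"
        using n sp[OF p] by (auto simp: fut_def)
      finally show "fut m p \<in> prod_emb UNIV (\<lambda>_. noise \<pi>) J (Pi\<^sub>E J C) \<longleftrightarrow> (\<forall>i<n. fut m p i \<in> ?C i)" .
    qed
    also have "\<dots> = emeasure mu A * (\<Prod>i<n. emeasure (noise \<pi>) (?C i))"
      using C by (intro emeasure_past_fut A) simp
    also have "(\<Prod>i<n. emeasure (noise \<pi>) (?C i)) = (\<Prod>i\<in>J. emeasure (noise \<pi>) (C i))"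
      using n by (intro prod.mono_neutral_cong_right) (auto simp: noise.P.emeasure_space_1)
    also have "\<dots> = emeasure noises (prod_emb UNIV (\<lambda>_. noise \<pi>) J (Pi\<^sub>E J C))"
      using J C by (intro V.emeasure_PiM_emb[symmetric]) auto
    finally show "emeasure ?\<nu> (prod_emb UNIV (\<lambda>_. noise \<pi>) J (Pi\<^sub>E J C))
        = emeasure (scale_measure (emeasure mu A) noises) (prod_emb UNIV (\<lambda>_. noise \<pi>) J (Pi\<^sub>E J C))"
      by simp
  qed
  then have "emeasure ?\<nu> G = emeasure mu A * emeasure noises G" by simp
  moreover have "emeasure ?D (A \<times> G) = emeasure ?\<nu> G"
    unfolding \<nu>[OF G] by (subst emeasure_distr) (auto intro!: arg_cong[where f = "emeasure NN"])
  ultimately show "emeasure ?D (A \<times> G) = emeasure (mu \<Otimes>\<^sub>M noises) (A \<times> G)"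
    by (subst V.P.emeasure_pair_measure_Times) simp_all
qed simp

text \<open>Two replacements per step: the new letter by the one that the noise chooses, then the
  true past inside the transition by the chain. Both keep weak equality, being images under jointly
  measurable maps. Entry \<open>i\<close> of \<open>fut m\<close> is the noise of time m + 1 + i, so
  \<open>k\<close> steps lead to time m + k.\<close>

lemma weq_run: "weq NN (past_space \<pi>) (\<lambda>p. past X (m + int k) (fst p)) (\<lambda>p. run (past X m (fst p)) (fut m p) k)"
proof (induction k)
  case 0
  show ?case by (simp add: weq_refl)
next
  case (Suc k)
  let ?n = "m + int k"
  have n: "m + int (Suc k) = ?n + 1" by simp
  have u: "fut m p k = snd p (?n + 1)" for p by (simp add: fut_def algebra_simps)
  have R [measurable]: "(\<lambda>p. run (past X m (fst p)) (fut m p) i) \<in> measurable NN (past_space \<pi>)" for i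
    by (rule run_measurable) measurable
  have l [measurable]: "(\<lambda>p. letter (f (past X ?n (fst p))) (snd p (?n + 1))) \<in> measurable NN \<pi>"
    by (rule letter_f_measurable) measurable
  have "weq NN (past_space \<pi>) (\<lambda>p. past X (?n + 1) (fst p)) (\<lambda>p. step (past X ?n (fst p)) (snd p (?n + 1)))"
    using weq_compose[where h = "\<lambda>q. case_nat (fst q) (snd q)" and Q = "past_space \<pi>",
        OF XN_measurable l pastN_measurable[of ?n] weq_letter[of "?n + 1", unfolded add_diff_cancel_right']]
    unfolding step_def by (simp add: past_Suc[of X "?n + 1"])
  moreover have "weq NN (past_space \<pi>) (\<lambda>p. step (past X ?n (fst p)) (snd p (?n + 1)))
      (\<lambda>p. step (run (past X m (fst p)) (fut m p) k) (snd p (?n + 1)))"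
    using weq_compose[where h = "\<lambda>q. step (fst q) (snd q)" and Q = "past_space \<pi>",
        OF pastN_measurable R snd_NN[of "?n + 1"] Suc.IH]
    by simp
  ultimately have "weq NN (past_space \<pi>) (\<lambda>p. past X (?n + 1) (fst p)) (\<lambda>p. step (run (past X m (fst p)) (fut m p) k) (snd p (?n + 1)))"
    by (rule weq_trans) measurable
  then show ?case by (simp only: n run.simps u)
qed

lemma weq_letter_run:
  "weq NN \<pi> (\<lambda>p. X (m + 1 + int k) (fst p)) (\<lambda>p. letter (f (run (past X m (fst p)) (fut m p) k)) (fut m p k))"
proof -
  let ?n = "m + int k"
  have u: "fut m p k = snd p (?n + 1)" for p by (simp add: fut_def algebra_simps)
  have R [measurable]: "(\<lambda>p. run (past X m (fst p)) (fut m p) k) \<in> measurable NN (past_space \<pi>)"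
    by (rule run_measurable) measurable
  have "weq NN \<pi> (\<lambda>p. X (?n + 1) (fst p)) (\<lambda>p. letter (f (past X ?n (fst p))) (snd p (?n + 1)))"
    using weq_letter[of "?n + 1"] by simp
  moreover have "weq NN \<pi> (\<lambda>p. letter (f (past X ?n (fst p))) (snd p (?n + 1)))
      (\<lambda>p. letter (f (run (past X m (fst p)) (fut m p) k)) (snd p (?n + 1)))"
    using weq_compose[where h = "\<lambda>q. letter (f (fst q)) (snd q)" and Q = \<pi>,
        OF pastN_measurable R snd_NN[of "?n + 1"] weq_run]
    by (simp add: letter_f_measurable)
  ultimately have "weq NN \<pi> (\<lambda>p. X (?n + 1) (fst p)) (\<lambda>p. letter (f (run (past X m (fst p)) (fut m p) k)) (snd p (?n + 1)))"
    by (rule weq_trans[OF _ _ XN_measurable letter_f_measurable[OF R snd_NN]])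
  then show ?thesis by (simp add: u algebra_simps)
qed

end

section \<open>Measurability with respect to the noises\<close>

context coupled_chain
begin

text \<open>The chain started from \<open>x k\<close> uses only noises up to time \<open>n\<close>,
  and off the event of disagreement it yields the true letter up to a null event. By the choice of
  the seeds the probability of disagreement tends to 0, which suffices for membership in a completed
  sigma-field.\<close>

lemma X_natural_filtration: "XN n \<in> measurable (natural_filtration NN (noise \<pi>) UU n) \<pi>"
proof (rule measurableI)
  let ?F = "natural_filtration NN (noise \<pi>) UU n"
  show "XN n p \<in> space \<pi>" if "p \<in> space ?F" for p
    using measurable_space[OF XN_meas] that unfolding space_natural_filtration .
  fix A assume A [measurable]: "A \<in> sets \<pi>"
  from ex_seeds obtain x where x': "(\<forall>k. x k \<in> space (past_space \<pi>)) \<and>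
      (\<lambda>k. \<integral>\<^sup>+ s. \<integral>\<^sup>+ v. (if agree s (x k) v k then 0 else 1) \<partial>noises \<partial>mu) \<longlonglongrightarrow> 0"
    by (rule exE)
  then have x: "\<And>k. x k \<in> space (past_space \<pi>)" by simp
  from x' have lim: "(\<lambda>k. \<integral>\<^sup>+ s. \<integral>\<^sup>+ v. (if agree s (x k) v k then 0 else 1) \<partial>noises \<partial>mu) \<longlonglongrightarrow> 0"
    by (rule conjunct2)
  \<comment> \<open>The step numbered \<open>k\<close>, counted from 0, after a start at time
    \<open>m k\<close> produces the letter of time \<open>n\<close>; hence the extra 1.\<close>
  define m where "m k = n - 1 - int k" for k
  have mk: "m k + 1 + int k = n" for k by (simp add: m_def)
  define c where "c k p = letter (f (run (x k) (fut (m k) p) k)) (fut (m k) p k)" for k p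
  have futF: "(\<lambda>p. fut (m k) p i) \<in> measurable ?F (noise \<pi>)" if "i \<le> k" for k i
    unfolding fut_def by (rule measurable_natural_filtration[where X = UU, OF _ snd_NN]) (use that mk[of k] in simp)
  \<comment> \<open>\<open>fut\<close> also contains noises after time \<open>n\<close>. Steps up to
    \<open>k\<close> do not read them, so they are overwritten by a constant to make the argument
    measurable at time \<open>n\<close>.\<close>
  obtain u0 where u0: "u0 \<in> space (noise \<pi>)" using noise.P.not_empty by blast
  have cF: "c k \<in> measurable ?F \<pi>" for k
  proof -
    let ?v = "\<lambda>p i. if i \<le> k then fut (m k) p i else u0"
    have v: "?v \<in> measurable ?F noises"
    proof (rule measurable_PiM_UNIV)
      show "(\<lambda>p. ?v p i) \<in> measurable ?F (noise \<pi>)" for i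
        using futF u0 by (cases "i \<le> k") simp_all
    qed
    have "c k = (\<lambda>p. letter (f (run (x k) (?v p) k)) (?v p k))"
    proof
      fix p
      have "run (x k) (?v p) k = run (x k) (fut (m k) p) k" by (rule run_cong) simp
      then show "c k p = letter (f (run (x k) (?v p) k)) (?v p k)" by (simp add: c_def)
    qed
    also have "\<dots> \<in> measurable ?F \<pi>"
      by (rule letter_f_measurable[OF run_measurable[OF _ v] measurable_compose[OF v measurable_component_singleton]])
         (use x in simp_all)
    finally show ?thesis .
  qed
  have cN [measurable]: "c k \<in> measurable NN \<pi>" for k
    unfolding c_def by (rule letter_f_measurable) (use x in measurable)
  define Y where "Y = {p \<in> space NN. X n (fst p) \<in> A}"
  define Ck where "Ck k = {p \<in> space NN. c k p \<in> A}" for k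
  have [measurable]: "Y \<in> sets NN" "Ck k \<in> sets NN" for k unfolding Y_def Ck_def by measurable
  have "Y \<in> sets ?F"
  proof (rule sets_if_approx[OF NN.prob_space_axioms space_natural_filtration null_sets_natural_filtration, where C = Ck])
    show "Y \<in> sets NN" "Ck k \<in> sets NN" for k by measurable
    show "Ck k \<in> sets ?F" for k
      using measurable_sets[OF cF A, of k] unfolding Ck_def space_natural_filtration by (simp add: vimage_def Int_def conj_commute)
    have "emeasure NN ((Y - Ck k) \<union> (Ck k - Y)) \<le> (\<integral>\<^sup>+ s. \<integral>\<^sup>+ v. (if agree s (x k) v k then 0 else 1) \<partial>noises \<partial>mu)" for k
    proof -
      let ?l = "\<lambda>p. letter (f (run (past X (m k) (fst p)) (fut (m k) p) k)) (fut (m k) p k)"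
      let ?b = "{p \<in> space NN. \<not> agree (past X (m k) (fst p)) (x k) (fut (m k) p) k}"
      let ?z = "{p \<in> space NN. (X n (fst p) \<in> A) \<noteq> (?l p \<in> A)}"
      have z: "?z \<in> null_sets NN"
        using weq_letter_run[of "m k" k] A unfolding mk weq_def by blast
      have b [measurable]: "?b \<in> sets NN" using x by measurable
      \<comment> \<open>Equal positions in the same noise give equal letters, so off the
        disagreement only the null event from weak equality is left.\<close>
      have "(Y - Ck k) \<union> (Ck k - Y) \<subseteq> ?z \<union> ?b"
      proof
        fix p assume p: "p \<in> (Y - Ck k) \<union> (Ck k - Y)"
        then have pN: "p \<in> space NN" by (auto simp: Y_def Ck_def)
        show "p \<in> ?z \<union> ?b"
        proof (cases "agree (past X (m k) (fst p)) (x k) (fut (m k) p) k")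
          case True
          then have "?l p = c k p" by (simp add: agree_def c_def letter_def)
          then show ?thesis using p by (auto simp: Y_def Ck_def)
        qed (use pN in simp)
      qed
      then have "emeasure NN ((Y - Ck k) \<union> (Ck k - Y)) \<le> emeasure NN (?z \<union> ?b)"
        using z b by (intro emeasure_mono) auto
      also have "\<dots> \<le> emeasure NN ?z + emeasure NN ?b"
        using z b by (intro emeasure_subadditive) auto
      also have "emeasure NN ?z = 0" using z by (rule null_setsD1)
      also have "0 + emeasure NN ?b = (\<integral>\<^sup>+ p. (if \<not> agree (past X (m k) (fst p)) (x k) (fut (m k) p) k then 1 else 0) \<partial>NN)"
        unfolding emeasure_Collect_if[OF b] by simp
      also have "\<dots> = (\<integral>\<^sup>+ q. (if agree (fst q) (x k) (snd q) k then 0 else 1) \<partial>distr NN (past_space \<pi> \<Otimes>\<^sub>M noises) (\<lambda>p. (past X (m k) (fst p), fut (m k) p)))"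
        using x by (subst nn_integral_distr) (auto intro!: nn_integral_cong)
      also have "\<dots> = (\<integral>\<^sup>+ s. \<integral>\<^sup>+ v. (if agree s (x k) v k then 0 else 1) \<partial>noises \<partial>mu)"
      proof -
        have "(\<lambda>q. if agree (fst q) (x k) (snd q) k then 0 else 1 :: ennreal) \<in> borel_measurable (mu \<Otimes>\<^sub>M noises)"
        proof -
          have [measurable]: "fst \<in> measurable (mu \<Otimes>\<^sub>M noises) (past_space \<pi>)" by (rule measurable_to_mu) simp
          show ?thesis using x by measurable
        qed
        from V.P.nn_integral_fst[OF this] show ?thesis unfolding distr_past_fut by simp
      qed
      finally show ?thesis .
    qed
    then show "(\<lambda>k. emeasure NN ((Y - Ck k) \<union> (Ck k - Y))) \<longlonglongrightarrow> 0"
      by (intro tendsto_sandwich[OF _ _ tendsto_const lim]) simp_all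
  qed
  then show "XN n -` A \<inter> space ?F \<in> sets ?F"
    unfolding space_natural_filtration Y_def by (simp add: vimage_def Int_def conj_commute)
qed

lemma generating_parametrization_NN: "generating_parametrization NN \<pi> XN (noise \<pi>) UU"
  unfolding generating_parametrization_def using parametrization_NN X_natural_filtration by blast

end

section \<open>From a generating parametrization to immersion\<close>

text \<open>The freezing argument: the identity into \<open>W\<close> and \<open>U\<close> have a
  product law, so the conditional probability of the event given \<open>W\<close> is the measure of
  the section of \<open>A\<close>. As \<open>A\<close> sees the first coordinate only through
  \<open>H\<close>, the measure of the section is even \<open>H\<close>-measurable.\<close>

lemma independent_noise_section:
  assumes P: "prob_space P" and W: "subalgebra P W" and H: "subalgebra W H" and U: "U \<in> measurable P S"
    and ind: "prob_space.indep_set P {U -` A \<inter> space P | A. A \<in> sets S} (sets W)"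
    and A: "A \<in> sets (H \<Otimes>\<^sub>M S)"
  shows "(\<lambda>\<omega>. measure (distr P S U) (Pair \<omega> -` A)) \<in> borel_measurable H"
    and "{\<omega> \<in> space P. (\<omega>, U \<omega>) \<in> A} \<in> sets P"
    and "w \<in> sets W \<Longrightarrow> measure P ({\<omega> \<in> space P. (\<omega>, U \<omega>) \<in> A} \<inter> w)
           = (\<integral>\<omega>\<in>w. measure (distr P S U) (Pair \<omega> -` A) \<partial>P)"
proof -
  interpret prob_space P by fact
  let ?R = "distr P S U" and ?W = "restr_to_subalg P W" and ?th = "\<lambda>\<omega>. measure (distr P S U) (Pair \<omega> -` A)"
  interpret R: prob_space ?R using U by (rule prob_space_distr)
  have sp: "space W = space P" "space H = space P" and WP: "sets W \<subseteq> sets P" and HW: "sets H \<subseteq> sets W"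
    using W H by (auto simp: subalgebra_def)
  have sW: "sets ?W = sets W" using W by (rule sets_restr_to_subalg)
  have AS: "A \<in> sets (H \<Otimes>\<^sub>M ?R)" using A by (simp cong: sets_pair_measure_cong)
  show th: "?th \<in> borel_measurable H"
    using R.measurable_emeasure_Pair[OF AS] unfolding measure_def by measurable
  have thW: "?th \<in> borel_measurable W" using H th by (rule measurable_from_subalg)
  have thP: "?th \<in> borel_measurable P" using W thW by (rule measurable_from_subalg)
  have AW: "A \<in> sets (W \<Otimes>\<^sub>M S)"
  proof -
    have "id \<in> measurable W H" using HW by (intro measurableI) (auto simp: sp)
    then have "(\<lambda>p. (fst p, snd p)) \<in> measurable (W \<Otimes>\<^sub>M S) (H \<Otimes>\<^sub>M S)"
      using measurable_compose[OF measurable_fst, of id W H S] by (intro measurable_Pair measurable_snd) simp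
    from measurable_sets[OF this A] sets.sets_into_space[OF A] show ?thesis
      by (simp add: space_pair_measure sp Int_absorb2)
  qed
  have idW: "(\<lambda>\<omega>. \<omega>) \<in> measurable P W" using WP by (intro measurableI) (auto simp: sp)
  have pairW: "(\<lambda>\<omega>. (\<omega>, U \<omega>)) \<in> measurable P (W \<Otimes>\<^sub>M S)" using idW U by (rule measurable_Pair)
  have pre: "{\<omega> \<in> space P. (\<omega>, U \<omega>) \<in> B} \<in> sets P" if "B \<in> sets (W \<Otimes>\<^sub>M S)" for B
    using measurable_sets[OF pairW that] by (simp add: vimage_def Int_def conj_commute)
  show a: "{\<omega> \<in> space P. (\<omega>, U \<omega>) \<in> A} \<in> sets P" using AW by (rule pre)
  interpret W: prob_space ?W using W by (rule prob_space_restr_to_subalg) (rule prob_space_axioms)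
  interpret WR: pair_prob_space ?W ?R ..
  have sets_WR: "sets (?W \<Otimes>\<^sub>M ?R) = sets (W \<Otimes>\<^sub>M S)" by (intro sets_pair_measure_cong sW) simp
  have J: "distr P (W \<Otimes>\<^sub>M S) (\<lambda>\<omega>. (\<omega>, U \<omega>)) = ?W \<Otimes>\<^sub>M ?R"
  proof (rule measure_eqI_rectangles[where P = W and Q = S])
    show "sets (?W \<Otimes>\<^sub>M ?R) = sets (W \<Otimes>\<^sub>M S)" by (rule sets_WR)
    show "finite_measure (distr P (W \<Otimes>\<^sub>M S) (\<lambda>\<omega>. (\<omega>, U \<omega>)))" using pairW by (rule finite_measure_distr)
    fix B C assume B: "B \<in> sets W" and C: "C \<in> sets S"
    have BP: "B \<in> sets P" using B WP by blast
    have "emeasure (distr P (W \<Otimes>\<^sub>M S) (\<lambda>\<omega>. (\<omega>, U \<omega>))) (B \<times> C) = emeasure P ((U -` C \<inter> space P) \<inter> B)"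
      using B C sets.sets_into_space[OF BP]
      by (subst emeasure_distr[OF pairW]) (auto intro!: arg_cong[where f = "emeasure P"])
    also have "\<dots> = ennreal (prob (U -` C \<inter> space P) * prob B)"
      using indep_setD[OF ind _ B, of "U -` C \<inter> space P"] C unfolding emeasure_eq_measure by auto
    also have "\<dots> = emeasure ?W B * emeasure ?R C"
      using C by (simp add: emeasure_restr_to_subalg[OF W B] emeasure_distr[OF U] emeasure_eq_measure ennreal_mult' mult.commute)
    also have "\<dots> = emeasure (?W \<Otimes>\<^sub>M ?R) (B \<times> C)"
      using B C by (intro R.emeasure_pair_measure_Times[symmetric]) (simp_all add: sW)
    finally show "emeasure (distr P (W \<Otimes>\<^sub>M S) (\<lambda>\<omega>. (\<omega>, U \<omega>))) (B \<times> C) = emeasure (?W \<Otimes>\<^sub>M ?R) (B \<times> C)" .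
  qed simp
  assume w: "w \<in> sets W"
  have wP: "w \<in> sets P" using w WP by blast
  let ?B = "A \<inter> (w \<times> space S)"
  have B: "?B \<in> sets (W \<Otimes>\<^sub>M S)" using AW w by auto
  have "emeasure P ({\<omega> \<in> space P. (\<omega>, U \<omega>) \<in> A} \<inter> w) = emeasure (distr P (W \<Otimes>\<^sub>M S) (\<lambda>\<omega>. (\<omega>, U \<omega>))) ?B"
    using measurable_space[OF U] sets.sets_into_space[OF wP]
    by (subst emeasure_distr[OF pairW B]) (auto intro!: arg_cong[where f = "emeasure P"])
  also have "\<dots> = (\<integral>\<^sup>+ \<omega>. emeasure ?R (Pair \<omega> -` ?B) \<partial>?W)"
    unfolding J using B unfolding sets_WR[symmetric] by (rule R.emeasure_pair_measure_alt)
  also have "\<dots> = (\<integral>\<^sup>+ \<omega>. ennreal (indicator w \<omega> * ?th \<omega>) \<partial>?W)"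
  proof (rule nn_integral_cong)
    fix \<omega> assume "\<omega> \<in> space ?W"
    have "Pair \<omega> -` A \<subseteq> space S"
      using sets.sets_into_space[OF A] by (auto simp: space_pair_measure)
    then have "Pair \<omega> -` ?B = (if \<omega> \<in> w then Pair \<omega> -` A else {})" by auto
    then show "emeasure ?R (Pair \<omega> -` ?B) = ennreal (indicator w \<omega> * ?th \<omega>)"
      by (simp add: R.emeasure_eq_measure indicator_def)
  qed
  also have "\<dots> = (\<integral>\<^sup>+ \<omega>. ennreal (indicator w \<omega> * ?th \<omega>) \<partial>P)"
    using thW w by (intro nn_integral_subalgebra2 W measurable_compose[OF _ measurable_ennreal] borel_measurable_times
      borel_measurable_indicator)
  also have "\<dots> = ennreal (\<integral>\<omega>\<in>w. ?th \<omega> \<partial>P)"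
    unfolding set_lebesgue_integral_def real_scaleR_def
  proof (rule nn_integral_eq_integral)
    show "integrable P (\<lambda>\<omega>. indicat_real w \<omega> * ?th \<omega>)"
    proof (rule integrable_const_bound[of _ 1])
      show "AE \<omega> in P. norm (indicat_real w \<omega> * ?th \<omega>) \<le> 1"
        by (simp add: indicator_def)
      show "(\<lambda>\<omega>. indicat_real w \<omega> * ?th \<omega>) \<in> borel_measurable P"
        using wP thP by (intro borel_measurable_times borel_measurable_indicator)
    qed
  qed simp
  finally show "prob ({\<omega> \<in> space P. (\<omega>, U \<omega>) \<in> A} \<inter> w) = (\<integral>\<omega>\<in>w. ?th \<omega> \<partial>P)"
    unfolding emeasure_eq_measure by (subst (asm) ennreal_inj) (auto simp: set_lebesgue_integral_def)
qed

text \<open>Conditioning \<open>a\<close> on the larger sigma-field \<open>W\<close> gives the same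
  \<open>th\<close> as conditioning on \<open>H\<close>. Since \<open>b\<close> lies in
  \<open>W\<close>, the indicator of \<open>a\<close> may be replaced by \<open>th\<close> in the
  conditional expectation given \<open>H\<close>, and \<open>th\<close> is then pulled out.\<close>

lemma cond_indep_noise:
  assumes P: "prob_space P" and W: "subalgebra P W" and H: "subalgebra W H" and U: "U \<in> measurable P S"
    and ind: "prob_space.indep_set P {U -` A \<inter> space P | A. A \<in> sets S} (sets W)"
    and F: "\<And>a. a \<in> sets F \<Longrightarrow> \<exists>A\<in>sets (H \<Otimes>\<^sub>M S). a = {\<omega> \<in> space P. (\<omega>, U \<omega>) \<in> A}"
    and G: "sets G \<subseteq> sets W"
  shows "cond_indep P H F G"
  unfolding cond_indep_def
proof (intro ballI)
  interpret prob_space P by fact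
  have WP: "sets W \<subseteq> sets P" and HW: "sets H \<subseteq> sets W"
    using W H by (auto simp: subalgebra_def)
  have HP: "subalgebra P H" using W H by (auto simp: subalgebra_def)
  interpret finite_measure_subalgebra P H by unfold_locales (rule HP)
  fix a b assume "a \<in> sets F" and b: "b \<in> sets G"
  then obtain A where A: "A \<in> sets (H \<Otimes>\<^sub>M S)" and a: "a = {\<omega> \<in> space P. (\<omega>, U \<omega>) \<in> A}"
    using F by blast
  define th where "th = (\<lambda>\<omega>. measure (distr P S U) (Pair \<omega> -` A))"
  note sec = independent_noise_section[OF P W H U ind A, folded a th_def]
  interpret R: prob_space "distr P S U" using U by (rule prob_space_distr)
  have bW: "b \<in> sets W" and bP: "b \<in> sets P" using b G WP by auto
  have thP: "th \<in> borel_measurable P" using HP sec(1) by (rule measurable_from_subalg)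
  have bd: "0 \<le> th \<omega>" "th \<omega> \<le> 1" for \<omega> by (auto simp: th_def)
  have ith: "integrable P th"
    by (rule integrable_const_bound[of _ 1]) (use bd thP in auto)
  have iind: "integrable P (indicat_real c)" if "c \<in> sets P" for c
    using that by (intro integrable_real_indicator) (simp_all add: less_top[symmetric])
  have int: "(\<integral>x\<in>c. indicat_real d x \<partial>P) = prob (d \<inter> c)" if "c \<in> sets P" "d \<in> sets P" for c d
  proof -
    have "(\<integral>x\<in>c. indicat_real d x \<partial>P) = (\<integral>x. indicat_real (d \<inter> c) x \<partial>P)"
      unfolding set_lebesgue_integral_def by (intro Bochner_Integration.integral_cong) (auto simp: indicator_def)
    then show ?thesis using that by simp
  qed
  have ra: "AE \<omega> in P. real_cond_exp P H (indicator a) \<omega> = th \<omega>"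
  proof (rule real_cond_exp_charact)
    fix c assume "c \<in> sets H"
    then show "(\<integral>x\<in>c. indicat_real a x \<partial>P) = (\<integral>x\<in>c. th x \<partial>P)"
      using HW WP sec(2) by (subst int) (auto intro!: sec(3))
  qed (use sec(1,2) ith iind in auto)
  have ithb: "integrable P (\<lambda>\<omega>. th \<omega> * indicat_real c \<omega>)" if "c \<in> sets P" for c
    by (rule integrable_const_bound[of _ 1]) (use bd thP that in \<open>auto simp: indicator_def\<close>)
  have "AE \<omega> in P. real_cond_exp P H (indicator (a \<inter> b)) \<omega> = th \<omega> * real_cond_exp P H (indicator b) \<omega>"
  proof (rule real_cond_exp_charact)
    show "integrable P (indicat_real (a \<inter> b))" using sec(2) bP by (intro iind) auto
    show "integrable P (\<lambda>\<omega>. th \<omega> * real_cond_exp P H (indicat_real b) \<omega>)"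
      using bP by (intro real_cond_exp_intg(1) ithb sec(1)) auto
    show "(\<lambda>\<omega>. th \<omega> * real_cond_exp P H (indicat_real b) \<omega>) \<in> borel_measurable H"
      using sec(1) by (intro borel_measurable_times) auto
    fix c assume c: "c \<in> sets H"
    then have cW: "c \<in> sets W" and cP: "c \<in> sets P" using HW WP by auto
    have "(\<integral>x\<in>c. indicat_real (a \<inter> b) x \<partial>P) = prob (a \<inter> b \<inter> c)"
      using cP sec(2) bP by (intro int) auto
    also have "\<dots> = prob (a \<inter> (b \<inter> c))" by (simp add: Int_assoc)
    also have "\<dots> = (\<integral>x\<in>b \<inter> c. th x \<partial>P)" using bW cW by (intro sec(3)) auto
    also have "\<dots> = (\<integral>x. (indicat_real c x * th x) * indicat_real b x \<partial>P)"
      unfolding set_lebesgue_integral_def by (intro Bochner_Integration.integral_cong) (auto simp: indicator_def)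
    also have "\<dots> = (\<integral>x. (indicat_real c x * th x) * real_cond_exp P H (indicat_real b) x \<partial>P)"
    proof (rule real_cond_exp_intg(2)[symmetric])
      have "(\<lambda>x. indicat_real c x * th x * indicat_real b x) = (\<lambda>x. th x * indicat_real (b \<inter> c) x)"
        by (auto simp: indicator_def)
      then show "integrable P (\<lambda>x. indicat_real c x * th x * indicat_real b x)"
        using ithb[of "b \<inter> c"] bP cP by auto
      show "(\<lambda>x. indicat_real c x * th x) \<in> borel_measurable H"
        using c sec(1) by (intro borel_measurable_times) auto
    qed (use bP in auto)
    also have "\<dots> = (\<integral>x\<in>c. th x * real_cond_exp P H (indicat_real b) x \<partial>P)"
      unfolding set_lebesgue_integral_def by (simp add: mult.assoc)
    finally show "(\<integral>x\<in>c. indicat_real (a \<inter> b) x \<partial>P) = (\<integral>x\<in>c. th x * real_cond_exp P H (indicat_real b) x \<partial>P)" .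
  qed
  with ra show "AE \<omega> in P. real_cond_exp P H (indicator (a \<inter> b)) \<omega>
      = real_cond_exp P H (indicator a) \<omega> * real_cond_exp P H (indicator b) \<omega>"
    by eventually_elim simp
qed

lemma natural_filtration_mono:
  assumes "m \<le> n"
  shows "sets (natural_filtration N E X m) \<subseteq> sets (natural_filtration N E X n)"
  unfolding sets_natural_filtration using assms by (intro sigma_sets_mono') (blast intro: order_trans)

text \<open>X up to time n + 1 is determined by X up to time n and the next noise. That noise is
  independent of X and U jointly up to time n, and the noises up to time n are part of this
  information, so \<open>cond_indep_noise\<close> applies.\<close>

lemma immersed_if_generating:
  assumes N: "prob_space N" and X: "\<And>n. X n \<in> measurable N E" and gp: "generating_parametrization N E X S U"
  shows "immersed N (natural_filtration N E X) (natural_filtration N S U)"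
  unfolding immersed_def
proof (intro allI conjI)
  fix n
  have U: "U k \<in> measurable N S" for k
    using gp unfolding generating_parametrization_def parametrization_def by blast
  have XF: "X k \<in> measurable (natural_filtration N S U k) E" for k
    using gp unfolding generating_parametrization_def by blast
  show "sets (natural_filtration N E X n) \<subseteq> sets (natural_filtration N S U n)"
  proof (rule natural_filtration_le)
    fix k assume "k \<le> n"
    with natural_filtration_mono[OF this, of N S U] XF[of k]
    show "X k \<in> measurable (natural_filtration N S U n) E"
      by (auto simp: measurable_def space_natural_filtration)
  qed (rule space_natural_filtration null_sets_natural_filtration)+
  let ?XU = "\<lambda>k \<omega>. (X k \<omega>, U k \<omega>)"
  let ?W = "natural_filtration N (E \<Otimes>\<^sub>M S) ?XU n" and ?H = "natural_filtration N E X n"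
  have XU: "?XU k \<in> measurable N (E \<Otimes>\<^sub>M S)" for k using X U by (rule measurable_Pair)
  have XUW: "?XU k \<in> measurable ?W (E \<Otimes>\<^sub>M S)" if "k \<le> n" for k
    using that XU by (rule measurable_natural_filtration)
  have HW: "sets ?H \<subseteq> sets ?W"
    by (rule natural_filtration_le) (use measurable_compose[OF XUW measurable_fst] in
      \<open>auto simp: space_natural_filtration intro!: subsetD[OF null_sets_natural_filtration]\<close>)
  have GW: "sets (natural_filtration N S U n) \<subseteq> sets ?W"
    by (rule natural_filtration_le) (use measurable_compose[OF XUW measurable_snd] in
      \<open>auto simp: space_natural_filtration intro!: subsetD[OF null_sets_natural_filtration]\<close>)
  let ?gen = "{U (n + 1) -` A \<inter> space N | A. A \<in> sets S} \<union> sets ?H"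
  let ?T = "sigma (space N) ?gen"
  have gen: "?gen \<subseteq> Pow (space N)"
    using sets.space_closed[of ?H] unfolding space_natural_filtration by auto
  then have sp: "space ?T = space N" and st: "sets ?T = sigma_sets (space N) ?gen"
    by (auto intro: space_measure_of sets_measure_of)
  have "sets (natural_filtration N E X (n + 1)) \<subseteq> sets ?T"
  proof (rule natural_filtration_le)
    show "null_sets (completion N) \<subseteq> sets ?T"
      using null_sets_natural_filtration[of N E X n] unfolding st by (auto intro: sigma_sets.Basic)
    fix k assume k: "k \<le> n + 1"
    show "X k \<in> measurable ?T E"
    proof (cases "k \<le> n")
      case True
      have "sets ?H \<subseteq> sets ?T" unfolding st by auto
      with measurable_natural_filtration[where X = X, OF True X] show ?thesis
        by (auto simp: measurable_def space_natural_filtration sp)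
    next
      case False
      with k have "k = n + 1" by simp
      then show ?thesis
        using gp unfolding generating_parametrization_def parametrization_def by blast
    qed
  qed (rule sp)
  \<comment> \<open>Preimages of product-measurable sets under the pair map form a sigma-algebra
    that contains both families of generators, so every event in \<open>?T\<close> is given by a
    single set in the product.\<close>
  also have "sets ?T \<subseteq> {{\<omega> \<in> space N. (\<omega>, U (n + 1) \<omega>) \<in> A} | A. A \<in> sets (?H \<Otimes>\<^sub>M S)}"
  proof -
    have fn: "(\<lambda>\<omega>. (\<omega>, U (n + 1) \<omega>)) \<in> space N \<rightarrow> space (?H \<Otimes>\<^sub>M S)"
      using measurable_space[OF U] by (auto simp: space_pair_measure space_natural_filtration)
    have "?gen \<subseteq> sets (vimage_algebra (space N) (\<lambda>\<omega>. (\<omega>, U (n + 1) \<omega>)) (?H \<Otimes>\<^sub>M S))"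
    proof
      fix a assume "a \<in> ?gen"
      then consider B where "a = U (n + 1) -` B \<inter> space N" "B \<in> sets S" | "a \<in> sets ?H" by blast
      then show "a \<in> sets (vimage_algebra (space N) (\<lambda>\<omega>. (\<omega>, U (n + 1) \<omega>)) (?H \<Otimes>\<^sub>M S))"
      proof cases
        case 1
        have "(\<lambda>\<omega>. (\<omega>, U (n + 1) \<omega>)) -` (space ?H \<times> B) \<inter> space N = a"
          unfolding 1(1) space_natural_filtration by auto
        then show ?thesis unfolding sets_vimage_algebra2[OF fn] using 1(2) by blast
      next
        case 2
        have "(\<lambda>\<omega>. (\<omega>, U (n + 1) \<omega>)) -` (a \<times> space S) \<inter> space N = a"
          using sets.sets_into_space[OF 2] measurable_space[OF U] unfolding space_natural_filtration by auto
        then show ?thesis unfolding sets_vimage_algebra2[OF fn] using 2 by blast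
      qed
    qed
    then have "sets ?T \<subseteq> sets (vimage_algebra (space N) (\<lambda>\<omega>. (\<omega>, U (n + 1) \<omega>)) (?H \<Otimes>\<^sub>M S))"
      unfolding st using sets.sigma_sets_subset[of ?gen "vimage_algebra (space N) (\<lambda>\<omega>. (\<omega>, U (n + 1) \<omega>)) (?H \<Otimes>\<^sub>M S)"] by simp
    then show ?thesis unfolding sets_vimage_algebra2[OF fn] by (auto simp: vimage_def Int_def conj_commute)
  qed
  finally have F: "\<exists>A\<in>sets (?H \<Otimes>\<^sub>M S). a = {\<omega> \<in> space N. (\<omega>, U (n + 1) \<omega>) \<in> A}"
    if "a \<in> sets (natural_filtration N E X (n + 1))" for a using that by blast
  show "cond_indep (completion N) ?H (natural_filtration N E X (n + 1)) (natural_filtration N S U n)"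
  proof (rule cond_indep_noise[where W = ?W and U = "U (n + 1)" and S = S])
    show "prob_space (completion N)" using N by (rule prob_space.prob_space_completion)
    show "subalgebra (completion N) ?W"
      using sets_natural_filtration_completion[where X = ?XU, OF XU]
      by (simp add: subalgebra_def space_natural_filtration)
    show "subalgebra ?W ?H" using HW by (simp add: subalgebra_def space_natural_filtration)
    show "U (n + 1) \<in> measurable (completion N) S" using U by (rule measurable_completion)
    show "prob_space.indep_set (completion N) {U (n + 1) -` A \<inter> space (completion N) | A. A \<in> sets S} (sets ?W)"
      using gp unfolding generating_parametrization_def parametrization_def by simp
  qed (use F GW in auto)
qed

text \<open>The heights of the marks together with the indicators of countably many events determine the noise up to
  null sets when \<open>G\<close> generates the measure algebra.\<close>

definition code :: "(nat \<Rightarrow> 'e set) \<Rightarrow> (nat \<Rightarrow> 'e \<times> real) \<Rightarrow> nat \<Rightarrow> real" where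
  "code G u m = (case prod_decode m of
     (j, 0) \<Rightarrow> snd (u j) | (j, Suc i) \<Rightarrow> indicator (G i) (fst (u j)))"

lemma code_simps [simp]:
  "code G u (prod_encode (j, 0)) = snd (u j)"
  "code G u (prod_encode (j, Suc i)) = indicator (G i) (fst (u j))"
  by (simp_all add: code_def)

lemma measurable_borel_sequence:
  fixes h :: "'a \<Rightarrow> nat \<Rightarrow> real"
  shows "h \<in> borel_measurable N \<longleftrightarrow> (\<forall>m. (\<lambda>x. h x m) \<in> borel_measurable N)"
proof -
  have eq: "measurable N borel = measurable N (Pi\<^sub>M UNIV (\<lambda>_::nat. borel :: real measure))"
    by (rule measurable_cong_sets[OF refl sets_PiM_equal_borel[symmetric]])
  show ?thesis
  proof
    assume "h \<in> borel_measurable N"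
    then have "h \<in> measurable N (Pi\<^sub>M UNIV (\<lambda>_::nat. borel :: real measure))" unfolding eq .
    from measurable_compose[OF this measurable_component_singleton]
    show "\<forall>m. (\<lambda>x. h x m) \<in> borel_measurable N" by simp
  next
    assume "\<forall>m. (\<lambda>x. h x m) \<in> borel_measurable N"
    then show "h \<in> borel_measurable N" unfolding eq by (intro measurable_PiM_UNIV) (rule spec)
  qed
qed

context chain
begin

lemma measurable_noise_iff:
  "h \<in> measurable N (noise \<pi>) \<longleftrightarrow>
    (\<forall>j. (\<lambda>x. fst (h x j)) \<in> measurable N \<pi> \<and> (\<lambda>x. snd (h x j)) \<in> borel_measurable N)"
proof safe
  fix j assume "h \<in> measurable N (noise \<pi>)"
  then have "(\<lambda>x. h x j) \<in> measurable N (\<pi> \<Otimes>\<^sub>M borel)"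
    using measurable_compose[OF _ measurable_component_singleton, of h N UNIV "\<lambda>_. mark \<pi>" j]
    by (simp add: measurable_cong_sets[OF refl sets_mark])
  then show "(\<lambda>x. fst (h x j)) \<in> measurable N \<pi>" "(\<lambda>x. snd (h x j)) \<in> borel_measurable N"
    by (rule measurable_compose[OF _ measurable_fst], rule measurable_compose[OF _ measurable_snd])
next
  assume "\<forall>j. (\<lambda>x. fst (h x j)) \<in> measurable N \<pi> \<and> (\<lambda>x. snd (h x j)) \<in> borel_measurable N"
  then have "(\<lambda>x. h x j) \<in> measurable N (mark \<pi>)" for j
    unfolding measurable_cong_sets[OF refl sets_mark] by (intro measurable_pair) (simp_all add: comp_def)
  then show "h \<in> measurable N (noise \<pi>)" by (rule measurable_PiM_UNIV)
qed

lemma code_measurable: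
  assumes G: "\<And>i. G i \<in> sets \<pi>"
  shows "code G \<in> borel_measurable (noise \<pi>)"
  unfolding measurable_borel_sequence
proof
  fix m
  obtain j i where m: "m = prod_encode (j, i)" by (metis prod_decode_inverse surj_pair)
  have id: "(\<lambda>u. fst (u j)) \<in> measurable (noise \<pi>) \<pi>" "(\<lambda>u. snd (u j)) \<in> borel_measurable (noise \<pi>)"
    using measurable_noise_iff[of "\<lambda>u. u" "noise \<pi>"] by simp_all
  show "(\<lambda>u. code G u m) \<in> borel_measurable (noise \<pi>)"
  proof (cases i)
    case 0
    then show ?thesis using id(2) by (simp add: m)
  next
    case (Suc l)
    then show ?thesis
      using measurable_compose[OF id(1) borel_measurable_indicator[OF G]] by (simp add: m)
  qed
qed

text \<open>The letter at a fixed position follows \<pi>, unlike the chosen one. Hence \<pi>-null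
  sets of letters give null events.\<close>

lemma emeasure_letter_NN:
  assumes A: "A \<in> sets \<pi>"
  shows "emeasure NN {p \<in> space NN. fst (snd p n j) \<in> A} = emeasure \<pi> A"
proof -
  have id: "(\<lambda>u. fst (u j)) \<in> measurable (noise \<pi>) \<pi>"
    using measurable_noise_iff[of "\<lambda>u. u" "noise \<pi>"] by simp
  let ?B = "{u \<in> space (noise \<pi>). fst (u j) \<in> A}"
  have B: "?B \<in> sets (noise \<pi>)"
    using measurable_sets[OF id A] by (simp add: vimage_def Int_def conj_commute)
  have "{p \<in> space NN. fst (snd p n j) \<in> A} = {p \<in> space NN. snd p n \<in> ?B}"
    using measurable_space[OF snd_NN] by auto
  then have "emeasure NN {p \<in> space NN. fst (snd p n j) \<in> A} = emeasure (noise \<pi>) ?B"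
    using emeasure_noise_NN[OF B] by simp
  also have "\<dots> = (\<integral>\<^sup>+ u. indicator A (fst (u j)) \<partial>noise \<pi>)"
    unfolding emeasure_Collect_if[OF B] by (intro nn_integral_cong) (simp add: indicator_def)
  also have "\<dots> = (\<integral>\<^sup>+ b. \<integral>\<^sup>+ u. indicator A (fst (mk j b u j)) \<partial>noise \<pi> \<partial>\<pi>)"
    by (rule nn_integral_mk[OF measurable_compose[OF id borel_measurable_indicator[OF A]]])
  also have "\<dots> = emeasure \<pi> A"
    using A by (simp add: mk_def noise.P.emeasure_space_1)
  finally show ?thesis .
qed

text \<open>The code returns heights exactly and letters through the sets \<open>G i\<close>. Any
  other event for a letter agrees with one generated by \<open>G\<close> up to a \<pi>-null set of
  letters, that is, a null event, whose subsets all lie in the completed sigma-field.\<close>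

lemma sets_natural_filtration_code:
  assumes G: "\<And>i. G i \<in> sets \<pi>"
    and dense: "\<And>A. A \<in> sets \<pi> \<Longrightarrow> \<exists>B\<in>sigma_sets (space \<pi>) (range G). (A - B) \<union> (B - A) \<in> null_sets \<pi>"
  shows "sets (natural_filtration NN borel (\<lambda>n. code G \<circ> UU n) n) = sets (natural_filtration NN (noise \<pi>) UU n)"
proof
  show "sets (natural_filtration NN borel (\<lambda>n. code G \<circ> UU n) n) \<subseteq> sets (natural_filtration NN (noise \<pi>) UU n)"
  proof (rule natural_filtration_le)
    show "code G \<circ> UU k \<in> borel_measurable (natural_filtration NN (noise \<pi>) UU n)" if "k \<le> n" for k
      using measurable_natural_filtration[where X = UU, OF that snd_NN] code_measurable[OF G]
      by (rule measurable_comp)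
  qed (rule space_natural_filtration null_sets_natural_filtration)+
  define T where "T = natural_filtration NN borel (\<lambda>n. code G \<circ> UU n) n"
  have space_T: "space T = space NN" and null_T: "null_sets (completion NN) \<subseteq> sets T"
    unfolding T_def by (rule space_natural_filtration null_sets_natural_filtration)+
  have "sets (natural_filtration NN (noise \<pi>) UU n) \<subseteq> sets T"
  proof (rule natural_filtration_le)
    fix k assume k: "k \<le> n"
    have "code G \<circ> UU k \<in> borel_measurable T"
      unfolding T_def using k measurable_comp[OF snd_NN code_measurable[OF G]]
      by (rule measurable_natural_filtration[where X = "\<lambda>n. code G \<circ> UU n"])
    then have cm: "(\<lambda>p. code G (snd p k) m) \<in> borel_measurable T" for m
      unfolding measurable_borel_sequence by simp
    have Gi: "{p \<in> space NN. fst (snd p k j) \<in> G i} \<in> sets T" for i j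
    proof -
      have "(\<lambda>p. code G (snd p k) (prod_encode (j, Suc i))) -` {1} \<inter> space T \<in> sets T"
        using cm by (rule measurable_sets) simp
      moreover have "(\<lambda>p. code G (snd p k) (prod_encode (j, Suc i))) -` {1} \<inter> space T = {p \<in> space NN. fst (snd p k j) \<in> G i}"
        unfolding space_T by (auto simp: indicator_eq_1_iff)
      ultimately show ?thesis by simp
    qed
    have sp: "fst (snd p k j) \<in> space \<pi>" if "p \<in> space NN" for p j
      using measurable_space[OF snd_NN[of k] that]
      by (auto simp: space_PiM space_mark PiE_iff mem_Times_iff)
    have "(\<lambda>p. fst (snd p k j)) \<in> measurable T \<pi>" for j
    proof (rule measurableI)
      show "fst (snd p k j) \<in> space \<pi>" if "p \<in> space T" for p
        using that sp unfolding space_T by simp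
      fix A assume A: "A \<in> sets \<pi>"
      from dense[OF this] obtain B where Bs: "B \<in> sigma_sets (space \<pi>) (range G)"
        and null: "(A - B) \<union> (B - A) \<in> null_sets \<pi>" by (rule bexE)
      have "{p \<in> space NN. fst (snd p k j) \<in> B} \<in> sets T"
        using Bs
      proof (induction rule: sigma_sets.induct)
        case (Basic B)
        then show ?case using Gi by auto
      next
        case Empty
        then show ?case by simp
      next
        case (Compl B)
        have "{p \<in> space NN. fst (snd p k j) \<in> space \<pi> - B} = space T - {p \<in> space NN. fst (snd p k j) \<in> B}"
          using sp unfolding space_T by auto
        then show ?case using sets.compl_sets[OF Compl.IH] by simp
      next
        case (Union B)
        have "{p \<in> space NN. fst (snd p k j) \<in> (\<Union>i. B i)} = (\<Union>i. {p \<in> space NN. fst (snd p k j) \<in> B i})" by auto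
        then show ?case using Union.IH by auto
      qed
      moreover have null': "{p \<in> space NN. fst (snd p k j) \<in> (A - B) \<union> (B - A)} \<in> null_sets (completion NN)"
      proof (rule null_sets_completionI, rule null_setsI)
        have m: "(\<lambda>p. fst (snd p k j)) \<in> measurable NN \<pi>"
          using snd_NN unfolding measurable_noise_iff by blast
        show "{p \<in> space NN. fst (snd p k j) \<in> (A - B) \<union> (B - A)} \<in> sets NN"
          using measurable_sets[OF m null_setsD2[OF null]] by (simp add: vimage_def Int_def conj_commute)
        show "emeasure NN {p \<in> space NN. fst (snd p k j) \<in> (A - B) \<union> (B - A)} = 0"
          unfolding emeasure_letter_NN[OF null_setsD2[OF null]] using null by (rule null_setsD1)
      qed
      have sub: "Y \<in> sets T" if "Y \<subseteq> {p \<in> space NN. fst (snd p k j) \<in> (A - B) \<union> (B - A)}" for Y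
        using null_T null_sets_completion_subset[OF that null'] by (rule subsetD)
      moreover have "{p \<in> space NN. fst (snd p k j) \<in> B - A} \<in> sets T" by (rule sub) blast
      moreover have "{p \<in> space NN. fst (snd p k j) \<in> A - B} \<in> sets T" by (rule sub) blast
      ultimately have "({p \<in> space NN. fst (snd p k j) \<in> B} - {p \<in> space NN. fst (snd p k j) \<in> B - A})
          \<union> {p \<in> space NN. fst (snd p k j) \<in> A - B} \<in> sets T"
        by (intro sets.Un sets.Diff)
      moreover have "({p \<in> space NN. fst (snd p k j) \<in> B} - {p \<in> space NN. fst (snd p k j) \<in> B - A})
          \<union> {p \<in> space NN. fst (snd p k j) \<in> A - B} = (\<lambda>p. fst (snd p k j)) -` A \<inter> space T"
        unfolding space_T by auto
      ultimately show "(\<lambda>p. fst (snd p k j)) -` A \<inter> space T \<in> sets T" by simp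
    qed
    moreover have "(\<lambda>p. snd (snd p k j)) \<in> borel_measurable T" for j
      using cm[of "prod_encode (j, 0)"] by simp
    ultimately show "UU k \<in> measurable T (noise \<pi>)" unfolding measurable_noise_iff by blast
  qed (rule space_T null_T)+
  then show "sets (natural_filtration NN (noise \<pi>) UU n) \<subseteq> sets (natural_filtration NN borel (\<lambda>n. code G \<circ> UU n) n)"
    unfolding T_def .
qed

text \<open>The noises are added in the order of time, the latest one being independent of
  everything before it. Induction on the maximum of a finite set of times arranges this on the
  integers, which have no first time.\<close>

lemma indep_UU: "NN.indep_vars (\<lambda>_. noise \<pi>) UU UNIV"
  unfolding NN.indep_vars_def2
proof (intro conjI ballI)
  show "UU n \<in> measurable NN (noise \<pi>)" for n by (rule snd_NN)
  show "NN.indep_sets (\<lambda>n. {UU n -` A \<inter> space NN | A. A \<in> sets (noise \<pi>)}) UNIV"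
  proof (rule NN.indep_setsI)
    show "{UU n -` A \<inter> space NN | A. A \<in> sets (noise \<pi>)} \<subseteq> sets NN" for n
      using measurable_sets[OF snd_NN] by blast
    fix A and J :: "int set"
    assume ne: "J \<noteq> {}" and fin: "finite J" and "\<forall>j\<in>J. A j \<in> {UU j -` A \<inter> space NN | A. A \<in> sets (noise \<pi>)}"
    then obtain C where C: "\<And>j. j \<in> J \<Longrightarrow> C j \<in> sets (noise \<pi>)" "\<And>j. j \<in> J \<Longrightarrow> A j = UU j -` C j \<inter> space NN"
      by simp metis
    have "NN.prob (space NN \<inter> (\<Inter>j\<in>J. A j)) = (\<Prod>j\<in>J. NN.prob (A j))"
      using fin C
    proof (induction J rule: finite_linorder_max_induct)
      case empty
      then show ?case by (simp add: NN.prob_space)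
    next
      case (insert b J)
      have "(\<Inter>j\<in>J. A j) \<inter> space (Wm (b - 1)) \<in> sets (Wm (b - 1))"
      proof (cases "J = {}")
        case False
        have "A j \<in> sets (Wm (b - 1))" if j: "j \<in> J" for j
        proof -
          have "j \<le> b - 1" using insert.hyps j by auto
          from measurable_sets[OF noise_Wm[OF this] insert.prems(1)[of j]] show ?thesis
            using insert.prems(2)[of j] j by (simp add: space_Wm)
        qed
        then show ?thesis using False insert.hyps(1) by (intro sets.Int sets.finite_INT) auto
      qed simp
      then have Y: "space NN \<inter> (\<Inter>j\<in>J. A j) \<in> sets (Wm (b - 1))" by (simp add: space_Wm Int_commute)
      have Ab: "{p \<in> space NN. snd p (b - 1 + 1) \<in> C b} = A b"
        using insert.prems(2)[of b] by auto
      have "NN.prob (space NN \<inter> (\<Inter>j\<in>insert b J. A j)) = NN.prob ((space NN \<inter> (\<Inter>j\<in>J. A j)) \<inter> A b)"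
        by (intro arg_cong[where f = NN.prob]) auto
      also have "\<dots> = NN.prob (space NN \<inter> (\<Inter>j\<in>J. A j)) * NN.prob (A b)"
        using prob_Wm_step[OF Y, of "C b"] insert.prems(1)[of b] unfolding Ab by simp
      also have "NN.prob (space NN \<inter> (\<Inter>j\<in>J. A j)) = (\<Prod>j\<in>J. NN.prob (A j))"
        using insert.prems by (intro insert.IH) auto
      finally show ?case using insert.hyps by (subst prod.insert) auto
    qed
    moreover have "space NN \<inter> (\<Inter>j\<in>J. A j) = (\<Inter>j\<in>J. A j)" using ne C(2) by auto
    ultimately show "NN.prob (\<Inter>j\<in>J. A j) = (\<Prod>j\<in>J. NN.prob (A j))" by simp
  qed
qed

lemma iid_UU: "iid_process NN (noise \<pi>) UU"
  unfolding iid_process_def using indep_UU distr_noise_NN by simp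

lemma iid_code:
  assumes G: "\<And>i. G i \<in> sets \<pi>"
  shows "iid_process NN borel (\<lambda>n. code G \<circ> UU n)"
  unfolding iid_process_def
proof (intro conjI allI)
  show "NN.indep_vars (\<lambda>_. borel) (\<lambda>n. code G \<circ> UU n) UNIV"
    using indep_UU code_measurable[OF G] by (rule NN.indep_vars_compose)
  have "distr NN borel (code G \<circ> UU n) = distr (noise \<pi>) borel (code G)" for n
    using distr_distr[OF code_measurable[OF G] snd_NN[of n]] by (simp add: distr_noise_NN)
  then show "distr NN borel (code G \<circ> UU n) = distr NN borel (code G \<circ> UU 0)" for n by simp
qed

end

lemma natural_filtration_cong_sets: "sets E = sets E' \<Longrightarrow> natural_filtration N E X = natural_filtration N E' X"
  by (simp add: natural_filtration_def fun_eq_iff)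

lemma generating_parametrization_cong_sets:
  assumes "sets E = sets E'"
  shows "generating_parametrization N E X S U = generating_parametrization N E' X S U"
proof -
  have "natural_filtration N (E \<Otimes>\<^sub>M S) Z = natural_filtration N (E' \<Otimes>\<^sub>M S) Z" for Z
    by (rule natural_filtration_cong_sets) (rule sets_pair_measure_cong[OF assms refl])
  then show ?thesis
    unfolding generating_parametrization_def parametrization_def
    by (simp add: natural_filtration_cong_sets[OF assms] measurable_cong_sets[OF refl assms])
qed

context coupled_chain
begin

lemma enlargement_NN: "enlargement M NN fst"
  unfolding enlargement_def using NN.prob_space_axioms fst_NN distr_NN_fst by blast

lemma immersed_NN: "immersed NN (natural_filtration NN \<pi> XN) (natural_filtration NN (noise \<pi>) UU)"
  by (rule immersed_if_generating[OF NN.prob_space_axioms XN_meas generating_parametrization_NN])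

text \<open>\<open>E\<close> stands for the original reference measure: it has the same measurable
  sets as the probability measure \<pi>, and the conclusions depend on it only through these
  sets.\<close>

lemma parametrization_and_standardness:
  assumes E: "sets E = sets \<pi>"
  shows "admits_generating_parametrization
           TYPE('w \<times> (int \<Rightarrow> nat \<Rightarrow> 'e \<times> real)) TYPE(nat \<Rightarrow> 'e \<times> real) M E X"
    and "immersible_in_iid TYPE('w \<times> (int \<Rightarrow> nat \<Rightarrow> 'e \<times> real)) (noise \<pi>) M E X"
    and "essentially_separable \<pi> \<Longrightarrow>
            standard TYPE('w \<times> (int \<Rightarrow> nat \<Rightarrow> 'e \<times> real)) TYPE(nat \<Rightarrow> real) M E X"
proof -
  show "admits_generating_parametrization
           TYPE('w \<times> (int \<Rightarrow> nat \<Rightarrow> 'e \<times> real)) TYPE(nat \<Rightarrow> 'e \<times> real) M E X"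
    unfolding admits_generating_parametrization_def generating_parametrization_cong_sets[OF E]
    using enlargement_NN generating_parametrization_NN by blast
  show "immersible_in_iid TYPE('w \<times> (int \<Rightarrow> nat \<Rightarrow> 'e \<times> real)) (noise \<pi>) M E X"
    unfolding immersible_in_iid_def natural_filtration_cong_sets[OF E]
    using enlargement_NN iid_UU immersed_NN by blast
  assume "essentially_separable \<pi>"
  then obtain G where cG: "countable G" and Gs: "G \<subseteq> sets \<pi>"
    and dense: "\<And>A. A \<in> sets \<pi> \<Longrightarrow> \<exists>B\<in>sigma_sets (space \<pi>) G. (A - B) \<union> (B - A) \<in> null_sets \<pi>"
    unfolding essentially_separable_def by blast
  \<comment> \<open>Inserting the empty set makes the countable family nonempty, so that it is the
    range of a sequence.\<close>
  define H where "H = from_nat_into (insert {} G)"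
  have rH: "range H = insert {} G"
    unfolding H_def using cG by (intro range_from_nat_into) auto
  have H: "H i \<in> sets \<pi>" for i using rangeI[of H i] Gs unfolding rH by auto
  have "sigma_sets (space \<pi>) G \<subseteq> sigma_sets (space \<pi>) (range H)"
    unfolding rH by (rule sigma_sets_mono') blast
  with dense have dH: "\<exists>B\<in>sigma_sets (space \<pi>) (range H). (A - B) \<union> (B - A) \<in> null_sets \<pi>" if "A \<in> sets \<pi>" for A
    using that by blast
  have nf: "sets (natural_filtration NN borel (\<lambda>n. code H \<circ> UU n) n) = sets (natural_filtration NN (noise \<pi>) UU n)" for n
    by (rule sets_natural_filtration_code[of H]) (fact H, fact dH)
  have "immersed NN (natural_filtration NN \<pi> XN) (natural_filtration NN borel (\<lambda>n. code H \<circ> UU n))"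
    using immersed_NN unfolding immersed_def cond_indep_def nf .
  then show "standard TYPE('w \<times> (int \<Rightarrow> nat \<Rightarrow> 'e \<times> real)) TYPE(nat \<Rightarrow> real) M E X"
    unfolding standard_def immersible_in_iid_def natural_filtration_cong_sets[OF E]
    using enlargement_NN iid_code[of H, OF H] by blast
qed

end

section \<open>Change of the reference measure\<close>

lemma density_reweight:
  assumes h: "h \<in> borel_measurable \<pi>" "\<And>a. 0 < h a" and f: "f \<in> borel_measurable \<pi>"
  shows "density (density \<pi> (\<lambda>a. ennreal (h a))) (\<lambda>a. ennreal (f a / h a)) = density \<pi> (\<lambda>a. ennreal (f a))"
proof -
  have "ennreal (h a) * ennreal (f a / h a) = ennreal (f a)" for a
    using h(2)[of a] by (subst ennreal_mult'[symmetric]) auto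
  then show ?thesis using h(1) f by (subst density_density_eq) simp_all
qed

lemma section_measurable:
  assumes "(\<lambda>(z, a). f z a) \<in> borel_measurable (P \<Otimes>\<^sub>M \<pi>)" "z \<in> space P"
  shows "f z \<in> borel_measurable \<pi>"
  using measurable_compose[OF measurable_Pair1'[OF assms(2)] assms(1)] by simp

lemma conditional_density_reweight:
  assumes h: "h \<in> borel_measurable \<pi>" "\<And>a. 0 < h a" and P: "sets P' = sets P"
    and cd: "conditional_density M P Z \<pi> W f"
  shows "conditional_density M P' Z (density \<pi> (\<lambda>a. ennreal (h a))) W (\<lambda>z a. f z a / h a)"
  unfolding conditional_density_def sets_eq_imp_space_eq[OF P] P sets_density space_density
proof (intro conjI ballI)
  have m: "(\<lambda>(z, a). f z a) \<in> borel_measurable (P \<Otimes>\<^sub>M \<pi>)" using cd by (simp add: conditional_density_def)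
  have sec: "f z \<in> borel_measurable \<pi>" if "z \<in> space P" for z using m that by (rule section_measurable)
  have "(\<lambda>p. (case p of (z, a) \<Rightarrow> f z a) / h (snd p)) \<in> borel_measurable (P \<Otimes>\<^sub>M \<pi>)"
    using m measurable_compose[OF measurable_snd h(1)] by (rule borel_measurable_divide)
  moreover have "(\<lambda>p. (case p of (z, a) \<Rightarrow> f z a) / h (snd p)) = (\<lambda>(z, a). f z a / h a)"
    by (auto simp: fun_eq_iff)
  moreover have "sets (P' \<Otimes>\<^sub>M density \<pi> (\<lambda>a. ennreal (h a))) = sets (P \<Otimes>\<^sub>M \<pi>)"
    by (rule sets_pair_measure_cong[OF P sets_density])
  ultimately show "(\<lambda>(z, a). f z a / h a) \<in> borel_measurable (P' \<Otimes>\<^sub>M density \<pi> (\<lambda>a. ennreal (h a)))"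
    using measurable_cong_sets[OF _ refl] by metis
  show "0 \<le> f z a / h a" if "z \<in> space P" "a \<in> space \<pi>" for z a
    using that cd h(2)[of a] by (auto simp: conditional_density_def intro!: divide_nonneg_pos)
  show "(\<integral>\<^sup>+ a. ennreal (f z a / h a) \<partial>density \<pi> (\<lambda>a. ennreal (h a))) = 1" if z: "z \<in> space P" for z
  proof -
    let ?d = "density (density \<pi> (\<lambda>a. ennreal (h a))) (\<lambda>a. ennreal (f z a / h a))"
    have "(\<integral>\<^sup>+ a. ennreal (f z a / h a) \<partial>density \<pi> (\<lambda>a. ennreal (h a))) = (\<integral>\<^sup>+ a. 1 \<partial>?d)"
      using sec[OF z] h(1) by (subst nn_integral_density) auto
    also have "\<dots> = (\<integral>\<^sup>+ a. ennreal (f z a) \<partial>\<pi>)"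
      unfolding density_reweight[where f = "f z", OF h sec[OF z]]
      using sec[OF z] by (subst nn_integral_density) auto
    finally show ?thesis using cd z by (simp add: conditional_density_def)
  qed
  fix A B assume A: "A \<in> sets P" and B: "B \<in> sets \<pi>"
  have "emeasure M {\<omega> \<in> space M. Z \<omega> \<in> A \<and> W \<omega> \<in> B}
      = (\<integral>\<^sup>+ \<omega>. indicator A (Z \<omega>) * emeasure (density \<pi> (\<lambda>a. ennreal (f (Z \<omega>) a))) B \<partial>M)"
    using cd A B by (simp add: conditional_density_def)
  also have "\<dots> = (\<integral>\<^sup>+ \<omega>. indicator A (Z \<omega>) * emeasure (density (density \<pi> (\<lambda>a. ennreal (h a))) (\<lambda>a. ennreal (f (Z \<omega>) a / h a))) B \<partial>M)"
  proof (rule nn_integral_cong)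
    fix \<omega>
    show "indicator A (Z \<omega>) * emeasure (density \<pi> (\<lambda>a. ennreal (f (Z \<omega>) a))) B
       = indicator A (Z \<omega>) * emeasure (density (density \<pi> (\<lambda>a. ennreal (h a))) (\<lambda>a. ennreal (f (Z \<omega>) a / h a))) B"
    proof (cases "Z \<omega> \<in> A")
      case True
      then have "Z \<omega> \<in> space P" using sets.sets_into_space[OF A] by blast
      from density_reweight[where f = "f (Z \<omega>)", OF h sec[OF this]] show ?thesis by simp
    qed simp
  qed
  finally show "emeasure M {\<omega> \<in> space M. Z \<omega> \<in> A \<and> W \<omega> \<in> B}
      = (\<integral>\<^sup>+ \<omega>. indicator A (Z \<omega>) * emeasure (density (density \<pi> (\<lambda>a. ennreal (h a))) (\<lambda>a. ennreal (f (Z \<omega>) a / h a))) B \<partial>M)" .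
qed

lemma density_dist_reweight:
  assumes h: "h \<in> borel_measurable \<pi>" "\<And>a. 0 < h a" and f: "f \<in> borel_measurable \<pi>" and g: "g \<in> borel_measurable \<pi>"
  shows "density_dist (density \<pi> (\<lambda>a. ennreal (h a))) (\<lambda>a. f a / h a) (\<lambda>a. g a / h a) = density_dist \<pi> f g"
proof -
  have "h a * \<bar>f a / h a - g a / h a\<bar> = \<bar>f a - g a\<bar>" for a
    using h(2)[of a] by (simp add: diff_divide_distrib[symmetric] abs_divide)
  moreover have "(\<integral>a. \<bar>f a / h a - g a / h a\<bar> \<partial>density \<pi> (\<lambda>a. ennreal (h a)))
      = (\<integral>a. h a *\<^sub>R \<bar>f a / h a - g a / h a\<bar> \<partial>\<pi>)"
    using h f g by (intro integral_density) (auto intro: less_imp_le)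
  ultimately show ?thesis by (simp add: density_dist_def)
qed

lemma word_space_mem:
  assumes "\<And>n. X n \<in> measurable M E" "\<omega> \<in> space M"
  shows "past X m \<omega> \<in> space (past_space E)" "word X n \<omega> \<in> space (word_space E n)"
  using measurable_space[OF assms(1) assms(2)] by (auto simp: past_def word_def space_PiM PiE_iff)

text \<open>The total variation distance does not depend on the reference measure, so the
  summability assumption carries over literally.\<close>

lemma eta_reweight:
  assumes h: "h \<in> borel_measurable \<pi>" "\<And>a. 0 < h a" and X: "\<And>n. X n \<in> measurable M \<pi>"
    and f: "(\<lambda>(z, a). f z a) \<in> borel_measurable (past_space \<pi> \<Otimes>\<^sub>M \<pi>)"
    and g: "\<And>n. (\<lambda>(z, a). g n z a) \<in> borel_measurable (word_space \<pi> n \<Otimes>\<^sub>M \<pi>)"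
  shows "eta M (density \<pi> (\<lambda>a. ennreal (h a))) X (\<lambda>z a. f z a / h a) (\<lambda>n z a. g n z a / h a) = eta M \<pi> X f g"
proof
  fix n
  show "eta M (density \<pi> (\<lambda>a. ennreal (h a))) X (\<lambda>z a. f z a / h a) (\<lambda>n z a. g n z a / h a) n = eta M \<pi> X f g n"
    unfolding eta_def
  proof (rule Bochner_Integration.integral_cong[OF refl])
    fix p assume "p \<in> space (M \<Otimes>\<^sub>M M)"
    then obtain \<omega> \<omega>' where p: "p = (\<omega>, \<omega>')" "\<omega> \<in> space M" "\<omega>' \<in> space M" by (auto simp: space_pair_measure)
    have w: "word X n \<omega>' \<in> space (word_space \<pi> n)" using X p(3) by (rule word_space_mem)
    have x: "past X (- int n - 1) \<omega> \<in> space (past_space \<pi>)" using X p(2) by (rule word_space_mem)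
    have c: "comb_seq n (word X n \<omega>') (past X (- int n - 1) \<omega>) \<in> space (past_space \<pi>)"
      using w x by (auto simp: space_PiM PiE_iff comb_seq_def)
    show "(case p of (\<omega>, \<omega>') \<Rightarrow> density_dist (density \<pi> (\<lambda>a. ennreal (h a))) (\<lambda>a. g n (word X n \<omega>') a / h a)
            (\<lambda>a. f (comb_seq n (word X n \<omega>') (past X (- int n - 1) \<omega>)) a / h a))
        = (case p of (\<omega>, \<omega>') \<Rightarrow> density_dist \<pi> (g n (word X n \<omega>'))
            (f (comb_seq n (word X n \<omega>') (past X (- int n - 1) \<omega>))))"
      unfolding p(1) prod.case
      by (rule density_dist_reweight[OF h section_measurable[OF g w] section_measurable[OF f c]])
  qed
qed

text \<open>A sigma-finite measure has a strictly positive integrable function, whose integral is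
  positive unless the whole space is null; \<open>h\<close> is its normalisation. Strict positivity
  at every point is what allows the densities to be divided by \<open>h\<close> everywhere.\<close>

lemma exists_equivalent_prob_density:
  assumes sf: "sigma_finite_measure \<pi>" and ne: "emeasure \<pi> (space \<pi>) \<noteq> 0"
  shows "\<exists>h::'e \<Rightarrow> real. h \<in> borel_measurable \<pi> \<and> (\<forall>a. 0 < h a) \<and> prob_space (density \<pi> (\<lambda>a. ennreal (h a)))"
proof -
  obtain k :: "'e \<Rightarrow> real" where k: "k \<in> borel_measurable \<pi>" "\<And>a. 0 < k a" "integrable \<pi> k"
    using sigma_finite_measure.obtain_positive_integrable_function[OF sf] by metis
  define c where "c = (\<integral>a. k a \<partial>\<pi>)"
  have nn: "(\<integral>\<^sup>+ a. ennreal (k a) \<partial>\<pi>) = ennreal c"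
    unfolding c_def using k by (intro nn_integral_eq_integral) (auto intro: less_imp_le)
  have c0: "0 < c"
  proof (rule ccontr)
    assume "\<not> 0 < c"
    then have "(\<integral>\<^sup>+ a. ennreal (k a) \<partial>\<pi>) = 0" unfolding nn by (simp add: ennreal_eq_0_iff)
    then have "AE a in \<pi>. ennreal (k a) = 0" using k(1) by (subst (asm) nn_integral_0_iff_AE) auto
    then have "AE a in \<pi>. False" by eventually_elim (metis ennreal_eq_0_iff k(2) not_le)
    then have "space \<pi> \<in> null_sets \<pi>" using AE_iff_null[of \<pi> "\<lambda>_. False"] by simp
    then show False using ne by (auto dest: null_setsD1)
  qed
  have m: "(\<lambda>a. k a / c) \<in> borel_measurable \<pi>" using k(1) by simp
  have "(\<integral>\<^sup>+ a. ennreal (k a / c) \<partial>\<pi>) = 1"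
  proof -
    have "(\<integral>\<^sup>+ a. ennreal (k a / c) \<partial>\<pi>) = (\<integral>\<^sup>+ a. ennreal (k a) / ennreal c \<partial>\<pi>)"
      using k(2) c0 by (intro nn_integral_cong) (simp add: divide_ennreal less_imp_le)
    also have "\<dots> = 1" using k(1) c0 by (simp add: nn_integral_divide nn ennreal_divide_self)
    finally show ?thesis .
  qed
  then have "prob_space (density \<pi> (\<lambda>a. ennreal (k a / c)))"
    using m by (intro prob_spaceI) (simp add: emeasure_density cong: nn_integral_cong)
  then show ?thesis using m k(2) c0 by (intro exI[of _ "\<lambda>a. k a / c"]) auto
qed

text \<open>Immersion is obtained in the i.i.d. noises themselves, whose values need not lie in a
  separable space. Essential separability enters in the last claim, where the noises are coded by
  real sequences.\<close>

theorem theorem3: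
  fixes M :: "'w measure" and \<pi> :: "'e measure"
    and X :: "int \<Rightarrow> 'w \<Rightarrow> 'e"
    and f :: "(nat \<Rightarrow> 'e) \<Rightarrow> 'e \<Rightarrow> real"
    and g :: "nat \<Rightarrow> (nat \<Rightarrow> 'e) \<Rightarrow> 'e \<Rightarrow> real"
  assumes "prob_space M"
    and "sigma_finite_measure \<pi>"
    and "stationary M \<pi> X"
    and "conditional_density M (past_space \<pi>) (past X (-1)) \<pi> (X 0) f"
    and "\<And>n. conditional_density M (word_space \<pi> n) (word X n) \<pi> (X 0) (g n)"
    and "AE a in \<pi>. AE \<omega> in M. f (past X (-1) \<omega>) a > 0"
    and "summable (eta M \<pi> X f g)"
  shows "admits_generating_parametrization
           TYPE('w \<times> (int \<Rightarrow> nat \<Rightarrow> 'e \<times> real)) TYPE(nat \<Rightarrow> 'e \<times> real) M \<pi> X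
       \<and> (\<exists>S :: (nat \<Rightarrow> 'e \<times> real) measure.
            immersible_in_iid TYPE('w \<times> (int \<Rightarrow> nat \<Rightarrow> 'e \<times> real)) S M \<pi> X)
       \<and> (essentially_separable \<pi> \<longrightarrow>
            standard TYPE('w \<times> (int \<Rightarrow> nat \<Rightarrow> 'e \<times> real)) TYPE(nat \<Rightarrow> real) M \<pi> X)"
proof -
  interpret M: prob_space M by fact
  have X: "X n \<in> measurable M \<pi>" for n using assms(3) by (simp add: stationary_def)
  \<comment> \<open>A single conditional density with integral 1 shows that \<pi> is not the zero
    measure.\<close>
  obtain \<omega>\<^sub>0 where "\<omega>\<^sub>0 \<in> space M" using M.not_empty by blast
  then have "past X (-1) \<omega>\<^sub>0 \<in> space (past_space \<pi>)" using X by (intro word_space_mem)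
  then have one: "(\<integral>\<^sup>+ a. ennreal (f (past X (-1) \<omega>\<^sub>0) a) \<partial>\<pi>) = 1"
    using assms(4) by (simp add: conditional_density_def)
  have "emeasure \<pi> (space \<pi>) \<noteq> 0"
  proof
    assume "emeasure \<pi> (space \<pi>) = 0"
    then have "AE a in \<pi>. ennreal (f (past X (-1) \<omega>\<^sub>0) a) = 0" by (intro AE_I[of _ _ "space \<pi>"]) auto
    then have "(\<integral>\<^sup>+ a. ennreal (f (past X (-1) \<omega>\<^sub>0) a) \<partial>\<pi>) = (\<integral>\<^sup>+ a. 0 \<partial>\<pi>)" by (rule nn_integral_cong_AE)
    with one show False by simp
  qed
  with exists_equivalent_prob_density[OF assms(2)]
  obtain h where h: "h \<in> borel_measurable \<pi>" "\<And>a. 0 < h a" and prob: "prob_space (density \<pi> (\<lambda>a. ennreal (h a)))"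
    by blast
  let ?\<pi> = "density \<pi> (\<lambda>a. ennreal (h a))"
  let ?f = "\<lambda>z a. f z a / h a" and ?g = "\<lambda>n z a. g n z a / h a"
  \<comment> \<open>Product sigma-fields depend on their factors only through the measurable sets,
    so neither they nor the laws on them change with the density \<open>h\<close>.\<close>
  have sets: "sets (Pi\<^sub>M I (\<lambda>_. ?\<pi>)) = sets (Pi\<^sub>M I (\<lambda>_. \<pi>))" for I :: "'i set"
    by (intro sets_PiM_cong) auto
  have law: "distr M (Pi\<^sub>M I (\<lambda>_. ?\<pi>)) Z = distr M (Pi\<^sub>M I (\<lambda>_. \<pi>)) Z" for I :: "'i set" and Z
    by (rule distr_cong[OF refl sets refl])
  interpret P: prob_space ?\<pi> by (rule prob)
  interpret coupled_chain ?\<pi> M X ?f ?g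
  proof unfold_locales
    show "stationary M ?\<pi> X"
      using assms(3) unfolding stationary_def law by (simp add: measurable_cong_sets[OF refl sets_density])
    show "conditional_density M (past_space ?\<pi>) (past X (-1)) ?\<pi> (X 0) ?f"
      by (rule conditional_density_reweight[OF h sets assms(4)])
    show "conditional_density M (word_space ?\<pi> n) (word X n) ?\<pi> (X 0) (?g n)" for n
      by (rule conditional_density_reweight[OF h sets assms(5)])
    show "AE a in ?\<pi>. AE \<omega> in M. 0 < ?f (past X (-1) \<omega>) a"
      using h assms(6) by (subst AE_density) auto
    have "eta M ?\<pi> X ?f ?g = eta M \<pi> X f g"
      using assms(4,5) by (intro eta_reweight h X) (simp_all add: conditional_density_def)
    then show "summable (eta M ?\<pi> X ?f ?g)" using assms(7) by simp
  qed
  have sep: "essentially_separable ?\<pi>" if es: "essentially_separable \<pi>"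
  proof -
    \<comment> \<open>A measure with a density is absolutely continuous, so the null differences in
      the approximation stay null.\<close>
    have null: "null_sets \<pi> \<subseteq> null_sets ?\<pi>"
      using absolutely_continuousI_density[of "\<lambda>a. ennreal (h a)" \<pi>] h(1) by (simp add: absolutely_continuous_def)
    from es obtain G where G: "countable G" "G \<subseteq> sets \<pi>"
      and dense: "\<forall>A\<in>sets \<pi>. \<exists>B\<in>sigma_sets (space \<pi>) G. (A - B) \<union> (B - A) \<in> null_sets \<pi>"
      unfolding essentially_separable_def by (elim exE conjE)
    show ?thesis
      unfolding essentially_separable_def sets_density space_density
    proof (intro exI[of _ G] conjI ballI G)
      fix A assume "A \<in> sets \<pi>"
      with dense obtain B where "B \<in> sigma_sets (space \<pi>) G" "(A - B) \<union> (B - A) \<in> null_sets \<pi>" by (metis (no_types))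
      then show "\<exists>B\<in>sigma_sets (space \<pi>) G. (A - B) \<union> (B - A) \<in> null_sets ?\<pi>" by (intro bexI[of _ B] subsetD[OF null])
    qed
  qed
  note c = parametrization_and_standardness[OF sets_density[symmetric]]
  show ?thesis
  proof (intro conjI impI exI)
    show "admits_generating_parametrization
           TYPE('w \<times> (int \<Rightarrow> nat \<Rightarrow> 'e \<times> real)) TYPE(nat \<Rightarrow> 'e \<times> real) M \<pi> X" by (rule c(1))
    show "immersible_in_iid TYPE('w \<times> (int \<Rightarrow> nat \<Rightarrow> 'e \<times> real)) (noise ?\<pi>) M \<pi> X" by (rule c(2))
    assume "essentially_separable \<pi>"
    then show "standard TYPE('w \<times> (int \<Rightarrow> nat \<Rightarrow> 'e \<times> real)) TYPE(nat \<Rightarrow> real) M \<pi> X" by (intro c(3) sep)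
  qed
qed

end
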